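(* Let $\check p:\check X\to B$ be a semi-flat Lagrangian torus fibration over a compact complete special integral affine manifold $B$ (without boundary, of dimension $n$). Let $g$ be an integral Hessian type metric on $B$. With respect to the prequantum line bundle $(\check L_g,\nabla_{\check L_g})$ associated to the metric $g$, the SYZ transform $\mathcal F$ induces a canonical isomorphism between the space $\Gamma_{P_{\mathbb R}}(\check X,\check L_g)$ of real polarized sections and the space $\Gamma_{P_{\mathbb C}}(\check X,\check L_g)$ of complex polarized sections.
   Context: Integral affine manifolds. An $n$-dimensional integral affine manifold $B$ has an atlas with transition functions in $GL(n,\mathbb Z)\rtimes\mathbb R^n$; it is special if the transition functions lie in $SL(n,\mathbb Z)\rtimes\mathbb R^n$; it is complete if its universal cover is diffeomorphic to $\mathbb R^n$ as an affine manifold. In local affine coordinates $(x^j)$ put $\Lambda=\bigoplus_j\mathbb Z\,\partial/\partial x^j\subset TB$, $\Lambda^*=\bigoplus_j\mathbb Z\,dx^j\subset T^*B$, $\check X=TB/\Lambda$, $X=T^*B/\Lambda^*$, with projections $\check p:\check X\to B$, $p:X\to B$ and dual fiber coordinates $\check y^j$ on $\check X$, $y_j$ on $X$. $L_0$ is the zero section of $p$; $\check F_x=\check p^{-1}(x)$. Metric. A Hessian type metric $g$ is a Riemannian metric given locally by $g_{jk}=\partial^2\phi/\partial x^j\partial x^k$ for a smooth convex potential $\phi$ in affine coordinates. It is integral if there are an open cover $\{U\}$ by affine charts and potentials $\phi_U:U\to\mathbb R$ such that on each nonempty overlap $\phi_U(x_U(x_V))-\phi_V(x_V)=\langle m_{UV},x_V\rangle+a_{UV}$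 with $m_{UV}\in\mathbb Z^n$, $a_{UV}\in\mathbb R$. Then $L_g=\{(x,d\phi(x))\in X:x\in B\}$ is a well-defined Lagrangian section of $p$. Kähler structure. $\check X$ has complex coordinates $z_j=\check y^j+ix^j$ and Kähler form $\check\omega_g=\sum_{j,k}g_{jk}\,d\check y^j\wedge dx^k$. Line bundle. $\check L_g$ (the SYZ transform of $L_g$) is the Hermitian line bundle with unitary frames $\check 1_U$ over $\check p^{-1}(U)$, where $\check 1_U=e^{2\pi i(m_{UV},\check y)}\check 1_V$ on overlaps ($d\phi_U-d\phi_V=m_{UV}\in\Lambda^*$), and connection $\nabla_{\check L_g}=d+2\pi i\sum_j\frac{\partial\phi_U}{\partial x^j}d\check y^j$ with respect to $\check 1_U$. It is a prequantum line bundle, i.e. $\frac{i}{2\pi}F_{\nabla_{\check L_g}}=\check\omega_g$. Its holomorphic structure is the $(0,1)$-part of $\nabla_{\check L_g}$. Polarizations. $P_{\mathbb R}=\ker(\check p_* )\otimes\mathbb C$ (real polarization) and $P_{\mathbb C}=T^{0,1}\check X$ (complex polarization). $\Gamma_P(\check X,\check L_g)$ denotes the space of sections (in the $L^2$-completion of the space of smooth sections) covariantly constant along $P$. A submanifold $S\subset\check X$ is Bohr-Sommerfeld if $\nabla_{\check L_g}|_S$ is the trivial connection $d$ (in a suitable frame over $S$). The space $\Gamma_{P_{\mathbb R}}$ is understood through Śniatycki's canonical identification $\Gamma_{P_{\mathbb R}}(\check X,\check L_g)\cong\bigoplus_{\check F_x\ \text{Bohr-Sommerfeld}}\mathbb C\cdot\check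 F_x$, and $\Gamma_{P_{\mathbb C}}(\check X,\check L_g)=H^0(\check X,\check L_g)$. Path space and SYZ transform. The fiberwise geodesic path space $P(L_0,L_g)$ is the covering of $B$ whose fiber over $x$ is the set of homotopy classes of paths in $p^{-1}(x)$ from $L_0$ to $L_g$; equivalently $P(L_0,L_g)=\{(x,\eta):\eta\in T_x^*B,\ \eta\equiv d\phi(x)\bmod\Lambda_x^*\}$, where $\eta$ is the velocity of the affine representative. A function $f$ on $P(L_0,L_g)$ is rapidly decaying if for every compact $K\subset B$ and integers $k,l\ge0$, $\sup_{x\in K}|\eta|^k|\nabla^lf(x,\eta)|\to0$ as $|\eta|\to\infty$, where $\nabla$ is the flat affine connection and norms are taken with respect to $g$. For a rapidly decaying function $f$ on $P(L_0,L_g)$, the SYZ transform is the section of $\check L_g$ given over $\check p^{-1}(U)$ by $$\mathcal F(f)=\sum_{m\in\mathbb Z^n}f(x,d\phi_U(x)+m)\,e^{2\pi i(m,\check y)}\,\check 1_U.$$ *)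

theory Defs
  imports "HOL-Analysis.Analysis" "HOL-Library.Function_Algebras"
begin

section \<open>Smooth functions and partial derivatives\<close>

text \<open>The set \<open>S\<close> is meant to be open.\<close>

fun Ck_on :: "nat \<Rightarrow> 'a::real_normed_vector set \<Rightarrow> ('a \<Rightarrow> 'b::real_normed_vector) \<Rightarrow> bool" where
  "Ck_on 0 S f \<longleftrightarrow> continuous_on S f"
| "Ck_on (Suc k) S f \<longleftrightarrow>
     f differentiable_on S \<and> (\<forall>v. Ck_on k S (\<lambda>x. frechet_derivative f (at x) v))"

definition smooth_on :: "'a::real_normed_vector set \<Rightarrow> ('a \<Rightarrow> 'b::real_normed_vector) \<Rightarrow> bool" where
  "smooth_on S f \<longleftrightarrow> (\<forall>k. Ck_on k S f)"

definition partial :: "'n::finite \<Rightarrow> (real^'n \<Rightarrow> 'a::real_normed_vector) \<Rightarrow> real^'n \<Rightarrow> 'a" where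
  "partial j f x = frechet_derivative f (at x) (axis j 1)"

text \<open>\<open>partials [j\<^sub>1, \<dots>, j\<^sub>l] f\<close> is the iterated partial derivative.\<close>

definition partials :: "'n::finite list \<Rightarrow> (real^'n \<Rightarrow> 'a::real_normed_vector) \<Rightarrow> real^'n \<Rightarrow> 'a" where
  "partials J f = foldr partial J f"

definition grad :: "(real^'n::finite \<Rightarrow> real) \<Rightarrow> real^'n \<Rightarrow> real^'n" where
  "grad \<phi> x = (\<chi> j. partial j \<phi> x)"


section \<open>Integral affine manifolds\<close>

text \<open>
  The manifold \<open>B\<close> is a whole type \<open>'b\<close> (Hausdorff by its type class; it will be compact, so
  second countability is automatic).  A chart is a domain with a coordinate map; its values outside
  the domain are irrelevant.
\<close>

type_synonym ('b, 'n) chart = "'b set \<times> ('b \<Rightarrow> real^'n)"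

definition is_chart :: "('b::topological_space, 'n::finite) chart \<Rightarrow> bool" where
  "is_chart c \<longleftrightarrow> open (fst c) \<and> open (snd c ` fst c) \<and>
     (\<exists>h. homeomorphism (fst c) (snd c ` fst c) (snd c) h)"

abbreviation chart_range :: "('b, 'n::finite) chart \<Rightarrow> (real^'n) set" where
  "chart_range c \<equiv> snd c ` fst c"

abbreviation chart_inv :: "('b, 'n::finite) chart \<Rightarrow> real^'n \<Rightarrow> 'b" where
  "chart_inv c \<equiv> inv_into (fst c) (snd c)"

definition integer_matrix :: "real^'n^'n \<Rightarrow> bool" where
  "integer_matrix A \<longleftrightarrow> (\<forall>i j. A $ i $ j \<in> \<int>)"

definition GLZ :: "(real^'n::finite^'n) set" where
  "GLZ = {A. integer_matrix A \<and>
             (\<exists>A'. integer_matrix A' \<and> A ** A' = mat 1 \<and> A' ** A = mat 1)}"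

definition SLZ :: "(real^'n::finite^'n) set" where
  "SLZ = {A. integer_matrix A \<and> det A = 1}"

text \<open>Near \<open>b\<close> the change of coordinates from \<open>d\<close> to \<open>c\<close> is \<open>x \<mapsto> A x + t\<close>.\<close>

definition affine_transition ::
  "'b::topological_space \<Rightarrow> ('b, 'n::finite) chart \<Rightarrow> ('b, 'n) chart \<Rightarrow> real^'n^'n \<Rightarrow> real^'n \<Rightarrow> bool"
where
  "affine_transition b c d A t \<longleftrightarrow>
     (\<exists>W. open W \<and> b \<in> W \<and> W \<subseteq> fst c \<inter> fst d \<and> (\<forall>q\<in>W. snd c q = A *v snd d q + t))"

text \<open>
  Transition functions lie in \<open>G \<ltimes> \<real>\<^sup>n\<close>; the element of \<open>G \<ltimes> \<real>\<^sup>n\<close> is locally constant, as the overlap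
  of two charts may be disconnected.
\<close>

definition compatible ::
  "(real^'n^'n) set \<Rightarrow> ('b::topological_space, 'n::finite) chart \<Rightarrow> ('b, 'n) chart \<Rightarrow> bool" where
  "compatible G c d \<longleftrightarrow> (\<forall>b \<in> fst c \<inter> fst d. \<exists>A\<in>G. \<exists>t. affine_transition b c d A t)"

definition affine_atlas :: "(real^'n^'n) set \<Rightarrow> ('b::topological_space, 'n::finite) chart set \<Rightarrow> bool"
where
  "affine_atlas G \<A> \<longleftrightarrow>
     (\<forall>c\<in>\<A>. is_chart c) \<and> (\<Union>c\<in>\<A>. fst c) = UNIV \<and> (\<forall>c\<in>\<A>. \<forall>d\<in>\<A>. compatible G c d)"

definition integral_affine_manifold :: "('b::t2_space, 'n::finite) chart set \<Rightarrow> bool" where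
  "integral_affine_manifold \<A> \<longleftrightarrow> affine_atlas GLZ \<A>"

definition special_integral_affine_manifold :: "('b::t2_space, 'n::finite) chart set \<Rightarrow> bool" where
  "special_integral_affine_manifold \<A> \<longleftrightarrow> integral_affine_manifold \<A> \<and> affine_atlas SLZ \<A>"

text \<open>
  As \<open>\<real>\<^sup>n\<close> is simply connected, the universal cover is affinely diffeomorphic to \<open>\<real>\<^sup>n\<close> iff there is a
  covering map \<open>\<real>\<^sup>n \<rightarrow> B\<close> that is an affine isomorphism locally.
\<close>

definition complete_affine :: "('b::t2_space, 'n::finite) chart set \<Rightarrow> bool" where
  "complete_affine \<A> \<longleftrightarrow>
     (\<exists>\<pi> :: real^'n \<Rightarrow> 'b. covering_space UNIV \<pi> UNIV \<and>
        (\<forall>c\<in>\<A>. \<forall>v. \<pi> v \<in> fst c \<longrightarrow>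
           (\<exists>W A t. open W \<and> v \<in> W \<and> invertible A \<and>
              (\<forall>w\<in>W. \<pi> w \<in> fst c \<and> snd c (\<pi> w) = A *v w + t))))"

definition affine_charts :: "('b::t2_space, 'n::finite) chart set \<Rightarrow> ('b, 'n) chart set" where
  "affine_charts \<A> = {c. is_chart c \<and> (\<forall>d\<in>\<A>. compatible GLZ c d \<and> compatible GLZ d c)}"

definition charts_at :: "('b::t2_space, 'n::finite) chart set \<Rightarrow> 'b \<Rightarrow> ('b, 'n) chart set" where
  "charts_at \<A> b = {c \<in> affine_charts \<A>. b \<in> fst c}"


section \<open>Tangent and cotangent bundles, lattices and torus bundles\<close>

text \<open>
  A (co)tangent vector at \<open>b\<close> is the family of its components in all affine charts at \<open>b\<close>, subject to
  the (co)vector transformation law, and \<open>0\<close> at all other charts.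
\<close>

type_synonym ('b, 'n) vect = "('b, 'n) chart \<Rightarrow> real^'n"

definition tangent_space :: "('b::t2_space, 'n::finite) chart set \<Rightarrow> 'b \<Rightarrow> ('b, 'n) vect set" where
  "tangent_space \<A> b =
     {\<xi>. (\<forall>c\<in>charts_at \<A> b. \<forall>d\<in>charts_at \<A> b. \<forall>A t.
            affine_transition b c d A t \<longrightarrow> \<xi> c = A *v \<xi> d) \<and>
         (\<forall>c. c \<notin> charts_at \<A> b \<longrightarrow> \<xi> c = 0)}"

definition cotangent_space :: "('b::t2_space, 'n::finite) chart set \<Rightarrow> 'b \<Rightarrow> ('b, 'n) vect set" where
  "cotangent_space \<A> b =
     {\<eta>. (\<forall>c\<in>charts_at \<A> b. \<forall>d\<in>charts_at \<A> b. \<forall>A t.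
            affine_transition b c d A t \<longrightarrow> \<eta> d = transpose A *v \<eta> c) \<and>
         (\<forall>c. c \<notin> charts_at \<A> b \<longrightarrow> \<eta> c = 0)}"

text \<open>The vector with components \<open>y\<close> in the chart \<open>c \<in> charts_at \<A> b\<close>.\<close>

definition tangent_of ::
  "('b::t2_space, 'n::finite) chart set \<Rightarrow> ('b, 'n) chart \<Rightarrow> 'b \<Rightarrow> real^'n \<Rightarrow> ('b, 'n) vect" where
  "tangent_of \<A> c b y = (THE \<xi>. \<xi> \<in> tangent_space \<A> b \<and> \<xi> c = y)"

definition cotangent_of ::
  "('b::t2_space, 'n::finite) chart set \<Rightarrow> ('b, 'n) chart \<Rightarrow> 'b \<Rightarrow> real^'n \<Rightarrow> ('b, 'n) vect" where
  "cotangent_of \<A> c b y = (THE \<eta>. \<eta> \<in> cotangent_space \<A> b \<and> \<eta> c = y)"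

definition tangent_lattice :: "('b::t2_space, 'n::finite) chart set \<Rightarrow> 'b \<Rightarrow> ('b, 'n) vect set" where
  "tangent_lattice \<A> b = {l \<in> tangent_space \<A> b. \<forall>c\<in>charts_at \<A> b. \<forall>j. l c $ j \<in> \<int>}"

definition cotangent_lattice :: "('b::t2_space, 'n::finite) chart set \<Rightarrow> 'b \<Rightarrow> ('b, 'n) vect set" where
  "cotangent_lattice \<A> b = {l \<in> cotangent_space \<A> b. \<forall>c\<in>charts_at \<A> b. \<forall>j. l c $ j \<in> \<int>}"

text \<open>Points of \<open>TB/\<Lambda>\<close> and \<open>T\<^sup>*B/\<Lambda>\<^sup>*\<close> are pairs of a base point and a coset; the projections are \<open>fst\<close>.\<close>

type_synonym ('b, 'n) torus_point = "'b \<times> ('b, 'n) vect set"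

definition check_point ::
  "('b::t2_space, 'n::finite) chart set \<Rightarrow> 'b \<Rightarrow> ('b, 'n) vect \<Rightarrow> ('b, 'n) torus_point" where
  "check_point \<A> b \<xi> = (b, (\<lambda>l. \<xi> + l) ` tangent_lattice \<A> b)"

definition dual_point ::
  "('b::t2_space, 'n::finite) chart set \<Rightarrow> 'b \<Rightarrow> ('b, 'n) vect \<Rightarrow> ('b, 'n) torus_point" where
  "dual_point \<A> b \<eta> = (b, (\<lambda>l. \<eta> + l) ` cotangent_lattice \<A> b)"

definition X_check :: "('b::t2_space, 'n::finite) chart set \<Rightarrow> ('b, 'n) torus_point set" where
  "X_check \<A> = {check_point \<A> b \<xi> | b \<xi>. \<xi> \<in> tangent_space \<A> b}"


section \<open>Integral Hessian type metrics\<close>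

definition metric_matrix ::
  "('b::t2_space, 'n::finite) chart set \<Rightarrow> ('b \<Rightarrow> ('b, 'n) vect \<Rightarrow> ('b, 'n) vect \<Rightarrow> real) \<Rightarrow>
   ('b, 'n) chart \<Rightarrow> 'b \<Rightarrow> real^'n^'n" where
  "metric_matrix \<A> g c b =
     (\<chi> j k. g b (tangent_of \<A> c b (axis j 1)) (tangent_of \<A> c b (axis k 1)))"

definition riemannian_metric ::
  "('b::t2_space, 'n::finite) chart set \<Rightarrow> ('b \<Rightarrow> ('b, 'n) vect \<Rightarrow> ('b, 'n) vect \<Rightarrow> real) \<Rightarrow> bool" where
  "riemannian_metric \<A> g \<longleftrightarrow>
     (\<forall>b. \<forall>\<xi>\<in>tangent_space \<A> b. \<forall>\<zeta>\<in>tangent_space \<A> b.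
        g b \<xi> \<zeta> = g b \<zeta> \<xi> \<and>
        (\<xi> \<noteq> 0 \<longrightarrow> g b \<xi> \<xi> > 0) \<and>
        (\<forall>r. g b (\<lambda>c. r *\<^sub>R \<xi> c) \<zeta> = r * g b \<xi> \<zeta>) \<and>
        (\<forall>\<omega>\<in>tangent_space \<A> b. g b (\<xi> + \<omega>) \<zeta> = g b \<xi> \<zeta> + g b \<omega> \<zeta>)) \<and>
     (\<forall>c\<in>affine_charts \<A>. \<forall>j k.
        smooth_on (chart_range c) (\<lambda>x. metric_matrix \<A> g c (chart_inv c x) $ j $ k))"

text \<open>
  A potential for \<open>g\<close> over the chart \<open>c\<close>.  Convexity of \<open>\<phi>\<close> is contained in the positivity of \<open>g\<close>.
\<close>

type_synonym ('b, 'n) potential = "('b, 'n) chart \<times> (real^'n \<Rightarrow> real)"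

definition is_potential ::
  "('b::t2_space, 'n::finite) chart set \<Rightarrow> ('b \<Rightarrow> ('b, 'n) vect \<Rightarrow> ('b, 'n) vect \<Rightarrow> real) \<Rightarrow>
   ('b, 'n) potential \<Rightarrow> bool" where
  "is_potential \<A> g u \<longleftrightarrow>
     (case u of (c, \<phi>) \<Rightarrow>
        c \<in> affine_charts \<A> \<and> smooth_on (chart_range c) \<phi> \<and>
        (\<forall>b\<in>fst c. \<forall>j k. metric_matrix \<A> g c b $ j $ k = partial j (partial k \<phi>) (snd c b)))"

definition hessian_type_metric ::
  "('b::t2_space, 'n::finite) chart set \<Rightarrow> ('b \<Rightarrow> ('b, 'n) vect \<Rightarrow> ('b, 'n) vect \<Rightarrow> real) \<Rightarrow> bool" where
  "hessian_type_metric \<A> g \<longleftrightarrow>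
     riemannian_metric \<A> g \<and> (\<forall>b. \<exists>c \<phi>. b \<in> fst c \<and> is_potential \<A> g (c, \<phi>))"

text \<open>\<open>\<U>\<close> is an open cover by affine charts with potentials that exhibits \<open>g\<close> as integral.\<close>

definition integral_potentials ::
  "('b::t2_space, 'n::finite) chart set \<Rightarrow> ('b \<Rightarrow> ('b, 'n) vect \<Rightarrow> ('b, 'n) vect \<Rightarrow> real) \<Rightarrow>
   ('b, 'n) potential set \<Rightarrow> bool" where
  "integral_potentials \<A> g \<U> \<longleftrightarrow>
     (\<forall>u\<in>\<U>. is_potential \<A> g u) \<and> (\<Union>u\<in>\<U>. fst (fst u)) = UNIV \<and>
     (\<forall>(c, \<phi>)\<in>\<U>. \<forall>(d, \<psi>)\<in>\<U>. fst c \<inter> fst d \<noteq> {} \<longrightarrow>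
        (\<exists>m a. (\<forall>j. m $ j \<in> \<int>) \<and>
           (\<forall>q\<in>fst c \<inter> fst d. \<phi> (snd c q) - \<psi> (snd d q) = m \<bullet> snd d q + a)))"

text \<open>The covector \<open>d\<phi>\<^sub>U(b)\<close>, for \<open>b\<close> in the domain of \<open>u = (c, \<phi>\<^sub>U)\<close>.\<close>

definition d_pot ::
  "('b::t2_space, 'n::finite) chart set \<Rightarrow> ('b, 'n) potential \<Rightarrow> 'b \<Rightarrow> ('b, 'n) vect" where
  "d_pot \<A> u b = cotangent_of \<A> (fst u) b (grad (snd u) (snd (fst u) b))"

definition L_g ::
  "('b::t2_space, 'n::finite) chart set \<Rightarrow> ('b, 'n) potential set \<Rightarrow> ('b, 'n) torus_point set" where
  "L_g \<A> \<U> = {dual_point \<A> b (d_pot \<A> u b) | b u. u \<in> \<U> \<and> b \<in> fst (fst u)}"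


section \<open>The prequantum line bundle\<close>

text \<open>
  An element of the fibre of the line bundle at \<open>q\<close> is the family of its coefficients with respect
  to the frames \<open>1\<^sub>U\<close>, indexed by \<open>\<U>\<close>.  A section assigns such a family to each point; all
  coefficients that have no meaning are \<open>0\<close>, so that sections are equal iff they are equal as functions.
\<close>

type_synonym ('b, 'n) lsection = "('b, 'n) torus_point \<Rightarrow> ('b, 'n) potential \<Rightarrow> complex"

text \<open>The coefficient of \<open>s\<close> in the frame \<open>1\<^sub>U\<close>, in the coordinates \<open>(x, y)\<close> of \<open>p\<^sup>-\<^sup>1(U)\<close>.\<close>

definition coeff ::
  "('b::t2_space, 'n::finite) chart set \<Rightarrow> ('b, 'n) lsection \<Rightarrow> ('b, 'n) potential \<Rightarrow>
   (real^'n) \<times> (real^'n) \<Rightarrow> complex" where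
  "coeff \<A> s u = (\<lambda>(x, y). let b = chart_inv (fst u) x
                          in s (check_point \<A> b (tangent_of \<A> (fst u) b y)) u)"

text \<open>
  With \<open>m\<^sub>U\<^sub>V = d\<phi>\<^sub>U - d\<phi>\<^sub>V\<close> and \<open>1\<^sub>U = exp (2\<pi>i (m\<^sub>U\<^sub>V, y)) 1\<^sub>V\<close>, coefficients satisfy
  \<open>s\<^sub>V = exp (2\<pi>i (m\<^sub>U\<^sub>V, y)) s\<^sub>U\<close>; the pairing is computed in the chart of \<open>V\<close>.
\<close>

definition smooth_section ::
  "('b::t2_space, 'n::finite) chart set \<Rightarrow> ('b, 'n) potential set \<Rightarrow> ('b, 'n) lsection \<Rightarrow> bool" where
  "smooth_section \<A> \<U> s \<longleftrightarrow>
     (\<forall>q u. \<not> (q \<in> X_check \<A> \<and> u \<in> \<U> \<and> fst q \<in> fst (fst u)) \<longrightarrow> s q u = 0) \<and>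
     (\<forall>u\<in>\<U>. \<forall>v\<in>\<U>. \<forall>b\<in>fst (fst u) \<inter> fst (fst v). \<forall>\<xi>\<in>tangent_space \<A> b.
        s (check_point \<A> b \<xi>) v =
          exp (2 * of_real pi * \<i> *
               of_real ((d_pot \<A> u b - d_pot \<A> v b) (fst v) \<bullet> \<xi> (fst v))) *
          s (check_point \<A> b \<xi>) u) \<and>
     (\<forall>u\<in>\<U>. smooth_on (chart_range (fst u) \<times> UNIV) (coeff \<A> s u))"

text \<open>
  The coefficient in the frame \<open>1\<^sub>U\<close>, at the point with coordinates \<open>(x, y)\<close>, of \<open>\<nabla>\<^sub>Z s\<close> with
  \<open>\<nabla> = d + 2\<pi>i \<Sum>\<^sub>j \<partial>\<phi>\<^sub>U/\<partial>x\<^sub>j dy\<^sub>j\<close>, for the complexified tangent vector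
  \<open>Z = \<Sum>\<^sub>j p\<^sub>j \<partial>/\<partial>x\<^sub>j + w\<^sub>j \<partial>/\<partial>y\<^sub>j\<close>.
\<close>

definition nabla ::
  "('b::t2_space, 'n::finite) chart set \<Rightarrow> ('b, 'n) lsection \<Rightarrow> ('b, 'n) potential \<Rightarrow>
   (real^'n) \<times> (real^'n) \<Rightarrow> (complex^'n) \<times> (complex^'n) \<Rightarrow> complex" where
  "nabla \<A> s u = (\<lambda>(x, y) (p, w).
     (\<Sum>j\<in>UNIV. p $ j * frechet_derivative (coeff \<A> s u) (at (x, y)) (axis j 1, 0)) +
     (\<Sum>j\<in>UNIV. w $ j * frechet_derivative (coeff \<A> s u) (at (x, y)) (0, axis j 1)) +
     2 * of_real pi * \<i> * (\<Sum>j\<in>UNIV. of_real (partial j (snd u) x) * w $ j) * coeff \<A> s u (x, y))"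

text \<open>
  The complex polarization \<open>T\<^sup>0\<^sup>,\<^sup>1\<close> in the coordinates of any affine chart (with \<open>(p, w)\<close> as above): the
  complexified tangent vectors annihilated by all \<open>dz\<^sub>j = dy\<^sub>j + i dx\<^sub>j\<close>.
\<close>

definition P_complex :: "((complex^'n::finite) \<times> (complex^'n)) set" where
  "P_complex = {(p, w). \<forall>j. w $ j + \<i> * p $ j = 0}"

text \<open>Complex polarized sections, that is, the holomorphic sections of the line bundle.\<close>

definition Gamma_complex ::
  "('b::t2_space, 'n::finite) chart set \<Rightarrow> ('b, 'n) potential set \<Rightarrow> ('b, 'n) lsection set" where
  "Gamma_complex \<A> \<U> =
     {s. smooth_section \<A> \<U> s \<and>
         (\<forall>u\<in>\<U>. \<forall>x\<in>chart_range (fst u). \<forall>y. \<forall>Z\<in>P_complex. nabla \<A> s u (x, y) Z = 0)}"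

text \<open>
  The fibre over \<open>b\<close> is Bohr-Sommerfeld if the restricted line bundle has a frame \<open>h 1\<^sub>U\<close> in which the
  restricted connection is \<open>d\<close>, i.e. which is parallel.
\<close>

definition Bohr_Sommerfeld ::
  "('b::t2_space, 'n::finite) chart set \<Rightarrow> ('b, 'n) potential set \<Rightarrow> 'b \<Rightarrow> bool" where
  "Bohr_Sommerfeld \<A> \<U> b \<longleftrightarrow>
     (\<exists>u\<in>\<U>. b \<in> fst (fst u) \<and>
        (\<exists>h :: ('b, 'n) torus_point \<Rightarrow> complex.
           let H = (\<lambda>y. h (check_point \<A> b (tangent_of \<A> (fst u) b y))) in
             smooth_on UNIV H \<and> (\<forall>y. H y \<noteq> 0) \<and>
             (\<forall>y j. partial j H y +
                2 * of_real pi * \<i> * of_real (partial j (snd u) (snd (fst u) b)) * H y = 0)))"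

text \<open>
  Real polarized sections in Sniatycki's description: formal finite linear combinations of
  Bohr-Sommerfeld fibres, a fibre being identified with its base point.
\<close>

definition Gamma_real ::
  "('b::t2_space, 'n::finite) chart set \<Rightarrow> ('b, 'n) potential set \<Rightarrow> ('b \<Rightarrow> complex) set" where
  "Gamma_real \<A> \<U> = {a. finite {b. a b \<noteq> 0} \<and> (\<forall>b. a b \<noteq> 0 \<longrightarrow> Bohr_Sommerfeld \<A> \<U> b)}"


section \<open>The path space and the SYZ transform\<close>

text \<open>
  A homotopy class of paths in a fibre from the zero section to \<open>L_g\<close> is given by the velocity \<open>\<eta>\<close> of
  its affine representative \<open>t \<mapsto> [t \<eta>]\<close>.
\<close>

definition path_space ::
  "('b::t2_space, 'n::finite) chart set \<Rightarrow> ('b, 'n) potential set \<Rightarrow> ('b \<times> ('b, 'n) vect) set" where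
  "path_space \<A> \<U> = {(b, \<eta>). \<eta> \<in> cotangent_space \<A> b \<and> dual_point \<A> b \<eta> \<in> L_g \<A> \<U>}"

definition int_vec :: "int^'n \<Rightarrow> real^'n::finite" where
  "int_vec m = (\<chi> j. of_int (m $ j))"

text \<open>The restriction of \<open>f\<close> to the sheet \<open>\<eta> = d\<phi>\<^sub>U + m\<close> of the path space over \<open>U\<close>, in coordinates.\<close>

definition sheet ::
  "('b::t2_space, 'n::finite) chart set \<Rightarrow> ('b \<times> ('b, 'n) vect \<Rightarrow> complex) \<Rightarrow> ('b, 'n) potential \<Rightarrow>
   int^'n \<Rightarrow> real^'n \<Rightarrow> complex" where
  "sheet \<A> f u m x =
     (let b = chart_inv (fst u) x
      in f (b, cotangent_of \<A> (fst u) b (grad (snd u) x + int_vec m)))"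

text \<open>
  Norms with respect to the metric with inverse matrix \<open>G\<close>: of a covector, and of a covariant
  \<open>l\<close>-tensor given by its components \<open>T [j\<^sub>1, \<dots>, j\<^sub>l]\<close>.
\<close>

definition covector_norm :: "real^'n::finite^'n \<Rightarrow> real^'n \<Rightarrow> real" where
  "covector_norm G \<eta> = sqrt (\<eta> \<bullet> (G *v \<eta>))"

definition tensor_norm :: "real^'n::finite^'n \<Rightarrow> nat \<Rightarrow> ('n list \<Rightarrow> complex) \<Rightarrow> real" where
  "tensor_norm G l T =
     sqrt (Re (\<Sum>J | length J = l. \<Sum>K | length K = l.
                 of_real (\<Prod>i<l. G $ (J ! i) $ (K ! i)) * T J * cnj (T K)))"

text \<open>
  Rapidly decaying functions on the path space, extended by \<open>0\<close> outside of it.  In affine coordinates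
  the components of \<open>\<nabla>\<^sup>l f\<close> are the iterated partial derivatives.
\<close>

definition rapidly_decaying ::
  "('b::t2_space, 'n::finite) chart set \<Rightarrow> ('b \<Rightarrow> ('b, 'n) vect \<Rightarrow> ('b, 'n) vect \<Rightarrow> real) \<Rightarrow>
   ('b, 'n) potential set \<Rightarrow> ('b \<times> ('b, 'n) vect \<Rightarrow> complex) \<Rightarrow> bool" where
  "rapidly_decaying \<A> g \<U> f \<longleftrightarrow>
     (\<forall>P. P \<notin> path_space \<A> \<U> \<longrightarrow> f P = 0) \<and>
     (\<forall>u\<in>\<U>. \<forall>m. smooth_on (chart_range (fst u)) (sheet \<A> f u m)) \<and>
     (\<forall>K k l \<epsilon>. compact K \<and> \<epsilon> > 0 \<longrightarrow>
        (\<exists>R. \<forall>u\<in>\<U>. \<forall>b\<in>K \<inter> fst (fst u). \<forall>m.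
           let x = snd (fst u) b;
               G = matrix_inv (metric_matrix \<A> g (fst u) b);
               \<eta> = grad (snd u) x + int_vec m
           in covector_norm G \<eta> > R \<longrightarrow>
              covector_norm G \<eta> ^ k * tensor_norm G l (\<lambda>J. partials J (sheet \<A> f u m) x) < \<epsilon>))"

text \<open>
  The value of the transform does not depend on the representative \<open>\<xi>\<close> of \<open>q\<close>, because \<open>m\<close> is integral.
\<close>

definition SYZ ::
  "('b::t2_space, 'n::finite) chart set \<Rightarrow> ('b, 'n) potential set \<Rightarrow>
   ('b \<times> ('b, 'n) vect \<Rightarrow> complex) \<Rightarrow> ('b, 'n) lsection" where
  "SYZ \<A> \<U> f q u =
     (if q \<in> X_check \<A> \<and> u \<in> \<U> \<and> fst q \<in> fst (fst u)
      then let \<xi> = (SOME \<xi>. \<xi> \<in> snd q); y = \<xi> (fst u); x = snd (fst u) (fst q)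
           in infsum (\<lambda>m. sheet \<A> f u m x * exp (2 * of_real pi * \<i> * of_real (int_vec m \<bullet> y))) UNIV
      else 0)"

text \<open>
  The rapidly decaying functions whose transform is a complex polarized section, and the
  restriction of a function to the constant paths.  The constant path at \<open>b\<close> belongs to the path
  space exactly when \<open>b\<close> lies under an intersection point of the zero section and \<open>L_g\<close>, i.e. when
  the fibre over \<open>b\<close> is Bohr-Sommerfeld.
\<close>

definition polarized_functions ::
  "('b::t2_space, 'n::finite) chart set \<Rightarrow> ('b \<Rightarrow> ('b, 'n) vect \<Rightarrow> ('b, 'n) vect \<Rightarrow> real) \<Rightarrow>
   ('b, 'n) potential set \<Rightarrow> ('b \<times> ('b, 'n) vect \<Rightarrow> complex) set" where
  "polarized_functions \<A> g \<U> = {f. rapidly_decaying \<A> g \<U> f \<and> SYZ \<A> \<U> f \<in> Gamma_complex \<A> \<U>}"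

definition at_constant_paths :: "('b \<times> ('b, 'n::finite) vect \<Rightarrow> complex) \<Rightarrow> 'b \<Rightarrow> complex" where
  "at_constant_paths f b = f (b, 0)"

text \<open>
  The map induced by the transform: a Bohr-Sommerfeld fibre over \<open>b\<close> goes to the transform of the
  polarized function with value \<open>1\<close> at the constant path at \<open>b\<close> and \<open>0\<close> at all other constant paths.
\<close>

definition SYZ_induced ::
  "('b::t2_space, 'n::finite) chart set \<Rightarrow> ('b \<Rightarrow> ('b, 'n) vect \<Rightarrow> ('b, 'n) vect \<Rightarrow> real) \<Rightarrow>
   ('b, 'n) potential set \<Rightarrow> ('b \<Rightarrow> complex) \<Rightarrow> ('b, 'n) lsection" where
  "SYZ_induced \<A> g \<U> a = SYZ \<A> \<U> (inv_into (polarized_functions \<A> g \<U>) at_constant_paths a)"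


section \<open>Linear isomorphisms between spaces of functions\<close>

definition complex_subspace :: "(complex \<Rightarrow> 'v \<Rightarrow> 'v) \<Rightarrow> 'v::ab_group_add set \<Rightarrow> bool" where
  "complex_subspace sc V \<longleftrightarrow>
     0 \<in> V \<and> (\<forall>v\<in>V. \<forall>w\<in>V. v + w \<in> V) \<and> (\<forall>a. \<forall>v\<in>V. sc a v \<in> V)"

definition complex_linear_iso ::
  "(complex \<Rightarrow> 'v \<Rightarrow> 'v) \<Rightarrow> (complex \<Rightarrow> 'w \<Rightarrow> 'w) \<Rightarrow> 'v::ab_group_add set \<Rightarrow> 'w::ab_group_add set \<Rightarrow>
   ('v \<Rightarrow> 'w) \<Rightarrow> bool" where
  "complex_linear_iso sv sw V W T \<longleftrightarrow>
     complex_subspace sv V \<and> complex_subspace sw W \<and> bij_betw T V W \<and>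
     (\<forall>v\<in>V. \<forall>w\<in>V. T (v + w) = T v + T w) \<and> (\<forall>a. \<forall>v\<in>V. T (sv a v) = sw a (T v))"

definition fun_scale :: "complex \<Rightarrow> ('a \<Rightarrow> complex) \<Rightarrow> 'a \<Rightarrow> complex" where
  "fun_scale a f = (\<lambda>x. a * f x)"

definition section_scale :: "complex \<Rightarrow> ('a \<Rightarrow> 'i \<Rightarrow> complex) \<Rightarrow> 'a \<Rightarrow> 'i \<Rightarrow> complex" where
  "section_scale a s = (\<lambda>q u. a * s q u)"

end

theory Submission imports Defs begin

text \<open>
  The universal cover is \<open>\<real>\<^sup>n\<close>, with an affine deck group, and the local potentials glue to a convex function
  \<open>\<Phi>\<close> on it.  In the frame defined by \<open>\<Phi>\<close> a section is a function \<open>S(w, y)\<close> that is periodic in \<open>y\<close>, and the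
  transform is a fibrewise Fourier series.  Holomorphicity of \<open>S\<close> says that its \<open>m\<close>-th Fourier coefficient
  is \<open>c\<^sub>m exp (-2\<pi> H\<^sub>m)\<close> with \<open>H\<^sub>m(w) = \<Phi>(w) + (m, w)\<close>.  As \<open>B\<close> is compact, the coefficients are bounded, so
  \<open>c\<^sub>m = 0\<close> unless \<open>H\<^sub>m\<close> is bounded below.  In that case \<open>H\<^sub>m\<close> attains its minimum, by cocompactness and
  strict convexity; the minimum is a constant path, which lies over a Bohr-Sommerfeld fibre.  Conversely,
  \<open>H\<^sub>m(w) - min H\<^sub>m\<close> grows faster than any multiple of \<open>|m|\<close>, uniformly for \<open>w\<close> in a compact set, so that every choice of
  values at the Bohr-Sommerfeld fibres gives a rapidly decaying function.
\<close>

section \<open>Critical points of cocompact convex functions\<close>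

text \<open>No growth of \<Phi> is assumed, so every bound has to come from compactness of the base.
  The obstacle is that \<Phi> is not invariant: a deck transformation \<gamma> changes it by an
  affine function. What is invariant is its Bregman divergence \<open>breg\<close>, which does not
  see affine terms. It serves three times: as the measure of convexity that produces minima, as the
  exponent \<open>breg w (wmin m)\<close> of the solutions, and as the reason why these solutions
  descend to the path space. Subtracting min H_m is forced for the same reason: the frames of the
  line bundle only see differentials of potentials, so the additive constant in \<Phi> \<circ>
  \<gamma> has to cancel. Integrality of the metric lets \<Phi> differ from each local potential by
  an integral slope, so that sheets, Fourier modes and frames are indexed by one lattice. Different
  indices m may lead to the same Bohr-Sommerfeld fibre; they are then related by the deck group, and
  equality of the coefficients of a section at such indices is what attaches exactly one free number
  to each fibre.\<close>

lemma continuous_on_matrix_vector_mult [continuous_intros]: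
  fixes A :: "'a::topological_space \<Rightarrow> real^'n::finite^'m::finite"
  assumes "continuous_on S A" "continuous_on S x"
  shows "continuous_on S (\<lambda>w. A w *v x w)"
  unfolding matrix_vector_mult_def by (intro continuous_intros assms)

locale strictly_convex =
  fixes \<Phi> :: "real^'n::finite \<Rightarrow> real" and p :: "real^'n \<Rightarrow> real^'n" and H :: "real^'n \<Rightarrow> real^'n^'n"
  assumes grad: "\<And>x. (\<Phi> has_derivative (\<lambda>v. p x \<bullet> v)) (at x)"
    and hess: "\<And>x. (p has_derivative (\<lambda>v. H x *v v)) (at x)"
    and contH: "continuous_on UNIV H"
    and pos: "\<And>x v. v \<noteq> 0 \<Longrightarrow> v \<bullet> (H x *v v) > 0"
begin

text \<open>The Bregman divergence of \<Phi>. Adding an affine function to \<Phi> does not change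
  it, and it is natural under affine substitutions; hence it can be invariant under a group that
  preserves \<Phi> only up to affine functions.\<close>

definition breg :: "real^'n \<Rightarrow> real^'n \<Rightarrow> real" where
  "breg y x = \<Phi> y - \<Phi> x - p x \<bullet> (y - x)"

lemma cont_p: "continuous_on S p"
  using has_derivative_continuous[OF hess] by (auto intro: continuous_at_imp_continuous_on)

lemma cont_Phi: "continuous_on S \<Phi>"
  using has_derivative_continuous[OF grad] by (auto intro: continuous_at_imp_continuous_on)

lemma contPhi' [continuous_intros]: "continuous_on S f \<Longrightarrow> continuous_on S (\<lambda>x. \<Phi> (f x))"
  by (rule continuous_on_compose2[OF cont_Phi[of UNIV]]) auto

lemma contH' [continuous_intros]: "continuous_on S f \<Longrightarrow> continuous_on S (\<lambda>x. H (f x))"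
  by (rule continuous_on_compose2[OF contH]) auto

lemma breg_self [simp]: "breg x x = 0" by (simp add: breg_def)

lemma p_line_derivative:
  "((\<lambda>t. p (x + t *\<^sub>R v) \<bullet> v) has_real_derivative v \<bullet> (H (x + t *\<^sub>R v) *v v)) (at t)"
proof -
  have "((\<lambda>t. x + t *\<^sub>R v) has_derivative (\<lambda>h. h *\<^sub>R v)) (at t)" by (auto intro!: derivative_eq_intros)
  then have "((\<lambda>t. p (x + t *\<^sub>R v)) has_derivative (\<lambda>h. H (x + t *\<^sub>R v) *v (h *\<^sub>R v))) (at t)"
    by (rule has_derivative_compose[OF _ hess])
  then have "((\<lambda>t. p (x + t *\<^sub>R v) \<bullet> v) has_derivative (\<lambda>h. (H (x + t *\<^sub>R v) *v (h *\<^sub>R v)) \<bullet> v)) (at t)"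
    by (auto intro!: derivative_eq_intros)
  moreover have "(H (x + t *\<^sub>R v) *v (h *\<^sub>R v)) \<bullet> v = v \<bullet> (H (x + t *\<^sub>R v) *v v) * h" for h
    by (simp add: matrix_vector_mult_scaleR inner_commute)
  ultimately show ?thesis by (simp add: has_field_derivative_def)
qed

lemma Phi_line_derivative:
  "((\<lambda>t. \<Phi> (x + t *\<^sub>R v)) has_real_derivative p (x + t *\<^sub>R v) \<bullet> v) (at t)"
proof -
  have "((\<lambda>t. x + t *\<^sub>R v) has_derivative (\<lambda>h. h *\<^sub>R v)) (at t)" by (auto intro!: derivative_eq_intros)
  then have "((\<lambda>t. \<Phi> (x + t *\<^sub>R v)) has_derivative (\<lambda>h. p (x + t *\<^sub>R v) \<bullet> (h *\<^sub>R v))) (at t)"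
    by (rule has_derivative_compose[OF _ grad])
  moreover have "(\<lambda>h. p (x + t *\<^sub>R v) \<bullet> (h *\<^sub>R v)) = (*) (p (x + t *\<^sub>R v) \<bullet> v)" by auto
  ultimately show ?thesis by (simp add: has_field_derivative_def)
qed

lemma p_line_strict:
  assumes "v \<noteq> 0" "0 < t" shows "p x \<bullet> v < p (x + t *\<^sub>R v) \<bullet> v"
proof -
  have "p (x + 0 *\<^sub>R v) \<bullet> v < p (x + t *\<^sub>R v) \<bullet> v"
    by (rule DERIV_pos_imp_increasing[of 0 t "\<lambda>t. p (x + t *\<^sub>R v) \<bullet> v"])
       (use assms p_line_derivative pos in blast)+
  then show ?thesis by simp
qed

text \<open>By the mean value theorem on the segment from \<open>x\<close> to \<open>y\<close>, the
  divergence is the difference of the slopes at an interior point and at \<open>x\<close>, and the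
  slope increases strictly along the segment.\<close>

lemma breg_pos: assumes "y \<noteq> x" shows "breg y x > 0"
proof -
  define v where "v = y - x"
  have v: "v \<noteq> 0" "y = x + 1 *\<^sub>R v" using assms by (auto simp: v_def)
  obtain t where t: "0 < t" "t < 1" "\<Phi> (x + 1 *\<^sub>R v) - \<Phi> (x + 0 *\<^sub>R v) = (1 - 0) * (p (x + t *\<^sub>R v) \<bullet> v)"
    using MVT2[of 0 1 "\<lambda>t. \<Phi> (x + t *\<^sub>R v)" "\<lambda>t. p (x + t *\<^sub>R v) \<bullet> v"] Phi_line_derivative by auto
  have "breg y x = p (x + t *\<^sub>R v) \<bullet> v - p x \<bullet> v" using t(3) v by (simp add: breg_def)
  then show ?thesis using p_line_strict[OF v(1) t(1)] by simp
qed

lemma breg_nonneg: "breg y x \<ge> 0" by (cases "y = x") (auto simp: breg_pos less_imp_le)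

text \<open>The two opposite divergences add up to \<open>(p x - p y) \<bullet> (x - y)\<close>,
  which vanishes if the gradients agree. This makes the critical point of each \<Phi> + (m, w)
  unique.\<close>

lemma p_inj: assumes "p x = p y" shows "x = y"
proof (rule ccontr)
  assume "x \<noteq> y"
  then have "breg x y > 0" "breg y x > 0" by (auto intro: breg_pos)
  then show False using assms by (simp add: breg_def algebra_simps inner_diff_right)
qed

end

text \<open>Invariance is imposed on \<open>breg\<close> because \<Phi> itself changes by affine
  functions under the group. Cocompactness is expressed by one ball that meets every orbit.\<close>

locale cocompact_convex = strictly_convex \<Phi> p H
  for \<Phi> :: "real^'n::finite \<Rightarrow> real" and p H +
  fixes \<Gamma> :: "(real^'n \<Rightarrow> real^'n) set"
  assumes affine: "\<And>\<gamma>. \<gamma> \<in> \<Gamma> \<Longrightarrow> \<exists>A t. \<gamma> = (\<lambda>x. A *v x + t)"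
    and inverse: "\<And>\<gamma>. \<gamma> \<in> \<Gamma> \<Longrightarrow> \<exists>\<delta>\<in>\<Gamma>. \<gamma> \<circ> \<delta> = id \<and> \<delta> \<circ> \<gamma> = id"
    and equivariant: "\<And>\<gamma> x y. \<gamma> \<in> \<Gamma> \<Longrightarrow> breg (\<gamma> y) (\<gamma> x) = breg y x"
    and cocompact: "\<exists>r. \<forall>x. \<exists>\<gamma>\<in>\<Gamma>. norm (\<gamma> x) \<le> r"
begin

text \<open>
  An almost minimal point \<open>w\<close> is moved into a fixed ball by \<open>\<gamma>\<close>.  The strict midpoint convexity of \<open>\<Phi>\<close>
  is invariant under \<open>\<Gamma>\<close> and uniform on compact sets, so the values on the unit sphere
  around \<open>\<gamma> w\<close> exceed the value at \<open>w\<close>, and there is a critical point inside.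
\<close>

theorem critical_point_of_bounded_below:
  assumes L: "\<And>x. L \<le> \<Phi> x - b \<bullet> x"
  shows "\<exists>x. p x = b"
proof -
  define h where "h x = \<Phi> x - b \<bullet> x" for x
  define mid where "mid x y = (1/2) *\<^sub>R x + (1/2) *\<^sub>R y" for x y :: "real^'n"
  \<comment> \<open>The defect of midpoint convexity, written through \<open>breg\<close> at the
    midpoint: the two linear terms cancel there, so the same number is a second difference of
    \<open>h\<close> and also an invariant of the group.\<close>
  define gap where "gap x z = breg x (mid x z) + breg z (mid x z)" for x z
  have gap: "gap x z = h x + h z - 2 * h (mid x z)" for x z
    by (simp add: gap_def breg_def h_def mid_def inner_diff_right inner_add_right algebra_simps)
  obtain r where r: "\<And>x. \<exists>\<gamma>\<in>\<Gamma>. norm (\<gamma> x) \<le> r" using cocompact by blast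
  define K where "K = cball (0::real^'n) r \<times> sphere (0::real^'n) 1"
  have "compact K" unfolding K_def by (intro compact_Times compact_cball compact_sphere)
  moreover have "K \<noteq> {}"
  proof -
    have "axis undefined 1 \<in> sphere (0::real^'n) 1" by simp
    moreover have "r \<ge> 0" using r norm_ge_zero order_trans by blast
    then have "0 \<in> cball (0::real^'n) r" by simp
    ultimately show ?thesis unfolding K_def by blast
  qed
  moreover have "continuous_on K (\<lambda>z. gap (fst z) (fst z + snd z))"
  proof -
    have h: "continuous_on K (\<lambda>z. h (f z))" if "continuous_on K f" for f unfolding h_def by (intro contPhi' continuous_intros that)
    have "continuous_on K (\<lambda>z. fst z)" "continuous_on K (\<lambda>z. fst z + snd z)" "continuous_on K (\<lambda>z. mid (fst z) (fst z + snd z))"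
      unfolding mid_def by (intro continuous_intros)+
    from this[THEN h] show ?thesis unfolding gap by (intro continuous_on_diff continuous_on_add continuous_on_mult continuous_on_const)
  qed
  ultimately have "\<exists>z\<in>K. \<forall>y\<in>K. gap (fst z) (fst z + snd z) \<le> gap (fst y) (fst y + snd y)"
    by (rule continuous_attains_inf)
  then obtain z where z: "z \<in> K" "\<And>y. y \<in> K \<Longrightarrow> gap (fst z) (fst z + snd z) \<le> gap (fst y) (fst y + snd y)" by blast
  define \<eta> where "\<eta> = gap (fst z) (fst z + snd z)"
  have "\<eta> > 0"
  proof -
    have "snd z \<noteq> 0" using z(1) by (auto simp: K_def)
    moreover have "mid (fst z) (fst z + snd z) - fst z = (1/2) *\<^sub>R snd z" by (simp add: mid_def vec_eq_iff field_simps)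
    ultimately have "fst z \<noteq> mid (fst z) (fst z + snd z)" by auto
    then show ?thesis unfolding \<eta>_def gap_def using breg_pos breg_nonneg by (metis add_pos_nonneg)
  qed
  have \<eta>: "\<eta> \<le> gap x y" if "norm x \<le> r" "norm (y - x) = 1" for x y
    using z(2)[of "(x, y - x)"] that by (simp add: K_def \<eta>_def)
  define I where "I = Inf (range h)"
  have I: "I \<le> h x" for x unfolding I_def by (rule cInf_lower) (use L in \<open>auto simp: h_def bdd_below_def\<close>)
  obtain w where w: "h w < I + \<eta> / 2"
    using cInf_lessD[of "range h" "I + \<eta> / 2"] \<open>\<eta> > 0\<close> unfolding I_def by auto
  obtain \<gamma> where \<gamma>: "\<gamma> \<in> \<Gamma>" "norm (\<gamma> w) \<le> r" using r by blast
  obtain \<delta> where \<delta>: "\<delta> \<in> \<Gamma>" "\<And>x. \<gamma> (\<delta> x) = x" "\<And>x. \<delta> (\<gamma> x) = x" using inverse[OF \<gamma>(1)] by (metis comp_apply id_apply)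
  have cont: "continuous_on UNIV \<rho>" if "\<rho> \<in> \<Gamma>" for \<rho> using affine[OF that] by (auto intro!: continuous_intros)
  have \<gamma>mid: "\<gamma> (mid x y) = mid (\<gamma> x) (\<gamma> y)" for x y
  proof -
    obtain A t where "\<gamma> = (\<lambda>x. A *v x + t)" using affine[OF \<gamma>(1)] by blast
    then show ?thesis
      by (simp add: mid_def matrix_vector_right_distrib matrix_vector_mult_scaleR vec_eq_iff field_simps)
  qed
  \<comment> \<open>A compact neighbourhood of \<open>w\<close> that becomes the unit ball after
    transport by \<gamma>. Its Euclidean size is not controlled; only its boundary, where
    \<open>gap\<close> is at least \<eta>, matters.\<close>
  define S where "S = \<delta> ` cball (\<gamma> w) 1"
  have "compact S" unfolding S_def
    by (intro compact_continuous_image compact_cball continuous_on_subset[OF cont[OF \<delta>(1)]]) simp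
  moreover have wS: "w \<in> S" unfolding S_def using \<delta>(3)[of w] by (intro image_eqI[of _ _ "\<gamma> w"]) auto
  moreover have "continuous_on S h" unfolding h_def by (intro continuous_intros)
  ultimately obtain x where x: "x \<in> S" "\<And>y. y \<in> S \<Longrightarrow> h x \<le> h y" using continuous_attains_inf[of S h] by blast
  have "\<gamma> x \<in> cball (\<gamma> w) 1" using x(1) \<delta>(2) by (auto simp: S_def)
  moreover have "norm (\<gamma> x - \<gamma> w) \<noteq> 1"
  proof
    assume "norm (\<gamma> x - \<gamma> w) = 1"
    then have "\<eta> \<le> gap (\<gamma> w) (\<gamma> x)" by (rule \<eta>[OF \<gamma>(2)])
    also have "\<dots> = gap w x" unfolding gap_def \<gamma>mid[symmetric] equivariant[OF \<gamma>(1)] ..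
    \<comment> \<open>As \<open>x\<close> minimises on \<open>S\<close>, both \<open>h w\<close> and
      \<open>h x\<close> are below \<open>I + \<eta> / 2\<close>, while \<open>h\<close> at the
      midpoint is at least \<open>I\<close>; the second difference is then less than \<eta>.\<close>
    finally show False using gap[of w x] w x(2)[OF wS] I[of "mid w x"] by linarith
  qed
  ultimately have xb: "x \<in> \<gamma> -` ball (\<gamma> w) 1" by (simp add: dist_norm norm_minus_commute)
  have "open (\<gamma> -` ball (\<gamma> w) 1)" by (rule open_vimage[OF open_ball cont[OF \<gamma>(1)]])
  moreover have "\<gamma> -` ball (\<gamma> w) 1 \<subseteq> S" unfolding S_def
    using \<delta>(3) by (auto intro!: image_eqI[of _ \<delta> "\<gamma> _"] simp: less_imp_le)
  moreover have "(h has_derivative (\<lambda>v. (p x - b) \<bullet> v)) (at x)"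
    unfolding h_def by (rule derivative_eq_intros grad refl)+ (simp add: inner_diff_left)
  ultimately have "(\<lambda>v. (p x - b) \<bullet> v) = (\<lambda>v. 0)"
    using differential_zero_maxmin[OF xb] x(2) by blast
  then have "(p x - b) \<bullet> (p x - b) = 0" by meson
  then show ?thesis by auto
qed

end

section \<open>Smooth functions\<close>

lemma has_derivative_cong_open:
  assumes "open S" "x \<in> S" "\<And>y. y \<in> S \<Longrightarrow> f y = g y"
  shows "(f has_derivative f') (at x) \<longleftrightarrow> (g has_derivative f') (at x)"
  using has_derivative_transform_within_open[OF _ assms(1,2), of f f' UNIV g]
    has_derivative_transform_within_open[OF _ assms(1,2), of g f' UNIV f] assms(3) by auto

lemma frechet_derivative_cong_open:
  assumes "open S" "x \<in> S" "\<And>y. y \<in> S \<Longrightarrow> f y = g y"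
  shows "frechet_derivative f (at x) = frechet_derivative g (at x)"
  using has_derivative_cong_open[OF assms] by (simp add: frechet_derivative_def)

lemma Ck_on_cong:
  assumes "open S" "\<And>x. x \<in> S \<Longrightarrow> f x = g x"
  shows "Ck_on k S f \<longleftrightarrow> Ck_on k S g"
  using assms(2)
proof (induction k arbitrary: f g)
  case 0 then show ?case by (simp cong: continuous_on_cong)
next
  case (Suc k)
  have "f differentiable_on S \<longleftrightarrow> g differentiable_on S"
    using has_derivative_cong_open[OF assms(1) _ Suc.prems]
    by (simp add: differentiable_on_eq_differentiable_at[OF assms(1)] differentiable_def)
  moreover have "Ck_on k S (\<lambda>x. frechet_derivative f (at x) v) \<longleftrightarrow> Ck_on k S (\<lambda>x. frechet_derivative g (at x) v)" for v
    by (rule Suc.IH) (simp add: frechet_derivative_cong_open[OF assms(1) _ Suc.prems])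
  ultimately show ?case by simp
qed

lemma Ck_on_Suc_has_derivative:
  assumes "Ck_on (Suc k) S f" "open S" "x \<in> S"
  shows "(f has_derivative frechet_derivative f (at x)) (at x)"
  using assms by (auto simp: differentiable_on_eq_differentiable_at frechet_derivative_works[symmetric])

text \<open>On an open set any derivative exhibited by \<open>has_derivative\<close> agrees with
  \<open>frechet_derivative\<close>, so closure properties can be proved with explicit formulas for
  the derivative.\<close>

lemma Ck_on_SucI:
  assumes S: "open S" and d: "\<And>x. x \<in> S \<Longrightarrow> (f has_derivative f' x) (at x)"
    and c: "\<And>v. Ck_on k S (\<lambda>x. f' x v)"
  shows "Ck_on (Suc k) S f"
proof -
  have "frechet_derivative f (at x) = f' x" if "x \<in> S" for x
    using frechet_derivative_at[OF d[OF that]] by simp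
  then have "Ck_on k S (\<lambda>x. frechet_derivative f (at x) v)" for v
    using c[of v] Ck_on_cong[OF S, of "\<lambda>x. frechet_derivative f (at x) v" "\<lambda>x. f' x v"] by simp
  moreover have "f differentiable_on S"
    using d S by (auto simp: differentiable_on_eq_differentiable_at intro: differentiableI)
  ultimately show ?thesis by simp
qed

lemma Ck_on_subset:
  assumes "Ck_on k S f" "T \<subseteq> S" shows "Ck_on k T f"
  using assms by (induction k arbitrary: f) (auto intro: continuous_on_subset differentiable_on_subset)

lemma Ck_on_lower: "Ck_on (Suc k) S f \<Longrightarrow> Ck_on k S f"
proof (induction k arbitrary: f)
  case 0 then show ?case by (simp add: differentiable_imp_continuous_on)
next
  case (Suc k)
  then show ?case by (metis Ck_on.simps(2))
qed

text \<open>Patches regularity from chart to chart: every clause of \<open>Ck_on\<close> over an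
  open set concerns the behaviour near a point.\<close>

lemma Ck_on_local:
  assumes "\<And>x. x \<in> S \<Longrightarrow> \<exists>T. open T \<and> x \<in> T \<and> Ck_on k T f" "open S"
  shows "Ck_on k S f"
  using assms(1)
proof (induction k arbitrary: f)
  case 0
  have "continuous (at x) f" if "x \<in> S" for x
    using 0[OF that] by (auto simp: continuous_on_eq_continuous_at)
  then show ?case by (simp add: continuous_at_imp_continuous_on)
next
  case (Suc k)
  have "f differentiable (at x)" if x: "x \<in> S" for x
  proof -
    obtain T where "open T" "x \<in> T" "Ck_on (Suc k) T f" using Suc.prems[OF x] by blast
    then show ?thesis by (auto simp: differentiable_on_eq_differentiable_at)
  qed
  moreover have "Ck_on k S (\<lambda>x. frechet_derivative f (at x) v)" for v
    by (rule Suc.IH) (use Suc.prems in fastforce)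
  ultimately show ?case using assms(2) by (simp add: differentiable_on_eq_differentiable_at)
qed

section \<open>Closure properties of C^k functions\<close>

lemma Ck_on_const: "open S \<Longrightarrow> Ck_on k S (\<lambda>x. c)"
proof (induction k arbitrary: c)
  case (Suc k)
  then show ?case by (intro Ck_on_SucI[where f'="\<lambda>x v. 0"]) auto
qed simp

lemma Ck_on_add: "open S \<Longrightarrow> Ck_on k S f \<Longrightarrow> Ck_on k S g \<Longrightarrow> Ck_on k S (\<lambda>x. f x + g x)"
proof (induction k arbitrary: f g)
  case 0 then show ?case by (simp add: continuous_on_add)
next
  case (Suc k)
  show ?case
  proof (rule Ck_on_SucI[OF Suc.prems(1)])
    fix x assume x: "x \<in> S"
    show "((\<lambda>x. f x + g x) has_derivative (\<lambda>v. frechet_derivative f (at x) v + frechet_derivative g (at x) v)) (at x)"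
      by (rule has_derivative_add[OF Ck_on_Suc_has_derivative[OF Suc.prems(2,1) x] Ck_on_Suc_has_derivative[OF Suc.prems(3,1) x]])
  qed (use Suc in auto)
qed

lemma Ck_on_bilinear:
  assumes "bounded_bilinear pr"
  shows "open S \<Longrightarrow> Ck_on k S f \<Longrightarrow> Ck_on k S g \<Longrightarrow> Ck_on k S (\<lambda>x. pr (f x) (g x))"
proof (induction k arbitrary: f g)
  case 0 then show ?case using bounded_bilinear.continuous_on[OF assms] by simp
next
  case (Suc k)
  show ?case
  proof (rule Ck_on_SucI[OF Suc.prems(1)])
    fix x assume "x \<in> S"
    then show "((\<lambda>x. pr (f x) (g x)) has_derivative
       (\<lambda>v. pr (f x) (frechet_derivative g (at x) v) + pr (frechet_derivative f (at x) v) (g x))) (at x)"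
      by (intro bounded_bilinear.FDERIV[OF assms] Ck_on_Suc_has_derivative[OF Suc.prems(2,1)]
          Ck_on_Suc_has_derivative[OF Suc.prems(3,1)])
  next
    fix v
    show "Ck_on k S (\<lambda>x. pr (f x) (frechet_derivative g (at x) v) + pr (frechet_derivative f (at x) v) (g x))"
      by (intro Ck_on_add Suc.IH Suc.prems) (use Suc.prems in \<open>auto intro: Ck_on_lower\<close>)
  qed
qed

lemma Ck_on_linear_comp:
  assumes "bounded_linear L"
  shows "open S \<Longrightarrow> Ck_on k S f \<Longrightarrow> Ck_on k S (\<lambda>x. L (f x))"
proof (induction k arbitrary: f)
  case 0 then show ?case using bounded_linear.continuous_on[OF assms] by simp
next
  case (Suc k)
  show ?case
  proof (rule Ck_on_SucI[OF Suc.prems(1)])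
    fix x assume x: "x \<in> S"
    show "((\<lambda>x. L (f x)) has_derivative (\<lambda>v. L (frechet_derivative f (at x) v))) (at x)"
      by (rule bounded_linear.has_derivative[OF assms Ck_on_Suc_has_derivative[OF Suc.prems(2,1) x]])
  qed (use Suc in auto)
qed

lemma Ck_on_bounded_linear: "bounded_linear L \<Longrightarrow> open S \<Longrightarrow> Ck_on k S L"
proof (induction k)
  case 0 then show ?case by (simp add: linear_continuous_on)
next
  case (Suc k)
  show ?case by (rule Ck_on_SucI[where f'="\<lambda>x. L"]) (use Suc in \<open>auto intro: bounded_linear_imp_has_derivative Ck_on_const\<close>)
qed

text \<open>Transition maps, lifted charts and deck transformations are all affine. For such
  substitutions the derivative is again a function composed with the same map, so the induction
  closes at once.\<close>

lemma Ck_on_affine_comp: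
  assumes L: "bounded_linear L" and T: "open T"
  shows "open S \<Longrightarrow> (\<And>x. x \<in> S \<Longrightarrow> L x + c \<in> T) \<Longrightarrow> Ck_on k T f \<Longrightarrow> Ck_on k S (\<lambda>x. f (L x + c))"
proof (induction k arbitrary: f)
  case 0
  have "continuous_on S (\<lambda>x. L x + c)" using L by (intro continuous_intros linear_continuous_on)
  then show ?case using 0 by (auto intro: continuous_on_compose2)
next
  case (Suc k)
  show ?case
  proof (rule Ck_on_SucI[OF Suc.prems(1)])
    fix x assume x: "x \<in> S"
    have "((\<lambda>x. L x + c) has_derivative L) (at x)"
      using bounded_linear_imp_has_derivative[OF L] by (auto intro!: derivative_eq_intros)
    from has_derivative_compose[OF this Ck_on_Suc_has_derivative[OF Suc.prems(3) T Suc.prems(2)[OF x]]]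
    show "((\<lambda>x. f (L x + c)) has_derivative (\<lambda>v. frechet_derivative f (at (L x + c)) (L v))) (at x)" .
  next
    fix v show "Ck_on k S (\<lambda>x. frechet_derivative f (at (L x + c)) (L v))"
      using Suc.IH[of "\<lambda>y. frechet_derivative f (at y) (L v)"] Suc.prems by simp
  qed
qed

text \<open>The derivative of \<open>exp (f x)\<close> contains \<open>exp (f x)\<close> itself,
  which is covered by the induction hypothesis one order lower.\<close>

lemma Ck_on_exp:
  fixes f :: "'a::real_normed_vector \<Rightarrow> 'b::{real_normed_field,banach}"
  shows "open S \<Longrightarrow> Ck_on k S f \<Longrightarrow> Ck_on k S (\<lambda>x. exp (f x))"
proof (induction k)
  case 0 then show ?case by (simp add: continuous_on_exp)
next
  case (Suc k)
  show ?case
  proof (rule Ck_on_SucI[OF Suc.prems(1)])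
    fix x assume "x \<in> S"
    then have "(f has_derivative frechet_derivative f (at x)) (at x)"
      by (rule Ck_on_Suc_has_derivative[OF Suc.prems(2,1)])
    from has_derivative_compose[OF this DERIV_exp[unfolded has_field_derivative_def]]
    show "((\<lambda>x. exp (f x)) has_derivative (\<lambda>v. exp (f x) * frechet_derivative f (at x) v)) (at x)" .
  next
    fix v
    have "Ck_on k S (\<lambda>x. exp (f x))" by (rule Suc.IH[OF Suc.prems(1) Ck_on_lower[OF Suc.prems(2)]])
    then show "Ck_on k S (\<lambda>x. exp (f x) * frechet_derivative f (at x) v)"
      by (rule Ck_on_bilinear[OF bounded_bilinear_mult Suc.prems(1)]) (use Suc.prems in auto)
  qed
qed

lemma smooth_on_mult:
  fixes f g :: "'a::real_normed_vector \<Rightarrow> 'b::real_normed_algebra"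
  shows "open S \<Longrightarrow> smooth_on S f \<Longrightarrow> smooth_on S g \<Longrightarrow> smooth_on S (\<lambda>x. f x * g x)"
  by (simp add: smooth_on_def Ck_on_bilinear[OF bounded_bilinear_mult])

lemma smooth_on_add: "open S \<Longrightarrow> smooth_on S f \<Longrightarrow> smooth_on S g \<Longrightarrow> smooth_on S (\<lambda>x. f x + g x)"
  by (simp add: smooth_on_def Ck_on_add)

lemma smooth_on_const: "open S \<Longrightarrow> smooth_on S (\<lambda>x. c)"
  by (simp add: smooth_on_def Ck_on_const)

lemma smooth_on_linear_comp: "bounded_linear L \<Longrightarrow> open S \<Longrightarrow> smooth_on S f \<Longrightarrow> smooth_on S (\<lambda>x. L (f x))"
  by (simp add: smooth_on_def Ck_on_linear_comp)

lemma smooth_on_bounded_linear: "bounded_linear L \<Longrightarrow> open S \<Longrightarrow> smooth_on S L"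
  by (simp add: smooth_on_def Ck_on_bounded_linear)

lemma smooth_on_affine_comp:
  "bounded_linear L \<Longrightarrow> open T \<Longrightarrow> open S \<Longrightarrow> (\<And>x. x \<in> S \<Longrightarrow> L x + c \<in> T) \<Longrightarrow> smooth_on T f \<Longrightarrow>
   smooth_on S (\<lambda>x. f (L x + c))"
  by (simp add: smooth_on_def Ck_on_affine_comp)

lemma smooth_on_exp:
  fixes f :: "'a::real_normed_vector \<Rightarrow> 'b::{real_normed_field,banach}"
  shows "open S \<Longrightarrow> smooth_on S f \<Longrightarrow> smooth_on S (\<lambda>x. exp (f x))"
  by (simp add: smooth_on_def Ck_on_exp)

lemma smooth_on_cong: "open S \<Longrightarrow> (\<And>x. x \<in> S \<Longrightarrow> f x = g x) \<Longrightarrow> smooth_on S f \<longleftrightarrow> smooth_on S g"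
  using Ck_on_cong[of S f g] by (simp add: smooth_on_def)

lemma smooth_on_subset: "smooth_on S f \<Longrightarrow> T \<subseteq> S \<Longrightarrow> smooth_on T f"
  by (auto simp: smooth_on_def intro: Ck_on_subset)

lemma smooth_on_local:
  assumes "\<And>x. x \<in> S \<Longrightarrow> \<exists>T. open T \<and> x \<in> T \<and> smooth_on T f" "open S"
  shows "smooth_on S f"
  unfolding smooth_on_def by (intro allI Ck_on_local assms(2)) (use assms(1) in \<open>meson smooth_on_def\<close>)

lemma smooth_on_has_derivative:
  "smooth_on S f \<Longrightarrow> open S \<Longrightarrow> x \<in> S \<Longrightarrow> (f has_derivative frechet_derivative f (at x)) (at x)"
  unfolding smooth_on_def using Ck_on_Suc_has_derivative by blast

lemma smooth_on_derivative:
  assumes "smooth_on S f" shows "smooth_on S (\<lambda>x. frechet_derivative f (at x) v)"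
  unfolding smooth_on_def
proof
  fix k have "Ck_on (Suc k) S f" using assms unfolding smooth_on_def by blast
  then show "Ck_on k S (\<lambda>x. frechet_derivative f (at x) v)" by simp
qed

lemma smooth_on_continuous: "smooth_on S f \<Longrightarrow> continuous_on S f"
  unfolding smooth_on_def using Ck_on.simps(1) by blast

lemma smooth_on_partial: "smooth_on S f \<Longrightarrow> smooth_on S (partial j f)"
  unfolding partial_def by (rule smooth_on_derivative)

lemma partial_cong_open:
  "open S \<Longrightarrow> x \<in> S \<Longrightarrow> (\<And>y. y \<in> S \<Longrightarrow> f y = g y) \<Longrightarrow> partial j f x = partial j g x"
  unfolding partial_def using frechet_derivative_cong_open by metis

lemma partial_at: "(f has_derivative f') (at x) \<Longrightarrow> partial j f x = f' (axis j 1)"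
  unfolding partial_def by (metis frechet_derivative_at)

lemma linear_axis_expansion:
  fixes l :: "real^'n::finite \<Rightarrow> 'a::real_vector"
  assumes "linear l" shows "l v = (\<Sum>j\<in>UNIV. v $ j *\<^sub>R l (axis j 1))"
proof -
  have "(\<Sum>j\<in>UNIV. (v $ j) *\<^sub>R axis j 1) = v"
    using basis_expansion[of v] by (simp only: scalar_mult_eq_scaleR)
  then have "l v = l (\<Sum>j\<in>UNIV. (v $ j) *\<^sub>R axis j 1)" by (simp only:)
  then show ?thesis by (simp add: linear_sum[OF assms] linear_scale[OF assms])
qed

lemma has_derivative_partial:
  fixes f :: "real^'n::finite \<Rightarrow> 'a::real_normed_vector"
  assumes "(f has_derivative f') (at x)"
  shows "(f has_derivative (\<lambda>v. \<Sum>j\<in>UNIV. v $ j *\<^sub>R partial j f x)) (at x)"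
  using linear_axis_expansion[OF has_derivative_linear[OF assms]] assms partial_at[OF assms]
  by (metis (no_types, lifting) ext)

lemma has_derivative_grad:
  assumes "smooth_on S \<phi>" "open S" "x \<in> S"
  shows "(\<phi> has_derivative (\<lambda>v. grad \<phi> x \<bullet> v)) (at x)"
  using has_derivative_partial[OF smooth_on_has_derivative[OF assms]]
  by (simp add: grad_def inner_vec_def mult.commute)

lemma grad_at: "(f has_derivative (\<lambda>v. a \<bullet> v)) (at x) \<Longrightarrow> grad f x = a"
  by (simp add: grad_def partial_at inner_axis vec_eq_iff)

section \<open>Mixed partial derivatives and closed one-forms\<close>

lemma has_vector_derivative_line:
  assumes "(f has_derivative f') (at (x + t *\<^sub>R v))"
  shows "((\<lambda>t. f (x + t *\<^sub>R v)) has_vector_derivative f' v) (at t within U)"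
proof -
  have "((\<lambda>t. x + t *\<^sub>R v) has_derivative (\<lambda>h. h *\<^sub>R v)) (at t within U)"
    by (auto intro!: derivative_eq_intros)
  from has_derivative_compose[OF this assms]
  show ?thesis by (simp add: has_vector_derivative_def linear_scale[OF has_derivative_linear[OF assms]])
qed

text \<open>The increment of f along e_j is the integral of its j-th partial derivative.
  Differentiating this identity in direction e_i at 0 expresses the increment of the i-th partial
  derivative along e_j as an integral; differentiating that one along e_j at 0 compares the two
  mixed derivatives.\<close>

lemma mixed_partials_commute:
  fixes f :: "real^'n::finite \<Rightarrow> real"
  assumes f: "smooth_on S f" and S: "open S" "x \<in> S"
  shows "partial i (partial j f) x = partial j (partial i f) x"
proof -
  obtain r where r: "r > 0" "ball x r \<subseteq> S" using S open_contains_ball by blast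
  \<comment> \<open>Two displacements of length at most \<open>d\<close>, along different axes, must
    stay inside the ball of radius \<open>r\<close>.\<close>
  define d where "d = r / 3"
  have d: "d > 0" "2 * d < r" using r by (auto simp: d_def)
  let ?i = "axis i 1 :: real^'n" and ?j = "axis j 1 :: real^'n"
  have inS: "x + s *\<^sub>R ?i + t *\<^sub>R ?j \<in> S" if "\<bar>s\<bar> \<le> d" "\<bar>t\<bar> \<le> d" for s t
  proof -
    have "dist x (x + s *\<^sub>R ?i + t *\<^sub>R ?j) = norm (s *\<^sub>R ?i + t *\<^sub>R ?j)"
      by (metis add.assoc add_diff_cancel_left' dist_commute dist_norm)
    also have "\<dots> \<le> \<bar>s\<bar> * 1 + \<bar>t\<bar> * 1" by (metis norm_triangle_ineq norm_scaleR norm_axis_1)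
    finally show ?thesis using r that d by auto
  qed
  have inS': "x + t *\<^sub>R ?j \<in> S" if "\<bar>t\<bar> \<le> d" for t using inS[of 0 t] that d by simp
  have df: "(f has_derivative frechet_derivative f (at y)) (at y)" if "y \<in> S" for y
    using smooth_on_has_derivative[OF f S(1) that] .
  have dpf: "(partial k f has_derivative frechet_derivative (partial k f) (at y)) (at y)" if "y \<in> S" for y k
    using smooth_on_has_derivative[OF smooth_on_partial[OF f] S(1) that] .
  have ci: "continuous_on {0..d} (\<lambda>t. partial i (partial j f) (x + t *\<^sub>R ?j))"
    by (rule continuous_on_compose2[OF smooth_on_continuous[OF smooth_on_partial[OF smooth_on_partial[OF f]]]])
       (use inS' in \<open>auto intro!: continuous_intros\<close>)
  have key: "partial i f (x + t *\<^sub>R ?j) - partial i f x = integral {0..t} (\<lambda>\<tau>. partial i (partial j f) (x + \<tau> *\<^sub>R ?j))"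
    if t: "t \<in> {0..d}" for t
  proof -
    have eq: "integral (cbox 0 t) (\<lambda>\<tau>. partial j f ((x + s *\<^sub>R ?i) + \<tau> *\<^sub>R ?j)) = f ((x + t *\<^sub>R ?j) + s *\<^sub>R ?i) - f (x + s *\<^sub>R ?i)"
      if s: "s \<in> cbox (-d) d" for s
    proof -
      have "((\<lambda>\<tau>. partial j f ((x + s *\<^sub>R ?i) + \<tau> *\<^sub>R ?j)) has_integral
           f ((x + s *\<^sub>R ?i) + t *\<^sub>R ?j) - f ((x + s *\<^sub>R ?i) + 0 *\<^sub>R ?j)) {0..t}"
      proof (rule fundamental_theorem_of_calculus)
        fix \<tau> assume "\<tau> \<in> {0..t}"
        then have "x + s *\<^sub>R ?i + \<tau> *\<^sub>R ?j \<in> S" using t s inS by auto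
        then show "((\<lambda>\<tau>. f (x + s *\<^sub>R ?i + \<tau> *\<^sub>R ?j)) has_vector_derivative
            partial j f (x + s *\<^sub>R ?i + \<tau> *\<^sub>R ?j)) (at \<tau> within {0..t})"
          unfolding partial_def by (intro has_vector_derivative_line df)
      qed (use t in auto)
      then show ?thesis by (simp add: has_integral_iff add_ac)
    qed
    \<comment> \<open>The integral is differentiated in \<open>s\<close> in two ways: under the
      integral sign here, and through the difference of values of \<open>f\<close> in
      \<open>D2\<close>.\<close>
    have D1: "((\<lambda>s. integral (cbox 0 t) (\<lambda>\<tau>. partial j f ((x + s *\<^sub>R ?i) + \<tau> *\<^sub>R ?j))) has_vector_derivative
        integral (cbox 0 t) (\<lambda>\<tau>. partial i (partial j f) ((x + 0 *\<^sub>R ?i) + \<tau> *\<^sub>R ?j))) (at 0 within cbox (-d) d)"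
    proof (rule leibniz_rule_vector_derivative)
      fix s \<tau> assume s: "s \<in> cbox (-d) d" "\<tau> \<in> cbox 0 t"
      have "x + \<tau> *\<^sub>R ?j + s *\<^sub>R ?i \<in> S" using inS[of s \<tau>] s t by (auto simp: add_ac)
      from has_vector_derivative_line[OF dpf[OF this, of j]]
      show "((\<lambda>s. partial j f (x + s *\<^sub>R ?i + \<tau> *\<^sub>R ?j)) has_vector_derivative
          partial i (partial j f) (x + s *\<^sub>R ?i + \<tau> *\<^sub>R ?j)) (at s within cbox (-d) d)"
        by (simp add: partial_def add_ac)
    next
      fix s assume "s \<in> cbox (-d) d"
      then show "(\<lambda>\<tau>. partial j f (x + s *\<^sub>R ?i + \<tau> *\<^sub>R ?j)) integrable_on cbox 0 t"
        by (intro integrable_continuous continuous_on_compose2[OF smooth_on_continuous[OF smooth_on_partial[OF f]]])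
           (use inS t in \<open>auto intro!: continuous_intros\<close>)
    next
      show "continuous_on (cbox (-d) d \<times> cbox 0 t) (\<lambda>(s, \<tau>). partial i (partial j f) (x + s *\<^sub>R ?i + \<tau> *\<^sub>R ?j))"
        unfolding split_beta
        by (rule continuous_on_compose2[OF smooth_on_continuous[OF smooth_on_partial[OF smooth_on_partial[OF f]]]])
           (use inS t in \<open>auto intro!: continuous_intros\<close>)
    qed (use d in auto)
    have D2: "((\<lambda>s. integral (cbox 0 t) (\<lambda>\<tau>. partial j f ((x + s *\<^sub>R ?i) + \<tau> *\<^sub>R ?j))) has_vector_derivative
        partial i f (x + t *\<^sub>R ?j) - partial i f x) (at 0 within cbox (-d) d)"
    proof (rule has_vector_derivative_transform[OF _ eq])
      have "((\<lambda>s. f ((x + t *\<^sub>R ?j) + s *\<^sub>R ?i)) has_vector_derivative partial i f (x + t *\<^sub>R ?j)) (at 0 within cbox (-d) d)"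
        unfolding partial_def by (rule has_vector_derivative_line) (use df inS' t in auto)
      moreover have "((\<lambda>s. f (x + s *\<^sub>R ?i)) has_vector_derivative partial i f x) (at 0 within cbox (-d) d)"
        unfolding partial_def by (rule has_vector_derivative_line) (use df S in auto)
      ultimately show "((\<lambda>s. f ((x + t *\<^sub>R ?j) + s *\<^sub>R ?i) - f (x + s *\<^sub>R ?i)) has_vector_derivative
          partial i f (x + t *\<^sub>R ?j) - partial i f x) (at 0 within cbox (-d) d)"
        by (rule has_vector_derivative_diff)
    qed (use d in auto)
    show ?thesis
      using vector_derivative_unique_within_closed_interval[OF _ _ D2 D1] d by simp
  qed
  have "((\<lambda>t. integral {0..t} (\<lambda>\<tau>. partial i (partial j f) (x + \<tau> *\<^sub>R ?j))) has_vector_derivative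
      partial i (partial j f) (x + 0 *\<^sub>R ?j)) (at 0 within {0..d})"
    by (rule integral_has_vector_derivative[OF ci]) (use d in auto)
  then have E1: "((\<lambda>t. partial i f (x + t *\<^sub>R ?j) - partial i f x) has_vector_derivative partial i (partial j f) x) (at 0 within cbox 0 d)"
    using has_vector_derivative_transform[of 0 "{0..d}", OF _ key] d by simp
  have "((\<lambda>t. partial i f (x + t *\<^sub>R ?j)) has_vector_derivative partial j (partial i f) x) (at 0 within cbox 0 d)"
    unfolding partial_def[of j] by (rule has_vector_derivative_line) (use dpf S in auto)
  then have E2: "((\<lambda>t. partial i f (x + t *\<^sub>R ?j) - partial i f x) has_vector_derivative partial j (partial i f) x) (at 0 within cbox 0 d)"
    by (auto intro!: derivative_eq_intros)
  show ?thesis using vector_derivative_unique_within_closed_interval[OF _ _ E1 E2] d by simp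
qed

text \<open>The primitive is the integral of the form along the ray from 0, that is, of
  \<open>a (t *\<^sub>R x) \<bullet> x\<close> over t in [0,1]. Symmetry of \<open>A\<close>, i.e.
  closedness, identifies the gradient of the integrand with a total derivative in t.\<close>

lemma poincare_one_form:
  fixes a :: "real^'n::finite \<Rightarrow> real^'n" and A :: "real^'n \<Rightarrow> real^'n^'n"
  assumes d: "\<And>x. (a has_derivative (\<lambda>v. A x *v v)) (at x)" and cA: "continuous_on UNIV A"
    and sym: "\<And>x. transpose (A x) = A x"
  obtains \<Phi> where "\<And>x. (\<Phi> has_derivative (\<lambda>v. a x \<bullet> v)) (at x)"
proof -
  have ca: "continuous_on UNIV a" using has_derivative_continuous[OF d] by (auto intro: continuous_at_imp_continuous_on)
  have ca': "continuous_on S (\<lambda>x. a (f x))" if "continuous_on S f" for S :: "'x::topological_space set" and f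
    by (rule continuous_on_compose2[OF ca that]) auto
  have cA': "continuous_on S (\<lambda>x. A (f x))" if "continuous_on S f" for S :: "'x::topological_space set" and f
    by (rule continuous_on_compose2[OF cA that]) auto
  \<comment> \<open>This is the t-derivative of \<open>t *\<^sub>R a (t *\<^sub>R x)\<close>, which
    integrates to \<open>a x\<close>; by symmetry of \<open>A\<close> it is also the gradient in x
    of \<open>a (t *\<^sub>R x) \<bullet> x\<close>.\<close>
  define w where "w = (\<lambda>x t. a (t *\<^sub>R x) + t *\<^sub>R (A (t *\<^sub>R x) *v x))"
  have cw: "continuous_on S (\<lambda>z. w (f z) (g z))" if "continuous_on S f" "continuous_on S g"
    for S :: "'x::topological_space set" and f g
    unfolding w_def by (intro continuous_intros ca' cA' that)
  have intw: "integral (cbox 0 1) (w x) = a x" for x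
  proof -
    have "(w x has_integral 1 *\<^sub>R a (1 *\<^sub>R x) - 0 *\<^sub>R a (0 *\<^sub>R x)) {0..1}"
    proof (rule fundamental_theorem_of_calculus)
      fix t :: real
      have "((\<lambda>t. a (0 + t *\<^sub>R x)) has_vector_derivative A (0 + t *\<^sub>R x) *v x) (at t within {0..1})"
        by (rule has_vector_derivative_line[OF d])
      then have "((\<lambda>t. a (t *\<^sub>R x)) has_vector_derivative A (t *\<^sub>R x) *v x) (at t within {0..1})" by simp
      then show "((\<lambda>t. t *\<^sub>R a (t *\<^sub>R x)) has_vector_derivative w x t) (at t within {0..1})"
        unfolding w_def by (auto intro!: derivative_eq_intros)
    qed simp
    then show ?thesis by (simp add: has_integral_iff)
  qed
  define \<Phi> where "\<Phi> = (\<lambda>x. integral (cbox 0 1) (\<lambda>t::real. a (t *\<^sub>R x) \<bullet> x))"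
  have "(\<Phi> has_derivative (\<lambda>v. a x \<bullet> v)) (at x)" for x
  proof -
    have "(\<Phi> has_derivative blinfun_apply (integral (cbox 0 1) (\<lambda>t. blinfun_inner_left (w x t)))) (at x within UNIV)"
      unfolding \<Phi>_def
    proof (rule leibniz_rule)
      fix x :: "real^'n" and t :: real
      have "((\<lambda>x. t *\<^sub>R x) has_derivative (\<lambda>v. t *\<^sub>R v)) (at x)" by (auto intro!: derivative_eq_intros)
      from has_derivative_compose[OF this d]
      have "((\<lambda>x. a (t *\<^sub>R x)) has_derivative (\<lambda>v. A (t *\<^sub>R x) *v (t *\<^sub>R v))) (at x)" .
      then have "((\<lambda>x. a (t *\<^sub>R x) \<bullet> x) has_derivative (\<lambda>v. a (t *\<^sub>R x) \<bullet> v + (A (t *\<^sub>R x) *v (t *\<^sub>R v)) \<bullet> x)) (at x)"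
        by (rule has_derivative_inner) (rule has_derivative_ident)
      moreover have "a (t *\<^sub>R x) \<bullet> v + (A (t *\<^sub>R x) *v (t *\<^sub>R v)) \<bullet> x = blinfun_apply (blinfun_inner_left (w x t)) v" for v
        using dot_lmul_matrix[of x "A (t *\<^sub>R x)" v] sym[of "t *\<^sub>R x"]
        by (simp add: w_def inner_add_left inner_add_right matrix_vector_mult_scaleR inner_commute transpose_matrix_vector[symmetric])
      ultimately show "((\<lambda>x. a (t *\<^sub>R x) \<bullet> x) has_derivative blinfun_apply (blinfun_inner_left (w x t))) (at x within UNIV)"
        by (metis (no_types, lifting) ext)
    next
      show "(\<lambda>t. a (t *\<^sub>R x) \<bullet> x) integrable_on cbox 0 1" for x
        by (intro integrable_continuous continuous_intros ca')
      show "continuous_on (UNIV \<times> cbox 0 1) (\<lambda>(x, t). blinfun_inner_left (w x t))"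
        unfolding split_beta
        by (rule bounded_linear.continuous_on[OF bounded_linear_blinfun_inner_left]) (intro cw continuous_intros)
    qed auto
    moreover have "blinfun_apply (integral (cbox 0 1) (\<lambda>t. blinfun_inner_left (w x t))) v = a x \<bullet> v" for v
    proof -
      have iw: "w x integrable_on cbox 0 1"
        by (intro integrable_continuous cw[of _ "\<lambda>_. x" "\<lambda>t. t"] continuous_intros)
      have "integral (cbox 0 1) (\<lambda>t. blinfun_inner_left (w x t)) = blinfun_inner_left (integral (cbox 0 1) (w x))"
        using integral_linear[OF iw bounded_linear_blinfun_inner_left] by (simp add: o_def)
      then show ?thesis using intw by (simp add: inner_commute)
    qed
    ultimately show ?thesis by (metis (no_types, lifting) ext)
  qed
  then show ?thesis using that by blast
qed

section \<open>Fourier series on the torus\<close>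

definition ee :: "int^'n::finite \<Rightarrow> real^'n \<Rightarrow> complex" where
  "ee m y = exp (2 * of_real pi * \<i> * of_real (int_vec m \<bullet> y))"

lemma int_vec_simps [simp]:
  "int_vec 0 = 0" "int_vec (m + k) = int_vec m + int_vec k" "int_vec (m - k) = int_vec m - int_vec k"
  "int_vec (- m) = - int_vec m" "int_vec m $ j = of_int (m $ j)"
  by (simp_all add: int_vec_def vec_eq_iff)

lemma int_vec_inj: "int_vec m = int_vec k \<longleftrightarrow> m = k"
  by (auto simp: int_vec_def vec_eq_iff)

lemma int_vec_inner_Ints: "int_vec m \<bullet> int_vec k \<in> \<int>"
  by (auto simp: inner_vec_def intro!: Ints_sum Ints_mult)

lemma exp_2pi_Ints: "x \<in> \<int> \<Longrightarrow> exp (2 * of_real pi * \<i> * of_real x) = (1::complex)"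
  by (auto elim!: Ints_cases simp: exp_eq_1)

lemma ee_simps:
  "ee (m + k) y = ee m y * ee k y" "ee m (y + z) = ee m y * ee m z" "ee 0 y = 1"
  "norm (ee m y) = 1" "ee m (int_vec k) = 1" "ee (- m) y * ee m y = 1" "ee m y \<noteq> 0"
  by (simp_all add: ee_def inner_add_left inner_add_right distrib_left exp_add exp_2pi_Ints[OF int_vec_inner_Ints] exp_minus)

lemma cont_ee [continuous_intros]: "continuous_on S f \<Longrightarrow> continuous_on S (\<lambda>x. ee m (f x))"
  unfolding ee_def by (intro continuous_intros)

lemma ee_has_derivative: "(ee m has_derivative (\<lambda>v. ee m y * (2 * of_real pi * \<i> * of_real (int_vec m \<bullet> v)))) (at y)"
proof -
  have "((\<lambda>y. 2 * of_real pi * \<i> * of_real (int_vec m \<bullet> y) :: complex) has_derivative (\<lambda>v. 2 * of_real pi * \<i> * of_real (int_vec m \<bullet> v))) (at y)"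
    by (rule bounded_linear_imp_has_derivative)
       (intro bounded_linear_const_mult bounded_linear_compose[OF bounded_linear_of_real] bounded_linear_inner_right)
  from has_derivative_compose[OF this DERIV_exp[unfolded has_field_derivative_def]]
  show ?thesis unfolding ee_def[abs_def] .
qed

section \<open>Integration of periodic functions over the unit cube\<close>

definition periodic :: "(real^'n::finite \<Rightarrow> 'a) \<Rightarrow> bool" where
  "periodic h \<longleftrightarrow> (\<forall>m y. h (y + int_vec m) = h y)"

lemma periodic_axis: "periodic h \<Longrightarrow> h (y + axis j 1) = h y"
proof -
  assume "periodic h"
  moreover have "int_vec (axis j 1) = axis j 1" by (auto simp: int_vec_def axis_def vec_eq_iff)
  ultimately show ?thesis unfolding periodic_def by metis
qed

lemma translate_into_unit_cube:
  fixes y :: "real^'n::finite"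
  obtains k where "y + int_vec k \<in> cbox 0 1"
proof -
  have "y + int_vec (\<chi> j. - \<lfloor>y $ j\<rfloor>) \<in> cbox 0 1"
    unfolding mem_box_cart by (auto simp: algebra_simps) (metis add.commute less_eq_real_def real_of_int_floor_add_one_gt)
  then show ?thesis using that by blast
qed

lemma cbox_cut_le:
  fixes a b :: "real^'n::finite"
  shows "cbox a b \<inter> {x. x \<bullet> axis j 1 \<le> c} = cbox a (\<chi> i. if i = j then min (b $ j) c else b $ i)"
proof (intro set_eqI iffI)
  fix x assume x: "x \<in> cbox a (\<chi> i. if i = j then min (b $ j) c else b $ i)"
  have "a $ i \<le> x $ i \<and> x $ i \<le> (if i = j then min (b $ j) c else b $ i)" for i
    using x by (simp add: mem_box_cart)
  from this this[of j] have "a $ i \<le> x $ i \<and> x $ i \<le> b $ i" "x $ j \<le> c" for i by (metis min.boundedE)+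
  then show "x \<in> cbox a b \<inter> {x. x \<bullet> axis j 1 \<le> c}" by (simp add: mem_box_cart inner_axis)
qed (auto simp: mem_box_cart inner_axis)

lemma cbox_cut_ge:
  fixes a b :: "real^'n::finite"
  shows "cbox a b \<inter> {x. c \<le> x \<bullet> axis j 1} = cbox (\<chi> i. if i = j then max (a $ j) c else a $ i) b"
proof (intro set_eqI iffI)
  fix x assume x: "x \<in> cbox (\<chi> i. if i = j then max (a $ j) c else a $ i) b"
  have "x $ i \<le> b $ i \<and> (if i = j then max (a $ j) c else a $ i) \<le> x $ i" for i
    using x by (simp add: mem_box_cart)
  from this this[of j] have "a $ i \<le> x $ i \<and> x $ i \<le> b $ i" "c \<le> x $ j" for i by (metis max.boundedE)+
  then show "x \<in> cbox a b \<inter> {x. c \<le> x \<bullet> axis j 1}" by (simp add: mem_box_cart inner_axis)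
qed (auto simp: mem_box_cart inner_axis)

lemma prod_Basis_cart:
  fixes f :: "real^'n::finite \<Rightarrow> 'a::comm_monoid_mult"
  shows "(\<Prod>b\<in>Basis. f b) = (\<Prod>j\<in>UNIV. f (axis j 1))"
proof -
  have B: "(Basis :: (real^'n) set) = range (\<lambda>j. axis j 1)" by (auto simp: Basis_vec_def)
  have "prod f (range (\<lambda>j. axis j 1)) = prod (f \<circ> (\<lambda>j. axis j 1)) UNIV"
    by (rule prod.reindex) (auto simp: inj_on_def axis_eq_axis)
  then show ?thesis unfolding B by (simp add: o_def)
qed

lemma measure_unit_cube: "measure lborel (cbox 0 (1::real^'n::finite)) = 1"
proof -
  have "(\<Prod>b\<in>Basis. (1::real^'n) \<bullet> b - 0 \<bullet> b) = 1" unfolding prod_Basis_cart by (simp add: inner_axis)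
  then show ?thesis by (subst content_cbox) (auto simp: Basis_vec_def inner_axis)
qed

text \<open>The cube stretched by t in direction j is cut once at height t and once at height 1. One
  piece is the shifted cube, respectively the unit cube; the two remaining slabs are translates by a
  period.\<close>

lemma torus_integral_shift:
  fixes h :: "real^'n::finite \<Rightarrow> 'b::{real_normed_vector,banach}"
  assumes c: "continuous_on UNIV h" and p: "periodic h" and t: "0 \<le> t" "t \<le> 1"
  shows "integral (cbox 0 1) (\<lambda>y. h (y + t *\<^sub>R axis j 1)) = integral (cbox 0 1) h"
proof -
  let ?e = "axis j 1 :: real^'n"
  have i: "h integrable_on cbox a b" for a b
    by (intro integrable_continuous continuous_on_subset[OF c]) simp
  have eb: "?e \<in> Basis" by simp
  have "integral (cbox 0 1) (\<lambda>y. h (y + t *\<^sub>R ?e)) = integral (cbox (t *\<^sub>R ?e) (1 + t *\<^sub>R ?e)) h"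
    using integral_shift_cbox_plus[of 0 1 h "t *\<^sub>R ?e"] by (simp add: o_def add.commute)
  moreover have "integral (cbox 0 (1 + t *\<^sub>R ?e)) h =
      integral (cbox 0 (\<chi> i. if i = j then t else 1)) h + integral (cbox (t *\<^sub>R ?e) (1 + t *\<^sub>R ?e)) h"
  proof -
    have "cbox 0 (1 + t *\<^sub>R ?e) \<inter> {x. x \<bullet> ?e \<le> t} = cbox 0 (\<chi> i. if i = j then t else 1)"
      unfolding cbox_cut_le using t by (intro arg_cong2[where f=cbox]) (auto simp: vec_eq_iff axis_def)
    moreover have "cbox 0 (1 + t *\<^sub>R ?e) \<inter> {x. x \<bullet> ?e \<ge> t} = cbox (t *\<^sub>R ?e) (1 + t *\<^sub>R ?e)"
      unfolding cbox_cut_ge using t by (intro arg_cong2[where f=cbox]) (auto simp: vec_eq_iff axis_def)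
    ultimately show ?thesis using integral_split[OF i eb, of 0 "1 + t *\<^sub>R ?e" t] by simp
  qed
  moreover have "integral (cbox 0 (1 + t *\<^sub>R ?e)) h =
      integral (cbox 0 1) h + integral (cbox (0 + ?e) ((\<chi> i. if i = j then t else 1) + ?e)) h"
  proof -
    have "cbox 0 (1 + t *\<^sub>R ?e) \<inter> {x. x \<bullet> ?e \<le> 1} = cbox 0 1"
      unfolding cbox_cut_le using t by (intro arg_cong2[where f=cbox]) (auto simp: vec_eq_iff axis_def)
    moreover have "cbox 0 (1 + t *\<^sub>R ?e) \<inter> {x. x \<bullet> ?e \<ge> 1} = cbox (0 + ?e) ((\<chi> i. if i = j then t else 1) + ?e)"
      unfolding cbox_cut_ge using t by (intro arg_cong2[where f=cbox]) (auto simp: vec_eq_iff axis_def)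
    ultimately show ?thesis using integral_split[OF i eb, of 0 "1 + t *\<^sub>R ?e" 1] by simp
  qed
  moreover have "integral (cbox (0 + ?e) ((\<chi> i. if i = j then t else 1) + ?e)) h = integral (cbox 0 (\<chi> i. if i = j then t else 1)) h"
    using integral_shift_cbox_plus[of 0 "\<chi> i. if i = j then t else 1" h ?e] periodic_axis[OF p]
    by (simp add: o_def add.commute)
  ultimately show ?thesis by simp
qed

text \<open>The integral of a shifted function is constant in the shift; differentiate under the
  integral sign at shift 0. Later this serves as integration by parts on the torus.\<close>

lemma torus_integral_derivative:
  fixes h :: "real^'n::finite \<Rightarrow> complex"
  assumes d: "\<And>y. (h has_derivative h' y) (at y)" and c': "continuous_on UNIV (\<lambda>y. h' y (axis j 1))" and p: "periodic h"
  shows "integral (cbox 0 1) (\<lambda>y. h' y (axis j 1)) = 0"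
proof -
  let ?e = "axis j 1 :: real^'n"
  have c: "continuous_on UNIV h" using has_derivative_continuous[OF d] by (auto intro: continuous_at_imp_continuous_on)
  have D1: "((\<lambda>t. integral (cbox 0 1) (\<lambda>y. h (y + t *\<^sub>R ?e))) has_vector_derivative
      integral (cbox 0 1) (\<lambda>y. h' (y + 0 *\<^sub>R ?e) ?e)) (at 0 within cbox 0 1)"
  proof (rule leibniz_rule_vector_derivative)
    show "(\<lambda>y. h (y + t *\<^sub>R ?e)) integrable_on cbox 0 1" for t
      by (intro integrable_continuous continuous_on_compose2[OF c]) (auto intro!: continuous_intros)
    show "continuous_on (cbox 0 1 \<times> cbox 0 1) (\<lambda>(t, y). h' (y + t *\<^sub>R ?e) ?e)"
      unfolding split_beta by (rule continuous_on_compose2[OF c']) (auto intro!: continuous_intros)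
  qed (auto intro: has_vector_derivative_line d)
  have D2: "((\<lambda>t. integral (cbox 0 1) (\<lambda>y. h (y + t *\<^sub>R ?e))) has_vector_derivative 0) (at 0 within cbox 0 1)"
    by (rule has_vector_derivative_transform[where f="\<lambda>t. integral (cbox 0 1) h"])
       (use torus_integral_shift[OF c p] in auto)
  show ?thesis
    using vector_derivative_unique_within_closed_interval[OF _ _ D1 D2] by simp
qed

lemma integral_ee: "integral (cbox 0 1) (ee m) = (if m = 0 then 1 else 0)"
proof (cases "m = 0")
  case True
  then show ?thesis by (simp add: ee_simps(3)[abs_def] measure_unit_cube)
next
  case False
  then obtain j where j: "m $ j \<noteq> 0" by (auto simp: vec_eq_iff)
  \<comment> \<open>Half a period of \<open>ee m\<close> in direction \<open>j\<close>: the shift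
    multiplies the character by -1, so its integral equals its own negative. The absolute value
    keeps \<open>t\<close> in the range of \<open>torus_integral_shift\<close>.\<close>
  define t where "t = 1 / (2 * \<bar>real_of_int (m $ j)\<bar>)"
  have j1: "\<bar>real_of_int (m $ j)\<bar> \<ge> 1" using j by linarith
  have t: "0 \<le> t" "t \<le> 1" using j1 by (auto simp: t_def field_simps)
  have per: "periodic (ee m)" by (simp add: periodic_def ee_simps)
  have "ee m (t *\<^sub>R axis j 1) = exp (2 * of_real pi * \<i> * of_real (t * real_of_int (m $ j)))"
    by (simp add: ee_def inner_axis mult.commute)
  moreover have "t * real_of_int (m $ j) = 1/2 \<or> t * real_of_int (m $ j) = - 1/2"
    using j by (cases "m $ j > 0") (auto simp: t_def abs_if)
  moreover have "exp (2 * of_real pi * \<i> * of_real r) = (-1::complex)" if "r = 1/2 \<or> r = - 1/2" for r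
  proof -
    have "2 * of_real pi * \<i> * of_real r = of_real pi * \<i> \<or> 2 * of_real pi * \<i> * of_real r = - (of_real pi * \<i>)"
    proof (cases "r = 1/2")
      case True
      show ?thesis unfolding True by simp
    next
      case False
      then have r: "r = - 1/2" using that by simp
      show ?thesis unfolding r by simp
    qed
    then show ?thesis by (metis exp_minus exp_pi_i inverse_minus_eq inverse_1)
  qed
  ultimately have e: "ee m (t *\<^sub>R axis j 1) = -1" by metis
  have "integral (cbox 0 1) (ee m) = integral (cbox 0 1) (\<lambda>y. ee m (y + t *\<^sub>R axis j 1))"
    by (rule torus_integral_shift[symmetric]) (use per t in \<open>auto intro!: continuous_intros\<close>)
  also have "\<dots> = - integral (cbox 0 1) (ee m)" by (simp add: ee_simps e)
  finally show ?thesis using False by simp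
qed

text \<open>Lebesgue's argument: the peak kernels \<open>\<Prod>\<^sub>j ((1 + cos 2\<pi>(y\<^sub>j - y0\<^sub>j))/2)\<^sup>N\<close> are trigonometric polynomials.\<close>

lemma fourier_unique:
  fixes h :: "real^'n::finite \<Rightarrow> complex"
  assumes c: "continuous_on UNIV h" and p: "periodic h"
    and z: "\<And>m. integral (cbox 0 1) (\<lambda>y. h y * ee m y) = 0"
  shows "h y = 0"
proof -
  \<comment> \<open>The peak point is taken in the open cube first: for a point on a face the kernel
    would also peak on the opposite face of the cube.\<close>
  have inner: "h y0 = 0" if y0: "y0 \<in> box 0 1" for y0
  proof (rule ccontr)
    assume nz: "h y0 \<noteq> 0"
    define ck where "ck = (\<lambda>j (y::real^'n). (1 + cos (2 * pi * (y $ j - y0 $ j))) / 2)"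
    \<comment> \<open>The functions q for which all Fourier coefficients of h q vanish. Each factor
      \<open>ck j\<close> is a combination of three characters, so \<open>Z\<close> is stable under
      multiplication by it and contains all powers of the kernel.\<close>
    define Z where "Z = (\<lambda>q::real^'n \<Rightarrow> complex. continuous_on UNIV q \<and> (\<forall>m. integral (cbox 0 1) (\<lambda>y. h y * q y * ee m y) = 0))"
    have ii: "f integrable_on cbox a b" if "continuous_on UNIV f" for f :: "real^'n \<Rightarrow> complex" and a b
      by (intro integrable_continuous continuous_on_subset[OF that]) simp
    have Z1: "Z (\<lambda>y. 1)" unfolding Z_def using z by simp
    have Zck: "Z (\<lambda>y. q y * of_real (ck j y))" if q: "Z q" for q j
    proof -
      have cq: "continuous_on UNIV q" using q by (simp add: Z_def)
      define \<alpha> :: complex where "\<alpha> = exp (- (2 * of_real pi * \<i> * of_real (y0 $ j)))"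
      define \<beta> :: complex where "\<beta> = exp (2 * of_real pi * \<i> * of_real (y0 $ j))"
      have eq: "of_real (ck j y) = 1/2 + \<alpha>/4 * ee (axis j 1) y + \<beta>/4 * ee (- axis j 1) y" for y
      proof -
        have iv: "int_vec (axis j 1) \<bullet> y = y $ j"
        proof -
          have "int_vec (axis j 1) = axis j 1" by (auto simp: int_vec_def axis_def vec_eq_iff)
          then show ?thesis by (simp add: inner_axis' )
        qed
        define r where "r = 2 * pi * (y $ j - y0 $ j)"
        have 1: "\<alpha> * ee (axis j 1) y = exp (\<i> * of_real r)"
          unfolding \<alpha>_def ee_def iv exp_add[symmetric] r_def by (rule arg_cong[where f=exp]) (simp add: algebra_simps)
        have 2: "\<beta> * ee (- axis j 1) y = exp (- (\<i> * of_real r))"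
          unfolding \<beta>_def ee_def int_vec_simps inner_minus_left iv exp_add[symmetric] r_def
          by (rule arg_cong[where f=exp]) (simp add: algebra_simps)
        have 3: "complex_of_real (cos r) = (exp (\<i> * of_real r) + exp (- (\<i> * of_real r))) / 2"
          by (simp add: cos_exp_eq flip: cos_of_real)
        have "complex_of_real (ck j y) = 1/2 + (\<alpha> * ee (axis j 1) y) / 4 + (\<beta> * ee (- axis j 1) y) / 4"
          unfolding 1 2 ck_def r_def[symmetric] by (simp add: 3 field_simps)
        then show ?thesis by simp
      qed
      have "integral (cbox 0 1) (\<lambda>y. h y * (q y * of_real (ck j y)) * ee m y) = 0" for m
      proof -
        have A: "(\<lambda>y. h y * (q y * of_real (ck j y)) * ee m y) =
           (\<lambda>y. 1/2 * (h y * q y * ee m y) + (\<alpha>/4 * (h y * q y * ee (m + axis j 1) y) + \<beta>/4 * (h y * q y * ee (m - axis j 1) y)))"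
          unfolding eq diff_conv_add_uminus ee_simps(1) by (simp add: algebra_simps)
        have "integral (cbox 0 1) (\<lambda>y. 1/2 * (h y * q y * ee m y) + (\<alpha>/4 * (h y * q y * ee (m + axis j 1) y) + \<beta>/4 * (h y * q y * ee (m - axis j 1) y)))
         = integral (cbox 0 1) (\<lambda>y. 1/2 * (h y * q y * ee m y)) +
          (integral (cbox 0 1) (\<lambda>y. \<alpha>/4 * (h y * q y * ee (m + axis j 1) y)) + integral (cbox 0 1) (\<lambda>y. \<beta>/4 * (h y * q y * ee (m - axis j 1) y)))"
        proof -
          have "(\<lambda>y. 1/2 * (h y * q y * ee m y)) integrable_on cbox 0 1"
            "(\<lambda>y. \<alpha>/4 * (h y * q y * ee (m + axis j 1) y)) integrable_on cbox 0 1"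
            "(\<lambda>y. \<beta>/4 * (h y * q y * ee (m - axis j 1) y)) integrable_on cbox 0 1"
            by (intro ii continuous_intros c cq)+
          then show ?thesis by (simp only: integral_add integrable_add)
        qed
        moreover have "\<dots> = 0" using q by (simp add: Z_def)
        ultimately show ?thesis unfolding A by simp
      qed
      then show ?thesis unfolding Z_def ck_def by (auto intro!: continuous_intros cq)
    qed
    define K where "K = (\<lambda>y. \<Prod>j\<in>UNIV. ck j y)"
    have ZK: "Z (\<lambda>y. q y * of_real (K y))" if "Z q" for q
    proof -
      have "Z (\<lambda>y. q y * of_real (\<Prod>j\<in>J. ck j y))" for J :: "'n set"
      proof (induction J rule: infinite_finite_induct)
        case (insert x F)
        from Zck[OF insert.IH, of x] show ?case using insert.hyps by (simp add: mult_ac)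
      qed (use that in auto)
      then show ?thesis by (simp add: K_def)
    qed
    have ZN: "Z (\<lambda>y. of_real (K y ^ N))" for N
    proof (induction N)
      case (Suc N)
      from ZK[OF this] show ?case by (simp add: mult.commute)
    qed (use Z1 in simp)
    have cK: "continuous_on S K" for S unfolding K_def ck_def by (intro continuous_intros) auto
    have ck01: "0 \<le> ck j y" "ck j y \<le> 1" for j y
    proof -
      have "0 \<le> (1 + c) / 2" "(1 + c) / 2 \<le> 1" if "- 1 \<le> c" "c \<le> 1" for c :: real using that by auto
      then show "0 \<le> ck j y" "ck j y \<le> 1" unfolding ck_def by (metis cos_ge_minus_one cos_le_one)+
    qed
    have K01: "0 \<le> K y" "K y \<le> 1" for y unfolding K_def by (auto intro!: prod_nonneg prod_le_1 ck01)
    have K1: "y = y0" if y: "y \<in> cbox 0 1" "K y = 1" for y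
    proof -
      have "y $ j = y0 $ j" for j
      proof -
        have "K y \<le> ck j y"
        proof -
          have "K y = ck j y * (\<Prod>j\<in>UNIV - {j}. ck j y)" unfolding K_def by (subst prod.remove[of _ j]) auto
          also have "\<dots> \<le> ck j y * 1" by (intro mult_left_mono prod_le_1 ck01) (auto simp: ck01)
          finally show ?thesis by simp
        qed
        then have "ck j y = 1" using y ck01(2)[of j y] by simp
        then have "cos (2 * pi * (y $ j - y0 $ j)) = 1" by (simp add: ck_def)
        then obtain k :: int where "2 * pi * (y $ j - y0 $ j) = of_int k * 2 * pi" using cos_one_2pi_int by auto
        then have k: "y $ j - y0 $ j = of_int k" by simp
        have "0 < y0 $ j" "y0 $ j < 1" "0 \<le> y $ j" "y $ j \<le> 1" using y0 y by (auto simp: mem_box_cart)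
        then have "\<bar>real_of_int k\<bar> < 1" using k by linarith
        then have "k = 0" by linarith
        then show ?thesis using k by simp
      qed
      then show ?thesis by (simp add: vec_eq_iff)
    qed
    have Ky0: "K y0 = 1" by (simp add: K_def ck_def)
    define u where "u = (\<lambda>y. Re (cnj (h y0) * h y))"
    have cu: "continuous_on S u" for S unfolding u_def by (intro continuous_intros continuous_on_subset[OF c]) simp
    define \<epsilon> where "\<epsilon> = (norm (h y0))\<^sup>2 / 2"
    have eps: "\<epsilon> > 0" "u y0 = 2 * \<epsilon>"
    proof -
      show "\<epsilon> > 0" using nz by (simp add: \<epsilon>_def)
      have "u y0 = (Re (h y0))\<^sup>2 + (Im (h y0))\<^sup>2" by (simp add: u_def power2_eq_square)
      then show "u y0 = 2 * \<epsilon>" by (simp add: \<epsilon>_def cmod_power2)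
    qed
    have int0: "integral (cbox 0 1) (\<lambda>y. u y * K y ^ N) = 0" for N
    proof -
      have "integral (cbox 0 1) (\<lambda>y. h y * of_real (K y ^ N) * ee 0 y) = 0" using ZN[of N] unfolding Z_def by blast
      then have 0: "integral (cbox 0 1) (\<lambda>y. h y * of_real (K y ^ N)) = 0" by (simp add: ee_simps)
      have bl: "bounded_linear (\<lambda>w. Re (cnj (h y0) * w))"
        by (intro bounded_linear_compose[OF bounded_linear_Re] bounded_linear_mult_right)
      have "(\<lambda>y. h y * of_real (K y ^ N)) integrable_on cbox 0 1" by (intro ii continuous_intros c cK)
      from integral_linear[OF this bl] 0 have "integral (cbox 0 1) (\<lambda>y. Re (cnj (h y0) * (h y * of_real (K y ^ N)))) = 0"
        by (simp add: o_def)
      moreover have "Re (cnj (h y0) * (h y * of_real (K y ^ N))) = u y * K y ^ N" for y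
        by (simp add: u_def algebra_simps flip: of_real_power)
      ultimately show ?thesis by simp
    qed
    obtain M where M: "M > 0" "\<And>y. y \<in> cbox 0 1 \<Longrightarrow> \<bar>u y\<bar> \<le> M"
    proof -
      have "bounded (u ` cbox 0 1)" by (intro compact_imp_bounded compact_continuous_image cu compact_cbox)
      then show ?thesis using that unfolding bounded_pos by auto
    qed
    obtain d where d: "d > 0" "\<And>y. dist y y0 < d \<Longrightarrow> u y > \<epsilon>"
    proof -
      have "\<exists>d>0. \<forall>y. dist y y0 < d \<longrightarrow> dist (u y) (u y0) < \<epsilon>"
        using cu[of UNIV] eps(1) unfolding continuous_on_iff by auto
      then obtain d where "d > 0" "\<And>y. dist y y0 < d \<Longrightarrow> dist (u y) (u y0) < \<epsilon>" by blast
      moreover have "dist (u y) (u y0) < \<epsilon> \<Longrightarrow> u y > \<epsilon>" for y using eps by (auto simp: dist_real_def)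
      ultimately show ?thesis using that by blast
    qed
    obtain \<theta> where th: "0 \<le> \<theta>" "\<theta> < 1" "\<And>y. y \<in> cbox 0 1 \<Longrightarrow> dist y y0 \<ge> d \<Longrightarrow> K y \<le> \<theta>"
    proof (cases "cbox 0 1 - ball y0 d = {}")
      case True
      have False if "y \<in> cbox 0 1" "dist y y0 \<ge> d" for y using True that by (auto simp: dist_commute)
      then show ?thesis using that[of 0] by force
    next
      case False
      have "compact (cbox 0 1 - ball y0 d)" by (intro compact_diff) auto
      then obtain y1 where y1: "y1 \<in> cbox 0 1 - ball y0 d" "\<And>y. y \<in> cbox 0 1 - ball y0 d \<Longrightarrow> K y \<le> K y1"
        using continuous_attains_sup[OF _ False cK] by blast
      have "K y1 \<noteq> 1" using K1[of y1] y1 d by auto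
      then have "K y1 < 1" using K01(2)[of y1] by linarith
      then show ?thesis using that[of "K y1"] K01 y1(2) by (auto simp: dist_commute)
    qed
    \<comment> \<open>A level strictly between the maximum \<theta> of the kernel away from
      \<open>y0\<close> and its peak value 1. On a small box around \<open>y0\<close> the kernel
      exceeds it, and this box eventually dominates the integral.\<close>
    define \<theta>' where "\<theta>' = (1 + \<theta>) / 2"
    have th': "\<theta> < \<theta>'" "\<theta>' < 1" "\<theta>' > 0" using th by (auto simp: \<theta>'_def)
    have "open {y \<in> box 0 1. K y > \<theta>' \<and> dist y y0 < d}"
    proof -
      have "open {y. K y > \<theta>'}" by (intro open_Collect_less continuous_intros cK)
      moreover have "open {y. dist y y0 < d}" by (intro open_Collect_less continuous_intros)
      moreover have "{y \<in> box 0 1. K y > \<theta>' \<and> dist y y0 < d} = box 0 1 \<inter> {y. K y > \<theta>'} \<inter> {y. dist y y0 < d}" by auto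
      ultimately show ?thesis by auto
    qed
    moreover have "y0 \<in> {y \<in> box 0 1. K y > \<theta>' \<and> dist y y0 < d}" using y0 Ky0 th' d by auto
    ultimately obtain a b where ab: "y0 \<in> box a b" "cbox a b \<subseteq> {y \<in> box 0 1. K y > \<theta>' \<and> dist y y0 < d}"
      using open_contains_cbox by (metis (no_types, lifting))
    define V where "V = measure lborel (cbox a b)"
    have V: "V > 0" using ab(1) unfolding V_def by (auto simp: content_pos_lt_eq box_ne_empty mem_box)
    have sub: "cbox a b \<subseteq> cbox 0 1" using ab(2) box_subset_cbox by blast
    have lower: "\<epsilon> * \<theta>' ^ N * V \<le> M * \<theta> ^ N" for N
    proof -
      \<comment> \<open>A minorant of \<open>u y * K y ^ N\<close>: within distance \<open>d\<close>
        of \<open>y0\<close> the product is nonnegative and it exceeds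
        \<open>\<epsilon> * \<theta>' ^ N\<close> on the small box; farther away it is at least
        \<open>- M * \<theta> ^ N\<close>.\<close>
      define w where "w = (\<lambda>y. (if y \<in> cbox a b then \<epsilon> * \<theta>' ^ N else 0) - M * \<theta> ^ N)"
      have i1: "(\<lambda>y. if y \<in> cbox a b then \<epsilon> * \<theta>' ^ N else 0) integrable_on cbox 0 1"
        unfolding integrable_restrict_Int using sub by (simp add: Int_absorb2 integrable_const)
      have "integral (cbox 0 1) w = integral (cbox 0 1) (\<lambda>y. if y \<in> cbox a b then \<epsilon> * \<theta>' ^ N else 0) - integral (cbox 0 1) (\<lambda>y::real^'n. M * \<theta> ^ N)"
        unfolding w_def by (rule integral_diff[OF i1]) (simp add: integrable_const)
      also have "integral (cbox 0 1) (\<lambda>y. if y \<in> cbox a b then \<epsilon> * \<theta>' ^ N else 0) = \<epsilon> * \<theta>' ^ N * V"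
        using sub by (simp add: integral_restrict_Int Int_absorb2 V_def)
      also have "integral (cbox 0 1) (\<lambda>y::real^'n. M * \<theta> ^ N) = M * \<theta> ^ N"
        by (simp add: measure_unit_cube)
      finally have "integral (cbox 0 1) w = \<epsilon> * \<theta>' ^ N * V - M * \<theta> ^ N" .
      moreover have "integral (cbox 0 1) w \<le> integral (cbox 0 1) (\<lambda>y. u y * K y ^ N)"
      proof (rule integral_le)
        show "w integrable_on cbox 0 1" unfolding w_def by (intro integrable_diff i1) (simp add: integrable_const)
        show "(\<lambda>y. u y * K y ^ N) integrable_on cbox 0 1" by (intro integrable_continuous continuous_intros cu cK)
        fix y :: "real^'n" assume y: "y \<in> cbox 0 1"
        have nn: "0 \<le> M * \<theta> ^ N" using M th by simp
        show "w y \<le> u y * K y ^ N"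
        proof (cases "dist y y0 < d")
          case True
          then have uy: "u y > \<epsilon>" using d by blast
          show ?thesis
          proof (cases "y \<in> cbox a b")
            case True
            then have "\<theta>' ^ N \<le> K y ^ N" using ab(2) th' by (intro power_mono) auto
            then have "\<epsilon> * \<theta>' ^ N \<le> u y * K y ^ N" using uy eps th' by (intro mult_mono) auto
            then show ?thesis using True nn by (simp add: w_def)
          next
            case False
            have "0 \<le> u y * K y ^ N" using uy eps K01 by simp
            then show ?thesis using False nn by (simp add: w_def)
          qed
        next
          case False
          then have "y \<notin> cbox a b" using ab(2) by auto
          moreover have "\<bar>u y * K y ^ N\<bar> \<le> M * \<theta> ^ N"
            unfolding abs_mult using M(2)[OF y] th(3)[OF y] False K01 M(1) by (intro mult_mono) (auto intro!: power_mono)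
          ultimately show ?thesis by (simp add: w_def)
        qed
      qed
      ultimately show ?thesis using int0[of N] by simp
    qed
    have "(\<lambda>N. M * (\<theta> / \<theta>') ^ N) \<longlonglongrightarrow> M * 0"
      using th th' by (intro tendsto_intros LIMSEQ_power_zero) auto
    moreover have "\<epsilon> * V \<le> M * (\<theta> / \<theta>') ^ N" for N
      using lower[of N] th' by (simp add: power_divide field_simps)
    ultimately have "\<epsilon> * V \<le> M * 0" by (intro LIMSEQ_le_const) auto
    then show False using eps V by (simp add: mult_le_0_iff)
  qed
  \<comment> \<open>Periodicity moves a general point into the closed cube, and continuity reaches
    its faces from the open cube.\<close>
  obtain k where y': "y + int_vec k \<in> cbox 0 1" by (rule translate_into_unit_cube)
  have "cbox 0 (1::real^'n) = closure (box 0 1)"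
    by (rule closure_box[symmetric]) (auto simp: box_ne_empty Basis_vec_def inner_axis)
  moreover have "closed {y. h y = 0}" by (intro closed_Collect_eq c continuous_intros)
  moreover have "box 0 1 \<subseteq> {y. h y = 0}" using inner by auto
  ultimately have "cbox 0 1 \<subseteq> {y. h y = 0}" using closure_minimal by simp
  then have "h (y + int_vec k) = 0" using y' by blast
  then show ?thesis using p by (simp add: periodic_def)
qed

section \<open>Absolutely convergent Fourier series\<close>

lemma fourier_series_summable:
  "(\<lambda>m. norm (c m)) summable_on UNIV \<Longrightarrow> (\<lambda>m. c m * ee m y) summable_on UNIV"
  by (rule abs_summable_summable) (simp add: norm_mult ee_simps)

text \<open>Characters have modulus 1, so the Weierstrass test with the majorant
  \<open>norm (c m)\<close> gives uniform convergence over the finite subsets of the lattice, even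
  after a shift of the indices by k; uniform limits can be integrated term by term.\<close>

lemma fourier_series:
  fixes c :: "int^'n::finite \<Rightarrow> complex"
  assumes s: "(\<lambda>m. norm (c m)) summable_on UNIV"
  shows "continuous_on UNIV (\<lambda>y. infsum (\<lambda>m. c m * ee m y) UNIV)"
    and "periodic (\<lambda>y. infsum (\<lambda>m. c m * ee m y) UNIV)"
    and "integral (cbox 0 1) (\<lambda>y. infsum (\<lambda>m. c m * ee m y) UNIV * ee (- k) y) = c k"
proof -
  have u: "uniform_limit UNIV (\<lambda>X y. \<Sum>m\<in>X. c m * ee (m + k) y) (\<lambda>y. infsum (\<lambda>m. c m * ee (m + k) y) UNIV) (finite_subsets_at_top UNIV)" for k
    by (rule Weierstrass_m_test_general[OF _ s]) (simp add: norm_mult ee_simps(4))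
  show "continuous_on UNIV (\<lambda>y. infsum (\<lambda>m. c m * ee m y) UNIV)"
    by (rule uniform_limit_theorem[OF _ u[of 0, simplified]])
       (auto intro!: always_eventually continuous_intros)
  show "periodic (\<lambda>y. infsum (\<lambda>m. c m * ee m y) UNIV)" by (simp add: periodic_def ee_simps)
  have u': "uniform_limit (cbox 0 1) (\<lambda>X y. \<Sum>m\<in>X. c m * ee (m + - k) y) (\<lambda>y. infsum (\<lambda>m. c m * ee (m + - k) y) UNIV) (finite_subsets_at_top UNIV)"
    by (rule uniform_limit_on_subset[OF u]) simp
  obtain I J where IJ: "\<And>X. ((\<lambda>y. \<Sum>m\<in>X. c m * ee (m + - k) y) has_integral I X) (cbox 0 1)"
    "((\<lambda>y. infsum (\<lambda>m. c m * ee (m + - k) y) UNIV) has_integral J) (cbox 0 1)" "(I \<longlongrightarrow> J) (finite_subsets_at_top UNIV)"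
    by (rule uniform_limit_integral_cbox[OF u']) (auto intro!: continuous_intros)
  have I: "I X = (if k \<in> X then c k else 0)" if "finite X" for X
  proof -
    have "I X = integral (cbox 0 1) (\<lambda>y. \<Sum>m\<in>X. c m * ee (m + - k) y)" using integral_unique[OF IJ(1)] by simp
    also have "\<dots> = (\<Sum>m\<in>X. integral (cbox 0 1) (\<lambda>y. c m * ee (m + - k) y))"
      by (rule integral_sum[OF that]) (intro integrable_continuous continuous_intros)
    also have "\<dots> = (\<Sum>m\<in>X. if m = k then c k else 0)"
      by (intro sum.cong refl) (auto simp: integral_ee)
    finally show ?thesis using that by simp
  qed
  \<comment> \<open>By orthogonality the integral of a finite partial sum equals \<open>c k\<close>
    as soon as the index set contains \<open>k\<close>.\<close>
  have "\<forall>\<^sub>F X in finite_subsets_at_top UNIV. I X = c k"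
    unfolding eventually_finite_subsets_at_top by (rule exI[of _ "{k}"]) (auto simp: I)
  then have "(I \<longlongrightarrow> c k) (finite_subsets_at_top UNIV)" by (rule tendsto_eventually)
  then have "J = c k" using IJ(3) tendsto_unique[of "finite_subsets_at_top UNIV" I] by simp
  moreover have "infsum (\<lambda>m. c m * ee (m + - k) y) UNIV = infsum (\<lambda>m. c m * ee m y) UNIV * ee (- k) y" for y
    unfolding ee_simps(1) mult.assoc[symmetric] by (rule infsum_cmult_left) (use fourier_series_summable[OF s] in auto)
  ultimately show "integral (cbox 0 1) (\<lambda>y. infsum (\<lambda>m. c m * ee m y) UNIV * ee (- k) y) = c k"
    using IJ(2) by (simp add: integral_unique)
qed

lemma fourier_coefficients_unique:
  assumes "(\<lambda>m. norm (c m)) summable_on UNIV" "(\<lambda>m. norm (d m)) summable_on UNIV"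
    and "\<And>y. infsum (\<lambda>m. c m * ee m y) UNIV = infsum (\<lambda>m. d m * ee m y) UNIV"
  shows "c m = d m"
  using fourier_series(3)[OF assms(1), of m] fourier_series(3)[OF assms(2), of m] assms(3) by simp

text \<open>The difference of h and its Fourier series is continuous and periodic, and all its
  coefficients vanish, so \<open>fourier_unique\<close> applies.\<close>

lemma fourier_inversion:
  fixes h :: "real^'n::finite \<Rightarrow> complex"
  assumes h: "continuous_on UNIV h" "periodic h"
    and s: "(\<lambda>m. norm (integral (cbox 0 1) (\<lambda>y. h y * ee (- m) y))) summable_on UNIV"
  shows "h y = infsum (\<lambda>m. integral (cbox 0 1) (\<lambda>y. h y * ee (- m) y) * ee m y) UNIV"
proof -
  define S where "S = (\<lambda>y. infsum (\<lambda>m. integral (cbox 0 1) (\<lambda>y. h y * ee (- m) y) * ee m y) UNIV)"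
  note S = fourier_series[OF s, folded S_def]
  have "h y - S y = 0"
  proof (rule fourier_unique[of "\<lambda>y. h y - S y"])
    show "continuous_on UNIV (\<lambda>y. h y - S y)" by (intro continuous_intros h S)
    show "periodic (\<lambda>y. h y - S y)" using h(2) S(2) by (simp add: periodic_def)
    fix m
    have i: "(\<lambda>y. h y * ee m y) integrable_on cbox 0 1" "(\<lambda>y. S y * ee m y) integrable_on cbox 0 1"
      by (intro integrable_continuous continuous_intros continuous_on_subset[OF h(1)] continuous_on_subset[OF S(1)]; simp)+
    have "integral (cbox 0 1) (\<lambda>y. S y * ee m y) = integral (cbox 0 1) (\<lambda>y. h y * ee m y)"
      using S(3)[of "- m"] unfolding minus_minus S_def .
    then show "integral (cbox 0 1) (\<lambda>y. (h y - S y) * ee m y) = 0"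
      using integral_diff[OF i] by (simp add: left_diff_distrib)
  qed
  then show ?thesis by (simp add: S_def)
qed

section \<open>Summability over the integer lattice\<close>

lemma sum_lattice_weight_le:
  "(\<Sum>k\<in>{- int N..int N}. 1 / (1 + (real_of_int k)\<^sup>2)) \<le> 5 - 4 / (real N + 1)"
proof (induction N)
  case (Suc N)
  have "{- int (Suc N)..int (Suc N)} = insert (- int (Suc N)) (insert (int (Suc N)) {- int N..int N})" by auto
  then have "(\<Sum>k\<in>{- int (Suc N)..int (Suc N)}. 1 / (1 + (real_of_int k)\<^sup>2))
     = 2 / (1 + (real N + 1)\<^sup>2) + (\<Sum>k\<in>{- int N..int N}. 1 / (1 + (real_of_int k)\<^sup>2))"
  proof -
    have "(- 1 - real N)\<^sup>2 = (real N + 1)\<^sup>2" by (simp add: power2_eq_square algebra_simps)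
    then show ?thesis using \<open>{- int (Suc N)..int (Suc N)} = _\<close> by (simp add: add.commute)
  qed
  also have "\<dots> \<le> 2 / (1 + (real N + 1)\<^sup>2) + (5 - 4 / (real N + 1))" using Suc by simp
  \<comment> \<open>The two new terms are dominated by a telescoping difference. The bound starts as
    the equality 1 = 5 - 4 at N = 0, and the constant 4 leaves room for this estimate.\<close>
  also have "2 / (1 + (real N + 1)\<^sup>2) \<le> 4 / (real N + 1) - 4 / (real N + 2)"
  proof -
    have "4 / (real N + 1) - 4 / (real N + 2) = 4 / ((real N + 1) * (real N + 2))" by (simp add: field_simps)
    moreover have "2 / (1 + (real N + 1)\<^sup>2) \<le> 4 / ((real N + 1) * (real N + 2))"
    proof -
      have "2 * ((real N + 1) * (real N + 2)) \<le> 4 * (1 + (real N + 1)\<^sup>2)"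
        by (simp add: power2_eq_square algebra_simps)
      moreover have "1 + (real N + 1)\<^sup>2 > 0" "(real N + 1) * (real N + 2) > 0" by (auto intro: add_pos_nonneg)
      moreover have "2 / a \<le> 4 / b" if "2 * b \<le> 4 * a" "a > 0" "b > 0" for a b :: real
        using that by (simp add: field_simps)
      ultimately show ?thesis by blast
    qed
    ultimately show ?thesis by simp
  qed
  finally show ?case by (simp add: add.commute)
qed simp

text \<open>A product over the coordinates, so that sums over boxes factor into one-dimensional
  sums; it serves as the comparison series for all lattice sums.\<close>

definition lattice_weight :: "int^'n::finite \<Rightarrow> real" where
  "lattice_weight m = (\<Prod>j\<in>UNIV. 1 / (1 + (real_of_int (m $ j))\<^sup>2))"

lemma lattice_weight_nonneg: "lattice_weight m \<ge> 0"
  unfolding lattice_weight_def by (intro prod_nonneg) auto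

text \<open>A finite set of indices lies in a box, the sum over a box is a product of
  one-dimensional sums, and each of these is at most 5.\<close>

lemma lattice_weight_summable: "(lattice_weight :: int^'n::finite \<Rightarrow> real) summable_on UNIV"
proof (rule nonneg_bdd_above_summable_on[OF lattice_weight_nonneg])
  have "sum lattice_weight F \<le> 5 ^ CARD('n)" if "finite F" for F :: "(int^'n) set"
  proof -
    define N where "N = (\<Sum>m\<in>F. \<Sum>j\<in>UNIV. nat \<bar>m $ j\<bar>)"
    have N: "m $ j \<in> {- int N..int N}" if "m \<in> F" for m j
    proof -
      have "nat \<bar>m $ j\<bar> \<le> (\<Sum>j\<in>UNIV. nat \<bar>m $ j\<bar>)" by (rule member_le_sum) auto
      also have "\<dots> \<le> N" unfolding N_def by (rule member_le_sum[OF that]) (use \<open>finite F\<close> in auto)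
      finally show ?thesis by auto
    qed
    define P where "P = PiE (UNIV::'n set) (\<lambda>_. {- int N..int N})"
    have "F \<subseteq> vec_lambda ` P"
    proof
      fix m assume "m \<in> F"
      then have "vec_nth m \<in> P" using N by (auto simp: P_def PiE_def extensional_def)
      then show "m \<in> vec_lambda ` P" by (metis image_eqI vec_nth_inverse)
    qed
    moreover have fP: "finite P" unfolding P_def by (rule finite_PiE) auto
    ultimately have "sum lattice_weight F \<le> sum lattice_weight (vec_lambda ` P)"
      by (intro sum_mono2) (auto simp: lattice_weight_nonneg)
    also have "\<dots> = (\<Sum>g\<in>P. lattice_weight (vec_lambda g))"
      by (rule sum.reindex[unfolded o_def]) (auto simp: inj_on_def vec_lambda_inject)
    also have "\<dots> = (\<Sum>g\<in>P. \<Prod>j\<in>UNIV. 1 / (1 + (real_of_int (g j))\<^sup>2))" by (simp add: lattice_weight_def)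
    also have "\<dots> = (\<Prod>j\<in>(UNIV::'n set). \<Sum>k\<in>{- int N..int N}. 1 / (1 + (real_of_int k)\<^sup>2))"
      unfolding P_def by (rule prod_sum_PiE[symmetric]) auto
    also have "\<dots> \<le> (\<Prod>j\<in>(UNIV::'n set). 5)"
    proof (intro prod_mono conjI sum_nonneg)
      show "(\<Sum>k\<in>{- int N..int N}. 1 / (1 + (real_of_int k)\<^sup>2)) \<le> 5"
        using order_trans[OF sum_lattice_weight_le[of N], of 5] by simp
    qed auto
    finally show ?thesis by simp
  qed
  then show "bdd_above (sum lattice_weight ` {F. F \<subseteq> (UNIV :: (int^'n) set) \<and> finite F})" by (intro bdd_aboveI) auto
qed

lemma lattice_weight_lower: "1 \<le> (1 + (norm (int_vec m))\<^sup>2) ^ CARD('n) * lattice_weight (m :: int^'n::finite)"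
proof -
  have c: "\<bar>real_of_int (m $ j)\<bar> \<le> norm (int_vec m)" for j using component_le_norm_cart[of "int_vec m" j] by simp
  have "(\<Prod>j\<in>(UNIV::'n set). 1 + (real_of_int (m $ j))\<^sup>2) \<le> (\<Prod>j\<in>(UNIV::'n set). 1 + (norm (int_vec m))\<^sup>2)"
    by (intro prod_mono conjI add_left_mono) (use c in \<open>auto simp: abs_le_square_iff[symmetric]\<close>)
  also have "\<dots> = (1 + (norm (int_vec m))\<^sup>2) ^ CARD('n)" by simp
  finally have 1: "(\<Prod>j\<in>(UNIV::'n set). 1 + (real_of_int (m $ j))\<^sup>2) \<le> (1 + (norm (int_vec m))\<^sup>2) ^ CARD('n)" .
  have "lattice_weight m * (\<Prod>j\<in>(UNIV::'n set). 1 + (real_of_int (m $ j))\<^sup>2) = 1"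
    unfolding lattice_weight_def prod.distrib[symmetric]
    by (rule prod.neutral) (auto simp: add_nonneg_eq_0_iff)
  then show ?thesis using mult_left_mono[OF 1 lattice_weight_nonneg[of m]] by (simp add: mult.commute)
qed

lemma polynomial_decay_summable:
  fixes c :: "int^'n::finite \<Rightarrow> 'a::banach"
  assumes "\<And>m. norm (c m) * (1 + (norm (int_vec m))\<^sup>2) ^ CARD('n) \<le> C"
  shows "(\<lambda>m. norm (c m)) summable_on UNIV"
proof (rule summable_on_comparison_test[of "\<lambda>m. C * lattice_weight m"])
  show "(\<lambda>m. C * lattice_weight m) summable_on UNIV" by (intro summable_on_cmult_right lattice_weight_summable)
  fix m :: "int^'n"
  have "norm (c m) \<le> norm (c m) * ((1 + (norm (int_vec m))\<^sup>2) ^ CARD('n) * lattice_weight m)"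
    using mult_left_mono[OF lattice_weight_lower[of m], of "norm (c m)"] by simp
  also have "\<dots> \<le> C * lattice_weight m"
    using mult_right_mono[OF assms lattice_weight_nonneg, of m m] by (simp add: mult.assoc)
  finally show "norm (c m) \<le> C * lattice_weight m" .
qed auto

text \<open>Apply 1 + x \<le> exp x with x = r / (k + 1). Dividing by k + 1 instead of k keeps the
  case k = 0 harmless.\<close>

lemma power_le_exp:
  fixes r :: real assumes "r \<ge> 0"
  shows "(1 + r) ^ k \<le> real (k + 1) ^ k * exp r"
proof -
  have "1 + r \<le> real (k + 1) * (1 + r / real (k + 1))" using assms by (simp add: field_simps)
  then have "(1 + r) ^ k \<le> (real (k + 1) * (1 + r / real (k + 1))) ^ k" using assms by (intro power_mono) auto
  also have "\<dots> = real (k + 1) ^ k * (1 + r / real (k + 1)) ^ k" by (simp add: power_mult_distrib)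
  also have "(1 + r / real (k + 1)) ^ k \<le> exp (r / real (k + 1)) ^ k" using assms by (intro power_mono exp_ge_add_one_self) auto
  also have "\<dots> = exp (real k * (r / real (k + 1)))" by (simp only: exp_of_nat_mult)
  also have "\<dots> \<le> exp r" using assms by (simp add: field_simps mult_left_mono)
  finally show ?thesis by (simp add: mult_left_mono)
qed

lemma exp_decay_summable:
  fixes c :: "int^'n::finite \<Rightarrow> 'a::banach"
  assumes "\<And>m. norm (c m) \<le> C * exp (- norm (int_vec m))"
  shows "(\<lambda>m. norm (c m)) summable_on UNIV"
proof (rule polynomial_decay_summable)
  fix m :: "int^'n"
  define r where "r = norm (int_vec m)"
  define k where "k = 2 * CARD('n)"
  have r: "r \<ge> 0" by (simp add: r_def)
  have C: "C \<ge> 0" using order_trans[OF norm_ge_zero assms[of 0]] by simp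
  have "(1 + r\<^sup>2) ^ CARD('n) \<le> ((1 + r)\<^sup>2) ^ CARD('n)"
    using r by (intro power_mono) (auto simp: power2_eq_square algebra_simps)
  also have "\<dots> = (1 + r) ^ k" by (simp add: k_def power_mult)
  also have "\<dots> \<le> real (k + 1) ^ k * exp r" by (rule power_le_exp[OF r])
  finally have 1: "(1 + r\<^sup>2) ^ CARD('n) \<le> real (k + 1) ^ k * exp r" .
  have "norm (c m) * (1 + r\<^sup>2) ^ CARD('n) \<le> (C * exp (- r)) * (real (k + 1) ^ k * exp r)"
    using assms[of m] 1 r C unfolding r_def[symmetric] by (intro mult_mono) auto
  also have "\<dots> = C * real (k + 1) ^ k" by (simp add: exp_minus field_simps)
  finally show "norm (c m) * (1 + (norm (int_vec m))\<^sup>2) ^ CARD('n) \<le> C * real (2 * CARD('n) + 1) ^ (2 * CARD('n))"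
    by (simp add: r_def k_def)
qed

section \<open>Holomorphic exponential series\<close>

text \<open>Decay faster than every exponential. This is the right class because
  \<open>exp (ell m z)\<close> grows exponentially in m at a rate that depends on z, and because
  differentiation multiplies the coefficients by coordinates of m.\<close>

definition super_decay :: "(int^'n::finite \<Rightarrow> complex) \<Rightarrow> bool" where
  "super_decay c \<longleftrightarrow> (\<forall>\<rho>. \<exists>M. \<forall>m. norm (c m) \<le> M * exp (- \<rho> * norm (int_vec m)))"

lemma super_decay_coord:
  assumes "super_decay c" shows "super_decay (\<lambda>m. of_int (m $ j) * c m)"
  unfolding super_decay_def
proof
  fix \<rho>
  obtain M where M: "\<And>m. norm (c m) \<le> M * exp (- (\<rho> + 1) * norm (int_vec m))"
    using assms unfolding super_decay_def by meson
  have "norm (of_int (m $ j) * c m) \<le> M * exp (- \<rho> * norm (int_vec m))" for m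
  proof -
    define r where "r = norm (int_vec m)"
    have "\<bar>real_of_int (m $ j)\<bar> \<le> r" using component_le_norm_cart[of "int_vec m" j] by (simp add: r_def)
    also have "\<dots> \<le> exp r" using exp_ge_add_one_self[of r] by linarith
    finally have "norm (of_int (m $ j) * c m) \<le> exp r * (M * exp (- (\<rho> + 1) * r))"
      unfolding norm_mult using M[of m] by (intro mult_mono) (auto simp: r_def)
    also have "\<dots> = M * exp (r + - (\<rho> + 1) * r)" by (simp only: exp_add mult_ac)
    also have "r + - (\<rho> + 1) * r = - \<rho> * r" by (simp add: algebra_simps)
    finally show ?thesis by (simp add: r_def)
  qed
  then show "\<exists>M. \<forall>m. norm (of_int (m $ j) * c m) \<le> M * exp (- \<rho> * norm (int_vec m))" by blast
qed

text \<open>With z_j = y_j + i x_j, where \<open>fst\<close> is x and \<open>snd\<close> is y, this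
  is 2 \<pi> i (m, z); its exponential is the holomorphic extension of the character
  \<open>ee m\<close>.\<close>

definition ell :: "int^'n::finite \<Rightarrow> (real^'n) \<times> (real^'n) \<Rightarrow> complex" where
  "ell m z = 2 * of_real pi * \<i> * of_real (int_vec m \<bullet> snd z) - 2 * of_real pi * of_real (int_vec m \<bullet> fst z)"

definition theta :: "(int^'n::finite \<Rightarrow> complex) \<Rightarrow> (real^'n) \<times> (real^'n) \<Rightarrow> complex" where
  "theta c z = infsum (\<lambda>m. c m * exp (ell m z)) UNIV"

lemma ell_add: "ell m (z + h) = ell m z + ell m h"
  by (simp add: ell_def inner_add_right algebra_simps)

lemma ell_bound: "norm (ell m z) \<le> 4 * pi * norm (int_vec m) * norm z"
proof -
  have "norm (ell m z) \<le> norm (2 * of_real pi * \<i> * of_real (int_vec m \<bullet> snd z) :: complex) + norm (2 * of_real pi * of_real (int_vec m \<bullet> fst z) :: complex)"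
    unfolding ell_def by (rule norm_triangle_ineq4)
  also have "\<dots> = 2 * pi * \<bar>int_vec m \<bullet> snd z\<bar> + 2 * pi * \<bar>int_vec m \<bullet> fst z\<bar>" by (simp add: norm_mult)
  also have "\<dots> \<le> 2 * pi * (norm (int_vec m) * norm z) + 2 * pi * (norm (int_vec m) * norm z)"
  proof (intro add_mono mult_left_mono)
    show "\<bar>int_vec m \<bullet> snd z\<bar> \<le> norm (int_vec m) * norm z"
      using Cauchy_Schwarz_ineq2[of "int_vec m" "snd z"] mult_left_mono[OF norm_snd_le[of "snd z" "fst z"], of "norm (int_vec m)"]
      by simp
    show "\<bar>int_vec m \<bullet> fst z\<bar> \<le> norm (int_vec m) * norm z"
      using Cauchy_Schwarz_ineq2[of "int_vec m" "fst z"] mult_left_mono[OF norm_fst_le[of "fst z" "snd z"], of "norm (int_vec m)"]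
      by simp
  qed auto
  also have "\<dots> = 4 * pi * norm (int_vec m) * norm z" by simp
  finally show ?thesis .
qed

lemma super_decay_summable:
  assumes "super_decay c" "\<And>m. norm (b m) \<le> K * exp (\<rho> * norm (int_vec m))"
  shows "(\<lambda>m. norm (c m * b m)) summable_on UNIV"
proof -
  obtain M where M: "\<And>m. norm (c m) \<le> M * exp (- (\<rho> + 1) * norm (int_vec m))"
    using assms(1) unfolding super_decay_def by meson
  have M0: "M \<ge> 0" using order_trans[OF norm_ge_zero M[of 0]] by simp
  show ?thesis
  proof (rule exp_decay_summable)
    fix m
    have "norm (c m * b m) \<le> (M * exp (- (\<rho> + 1) * norm (int_vec m))) * (K * exp (\<rho> * norm (int_vec m)))"
      unfolding norm_mult using M assms(2) M0 by (intro mult_mono) auto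
    also have "\<dots> = M * K * (exp (- (\<rho> + 1) * norm (int_vec m)) * exp (\<rho> * norm (int_vec m)))" by simp
    also have "exp (- (\<rho> + 1) * norm (int_vec m)) * exp (\<rho> * norm (int_vec m)) = exp (- norm (int_vec m))"
      unfolding exp_add[symmetric] by (rule arg_cong[where f=exp]) (simp add: algebra_simps)
    finally show "norm (c m * b m) \<le> M * K * exp (- norm (int_vec m))" .
  qed
qed

lemma exp_ell_bound: "norm (exp (ell m z)) \<le> exp (4 * pi * norm z * norm (int_vec m))"
proof -
  have "norm (exp (ell m z)) \<le> exp (norm (ell m z))" by (rule norm_exp)
  also have "\<dots> \<le> exp (4 * pi * norm z * norm (int_vec m))" using ell_bound[of m z] by (simp add: mult_ac)
  finally show ?thesis .
qed

lemma theta_summable: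
  assumes "super_decay c" shows "(\<lambda>m. norm (c m * exp (ell m z))) summable_on UNIV"
  by (rule super_decay_summable[OF assms, of _ 1 "4 * pi * norm z"]) (unfold mult_1, rule exp_ell_bound)

lemma exp_remainder: "norm (exp b - 1 - b) \<le> (norm b)\<^sup>2 * exp (norm b)" for b :: complex
proof -
  have "norm (exp b - (\<Sum>k\<le>1. b ^ k / fact k)) \<le> exp \<bar>Re b\<bar> * norm b ^ Suc 1 / fact 1" by (rule Taylor_exp)
  also have "\<dots> \<le> exp (norm b) * (norm b)\<^sup>2"
    using abs_Re_le_cmod[of b] by (auto simp: power2_eq_square intro!: mult_right_mono)
  finally show ?thesis by (simp add: algebra_simps)
qed

text \<open>The linear form 2 \<pi> i dz_j. Splitting \<open>ell\<close> into these forms writes the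
  derivative of \<open>theta c\<close> as a finite combination of series of the same kind, with
  coefficients m_j c_m.\<close>

definition lam :: "'n::finite \<Rightarrow> (real^'n) \<times> (real^'n) \<Rightarrow> complex" where
  "lam j h = 2 * of_real pi * \<i> * of_real (snd h $ j) - 2 * of_real pi * of_real (fst h $ j)"

lemma ell_lam: "ell m h = (\<Sum>j\<in>UNIV. of_int (m $ j) * lam j h)"
  unfolding ell_def lam_def inner_vec_def
  by (simp add: sum_distrib_left sum_subtractf[symmetric] algebra_simps)

lemma bounded_linear_lam: "bounded_linear (lam j)"
  unfolding lam_def
  by (intro bounded_linear_sub bounded_linear_const_mult bounded_linear_compose[OF bounded_linear_of_real]
      bounded_linear_compose[OF bounded_linear_vec_nth] bounded_linear_fst bounded_linear_snd)

lemma summable_infsum_finite_sum: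
  fixes f :: "'i \<Rightarrow> 'a \<Rightarrow> complex"
  assumes "finite F" "\<And>i. i \<in> F \<Longrightarrow> f i summable_on A"
  shows "(\<lambda>x. \<Sum>i\<in>F. f i x) summable_on A \<and> infsum (\<lambda>x. \<Sum>i\<in>F. f i x) A = (\<Sum>i\<in>F. infsum (f i) A)"
  using assms by (induction F rule: finite_induct) (auto simp: infsum_add summable_on_add)

lemmas summable_on_sum' = summable_infsum_finite_sum[THEN conjunct1]
lemmas infsum_sum' = summable_infsum_finite_sum[THEN conjunct2]

lemma summable_infsum_diff:
  fixes f g :: "'a \<Rightarrow> complex"
  assumes "f summable_on A" "g summable_on A"
  shows "(\<lambda>x. f x - g x) summable_on A \<and> infsum (\<lambda>x. f x - g x) A = infsum f A - infsum g A"
proof -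
  have "(\<lambda>x. - g x) summable_on A" using assms(2) by (simp add: summable_on_uminus)
  from summable_on_add[OF assms(1) this] infsum_add[OF assms(1) this] show ?thesis by (simp add: infsum_uminus)
qed

text \<open>Termwise differentiation: for increments h of norm at most 1 the second-order remainders
  of the terms sum to at most a constant times the square of \<open>norm h\<close>, thanks to the
  decay of \<open>c\<close>.\<close>

lemma theta_derivative:
  assumes c: "super_decay c"
  shows "(theta c has_derivative (\<lambda>h. \<Sum>j\<in>UNIV. lam j h * theta (\<lambda>m. of_int (m $ j) * c m) z)) (at z)"
proof -
  define f' where "f' = (\<lambda>h. \<Sum>j\<in>UNIV. lam j h * theta (\<lambda>m. of_int (m $ j) * c m) z)"
  have s: "(\<lambda>m. c m * exp (ell m z)) summable_on UNIV" for z
    using theta_summable[OF c] by (rule abs_summable_summable)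
  have sj: "(\<lambda>m. of_int (m $ j) * c m * exp (ell m z)) summable_on UNIV" for j
    using theta_summable[OF super_decay_coord[OF c]] by (rule abs_summable_summable)
  have f': "f' h = infsum (\<lambda>m. c m * exp (ell m z) * ell m h) UNIV" "(\<lambda>m. c m * exp (ell m z) * ell m h) summable_on UNIV" for h
  proof -
    have e: "c m * exp (ell m z) * ell m h = (\<Sum>j\<in>UNIV. lam j h * (of_int (m $ j) * c m * exp (ell m z)))" for m
      unfolding ell_lam[of m h] by (simp add: sum_distrib_left mult_ac)
    show "(\<lambda>m. c m * exp (ell m z) * ell m h) summable_on UNIV"
      unfolding e by (intro summable_on_sum' summable_on_cmult_right sj finite)
    show "f' h = infsum (\<lambda>m. c m * exp (ell m z) * ell m h) UNIV"
    proof -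
      have "infsum (\<lambda>m. \<Sum>j\<in>UNIV. lam j h * (of_int (m $ j) * c m * exp (ell m z))) UNIV
        = (\<Sum>j\<in>UNIV. infsum (\<lambda>m. lam j h * (of_int (m $ j) * c m * exp (ell m z))) UNIV)"
        by (rule infsum_sum'[OF finite_class.finite_UNIV]) (intro summable_on_cmult_right sj)
      also have "\<dots> = f' h" unfolding f'_def theta_def
        by (intro sum.cong refl infsum_cmult_right) (use sj in auto)
      finally show ?thesis unfolding e by simp
    qed
  qed
  \<comment> \<open>The exponential rate that has to be beaten: \<open>4 * pi * norm z\<close> comes
    from \<open>exp (ell m z)\<close>, another \<open>4 * pi\<close> from
    \<open>exp (ell m h)\<close> with \<open>norm h \<le> 1\<close>, and 2 absorbs the square of
    \<open>norm (int_vec m)\<close> that \<open>ell m h\<close> contributes together with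
    \<open>K\<close>.\<close>
  define \<rho> where "\<rho> = 4 * pi * (norm z + 1) + 2"
  define K where "K = (4 * pi)\<^sup>2"
  define b where "b = (\<lambda>m::int^'a. complex_of_real (K * exp (\<rho> * norm (int_vec m))))"
  have sb: "(\<lambda>m. norm (c m * b m)) summable_on UNIV"
    by (rule super_decay_summable[OF c, of _ K \<rho>]) (simp only: b_def norm_of_real, simp add: K_def)
  define C where "C = infsum (\<lambda>m. norm (c m * b m)) UNIV"
  have rem: "norm (theta c (z + h) - theta c z - f' h) \<le> C * (norm h)\<^sup>2" if h: "norm h \<le> 1" for h
  proof -
    have tm: "norm (c m * exp (ell m (z + h)) - c m * exp (ell m z) - c m * exp (ell m z) * ell m h) \<le> norm (c m * b m) * (norm h)\<^sup>2" for m
    proof -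
      define r where "r = norm (int_vec m)"
      have r: "r \<ge> 0" by (simp add: r_def)
      have lh: "norm (ell m h) \<le> 4 * pi * r * norm h" using ell_bound[of m h] by (simp add: r_def)
      also have "\<dots> \<le> 4 * pi * r * 1" using h r by (intro mult_left_mono) auto
      finally have lh1: "norm (ell m h) \<le> 4 * pi * r" by simp
      have "norm (exp (ell m h) - 1 - ell m h) \<le> (norm (ell m h))\<^sup>2 * exp (norm (ell m h))" by (rule exp_remainder)
      also have "\<dots> \<le> (4 * pi * r * norm h)\<^sup>2 * exp (4 * pi * r)" using lh lh1 by (intro mult_mono power_mono) auto
      finally have 1: "norm (exp (ell m h) - 1 - ell m h) \<le> (4 * pi * r * norm h)\<^sup>2 * exp (4 * pi * r)" .
      have 2: "norm (exp (ell m z)) \<le> exp (4 * pi * norm z * r)" using exp_ell_bound by (simp add: r_def)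
      have r2: "r\<^sup>2 \<le> exp (2 * r)"
      proof -
        have "r \<le> exp r" using exp_ge_add_one_self[of r] by linarith
        then have "r\<^sup>2 \<le> (exp r)\<^sup>2" using r by (intro power_mono)
        then show ?thesis by (simp add: exp_double)
      qed
      have "norm (exp (ell m z)) * norm (exp (ell m h) - 1 - ell m h) \<le> exp (4 * pi * norm z * r) * ((4 * pi * r * norm h)\<^sup>2 * exp (4 * pi * r))"
        by (intro mult_mono 1 2) auto
      also have "\<dots> = (K * (norm h)\<^sup>2 * exp (4 * pi * norm z * r) * exp (4 * pi * r)) * r\<^sup>2" by (simp add: K_def power_mult_distrib)
      also have "\<dots> \<le> (K * (norm h)\<^sup>2 * exp (4 * pi * norm z * r) * exp (4 * pi * r)) * exp (2 * r)"
        by (intro mult_left_mono r2) (simp add: K_def)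
      also have "\<dots> = K * (norm h)\<^sup>2 * exp (4 * pi * norm z * r + 4 * pi * r + 2 * r)" by (simp add: exp_add)
      also have "4 * pi * norm z * r + 4 * pi * r + 2 * r = \<rho> * r" by (simp add: \<rho>_def algebra_simps)
      finally have 3: "norm (exp (ell m z)) * norm (exp (ell m h) - 1 - ell m h) \<le> norm (b m) * (norm h)\<^sup>2"
        unfolding b_def norm_of_real by (simp add: K_def r_def mult_ac)
      have "c m * exp (ell m (z + h)) - c m * exp (ell m z) - c m * exp (ell m z) * ell m h = c m * (exp (ell m z) * (exp (ell m h) - 1 - ell m h))"
        by (simp add: ell_add exp_add algebra_simps)
      then have "norm (c m * exp (ell m (z + h)) - c m * exp (ell m z) - c m * exp (ell m z) * ell m h) = norm (c m) * (norm (exp (ell m z)) * norm (exp (ell m h) - 1 - ell m h))"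
        by (simp add: norm_mult)
      also have "\<dots> \<le> norm (c m) * (norm (b m) * (norm h)\<^sup>2)" by (intro mult_left_mono 3) auto
      finally show ?thesis by (simp add: norm_mult mult.assoc)
    qed
    have "theta c (z + h) - theta c z - f' h = infsum (\<lambda>m. c m * exp (ell m (z + h)) - c m * exp (ell m z) - c m * exp (ell m z) * ell m h) UNIV"
    proof -
      have s1: "(\<lambda>m. c m * exp (ell m (z + h)) - c m * exp (ell m z)) summable_on UNIV"
        by (intro summable_infsum_diff[THEN conjunct1] s)
      show ?thesis unfolding theta_def f'(1)
        by (simp only: summable_infsum_diff[OF s1 f'(2)[of h], THEN conjunct2] summable_infsum_diff[OF s s, THEN conjunct2])
    qed
    also have "norm \<dots> \<le> infsum (\<lambda>m. norm (c m * b m) * (norm h)\<^sup>2) UNIV"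
    proof (rule norm_infsum_le[OF has_sum_infsum has_sum_infsum])
      show "(\<lambda>m. c m * exp (ell m (z + h)) - c m * exp (ell m z) - c m * exp (ell m z) * ell m h) summable_on UNIV"
        by (intro summable_infsum_diff[THEN conjunct1] s f'(2))
      show "(\<lambda>m. norm (c m * b m) * (norm h)\<^sup>2) summable_on UNIV" by (intro summable_on_cmult_left sb)
    qed (rule tm)
    also have "\<dots> = C * (norm h)\<^sup>2" unfolding C_def by (rule infsum_cmult_left) (use sb in auto)
    finally show ?thesis .
  qed
  have bl: "bounded_linear f'" unfolding f'_def
    by (intro bounded_linear_sum bounded_linear_mult_const bounded_linear_lam)
  have "((\<lambda>h. norm (theta c (z + h) - theta c z - f' h) / norm h) \<longlongrightarrow> 0) (at 0)"
  proof (rule Lim_null_comparison)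
    show "\<forall>\<^sub>F h in at 0. norm (norm (theta c (z + h) - theta c z - f' h) / norm h) \<le> C * norm h"
      unfolding eventually_at
    proof (intro exI[of _ 1] conjI ballI impI)
      fix h :: "(real^'a) \<times> (real^'a)" assume "h \<noteq> 0 \<and> dist h 0 < 1"
      then show "norm (norm (theta c (z + h) - theta c z - f' h) / norm h) \<le> C * norm h"
        using rem[of h] by (simp add: divide_le_eq power2_eq_square mult.assoc)
    qed simp
    show "((\<lambda>h. C * norm h) \<longlongrightarrow> 0) (at 0)" by (auto intro!: tendsto_eq_intros)
  qed
  then show ?thesis using bl unfolding f'_def[symmetric] has_derivative_at by simp
qed

lemma Ck_on_sum:
  "open S \<Longrightarrow> finite F \<Longrightarrow> (\<And>i. i \<in> F \<Longrightarrow> Ck_on k S (f i)) \<Longrightarrow> Ck_on k S (\<lambda>x. \<Sum>i\<in>F. f i x)"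
  by (rotate_tac 1, induction F rule: finite_induct) (auto intro: Ck_on_const Ck_on_add)

text \<open>By \<open>super_decay_coord\<close> the series in the derivative satisfy the same
  hypothesis, so induction on the order of differentiability applies to them.\<close>

lemma theta_smooth: assumes "super_decay c" shows "smooth_on UNIV (theta c)"
  unfolding smooth_on_def
proof
  fix k show "Ck_on k UNIV (theta c)"
    using assms
  proof (induction k arbitrary: c)
    case 0
    then show ?case using has_derivative_continuous[OF theta_derivative[OF 0]]
      unfolding Ck_on.simps by (intro continuous_at_imp_continuous_on ballI)
  next
    case (Suc k)
    show ?case
    proof (rule Ck_on_SucI)
      show "(theta c has_derivative (\<lambda>h. \<Sum>j\<in>UNIV. lam j h * theta (\<lambda>m. of_int (m $ j) * c m) x)) (at x)" for x
        by (rule theta_derivative[OF Suc.prems])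
      show "Ck_on k UNIV (\<lambda>x. \<Sum>j\<in>UNIV. lam j v * theta (\<lambda>m. of_int (m $ j) * c m) x)" for v
        by (intro Ck_on_sum Ck_on_bilinear[OF bounded_bilinear_mult] Ck_on_const Suc.IH super_decay_coord Suc.prems) auto
    qed simp
  qed
qed

section \<open>The integral general linear group\<close>

declare transpose_matrix_vector [simp del]

lemma invertible_matrix_inv:
  fixes A :: "real^'n::finite^'n"
  assumes "invertible A" shows "A ** matrix_inv A = mat 1" "matrix_inv A ** A = mat 1"
proof -
  have "A ** matrix_inv A = mat 1 \<and> matrix_inv A ** A = mat 1"
    using assms unfolding matrix_inv_def invertible_def by (rule someI_ex)
  then show "A ** matrix_inv A = mat 1" "matrix_inv A ** A = mat 1" by auto
qed

lemma integer_matrix_mult: "integer_matrix A \<Longrightarrow> integer_matrix B \<Longrightarrow> integer_matrix (A ** B)"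
  for A B :: "real^'n::finite^'n"
  unfolding integer_matrix_def matrix_matrix_mult_def by (auto intro!: Ints_sum Ints_mult)

lemma GLZ_mult: "A \<in> GLZ \<Longrightarrow> B \<in> GLZ \<Longrightarrow> A ** B \<in> GLZ"
proof -
  assume "A \<in> GLZ" "B \<in> GLZ"
  then obtain A' B' where *: "integer_matrix A" "integer_matrix A'" "A ** A' = mat 1" "A' ** A = mat 1"
    "integer_matrix B" "integer_matrix B'" "B ** B' = mat 1" "B' ** B = mat 1" unfolding GLZ_def by blast
  have "(A ** B) ** (B' ** A') = A ** (B ** B') ** A'" "(B' ** A') ** (A ** B) = B' ** (A' ** A) ** B"
    by (simp_all add: matrix_mul_assoc)
  then show "A ** B \<in> GLZ" unfolding GLZ_def using * integer_matrix_mult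
    by (auto intro!: exI[of _ "B' ** A'"])
qed

lemma GLZ_inv:
  assumes "A \<in> GLZ"
  shows "matrix_inv A \<in> GLZ" "A ** matrix_inv A = mat 1" "matrix_inv A ** A = mat 1"
proof -
  obtain A' where A': "integer_matrix A" "integer_matrix A'" "A ** A' = mat 1" "A' ** A = mat 1"
    using assms unfolding GLZ_def by blast
  then have "invertible A" unfolding invertible_def by blast
  then show 1: "A ** matrix_inv A = mat 1" "matrix_inv A ** A = mat 1"
    by (simp_all add: invertible_matrix_inv)
  have "matrix_inv A = (A' ** A) ** matrix_inv A" using A' by simp
  also have "\<dots> = A'" using 1 by (simp flip: matrix_mul_assoc)
  finally show "matrix_inv A \<in> GLZ" using A' unfolding GLZ_def by auto
qed

lemma GLZ_mat1: "mat 1 \<in> GLZ"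
proof -
  have "integer_matrix (mat 1 :: real^'a^'a)" by (simp add: integer_matrix_def mat_def)
  moreover have "mat 1 ** mat 1 = (mat 1 :: real^'a^'a)" by simp
  ultimately show ?thesis unfolding GLZ_def by blast
qed

lemma GLZ_transpose: assumes "A \<in> GLZ" shows "transpose A \<in> GLZ"
proof -
  obtain A' where A': "integer_matrix A" "integer_matrix A'" "A ** A' = mat 1" "A' ** A = mat 1"
    using assms unfolding GLZ_def by blast
  have "transpose A ** transpose A' = mat 1" "transpose A' ** transpose A = mat 1"
    using A' by (simp_all flip: matrix_transpose_mul)
  then show ?thesis using A' unfolding GLZ_def integer_matrix_def by (auto simp: transpose_def intro!: exI[of _ "transpose A'"])
qed

lemma GLZ_inv_vec: assumes "A \<in> GLZ" shows "A *v (matrix_inv A *v x) = x" "matrix_inv A *v (A *v x) = x"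
  using GLZ_inv[OF assms] by (simp_all add: matrix_vector_mul_assoc)

lemma GLZ_transpose_inv_vec:
  assumes "A \<in> GLZ"
  shows "transpose A *v (transpose (matrix_inv A) *v x) = x" "transpose (matrix_inv A) *v (transpose A *v x) = x"
  using GLZ_inv[OF assms] by (simp_all add: matrix_vector_mul_assoc flip: matrix_transpose_mul)

lemma integer_vec_iff: "(\<forall>j. v $ j \<in> \<int>) \<longleftrightarrow> v \<in> range int_vec"
proof
  assume "\<forall>j. v $ j \<in> \<int>"
  then have "v = int_vec (\<chi> j. \<lfloor>v $ j\<rfloor>)" by (auto simp: vec_eq_iff elim: Ints_cases)
  then show "v \<in> range int_vec" by blast
qed auto

lemma GLZ_int_vec: assumes "A \<in> GLZ" shows "A *v int_vec k \<in> range int_vec"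
proof -
  have "integer_matrix A" using assms by (simp add: GLZ_def)
  then show ?thesis unfolding integer_vec_iff[symmetric]
    by (auto simp: matrix_vector_mult_def integer_matrix_def intro!: Ints_sum Ints_mult)
qed

text \<open>The action on the lattice, pulled back from real vectors along the injection
  \<open>int_vec\<close>. It is meaningful for matrices that preserve the lattice, such as those in
  \<open>GLZ\<close>.\<close>

definition int_act :: "real^'n::finite^'n \<Rightarrow> int^'n \<Rightarrow> int^'n" where
  "int_act A k = (SOME l. int_vec l = A *v int_vec k)"

lemma int_vec_act: "A \<in> GLZ \<Longrightarrow> int_vec (int_act A k) = A *v int_vec k"
  unfolding int_act_def by (rule someI_ex) (metis GLZ_int_vec rangeE)

lemma bij_int_act: assumes "A \<in> GLZ" shows "bij (int_act A)"
proof (rule o_bij[of "int_act (matrix_inv A)"])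
  show "int_act (matrix_inv A) \<circ> int_act A = id" "int_act A \<circ> int_act (matrix_inv A) = id"
    using assms by (auto simp: fun_eq_iff int_vec_act GLZ_inv GLZ_inv_vec simp flip: int_vec_inj)
qed

lemma affine_eq_on_open:
  fixes A B :: "real^'n::finite^'m::finite"
  assumes "open W" "w \<in> W" "\<And>x. x \<in> W \<Longrightarrow> A *v x + s = B *v x + t"
  shows "A = B" "s = t"
proof -
  obtain e where e: "e > 0" "ball w e \<subseteq> W" using assms(1,2) open_contains_ball by blast
  have "A *v v = B *v v" for v
  proof (cases "v = 0")
    case False
    define r where "r = e / (2 * norm v)"
    have r: "r > 0" using e False by (simp add: r_def)
    have "dist w (w + r *\<^sub>R v) < e" using e False by (simp add: r_def dist_norm)
    then have "A *v (w + r *\<^sub>R v) + s = B *v (w + r *\<^sub>R v) + t" using e(2) assms(3) by auto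
    moreover have "A *v w + s = B *v w + t" using assms by blast
    ultimately have "(A *v (w + r *\<^sub>R v) + s) - (A *v w + s) = (B *v (w + r *\<^sub>R v) + t) - (B *v w + t)"
      by metis
    then have "r *\<^sub>R (A *v v) = r *\<^sub>R (B *v v)"
      by (simp add: matrix_vector_right_distrib matrix_vector_mult_scaleR)
    then show ?thesis using r by simp
  qed simp
  then show "A = B" by (simp add: matrix_eq)
  then show "s = t" using assms(2,3) by force
qed

lemma real_affine_eq_on_open:
  fixes m m' :: "real^'n::finite"
  assumes "open W" "w \<in> W" "\<And>x. x \<in> W \<Longrightarrow> m \<bullet> x + a = m' \<bullet> x + a'"
  shows "m = m'" "a = a'"
proof -
  define M where "M = (\<lambda>l::real^'n. (\<chi> i j. l $ j) :: real^'n^1)"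
  have M: "M l *v y = (\<chi> i. l \<bullet> y)" for l y by (simp add: M_def matrix_vector_mult_def inner_vec_def vec_eq_iff)
  have "M m *v y + (\<chi> i. a) = M m' *v y + (\<chi> i. a')" if "y \<in> W" for y using assms(3)[OF that] by (simp add: M vec_eq_iff)
  from affine_eq_on_open[OF assms(1,2) this] show "m = m'" "a = a'" by (auto simp: M_def vec_eq_iff)
qed

text \<open>Affine functions that agree on a nonempty open set coincide. Hence the set where the
  formula found near 0 holds locally is open and closed. The same pattern propagates integrality and
  deck transformations below.\<close>

lemma locally_affine_affine:
  fixes f :: "real^'n::finite \<Rightarrow> real"
  assumes "\<And>x. \<exists>W m a. open W \<and> x \<in> W \<and> (\<forall>y\<in>W. f y = m \<bullet> y + a)"
  obtains m a where "\<And>y. f y = m \<bullet> y + a"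
proof -
  obtain W0 m a where W0: "open W0" "0 \<in> W0" "\<And>y. y \<in> W0 \<Longrightarrow> f y = m \<bullet> y + a" using assms[of 0] by blast
  define S where "S = {x. \<exists>W. open W \<and> x \<in> W \<and> (\<forall>y\<in>W. f y = m \<bullet> y + a)}"
  have "open S" unfolding S_def open_subopen[of "Collect _"] by blast
  moreover have "closed S"
  proof (rule closed_limpt[THEN iffD2], intro allI impI)
    fix x assume x: "x islimpt S"
    obtain W m' a' where W: "open W" "x \<in> W" "\<And>y. y \<in> W \<Longrightarrow> f y = m' \<bullet> y + a'" using assms[of x] by blast
    obtain z where z: "z \<in> S" "z \<in> W" using x W by (auto simp: islimpt_def)
    then obtain V where V: "open V" "z \<in> V" "\<And>y. y \<in> V \<Longrightarrow> f y = m \<bullet> y + a" unfolding S_def by blast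
    have eq: "m \<bullet> y + a = m' \<bullet> y + a'" if "y \<in> V \<inter> W" for y using V(3)[of y] W(3)[of y] that by simp
    have "m = m'" "a = a'" using real_affine_eq_on_open[OF open_Int[OF V(1) W(1)] _ eq, of z] V(2) z by auto
    then show "x \<in> S" using W unfolding S_def by blast
  qed
  moreover have "0 \<in> S" using W0 unfolding S_def by blast
  ultimately have "S = UNIV" using clopen by blast
  then have "f y = m \<bullet> y + a" for y unfolding S_def by blast
  then show ?thesis using that by blast
qed

section \<open>Affine charts\<close>

lemma affine_chartsD:
  assumes "c \<in> affine_charts \<A>"
  shows "open (fst c)" "inj_on (snd c) (fst c)" "continuous_on (fst c) (snd c)" "open (chart_range c)"
  using assms unfolding affine_charts_def is_chart_def homeomorphism_def inj_on_def by (auto, metis)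

lemma chart_inv_eq: "c \<in> affine_charts \<A> \<Longrightarrow> b \<in> fst c \<Longrightarrow> chart_inv c (snd c b) = b"
  using affine_chartsD(2) by (rule inv_into_f_f)

lemma affine_transition_compose:
  assumes "affine_transition b c d A s" "affine_transition b d e B t"
  shows "affine_transition b c e (A ** B) (A *v t + s)"
proof -
  obtain V W where "open V" "b \<in> V" "V \<subseteq> fst c \<inter> fst d" "\<forall>q\<in>V. snd c q = A *v snd d q + s"
    "open W" "b \<in> W" "W \<subseteq> fst d \<inter> fst e" "\<forall>q\<in>W. snd d q = B *v snd e q + t"
    using assms unfolding affine_transition_def by blast
  then show ?thesis unfolding affine_transition_def
    by (intro exI[of _ "V \<inter> W"]) (auto simp: matrix_vector_right_distrib matrix_vector_mul_assoc)
qed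

lemma affine_charts_compatible:
  assumes at: "affine_atlas GLZ \<A>" and c: "c \<in> affine_charts \<A>" "d \<in> affine_charts \<A>" "b \<in> fst c" "b \<in> fst d"
  obtains A t where "A \<in> GLZ" "affine_transition b c d A t"
proof -
  obtain e where e: "e \<in> \<A>" "b \<in> fst e" using at unfolding affine_atlas_def by blast
  have "compatible GLZ c e" "compatible GLZ e d" using c e unfolding affine_charts_def by auto
  then have "\<exists>A\<in>GLZ. \<exists>t. affine_transition b c e A t" "\<exists>A\<in>GLZ. \<exists>t. affine_transition b e d A t"
    unfolding compatible_def using c e by simp_all
  then obtain A s B t where AB: "A \<in> GLZ" "affine_transition b c e A s" "B \<in> GLZ" "affine_transition b e d B t"
    by metis
  show ?thesis by (rule that[OF GLZ_mult[OF AB(1,3)] affine_transition_compose[OF AB(2,4)]])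
qed

lemma atlas_subset: "affine_atlas GLZ \<A> \<Longrightarrow> \<A> \<subseteq> affine_charts \<A>"
  unfolding affine_atlas_def affine_charts_def by blast

text \<open>The universal covering enters as a continuous surjection from \<real>^n that is integral
  affine in every affine chart. Its local sections and its deck group are reconstructed from
  this.\<close>

locale lift_setup =
  fixes \<A> :: "('b::t2_space, 'n::finite) chart set" and \<pi> :: "real^'n \<Rightarrow> 'b"
  assumes atlas: "affine_atlas GLZ \<A>"
    and cont: "continuous_on UNIV \<pi>" and surj: "surj \<pi>"
    and loc: "\<And>c w. c \<in> affine_charts \<A> \<Longrightarrow> \<pi> w \<in> fst c \<Longrightarrow>
      \<exists>W A t. open W \<and> w \<in> W \<and> A \<in> GLZ \<and> (\<forall>w'\<in>W. \<pi> w' \<in> fst c \<and> snd c (\<pi> w') = A *v w' + t)"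

text \<open>Composing the universal covering with a linear map makes one linear part, hence all of them, integral.\<close>

lemma ex_lift_setup:
  fixes \<A> :: "('b::t2_space, 'n::finite) chart set"
  assumes at: "affine_atlas GLZ \<A>" and co: "complete_affine \<A>"
  obtains \<pi> where "lift_setup \<A> \<pi>"
proof -
  obtain \<pi>0 :: "real^'n \<Rightarrow> 'b" where cs: "covering_space UNIV \<pi>0 UNIV" and
    l: "\<And>c v. c \<in> \<A> \<Longrightarrow> \<pi>0 v \<in> fst c \<Longrightarrow> \<exists>W A t. open W \<and> v \<in> W \<and> invertible A \<and>
              (\<forall>w\<in>W. \<pi>0 w \<in> fst c \<and> snd c (\<pi>0 w) = A *v w + t)"
    using co unfolding complete_affine_def by blast
  obtain c0 where c0: "c0 \<in> \<A>" "\<pi>0 0 \<in> fst c0" using at unfolding affine_atlas_def by blast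
  obtain W0 A0 t0 where A0: "open W0" "0 \<in> W0" "invertible A0" "\<And>w. w \<in> W0 \<Longrightarrow> \<pi>0 w \<in> fst c0 \<and> snd c0 (\<pi>0 w) = A0 *v w + t0"
    using l[OF c0] by blast
  \<comment> \<open>Precomposition with \<open>M\<close> turns the linear part at 0, in the chart
    \<open>c0\<close>, into the identity, which lies in \<open>GLZ\<close>; this starts the
    propagation.\<close>
  define M where "M = matrix_inv A0"
  have M: "A0 ** M = mat 1" "M ** A0 = mat 1" using A0(3) by (simp_all add: M_def invertible_matrix_inv)
  then have invM: "invertible M" unfolding invertible_def by blast
  define \<pi> where "\<pi> = (\<lambda>w. \<pi>0 (M *v w))"
  have cM: "continuous_on S (\<lambda>w. M *v w)" for S by (intro continuous_intros)
  have contp: "continuous_on UNIV \<pi>" unfolding \<pi>_def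
    using continuous_on_compose2[OF _ cM[of UNIV], of UNIV \<pi>0] cs unfolding covering_space_def by auto
  have surjp: "surj \<pi>"
  proof -
    have "\<exists>w. b = \<pi> w" for b
    proof -
      obtain v where "b = \<pi>0 v" using cs unfolding covering_space_def by blast
      then have "b = \<pi> (A0 *v v)" by (simp add: \<pi>_def matrix_vector_mul_assoc M)
      then show ?thesis by blast
    qed
    then show ?thesis by (auto simp: surj_def)
  qed
  have l': "\<exists>W A t. open W \<and> w \<in> W \<and> invertible A \<and> (\<forall>w'\<in>W. \<pi> w' \<in> fst c \<and> snd c (\<pi> w') = A *v w' + t)"
    if c: "c \<in> \<A>" "\<pi> w \<in> fst c" for c w
  proof -
    obtain W A t where W: "open W" "M *v w \<in> W" "invertible A" "\<And>w. w \<in> W \<Longrightarrow> \<pi>0 w \<in> fst c \<and> snd c (\<pi>0 w) = A *v w + t"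
      using l[of c "M *v w"] c unfolding \<pi>_def by metis
    have "open ((\<lambda>w. M *v w) -` W)" by (rule open_vimage[OF W(1) cM])
    moreover have "\<pi> w' \<in> fst c \<and> snd c (\<pi> w') = (A ** M) *v w' + t" if "w' \<in> (\<lambda>w. M *v w) -` W" for w'
      using W(4)[of "M *v w'"] that by (simp add: \<pi>_def matrix_vector_mul_assoc)
    moreover have "invertible (A ** M)" using W(3) invM by (rule invertible_mult)
    ultimately show ?thesis using W(2) by (metis vimageI)
  qed
  \<comment> \<open>Integrality of the lift near w as seen in chart c. By \<open>trans\<close> it
    does not depend on the chart, because coordinate changes have linear parts in
    \<open>GLZ\<close>.\<close>
  define G where "G = (\<lambda>w c. \<exists>W A t. open W \<and> w \<in> W \<and> A \<in> GLZ \<and> (\<forall>w'\<in>W. \<pi> w' \<in> fst c \<and> snd c (\<pi> w') = A *v w' + t))"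
  have trans: "G w c" if g: "G w d" "c \<in> affine_charts \<A>" "d \<in> affine_charts \<A>" "\<pi> w \<in> fst c" for w c d
  proof -
    obtain W A t where W: "open W" "w \<in> W" "A \<in> GLZ" "\<And>w'. w' \<in> W \<Longrightarrow> \<pi> w' \<in> fst d \<and> snd d (\<pi> w') = A *v w' + t"
      using g(1) unfolding G_def by metis
    have "\<pi> w \<in> fst d" using W by blast
    then obtain B s where B: "B \<in> GLZ" "affine_transition (\<pi> w) c d B s"
      using affine_charts_compatible[OF at g(2,3,4)] by metis
    then obtain V where V: "open V" "\<pi> w \<in> V" "V \<subseteq> fst c \<inter> fst d" "\<And>q. q \<in> V \<Longrightarrow> snd c q = B *v snd d q + s"
      unfolding affine_transition_def by blast
    have "open (\<pi> -` V)" by (rule open_vimage[OF V(1) contp])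
    then have "open (W \<inter> \<pi> -` V)" using W by blast
    moreover have "\<pi> w' \<in> fst c \<and> snd c (\<pi> w') = (B ** A) *v w' + (B *v t + s)" if "w' \<in> W \<inter> \<pi> -` V" for w'
      using W(4)[of w'] V(3) V(4)[of "\<pi> w'"] that
      by (auto simp: matrix_vector_right_distrib matrix_vector_mul_assoc)
    ultimately show ?thesis unfolding G_def using V(2) W(2) GLZ_mult[OF B(1) W(3)]
      by (intro exI[of _ "W \<inter> \<pi> -` V"] exI[of _ "B ** A"] exI[of _ "B *v t + s"]) simp
  qed
  define S where "S = {w. \<exists>c\<in>\<A>. G w c}"
  have G_open: "\<exists>W. open W \<and> w \<in> W \<and> (\<forall>w'\<in>W. G w' c)" if "G w c" for w c
    using that unfolding G_def by blast
  have "open S" unfolding open_subopen[of S]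
  proof
    fix w assume "w \<in> S"
    then obtain c where c: "c \<in> \<A>" "G w c" unfolding S_def by blast
    then obtain W where "open W" "w \<in> W" "\<forall>w'\<in>W. G w' c" using G_open by metis
    then show "\<exists>T. open T \<and> w \<in> T \<and> T \<subseteq> S" using c unfolding S_def by blast
  qed
  moreover have "closed S"
  proof (rule closed_limpt[THEN iffD2], intro allI impI)
    fix w assume w: "w islimpt S"
    obtain c where c: "c \<in> \<A>" "\<pi> w \<in> fst c" using at unfolding affine_atlas_def by blast
    obtain W A t where W: "open W" "w \<in> W" "invertible A" "\<And>w'. w' \<in> W \<Longrightarrow> \<pi> w' \<in> fst c \<and> snd c (\<pi> w') = A *v w' + t"
      using l'[OF c] by blast
    obtain z where z: "z \<in> S" "z \<in> W" using w W by (auto simp: islimpt_def)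
    then obtain d where "d \<in> \<A>" "G z d" unfolding S_def by blast
    then have "G z c" using trans[of z d c] atlas_subset[OF at] c z W by blast
    then obtain V B s where V: "open V" "z \<in> V" "B \<in> GLZ" "\<And>w'. w' \<in> V \<Longrightarrow> snd c (\<pi> w') = B *v w' + s"
      unfolding G_def by blast
    have eq: "A *v y + t = B *v y + s" if "y \<in> V \<inter> W" for y using V(4)[of y] W(4)[of y] that by simp
    \<comment> \<open>Near the limit point the lift is affine with one linear part \<open>A\<close>;
      at a nearby good point this is also the integral part \<open>B\<close>, and the two agree on
      an open set.\<close>
    have "A = B" by (rule affine_eq_on_open(1)[of "V \<inter> W" z A t B s]) (use V W z eq in auto)
    then have "G w c" unfolding G_def using W V by blast
    then show "w \<in> S" using c unfolding S_def by blast
  qed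
  moreover have "0 \<in> S"
  proof -
    have "open ((\<lambda>w. M *v w) -` W0)" by (rule open_vimage[OF A0(1) cM])
    then have "G 0 c0" unfolding G_def using A0 GLZ_mat1
      by (intro exI[of _ "(\<lambda>w. M *v w) -` W0"] exI[of _ "mat 1"] exI[of _ t0])
         (auto simp: \<pi>_def matrix_vector_mul_assoc M)
    then show ?thesis using c0 unfolding S_def by blast
  qed
  ultimately have S: "S = UNIV" using clopen by blast
  have "lift_setup \<A> \<pi>"
  proof
    fix c w assume c: "c \<in> affine_charts \<A>" "\<pi> w \<in> fst c"
    obtain d where "d \<in> \<A>" "G w d" using S unfolding S_def by blast
    then have "G w c" using trans[of w d c] c atlas_subset[OF at] by blast
    then show "\<exists>W A t. open W \<and> w \<in> W \<and> A \<in> GLZ \<and> (\<forall>w'\<in>W. \<pi> w' \<in> fst c \<and> snd c (\<pi> w') = A *v w' + t)"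
      unfolding G_def .
  qed (use at contp surjp in auto)
  then show ?thesis using that by blast
qed

context lift_setup
begin

lemma vimage_open: "open V \<Longrightarrow> open (\<pi> -` V)" by (rule open_vimage[OF _ cont])

lemma ex_chart: obtains c where "c \<in> affine_charts \<A>" "\<pi> w \<in> fst c"
  using atlas atlas_subset[OF atlas] unfolding affine_atlas_def by blast

definition is_lin :: "('b, 'n) chart \<Rightarrow> real^'n \<Rightarrow> real^'n^'n \<Rightarrow> bool" where
  "is_lin c w A \<longleftrightarrow> (\<exists>W t. open W \<and> w \<in> W \<and> (\<forall>w'\<in>W. \<pi> w' \<in> fst c \<and> snd c (\<pi> w') = A *v w' + t))"

text \<open>The Jacobian of the chart in the coordinates of the cover. It depends on the point of
  the cover and not only on its image: lifts that differ by a deck transformation see it multiplied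
  by the linear part of that transformation.\<close>

definition lin :: "('b, 'n) chart \<Rightarrow> real^'n \<Rightarrow> real^'n^'n" where
  "lin c w = (THE A. is_lin c w A)"

lemma is_lin_unique: "is_lin c w A \<Longrightarrow> is_lin c w B \<Longrightarrow> A = B"
proof -
  assume "is_lin c w A" "is_lin c w B"
  then obtain V W s t where VW: "open V" "w \<in> V" "\<forall>w'\<in>V. snd c (\<pi> w') = A *v w' + s"
    "open W" "w \<in> W" "\<forall>w'\<in>W. snd c (\<pi> w') = B *v w' + t" unfolding is_lin_def by blast
  have "A *v y + s = B *v y + t" if "y \<in> V \<inter> W" for y using VW that by (metis Int_iff)
  then show "A = B" using affine_eq_on_open(1)[of "V \<inter> W" w A s B t] VW by blast
qed

lemma is_lin_eq: "is_lin c w A \<Longrightarrow> lin c w = A"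
  unfolding lin_def using is_lin_unique by blast

lemma lin_GLZ: "c \<in> affine_charts \<A> \<Longrightarrow> \<pi> w \<in> fst c \<Longrightarrow> lin c w \<in> GLZ"
  using loc is_lin_eq unfolding is_lin_def by metis

lemma lin_local:
  assumes "c \<in> affine_charts \<A>" "\<pi> w \<in> fst c"
  obtains e t where "e > 0" "\<And>w'. w' \<in> ball w e \<Longrightarrow> \<pi> w' \<in> fst c" "\<And>w'. w' \<in> ball w e \<Longrightarrow> lin c w' = lin c w"
    "\<And>w'. w' \<in> ball w e \<Longrightarrow> snd c (\<pi> w') = lin c w *v w' + t"
proof -
  obtain W A t where W: "open W" "w \<in> W" "\<And>w'. w' \<in> W \<Longrightarrow> \<pi> w' \<in> fst c \<and> snd c (\<pi> w') = A *v w' + t"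
    using loc[OF assms] by blast
  then have "is_lin c w' A" if "w' \<in> W" for w' using that unfolding is_lin_def by blast
  then have "lin c w' = A" if "w' \<in> W" for w' using that is_lin_eq by blast
  moreover obtain e where "e > 0" "ball w e \<subseteq> W" using W open_contains_ball by blast
  ultimately show ?thesis using that[of e t] W by (metis subsetD)
qed

abbreviation cinv :: "('b, 'n) chart \<Rightarrow> real^'n \<Rightarrow> real^'n^'n" where "cinv c w \<equiv> matrix_inv (lin c w)"

text \<open>The lift is affine and invertible near w, so inverting it gives a local section of \<pi>
  through w, written in the chart. Functions in chart coordinates are compared with functions on the
  cover along this section.\<close>

lemma local_inverse:
  assumes c: "c \<in> affine_charts \<A>" "\<pi> w \<in> fst c"
  obtains T t where "open T" "snd c (\<pi> w) \<in> T" "T \<subseteq> chart_range c" "w = cinv c w *v (snd c (\<pi> w)) + t"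
    "\<And>y. y \<in> T \<Longrightarrow> chart_inv c y = \<pi> (cinv c w *v y + t) \<and> lin c (cinv c w *v y + t) = lin c w"
proof -
  obtain e t where e: "e > 0" "\<And>w'. w' \<in> ball w e \<Longrightarrow> \<pi> w' \<in> fst c" "\<And>w'. w' \<in> ball w e \<Longrightarrow> lin c w' = lin c w"
    "\<And>w'. w' \<in> ball w e \<Longrightarrow> snd c (\<pi> w') = lin c w *v w' + t" using lin_local[OF c] by metis
  define s where "s = - (cinv c w *v t)"
  define T where "T = (\<lambda>y. cinv c w *v y + s) -` ball w e"
  have "open T" unfolding T_def by (intro open_vimage continuous_intros) auto
  have w: "cinv c w *v (lin c w *v w' + t) + s = w'" for w'
    by (simp add: s_def matrix_vector_right_distrib GLZ_inv_vec[OF lin_GLZ[OF c]])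
  have y: "y = snd c (\<pi> (cinv c w *v y + s))" if "y \<in> T" for y
  proof -
    have "lin c w *v (cinv c w *v y + s) + t = y"
      by (simp add: s_def matrix_vector_mult_diff_distrib GLZ_inv_vec[OF lin_GLZ[OF c]])
    then show ?thesis using that e(4) by (simp add: T_def)
  qed
  show ?thesis
  proof (rule that[of T s])
    show "open T" by fact

    show "T \<subseteq> chart_range c"
    proof
      fix y assume "y \<in> T"
      moreover from this have "\<pi> (cinv c w *v y + s) \<in> fst c" using e(2) by (simp add: T_def)
      ultimately show "y \<in> chart_range c" using y[of y] by blast
    qed
    have "w \<in> ball w e" using e(1) by simp
    then show "w = cinv c w *v (snd c (\<pi> w)) + s" "snd c (\<pi> w) \<in> T"
      using w[of w] e(4) by (simp_all add: T_def)
    fix y assume "y \<in> T"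
    then have "cinv c w *v y + s \<in> ball w e" by (simp add: T_def)
    then show "chart_inv c y = \<pi> (cinv c w *v y + s) \<and> lin c (cinv c w *v y + s) = lin c w"
      using y[OF \<open>y \<in> T\<close>] chart_inv_eq[OF c(1) e(2)] e(3) by metis
  qed
qed

text \<open>Near a point of the image, the local section from \<open>local_inverse\<close> takes its
  values in \<open>W\<close>.\<close>

lemma open_map: assumes "open W" shows "open (\<pi> ` W)"
proof (subst open_subopen, intro ballI)
  fix b assume "b \<in> \<pi> ` W"
  then obtain w where w: "w \<in> W" "b = \<pi> w" by blast
  obtain c where c: "c \<in> affine_charts \<A>" "\<pi> w \<in> fst c" using ex_chart by blast
  obtain T t where T: "open T" "snd c (\<pi> w) \<in> T" "T \<subseteq> chart_range c" "w = cinv c w *v (snd c (\<pi> w)) + t"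
    "\<And>y. y \<in> T \<Longrightarrow> chart_inv c y = \<pi> (cinv c w *v y + t)" using local_inverse[OF c] by metis
  define T' where "T' = T \<inter> (\<lambda>y. cinv c w *v y + t) -` W"
  have "open T'" unfolding T'_def by (intro open_Int T open_vimage assms continuous_intros)
  then have "open (fst c \<inter> snd c -` T')"
    by (rule continuous_open_preimage[OF affine_chartsD(3,1)[OF c(1)]])
  moreover have "b \<in> fst c \<inter> snd c -` T'" using w c T by (auto simp: T'_def)
  moreover have "fst c \<inter> snd c -` T' \<subseteq> \<pi> ` W"
  proof
    fix q assume q: "q \<in> fst c \<inter> snd c -` T'"
    then have "q = chart_inv c (snd c q)" using chart_inv_eq[OF c(1)] by simp
    also have "\<dots> = \<pi> (cinv c w *v snd c q + t)" using q T by (simp add: T'_def)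
    finally show "q \<in> \<pi> ` W" using q by (auto simp: T'_def)
  qed
  ultimately show "\<exists>T. open T \<and> b \<in> T \<and> T \<subseteq> \<pi> ` W" by blast
qed

lemma lin_transition:
  assumes "c \<in> affine_charts \<A>" "\<pi> w \<in> fst c" "d \<in> affine_charts \<A>" "\<pi> w \<in> fst d" "affine_transition (\<pi> w) c d A t"
  shows "lin c w = A ** lin d w"
proof -
  obtain V where V: "open V" "\<pi> w \<in> V" "V \<subseteq> fst c \<inter> fst d" "\<And>q. q \<in> V \<Longrightarrow> snd c q = A *v snd d q + t"
    using assms(5) unfolding affine_transition_def by blast
  obtain e s where e: "e > 0" "\<And>w'. w' \<in> ball w e \<Longrightarrow> snd d (\<pi> w') = lin d w *v w' + s" using lin_local[OF assms(3,4)] by metis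
  have "is_lin c w (A ** lin d w)" unfolding is_lin_def
    using V e vimage_open[OF V(1)]
    by (intro exI[of _ "\<pi> -` V \<inter> ball w e"] exI[of _ "A *v s + t"])
       (auto simp: matrix_vector_right_distrib matrix_vector_mul_assoc)
  then show ?thesis by (rule is_lin_eq)
qed

section \<open>Tangent and cotangent spaces in the coordinates of the cover\<close>

lemma charts_atI: "c \<in> affine_charts \<A> \<Longrightarrow> b \<in> fst c \<Longrightarrow> c \<in> charts_at \<A> b"
  by (simp add: charts_at_def)

lemma charts_atD: "c \<in> charts_at \<A> b \<Longrightarrow> c \<in> affine_charts \<A>" "c \<in> charts_at \<A> b \<Longrightarrow> b \<in> fst c"
  by (simp_all add: charts_at_def)

lemma ex_charts_at: obtains c where "c \<in> charts_at \<A> (\<pi> w)" using ex_chart charts_atI by metis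

text \<open>The flat trivialisation over the cover: y holds the components in the global affine
  coordinates at w. The value 0 at the remaining charts follows the convention of
  \<open>tangent_space\<close>.\<close>

definition tang :: "real^'n \<Rightarrow> real^'n \<Rightarrow> ('b, 'n) vect" where
  "tang w y = (\<lambda>c. if c \<in> charts_at \<A> (\<pi> w) then lin c w *v y else 0)"

text \<open>The inverse transpose makes the pairing with \<open>tang\<close> in any chart equal to
  the standard inner product of the components on the cover.\<close>

definition cotang :: "real^'n \<Rightarrow> real^'n \<Rightarrow> ('b, 'n) vect" where
  "cotang w y = (\<lambda>c. if c \<in> charts_at \<A> (\<pi> w) then transpose (cinv c w) *v y else 0)"

lemma charts_at_lin: "c \<in> charts_at \<A> (\<pi> w) \<Longrightarrow> lin c w \<in> GLZ" using lin_GLZ charts_atD by blast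

lemma transition_exists:
  assumes "c \<in> charts_at \<A> b" "d \<in> charts_at \<A> b"
  obtains A t where "affine_transition b c d A t"
  using affine_charts_compatible[OF atlas charts_atD(1)[OF assms(1)] charts_atD(1)[OF assms(2)]] charts_atD(2) assms by metis

lemma tangent_space_eq: "tangent_space \<A> (\<pi> w) = range (tang w)"
proof (intro set_eqI iffI)
  fix \<xi> assume "\<xi> \<in> range (tang w)"
  then obtain y where y: "\<xi> = tang w y" by blast
  have "\<xi> c = A *v \<xi> d" if "c \<in> charts_at \<A> (\<pi> w)" "d \<in> charts_at \<A> (\<pi> w)" "affine_transition (\<pi> w) c d A t" for c d A t
    using that lin_transition[OF charts_atD[OF that(1)] charts_atD[OF that(2)] that(3)]
    by (simp add: y tang_def matrix_vector_mul_assoc)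
  then show "\<xi> \<in> tangent_space \<A> (\<pi> w)" by (auto simp: tangent_space_def y tang_def)
next
  fix \<xi> assume \<xi>: "\<xi> \<in> tangent_space \<A> (\<pi> w)"
  obtain d where d: "d \<in> charts_at \<A> (\<pi> w)" using ex_charts_at by blast
  have "\<xi> = tang w (cinv d w *v \<xi> d)"
  proof
    fix c show "\<xi> c = tang w (cinv d w *v \<xi> d) c"
    proof (cases "c \<in> charts_at \<A> (\<pi> w)")
      case True
      obtain A t where A: "affine_transition (\<pi> w) c d A t" using transition_exists[OF True d] by blast
      have "\<xi> c = A *v \<xi> d" using \<xi> True d A unfolding tangent_space_def by blast
      also have "\<dots> = A *v (lin d w *v (cinv d w *v \<xi> d))" using GLZ_inv_vec[OF charts_at_lin[OF d]] by simp
      also have "\<dots> = lin c w *v (cinv d w *v \<xi> d)"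
        using lin_transition[OF charts_atD[OF True] charts_atD[OF d] A] by (simp add: matrix_vector_mul_assoc matrix_mul_assoc)
      finally show ?thesis using True by (simp add: tang_def)
    next
      case False
      then have "\<xi> c = 0" using \<xi> unfolding tangent_space_def by blast
      then show ?thesis using False by (simp add: tang_def)
    qed
  qed
  then show "\<xi> \<in> range (tang w)" by blast
qed

lemma tang_chart: "c \<in> charts_at \<A> (\<pi> w) \<Longrightarrow> tang w y c = lin c w *v y" by (simp add: tang_def)

lemma tang_inj: "tang w y = tang w y' \<longleftrightarrow> y = y'"
proof
  assume e: "tang w y = tang w y'"
  obtain d where d: "d \<in> charts_at \<A> (\<pi> w)" using ex_charts_at by blast
  have "lin d w *v y = lin d w *v y'" using e tang_chart[OF d] by metis
  then show "y = y'" using GLZ_inv_vec(2)[OF charts_at_lin[OF d]] by metis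
qed simp

lemma tangent_of_eq:
  assumes "c \<in> charts_at \<A> (\<pi> w)" shows "tangent_of \<A> c (\<pi> w) y = tang w (cinv c w *v y)"
  unfolding tangent_of_def tangent_space_eq
proof (rule the_equality)
  show "tang w (cinv c w *v y) \<in> range (tang w) \<and> tang w (cinv c w *v y) c = y"
    using assms by (simp add: tang_chart GLZ_inv_vec[OF charts_at_lin])
  fix \<xi> assume "\<xi> \<in> range (tang w) \<and> \<xi> c = y"
  then show "\<xi> = tang w (cinv c w *v y)" using assms by (auto simp: tang_chart GLZ_inv_vec[OF charts_at_lin])
qed

lemma cinv_transition:
  assumes c: "c \<in> charts_at \<A> (\<pi> w)" "d \<in> charts_at \<A> (\<pi> w)" and A: "affine_transition (\<pi> w) c d A t"
  shows "cinv c w ** A = cinv d w"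
proof -
  have l: "lin c w = A ** lin d w" by (rule lin_transition[OF charts_atD[OF c(1)] charts_atD[OF c(2)] A])
  have "cinv c w ** A = cinv c w ** A ** (lin d w ** cinv d w)" using GLZ_inv[OF charts_at_lin[OF c(2)]] by simp
  also have "\<dots> = cinv c w ** (A ** lin d w) ** cinv d w" by (simp add: matrix_mul_assoc)
  also have "\<dots> = cinv d w" unfolding l[symmetric] using GLZ_inv[OF charts_at_lin[OF c(1)]] by simp
  finally show ?thesis .
qed

lemma cotang_chart: "c \<in> charts_at \<A> (\<pi> w) \<Longrightarrow> cotang w y c = transpose (cinv c w) *v y" by (simp add: cotang_def)

lemma cotangent_space_eq: "cotangent_space \<A> (\<pi> w) = range (cotang w)"
proof (intro set_eqI iffI)
  fix \<eta> assume "\<eta> \<in> range (cotang w)"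
  then obtain y where y: "\<eta> = cotang w y" by blast
  have "\<eta> d = transpose A *v \<eta> c" if "c \<in> charts_at \<A> (\<pi> w)" "d \<in> charts_at \<A> (\<pi> w)" "affine_transition (\<pi> w) c d A t" for c d A t
    using that cinv_transition[OF that]
    by (simp add: y cotang_def matrix_vector_mul_assoc flip: matrix_transpose_mul)
  then show "\<eta> \<in> cotangent_space \<A> (\<pi> w)" by (auto simp: cotangent_space_def y cotang_def)
next
  fix \<eta> assume \<eta>: "\<eta> \<in> cotangent_space \<A> (\<pi> w)"
  obtain c where c: "c \<in> charts_at \<A> (\<pi> w)" using ex_charts_at by blast
  have "\<eta> = cotang w (transpose (lin c w) *v \<eta> c)"
  proof
    fix d show "\<eta> d = cotang w (transpose (lin c w) *v \<eta> c) d"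
    proof (cases "d \<in> charts_at \<A> (\<pi> w)")
      case True
      obtain A t where A: "affine_transition (\<pi> w) c d A t" using transition_exists[OF c True] by blast
      have "\<eta> d = transpose A *v \<eta> c" using \<eta> True c A unfolding cotangent_space_def by blast
      also have "\<dots> = transpose A *v (transpose (cinv c w) *v (transpose (lin c w) *v \<eta> c))"
        using GLZ_transpose_inv_vec[OF charts_at_lin[OF c]] by simp
      also have "\<dots> = transpose (cinv d w) *v (transpose (lin c w) *v \<eta> c)"
        unfolding cinv_transition[OF c True A, symmetric] by (simp add: matrix_vector_mul_assoc matrix_transpose_mul matrix_mul_assoc)
      finally show ?thesis using True by (simp add: cotang_def)
    next
      case False
      then have "\<eta> d = 0" using \<eta> unfolding cotangent_space_def by blast
      then show ?thesis using False by (simp add: cotang_def)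
    qed
  qed
  then show "\<eta> \<in> range (cotang w)" by blast
qed

lemma cotang_inj: "cotang w y = cotang w y' \<longleftrightarrow> y = y'"
proof
  assume e: "cotang w y = cotang w y'"
  obtain d where d: "d \<in> charts_at \<A> (\<pi> w)" using ex_charts_at by blast
  have "transpose (cinv d w) *v y = transpose (cinv d w) *v y'" using e cotang_chart[OF d] by metis
  then show "y = y'" using GLZ_transpose_inv_vec(1)[OF charts_at_lin[OF d]] by metis
qed simp

lemma cotangent_of_eq:
  assumes "c \<in> charts_at \<A> (\<pi> w)" shows "cotangent_of \<A> c (\<pi> w) y = cotang w (transpose (lin c w) *v y)"
  unfolding cotangent_of_def cotangent_space_eq
proof (rule the_equality)
  show "cotang w (transpose (lin c w) *v y) \<in> range (cotang w) \<and> cotang w (transpose (lin c w) *v y) c = y"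
    using assms by (simp add: cotang_chart GLZ_transpose_inv_vec[OF charts_at_lin])
  fix \<eta> assume "\<eta> \<in> range (cotang w) \<and> \<eta> c = y"
  then show "\<eta> = cotang w (transpose (lin c w) *v y)" using assms by (auto simp: cotang_chart GLZ_transpose_inv_vec[OF charts_at_lin])
qed

lemma tang_add: "tang w (x + y) = tang w x + tang w y"
  by (auto simp: tang_def fun_eq_iff matrix_vector_right_distrib)

lemma tang_scale: "tang w (r *\<^sub>R y) = (\<lambda>c. r *\<^sub>R tang w y c)"
  by (auto simp: tang_def fun_eq_iff matrix_vector_mult_scaleR)

lemma cotang_add: "cotang w (x + y) = cotang w x + cotang w y"
  by (auto simp: cotang_def fun_eq_iff matrix_vector_right_distrib)

lemma tang_0: "tang w y = 0 \<longleftrightarrow> y = 0"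
proof -
  have "tang w 0 = 0" by (auto simp: tang_def fun_eq_iff)
  then show ?thesis by (metis tang_inj)
qed

lemma cotang_0: "cotang w 0 = 0" by (auto simp: cotang_def fun_eq_iff)

lemma tangent_lattice_eq: "tangent_lattice \<A> (\<pi> w) = (\<lambda>k. tang w (int_vec k)) ` UNIV"
proof (intro set_eqI iffI)
  fix l assume "l \<in> tangent_lattice \<A> (\<pi> w)"
  then obtain y where y: "l = tang w y" "\<And>c j. c \<in> charts_at \<A> (\<pi> w) \<Longrightarrow> l c $ j \<in> \<int>"
    unfolding tangent_lattice_def tangent_space_eq by blast
  obtain c where c: "c \<in> charts_at \<A> (\<pi> w)" using ex_charts_at by blast
  have "lin c w *v y \<in> range int_vec" using y c by (simp add: tang_chart flip: integer_vec_iff)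
  then obtain k where "lin c w *v y = int_vec k" by blast
  then have "y = cinv c w *v int_vec k" using GLZ_inv_vec(2)[OF charts_at_lin[OF c]] by metis
  then have "y \<in> range int_vec" using GLZ_int_vec[OF GLZ_inv(1)[OF charts_at_lin[OF c]]] by simp
  then show "l \<in> range (\<lambda>k. tang w (int_vec k))" using y by auto
next
  fix l assume "l \<in> range (\<lambda>k. tang w (int_vec k))"
  then obtain k where k: "l = tang w (int_vec k)" by blast
  have "l c $ j \<in> \<int>" if "c \<in> charts_at \<A> (\<pi> w)" for c j
    using GLZ_int_vec[OF charts_at_lin[OF that], of k] that by (simp add: k tang_chart flip: integer_vec_iff)
  then show "l \<in> tangent_lattice \<A> (\<pi> w)" unfolding tangent_lattice_def tangent_space_eq k by blast
qed

lemma cotangent_lattice_eq: "cotangent_lattice \<A> (\<pi> w) = (\<lambda>k. cotang w (int_vec k)) ` UNIV"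
proof (intro set_eqI iffI)
  fix l assume "l \<in> cotangent_lattice \<A> (\<pi> w)"
  then obtain y where y: "l = cotang w y" "\<And>c j. c \<in> charts_at \<A> (\<pi> w) \<Longrightarrow> l c $ j \<in> \<int>"
    unfolding cotangent_lattice_def cotangent_space_eq by blast
  obtain c where c: "c \<in> charts_at \<A> (\<pi> w)" using ex_charts_at by blast
  have "transpose (cinv c w) *v y \<in> range int_vec" using y c by (simp add: cotang_chart flip: integer_vec_iff)
  then obtain k where "transpose (cinv c w) *v y = int_vec k" by blast
  then have "y = transpose (lin c w) *v int_vec k" using GLZ_transpose_inv_vec(1)[OF charts_at_lin[OF c]] by metis
  then have "y \<in> range int_vec" using GLZ_int_vec[OF GLZ_transpose[OF charts_at_lin[OF c]]] by simp
  then show "l \<in> range (\<lambda>k. cotang w (int_vec k))" using y by auto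
next
  fix l assume "l \<in> range (\<lambda>k. cotang w (int_vec k))"
  then obtain k where k: "l = cotang w (int_vec k)" by blast
  have "l c $ j \<in> \<int>" if "c \<in> charts_at \<A> (\<pi> w)" for c j
    using GLZ_int_vec[OF GLZ_transpose[OF GLZ_inv(1)[OF charts_at_lin[OF that]]], of k] that
    by (simp add: k cotang_chart flip: integer_vec_iff)
  then show "l \<in> cotangent_lattice \<A> (\<pi> w)" unfolding cotangent_lattice_def cotangent_space_eq k by blast
qed

text \<open>Treats tangent and cotangent vectors at once: an additive injection identifies cosets of
  the image lattice with vectors modulo integral vectors.\<close>

lemma coset_eq_iff:
  fixes f :: "real^'n \<Rightarrow> ('b, 'n) vect"
  assumes add: "\<And>x y. f (x + y) = f x + f y" and inj: "\<And>x y. f x = f y \<longleftrightarrow> x = y"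
  shows "(\<lambda>l. f y + l) ` range (\<lambda>k. f (int_vec k)) = (\<lambda>l. f y' + l) ` range (\<lambda>k. f (int_vec k)) \<longleftrightarrow> (\<exists>k. y' = y + int_vec k)"
proof
  assume e: "(\<lambda>l. f y + l) ` range (\<lambda>k. f (int_vec k)) = (\<lambda>l. f y' + l) ` range (\<lambda>k. f (int_vec k))"
  have "f y' + f (int_vec 0) \<in> (\<lambda>l. f y' + l) ` range (\<lambda>k. f (int_vec k))" by blast
  then obtain k where "f y' + f (int_vec 0) = f y + f (int_vec k)" unfolding e[symmetric] by blast
  then have "y' = y + int_vec k" unfolding add[symmetric] inj by simp
  then show "\<exists>k. y' = y + int_vec k" by blast
next
  assume "\<exists>k. y' = y + int_vec k"
  then obtain k where k: "y' = y + int_vec k" by blast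
  have 1: "f y' + f (int_vec l) = f y + f (int_vec (k + l))" for l unfolding add[symmetric] k by (simp add: add.assoc)
  have 2: "f y + f (int_vec l) = f y' + f (int_vec (l - k))" for l unfolding add[symmetric] k by simp
  have "range (\<lambda>k. f y + f (int_vec k)) = range (\<lambda>k. f y' + f (int_vec k))"
  proof (intro set_eqI iffI)
    fix z assume "z \<in> range (\<lambda>k. f y + f (int_vec k))"
    then obtain l where "z = f y + f (int_vec l)" by blast
    then show "z \<in> range (\<lambda>k. f y' + f (int_vec k))" unfolding 2 by blast
  next
    fix z assume "z \<in> range (\<lambda>k. f y' + f (int_vec k))"
    then obtain l where "z = f y' + f (int_vec l)" by blast
    then show "z \<in> range (\<lambda>k. f y + f (int_vec k))" unfolding 1 by blast
  qed
  then show "(\<lambda>l. f y + l) ` range (\<lambda>k. f (int_vec k)) = (\<lambda>l. f y' + l) ` range (\<lambda>k. f (int_vec k))"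
    by (simp only: image_image)
qed

lemma check_point_eq_iff: "check_point \<A> (\<pi> w) (tang w y) = check_point \<A> (\<pi> w) (tang w y') \<longleftrightarrow> (\<exists>k. y' = y + int_vec k)"
  unfolding check_point_def tangent_lattice_eq using coset_eq_iff[OF tang_add tang_inj] by auto

lemma dual_point_eq_iff: "dual_point \<A> (\<pi> w) (cotang w y) = dual_point \<A> (\<pi> w) (cotang w y') \<longleftrightarrow> (\<exists>k. y' = y + int_vec k)"
  unfolding dual_point_def cotangent_lattice_eq using coset_eq_iff[OF cotang_add cotang_inj] by auto

section \<open>The deck group\<close>

definition deck :: "(real^'n \<Rightarrow> real^'n) set" where
  "deck = {\<gamma>. (\<exists>A\<in>GLZ. \<exists>t. \<gamma> = (\<lambda>x. A *v x + t)) \<and> (\<forall>x. \<pi> (\<gamma> x) = \<pi> x)}"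

text \<open>The closedness step for \<open>deck_transitive\<close>: in one chart at z both sides are
  affine near z and agree on a nonempty open set, hence near z; injectivity of the chart gives
  equality of the points.\<close>

lemma affine_agree_extends:
  assumes z: "\<pi> (M *v z + s) = \<pi> z"
    and W: "\<And>e. e > 0 \<Longrightarrow> \<exists>z1. dist z1 z < e \<and> (\<exists>V. open V \<and> z1 \<in> V \<and> (\<forall>y\<in>V. \<pi> (M *v y + s) = \<pi> y))"
  shows "\<exists>W. open W \<and> z \<in> W \<and> (\<forall>y\<in>W. \<pi> (M *v y + s) = \<pi> y)"
proof -
  obtain c where c: "c \<in> affine_charts \<A>" "\<pi> z \<in> fst c" using ex_chart by blast
  have c': "\<pi> (M *v z + s) \<in> fst c" using c z by simp
  obtain e t where e: "e > 0" "\<And>w'. w' \<in> ball z e \<Longrightarrow> \<pi> w' \<in> fst c"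
    "\<And>w'. w' \<in> ball z e \<Longrightarrow> snd c (\<pi> w') = lin c z *v w' + t" using lin_local[OF c] by metis
  obtain e' t' where e': "e' > 0" "\<And>w'. w' \<in> ball (M *v z + s) e' \<Longrightarrow> \<pi> w' \<in> fst c"
    "\<And>w'. w' \<in> ball (M *v z + s) e' \<Longrightarrow> snd c (\<pi> w') = lin c (M *v z + s) *v w' + t'" using lin_local[OF c(1) c'] by metis
  define U where "U = ball z e \<inter> (\<lambda>y. M *v y + s) -` ball (M *v z + s) e'"
  have U: "open U" "z \<in> U" unfolding U_def using e e' by (auto intro!: open_Int open_vimage continuous_intros)
  then obtain r where r: "r > 0" "\<And>y. dist y z < r \<Longrightarrow> y \<in> U" unfolding open_dist by blast
  obtain z1 V where z1: "dist z1 z < r" "open V" "z1 \<in> V" "\<And>y. y \<in> V \<Longrightarrow> \<pi> (M *v y + s) = \<pi> y" using W[OF r(1)] by blast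
  let ?B = "lin c (M *v z + s)"
  have f1: "snd c (\<pi> (M *v y + s)) = (?B ** M) *v y + (?B *v s + t')" if "y \<in> U" for y
    using e'(3)[of "M *v y + s"] that by (simp add: U_def matrix_vector_right_distrib matrix_vector_mul_assoc)
  have f2: "snd c (\<pi> y) = lin c z *v y + t" if "y \<in> U" for y using e(3) that by (simp add: U_def)
  have "?B ** M = lin c z \<and> ?B *v s + t' = t"
  proof -
    have "(?B ** M) *v y + (?B *v s + t') = lin c z *v y + t" if "y \<in> U \<inter> V" for y
      using f1[of y] f2[of y] z1(4)[of y] that by simp
    then show ?thesis
      using affine_eq_on_open[of "U \<inter> V" z1 "?B ** M" "?B *v s + t'" "lin c z" t] U z1 r by blast
  qed
  then have "\<pi> (M *v y + s) = \<pi> y" if "y \<in> U" for y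
    using f1[OF that] f2[OF that] that e(2) e'(2) inj_onD[OF affine_chartsD(2)[OF c(1)]] by (auto simp: U_def)
  then show ?thesis using U by blast
qed

text \<open>The candidate is determined by its germ: in a common chart it must be the local lift at
  w followed by the inverse of the local lift at w'. That it covers the identity everywhere follows
  by connectedness of the cover.\<close>

lemma deck_transitive:
  assumes "\<pi> w = \<pi> w'" obtains \<gamma> where "\<gamma> \<in> deck" "\<gamma> w = w'"
proof -
  obtain c where c: "c \<in> affine_charts \<A>" "\<pi> w \<in> fst c" using ex_chart by blast
  have c': "\<pi> w' \<in> fst c" using c assms by simp
  \<comment> \<open>The linear part forced by the two Jacobians in a common chart; it is integral
    since both of them are.\<close>
  define M where "M = cinv c w' ** lin c w"
  have MG: "M \<in> GLZ" unfolding M_def by (intro GLZ_mult GLZ_inv lin_GLZ c c')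
  define s where "s = w' - M *v w"
  define S where "S = {z. \<exists>W. open W \<and> z \<in> W \<and> (\<forall>y\<in>W. \<pi> (M *v y + s) = \<pi> y)}"
  have "open S" unfolding open_subopen[of S] unfolding S_def by blast
  have "w \<in> S"
  proof -
    obtain e t where e: "e > 0" "\<And>y. y \<in> ball w e \<Longrightarrow> \<pi> y \<in> fst c"
      "\<And>y. y \<in> ball w e \<Longrightarrow> snd c (\<pi> y) = lin c w *v y + t" using lin_local[OF c] by metis
    obtain e' t' where e': "e' > 0" "\<And>y. y \<in> ball w' e' \<Longrightarrow> \<pi> y \<in> fst c"
      "\<And>y. y \<in> ball w' e' \<Longrightarrow> snd c (\<pi> y) = lin c w' *v y + t'" using lin_local[OF c(1) c'] by metis
    define U where "U = ball w e \<inter> (\<lambda>y. M *v y + s) -` ball w' e'"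
    have U: "open U" "w \<in> U" unfolding U_def using e e' by (auto intro!: open_Int open_vimage continuous_intros simp: s_def)
    have eq: "lin c w *v w + t = lin c w' *v w' + t'" using e(3)[of w] e'(3)[of w'] e e' assms by simp
    have "\<pi> (M *v y + s) = \<pi> y" if y: "y \<in> U" for y
    proof -
      have "snd c (\<pi> (M *v y + s)) = lin c w' *v (M *v y + s) + t'" using e'(3) y by (simp add: U_def)
      also have "\<dots> = lin c w *v y - lin c w *v w + (lin c w' *v w' + t')"
        by (simp add: s_def M_def matrix_vector_right_distrib matrix_vector_mult_diff_distrib GLZ_inv_vec[OF lin_GLZ[OF c(1) c']]
            flip: matrix_vector_mul_assoc)
      also have "\<dots> = snd c (\<pi> y)" using e(3) y by (simp add: U_def flip: eq)
      finally show ?thesis using y e(2) e'(2) inj_onD[OF affine_chartsD(2)[OF c(1)]] by (auto simp: U_def)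
    qed
    then show ?thesis using U unfolding S_def by blast
  qed
  have "closed S"
  proof (rule closed_limpt[THEN iffD2], intro allI impI)
    fix z assume z: "z islimpt S"
    have "closed {y. \<pi> (M *v y + s) = \<pi> y}"
      by (intro closed_Collect_eq continuous_on_compose2[OF cont] continuous_intros cont) auto
    moreover have "S \<subseteq> {y. \<pi> (M *v y + s) = \<pi> y}" unfolding S_def by blast
    ultimately have "z \<in> {y. \<pi> (M *v y + s) = \<pi> y}" using z closed_limpt islimpt_subset by blast
    then have pz: "\<pi> (M *v z + s) = \<pi> z" by simp
    have "\<exists>W. open W \<and> z \<in> W \<and> (\<forall>y\<in>W. \<pi> (M *v y + s) = \<pi> y)"
    proof (rule affine_agree_extends[OF pz])
      fix e :: real assume "e > 0"
      then obtain z1 where "z1 \<in> S" "dist z1 z < e" using z unfolding islimpt_approachable by blast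
      then show "\<exists>z1. dist z1 z < e \<and> (\<exists>V. open V \<and> z1 \<in> V \<and> (\<forall>y\<in>V. \<pi> (M *v y + s) = \<pi> y))"
        unfolding S_def by blast
    qed
    then show "z \<in> S" unfolding S_def by blast
  qed
  then have "S = UNIV" using \<open>open S\<close> \<open>w \<in> S\<close> clopen by blast
  then have "\<pi> (M *v y + s) = \<pi> y" for y unfolding S_def by blast
  then have "(\<lambda>y. M *v y + s) \<in> deck" unfolding deck_def using MG by blast
  then show ?thesis using that[of "\<lambda>y. M *v y + s"] by (simp add: s_def)
qed

lemma deckD: assumes "\<gamma> \<in> deck" obtains A t where "A \<in> GLZ" "\<gamma> = (\<lambda>x. A *v x + t)" "\<And>x. \<pi> (\<gamma> x) = \<pi> x"
  using assms unfolding deck_def by blast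

lemma deck_inverse: assumes "\<gamma> \<in> deck" shows "\<exists>\<delta>\<in>deck. \<gamma> \<circ> \<delta> = id \<and> \<delta> \<circ> \<gamma> = id"
proof -
  obtain A t where A: "A \<in> GLZ" "\<gamma> = (\<lambda>x. A *v x + t)" "\<And>x. \<pi> (\<gamma> x) = \<pi> x" using assms by (metis deckD)
  define \<delta> where "\<delta> = (\<lambda>x. matrix_inv A *v x + - (matrix_inv A *v t))"
  have 1: "\<gamma> (\<delta> x) = x" "\<delta> (\<gamma> x) = x" for x
    by (simp_all add: A(2) \<delta>_def matrix_vector_right_distrib matrix_vector_mult_diff_distrib GLZ_inv_vec[OF A(1)])
  have "\<pi> (\<delta> x) = \<pi> x" for x using A(3)[of "\<delta> x"] 1 by simp
  then have "\<delta> \<in> deck" unfolding deck_def using GLZ_inv(1)[OF A(1)] \<delta>_def by blast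
  then show ?thesis using 1 by (auto simp: fun_eq_iff)
qed

text \<open>Images of open balls are open and exhaust the compact base, so finitely many suffice,
  and the largest radius works. Transitivity on fibres turns a lift in that ball into a deck
  translate.\<close>

lemma deck_cocompact:
  assumes "compact (UNIV :: 'b set)" shows "\<exists>r. \<pi> ` cball 0 r = UNIV \<and> (\<forall>x. \<exists>\<gamma>\<in>deck. norm (\<gamma> x) \<le> r)"
proof -
  obtain C where C: "C \<subseteq> (UNIV::nat set)" "finite C" "UNIV \<subseteq> (\<Union>k\<in>C. \<pi> ` ball 0 (real k))"
  proof (rule compactE_image[OF assms, of "UNIV::nat set" "\<lambda>k. \<pi> ` ball 0 (real k)"])
    show "open (\<pi> ` ball 0 (real k))" for k by (intro open_map) simp
    have "b \<in> (\<Union>k. \<pi> ` ball 0 (real k))" for b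
    proof -
      obtain w where w: "b = \<pi> w" using surj by blast
      obtain k where "norm w < real k" using reals_Archimedean2 by blast
      then have "w \<in> ball 0 (real k)" by simp
      then show ?thesis using w by blast
    qed
    then show "UNIV \<subseteq> (\<Union>k. \<pi> ` ball 0 (real k))" by blast
  qed auto
  define r where "r = real (Max (insert 0 C))"
  have r: "\<pi> ` cball 0 r = UNIV"
  proof -
    have "b \<in> \<pi> ` cball 0 r" for b
    proof -
      obtain k w where k: "k \<in> C" "w \<in> ball 0 (real k)" "b = \<pi> w" using C(3) by blast
      have "k \<le> Max (insert 0 C)" using k(1) C(2) by simp
      then have "w \<in> cball 0 r" using k(2) by (simp add: r_def)
      then show ?thesis using k(3) by blast
    qed
    then show ?thesis by blast
  qed
  have "\<exists>\<gamma>\<in>deck. norm (\<gamma> x) \<le> r" for x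
  proof -
    have "\<pi> x \<in> \<pi> ` cball 0 r" using r by simp
    then obtain w where w: "w \<in> cball 0 r" "\<pi> x = \<pi> w" by blast
    obtain \<gamma> where "\<gamma> \<in> deck" "\<gamma> x = w" using deck_transitive[OF w(2)] by blast
    then show ?thesis using w(1) by auto
  qed
  then show ?thesis using r by blast
qed

lemma lin_deck:
  assumes \<gamma>: "\<gamma> = (\<lambda>x. A *v x + t)" "\<And>x. \<pi> (\<gamma> x) = \<pi> x" and c: "c \<in> charts_at \<A> (\<pi> w)"
  shows "lin c w = lin c (\<gamma> w) ** A"
proof -
  have c': "\<pi> (\<gamma> w) \<in> fst c" using charts_atD(2)[OF c] \<gamma>(2) by simp
  obtain e s where e: "e > 0" "\<And>w'. w' \<in> ball (\<gamma> w) e \<Longrightarrow> \<pi> w' \<in> fst c"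
    "\<And>w'. w' \<in> ball (\<gamma> w) e \<Longrightarrow> snd c (\<pi> w') = lin c (\<gamma> w) *v w' + s"
    using lin_local[OF charts_atD(1)[OF c] c'] by metis
  have "open (\<gamma> -` ball (\<gamma> w) e)" unfolding \<gamma>(1) by (intro open_vimage continuous_intros open_ball)
  moreover have "\<pi> w' \<in> fst c \<and> snd c (\<pi> w') = (lin c (\<gamma> w) ** A) *v w' + (lin c (\<gamma> w) *v t + s)"
    if "w' \<in> \<gamma> -` ball (\<gamma> w) e" for w'
  proof -
    have "\<pi> (\<gamma> w') \<in> fst c" "snd c (\<pi> (\<gamma> w')) = lin c (\<gamma> w) *v \<gamma> w' + s" using e that by auto
    moreover have "lin c (\<gamma> w) *v \<gamma> w' = (lin c (\<gamma> w) ** A) *v w' + lin c (\<gamma> w) *v t"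
      unfolding \<gamma>(1) by (simp add: matrix_vector_right_distrib matrix_vector_mul_assoc)
    ultimately show ?thesis using \<gamma>(2)[of w'] by simp
  qed
  ultimately have "is_lin c w (lin c (\<gamma> w) ** A)" unfolding is_lin_def using e(1) by (metis centre_in_ball vimageI)
  then show ?thesis by (rule is_lin_eq)
qed

lemma tang_deck:
  assumes \<gamma>: "\<gamma> = (\<lambda>x. A *v x + t)" "\<And>x. \<pi> (\<gamma> x) = \<pi> x"
  shows "tang (\<gamma> w) (A *v y) = tang w y"
proof
  fix c show "tang (\<gamma> w) (A *v y) c = tang w y c"
  proof (cases "c \<in> charts_at \<A> (\<pi> w)")
    case True
    then show ?thesis using lin_deck[OF \<gamma> True] \<gamma>(2)[of w] by (simp add: tang_def matrix_vector_mul_assoc)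
  qed (use \<gamma>(2)[of w] in \<open>simp add: tang_def\<close>)
qed

lemma cotang_deck:
  assumes A: "A \<in> GLZ" and \<gamma>: "\<gamma> = (\<lambda>x. A *v x + t)" "\<And>x. \<pi> (\<gamma> x) = \<pi> x"
  shows "cotang (\<gamma> w) y = cotang w (transpose A *v y)"
proof
  fix c show "cotang (\<gamma> w) y c = cotang w (transpose A *v y) c"
  proof (cases "c \<in> charts_at \<A> (\<pi> w)")
    case True
    have c': "c \<in> charts_at \<A> (\<pi> (\<gamma> w))" using True \<gamma>(2)[of w] by simp
    have G: "lin c w \<in> GLZ" "lin c (\<gamma> w) \<in> GLZ" using charts_at_lin True c' by auto
    have l: "lin c w = lin c (\<gamma> w) ** A" by (rule lin_deck[OF \<gamma> True])
    have "A ** cinv c w = cinv c (\<gamma> w) ** (lin c (\<gamma> w) ** A) ** cinv c w"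
      using GLZ_inv[OF G(2)] by (simp add: matrix_mul_assoc)
    also have "\<dots> = cinv c (\<gamma> w)" unfolding l[symmetric] using GLZ_inv[OF G(1)] by (simp flip: matrix_mul_assoc)
    finally have "cinv c (\<gamma> w) = A ** cinv c w" by simp
    then show ?thesis using True c' by (simp add: cotang_def matrix_vector_mul_assoc matrix_transpose_mul)
  qed (use \<gamma>(2)[of w] in \<open>simp add: cotang_def\<close>)
qed

end

section \<open>The global potential\<close>

lemma has_derivative_vec:
  fixes f :: "'n::finite \<Rightarrow> 'a::real_normed_vector \<Rightarrow> real"
  assumes "\<And>j. (f j has_derivative f' j) (at x)"
  shows "((\<lambda>x. \<chi> j. f j x) has_derivative (\<lambda>v. \<chi> j. f' j v)) (at x)"
proof (subst has_derivative_componentwise_within, intro ballI)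
  fix b :: "real^'n" assume "b \<in> Basis"
  then obtain j where "b = axis j 1" by (auto simp: Basis_vec_def)
  then show "((\<lambda>x. (\<chi> j. f j x) \<bullet> b) has_derivative (\<lambda>v. (\<chi> j. f' j v) \<bullet> b)) (at x)"
    using assms[of j] by (simp add: inner_axis)
qed

lemma smooth_on_eq: "open S \<Longrightarrow> smooth_on S f \<Longrightarrow> (\<And>x. x \<in> S \<Longrightarrow> g x = f x) \<Longrightarrow> smooth_on S g"
  using smooth_on_cong[of S g f] by simp

text \<open>Two uses of the Poincare lemma: symmetry of the first derivatives of the entries makes
  each row a closed form, whose primitives form a gradient field; symmetry of the matrix makes that
  field closed in turn.\<close>

lemma hessian_potential:
  fixes h :: "'n::finite \<Rightarrow> 'n \<Rightarrow> real^'n \<Rightarrow> real"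
  assumes s: "\<And>j k. smooth_on UNIV (h j k)" and sym: "\<And>j k x. h j k x = h k j x"
    and cl: "\<And>i j k x. partial i (h j k) x = partial j (h i k) x"
  obtains \<Phi> p where "\<And>x. (\<Phi> has_derivative (\<lambda>v. p x \<bullet> v)) (at x)"
    "\<And>x. (p has_derivative (\<lambda>v. (\<chi> j k. h j k x) *v v)) (at x)"
proof -
  have cs: "continuous_on UNIV (\<lambda>x. partial i (h j k) x)" for i j k
    by (intro smooth_on_continuous smooth_on_partial s)
  have dh: "((h j k) has_derivative (\<lambda>v. \<Sum>i\<in>UNIV. v $ i *\<^sub>R partial i (h j k) x)) (at x)" for j k x
    by (rule has_derivative_partial[OF smooth_on_has_derivative[OF s]]) auto
  have "\<exists>P. \<forall>x. (P has_derivative (\<lambda>v. (\<chi> j. h j k x) \<bullet> v)) (at x)" for k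
  proof -
    define a where "a = (\<lambda>x. \<chi> j. h j k x)"
    define A where "A = (\<lambda>x. (\<chi> j i. partial i (h j k) x) :: real^'n^'n)"
    have da: "(a has_derivative (\<lambda>v. A x *v v)) (at x)" for x
    proof -
      have "(a has_derivative (\<lambda>v. \<chi> j. \<Sum>i\<in>UNIV. v $ i *\<^sub>R partial i (h j k) x)) (at x)"
        unfolding a_def by (rule has_derivative_vec) (rule dh)
      moreover have "(\<lambda>v. \<chi> j. \<Sum>i\<in>UNIV. v $ i *\<^sub>R partial i (h j k) x) = (\<lambda>v. A x *v v)"
        by (simp add: fun_eq_iff A_def matrix_vector_mult_def vec_eq_iff mult.commute)
      ultimately show ?thesis by simp
    qed
    have cA: "continuous_on UNIV A" unfolding A_def by (intro continuous_intros cs)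
    have tA: "transpose (A x) = A x" for x using cl by (simp add: A_def transpose_def vec_eq_iff)
    obtain P where "\<And>x. (P has_derivative (\<lambda>v. a x \<bullet> v)) (at x)" by (rule poincare_one_form[OF da cA tA]) blast
    then show ?thesis unfolding a_def by blast
  qed
  then obtain P where P: "\<And>k x. (P k has_derivative (\<lambda>v. (\<chi> j. h j k x) \<bullet> v)) (at x)" by metis
  define p where "p = (\<lambda>x. \<chi> k. P k x)"
  define H where "H = (\<lambda>x. (\<chi> j k. h j k x) :: real^'n^'n)"
  have dp: "(p has_derivative (\<lambda>v. H x *v v)) (at x)" for x
  proof -
    have "(p has_derivative (\<lambda>v. \<chi> k. (\<chi> j. h j k x) \<bullet> v)) (at x)"
      unfolding p_def by (rule has_derivative_vec) (rule P)
    moreover have "(\<lambda>v. \<chi> k. (\<chi> j. h j k x) \<bullet> v) = (\<lambda>v. H x *v v)"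
      using sym by (simp add: fun_eq_iff H_def matrix_vector_mult_def inner_vec_def vec_eq_iff)
    ultimately show ?thesis by simp
  qed
  have cH: "continuous_on UNIV H" unfolding H_def by (intro continuous_intros smooth_on_continuous s)
  have tH: "transpose (H x) = H x" for x using sym by (simp add: H_def transpose_def vec_eq_iff)
  obtain \<Phi> where "\<And>x. (\<Phi> has_derivative (\<lambda>v. p x \<bullet> v)) (at x)" by (rule poincare_one_form[OF dp cH tH]) blast
  then show ?thesis using that dp unfolding H_def by blast
qed

lemma has_derivative_zero_ball:
  fixes f :: "'a::real_normed_vector \<Rightarrow> 'b::real_normed_vector"
  assumes "\<And>x. x \<in> ball w e \<Longrightarrow> (f has_derivative (\<lambda>h. 0)) (at x)"
  obtains c where "\<And>x. x \<in> ball w e \<Longrightarrow> f x = c"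
  using has_derivative_zero_constant[of "ball w e" f] assms by (metis convex_ball has_derivative_at_withinI)

definition second_form :: "(real^'n::finite \<Rightarrow> real) \<Rightarrow> real^'n \<Rightarrow> real^'n \<Rightarrow> real" where
  "second_form f x v = (\<Sum>k\<in>UNIV. \<Sum>j\<in>UNIV. v $ k * v $ j * partial j (partial k f) x)"

lemma frechet_partial: "smooth_on S f \<Longrightarrow> open S \<Longrightarrow> x \<in> S \<Longrightarrow>
    frechet_derivative f (at x) v = (\<Sum>k\<in>UNIV. v $ k *\<^sub>R partial k f x)"
  for f :: "real^'n::finite \<Rightarrow> 'a::real_normed_vector"
  unfolding partial_def
  by (rule linear_axis_expansion[OF has_derivative_linear[OF smooth_on_has_derivative]])

lemma second_form_eq:
  assumes f: "smooth_on S f" and S: "open S" "x \<in> S"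
  shows "frechet_derivative (\<lambda>y. frechet_derivative f (at y) v) (at x) v = second_form f x v"
proof -
  have "frechet_derivative (\<lambda>y. frechet_derivative f (at y) v) (at x)
      = frechet_derivative (\<lambda>y. \<Sum>k\<in>UNIV. v $ k *\<^sub>R partial k f y) (at x)"
    by (rule frechet_derivative_cong_open[OF S]) (rule frechet_partial[OF f S(1)])
  moreover have "((\<lambda>y. \<Sum>k\<in>UNIV. v $ k *\<^sub>R partial k f y) has_derivative
      (\<lambda>u. \<Sum>k\<in>UNIV. v $ k *\<^sub>R (\<Sum>j\<in>UNIV. u $ j *\<^sub>R partial j (partial k f) x))) (at x)"
  proof (intro has_derivative_sum has_derivative_scaleR_right)
    fix k show "(partial k f has_derivative (\<lambda>u. \<Sum>j\<in>UNIV. u $ j *\<^sub>R partial j (partial k f) x)) (at x)"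
      by (rule has_derivative_partial[OF smooth_on_has_derivative[OF smooth_on_partial[OF f] S]])
  qed
  ultimately show ?thesis
    by (simp add: frechet_derivative_at[symmetric] second_form_def sum_distrib_left mult.assoc)
qed

text \<open>An affine substitution has no second derivative, so no first-order term appears and the
  second derivative transforms as a quadratic form.\<close>

lemma second_form_affine:
  fixes L :: "real^'n::finite^'n"
  assumes f: "smooth_on T f" "open T" and S: "open S" "x \<in> S" and m: "\<And>y. y \<in> S \<Longrightarrow> L *v y + c \<in> T"
    and g: "\<And>y. y \<in> S \<Longrightarrow> g y = f (L *v y + c)"
  shows "second_form g x v = second_form f (L *v x + c) (L *v v)"
proof -
  have bl: "bounded_linear (\<lambda>y. L *v y)" by (rule matrix_vector_mul_bounded_linear)
  have sg: "smooth_on S g"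
    by (rule smooth_on_eq[OF S(1) smooth_on_affine_comp[OF bl f(2) S(1) m f(1)] g])
  have da: "((\<lambda>y. L *v y + c) has_derivative (\<lambda>v. L *v v)) (at y)" for y
    using bounded_linear_imp_has_derivative[OF bl] by (auto intro!: derivative_eq_intros)
  have 1: "frechet_derivative g (at y) v = frechet_derivative f (at (L *v y + c)) (L *v v)" if y: "y \<in> S" for y
  proof -
    have "((\<lambda>y. f (L *v y + c)) has_derivative (\<lambda>v. frechet_derivative f (at (L *v y + c)) (L *v v))) (at y)"
      using has_derivative_compose[OF da smooth_on_has_derivative[OF f m[OF y]]] .
    moreover have "frechet_derivative g (at y) = frechet_derivative (\<lambda>y. f (L *v y + c)) (at y)"
      by (rule frechet_derivative_cong_open[OF S(1) y g])
    ultimately show ?thesis by (simp add: frechet_derivative_at[symmetric])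
  qed
  define f2 where "f2 = (\<lambda>z. frechet_derivative f (at z) (L *v v))"
  have sf2: "smooth_on T f2" unfolding f2_def by (rule smooth_on_derivative[OF f(1)])
  have "frechet_derivative (\<lambda>y. frechet_derivative g (at y) v) (at x) = frechet_derivative (\<lambda>y. f2 (L *v y + c)) (at x)"
    by (rule frechet_derivative_cong_open[OF S]) (simp add: 1 f2_def)
  moreover have "((\<lambda>y. f2 (L *v y + c)) has_derivative (\<lambda>v. frechet_derivative f2 (at (L *v x + c)) (L *v v))) (at x)"
    using has_derivative_compose[OF da smooth_on_has_derivative[OF sf2 f(2) m[OF S(2)]]] .
  ultimately have "frechet_derivative (\<lambda>y. frechet_derivative g (at y) v) (at x) v = frechet_derivative f2 (at (L *v x + c)) (L *v v)"
    by (simp add: frechet_derivative_at[symmetric])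
  then show ?thesis unfolding f2_def using second_form_eq[OF sg S] second_form_eq[OF f m[OF S(2)]] by simp
qed

lemma partial_add_affine:
  assumes f: "smooth_on S f" and S: "open S" "x \<in> S" and g: "\<And>y. y \<in> S \<Longrightarrow> g y = f y + m \<bullet> y + a"
  shows "partial k g x = partial k f x + m $ k"
proof -
  have "((\<lambda>y. f y + m \<bullet> y + a) has_derivative (\<lambda>v. frechet_derivative f (at x) v + m \<bullet> v)) (at x)"
    using smooth_on_has_derivative[OF f S] by (auto intro!: derivative_eq_intros)
  from partial_at[OF this, of k] show ?thesis
    using partial_cong_open[OF S, of g "\<lambda>y. f y + m \<bullet> y + a" k] g by (simp add: partial_def inner_axis)
qed

lemma partial2_add_affine:
  assumes f: "smooth_on S f" and S: "open S" "x \<in> S" and g: "\<And>y. y \<in> S \<Longrightarrow> g y = f y + m \<bullet> y + a"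
  shows "partial j (partial k g) x = partial j (partial k f) x"
proof -
  have "partial j (partial k g) x = partial j (partial k f) x + (0::real^'a) $ j"
    by (rule partial_add_affine[OF smooth_on_partial[OF f] S, where a="m $ k"])
       (use partial_add_affine[OF f S(1) _ g] in auto)
  then show ?thesis by simp
qed

locale hessian_lift = lift_setup \<A> \<pi>
  for \<A> :: "('b::t2_space, 'n::finite) chart set" and \<pi> +
  fixes g :: "'b \<Rightarrow> ('b, 'n) vect \<Rightarrow> ('b, 'n) vect \<Rightarrow> real" and \<U> :: "('b, 'n) potential set"
  assumes metric: "riemannian_metric \<A> g" and pots: "integral_potentials \<A> g \<U>"
begin

definition dom :: "('b, 'n) potential \<Rightarrow> 'b set" where "dom u = fst (fst u)"

definition psi :: "('b, 'n) potential \<Rightarrow> real^'n \<Rightarrow> real" where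
  "psi u w = snd u (snd (fst u) (\<pi> w))"

lemma potD:
  assumes "u \<in> \<U>"
  shows "fst u \<in> affine_charts \<A>" "smooth_on (chart_range (fst u)) (snd u)"
    "b \<in> dom u \<Longrightarrow> metric_matrix \<A> g (fst u) b $ j $ k = partial j (partial k (snd u)) (snd (fst u) b)"
proof -
  have "is_potential \<A> g u" using pots assms unfolding integral_potentials_def by blast
  then show "fst u \<in> affine_charts \<A>" "smooth_on (chart_range (fst u)) (snd u)"
    "b \<in> dom u \<Longrightarrow> metric_matrix \<A> g (fst u) b $ j $ k = partial j (partial k (snd u)) (snd (fst u) b)"
    unfolding is_potential_def dom_def by (auto simp: split_beta)
qed

lemma ex_pot: obtains u where "u \<in> \<U>" "\<pi> w \<in> dom u"
  using pots unfolding integral_potentials_def dom_def by blast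

lemma pot_charts_at: "u \<in> \<U> \<Longrightarrow> b \<in> dom u \<Longrightarrow> fst u \<in> charts_at \<A> b"
  using potD(1) by (simp add: charts_at_def dom_def)

abbreviation lu :: "('b, 'n) potential \<Rightarrow> real^'n \<Rightarrow> real^'n^'n" where "lu u \<equiv> lin (fst u)"

lemma psi_local:
  assumes u: "u \<in> \<U>" "\<pi> w \<in> dom u"
  obtains e t where "e > 0" "\<And>w'. w' \<in> ball w e \<Longrightarrow> \<pi> w' \<in> dom u" "\<And>w'. w' \<in> ball w e \<Longrightarrow> lu u w' = lu u w"
    "\<And>w'. w' \<in> ball w e \<Longrightarrow> snd (fst u) (\<pi> w') = lu u w *v w' + t"
    "\<And>w'. w' \<in> ball w e \<Longrightarrow> lu u w *v w' + t \<in> chart_range (fst u)"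
    "\<And>w'. w' \<in> ball w e \<Longrightarrow> psi u w' = snd u (lu u w *v w' + t)" "smooth_on (ball w e) (psi u)"
proof -
  have d: "\<pi> w \<in> fst (fst u)" using u by (simp add: dom_def)
  obtain e t where e: "e > 0" "\<And>w'. w' \<in> ball w e \<Longrightarrow> \<pi> w' \<in> fst (fst u)" "\<And>w'. w' \<in> ball w e \<Longrightarrow> lu u w' = lu u w"
    "\<And>w'. w' \<in> ball w e \<Longrightarrow> snd (fst u) (\<pi> w') = lu u w *v w' + t" using lin_local[OF potD(1)[OF u(1)] d] by metis
  have r: "lu u w *v w' + t \<in> chart_range (fst u)" if "w' \<in> ball w e" for w' using e(2,4)[OF that] by (metis imageI)
  have p: "psi u w' = snd u (lu u w *v w' + t)" if "w' \<in> ball w e" for w' using e(4)[OF that] by (simp add: psi_def)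
  have "smooth_on (ball w e) (\<lambda>w'. snd u (lu u w *v w' + t))"
    by (rule smooth_on_affine_comp[OF matrix_vector_mul_bounded_linear affine_chartsD(4)[OF potD(1)[OF u(1)]] open_ball r potD(2)[OF u(1)]])
  from smooth_on_eq[OF open_ball this p] have s: "smooth_on (ball w e) (psi u)" .
  show ?thesis by (rule that[OF e(1) _ e(3,4) r p s]) (simp add: dom_def e(2))
qed

text \<open>The integral slope given in the chart of v is transported by the transposed linear part
  of that chart. It stays integral because the lift was normalised to have linear parts in
  \<open>GLZ\<close>.\<close>

lemma psi_difference:
  assumes u: "u \<in> \<U>" "\<pi> w \<in> dom u" and v: "v \<in> \<U>" "\<pi> w \<in> dom v"
  obtains W k a where "open W" "w \<in> W" "\<And>w'. w' \<in> W \<Longrightarrow> psi u w' = psi v w' + int_vec k \<bullet> w' + a"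
proof -
  obtain c \<phi> where uc: "u = (c, \<phi>)" by (cases u)
  obtain d \<psi> where vd: "v = (d, \<psi>)" by (cases v)
  have "(case u of (c, \<phi>) \<Rightarrow> case v of (d, \<psi>) \<Rightarrow> fst c \<inter> fst d \<noteq> {} \<longrightarrow>
        (\<exists>m a. (\<forall>j. m $ j \<in> \<int>) \<and> (\<forall>q\<in>fst c \<inter> fst d. \<phi> (snd c q) - \<psi> (snd d q) = m \<bullet> snd d q + a)))"
    using pots u(1) v(1) unfolding integral_potentials_def by blast
  then obtain m a where ma: "\<forall>j. m $ j \<in> \<int>" "\<And>q. q \<in> fst c \<inter> fst d \<Longrightarrow> \<phi> (snd c q) - \<psi> (snd d q) = m \<bullet> snd d q + a"
    using u(2) v(2) by (auto simp: uc vd dom_def)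
  obtain e t where e: "e > 0" "\<And>w'. w' \<in> ball w e \<Longrightarrow> \<pi> w' \<in> dom v" "\<And>w'. w' \<in> ball w e \<Longrightarrow> snd d (\<pi> w') = lu v w *v w' + t"
    using psi_local[OF v] vd by (metis fst_conv)
  obtain e' where e': "e' > 0" "\<And>w'. w' \<in> ball w e' \<Longrightarrow> \<pi> w' \<in> dom u" using psi_local[OF u] by metis
  obtain k0 where k0: "m = int_vec k0" using ma(1) unfolding integer_vec_iff by blast
  have G: "transpose (lu v w) \<in> GLZ" using GLZ_transpose charts_at_lin[OF pot_charts_at[OF v]] by blast
  define k where "k = int_act (transpose (lu v w)) k0"
  have k: "int_vec k \<bullet> y = m \<bullet> (lu v w *v y)" for y
    unfolding k_def int_vec_act[OF G] k0 by (simp add: transpose_matrix_vector dot_lmul_matrix)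
  have "psi u w' = psi v w' + int_vec k \<bullet> w' + (m \<bullet> t + a)" if "w' \<in> ball w e \<inter> ball w e'" for w'
    using ma(2)[of "\<pi> w'"] e(2,3)[of w'] e'(2)[of w'] that
    by (simp add: psi_def uc vd dom_def k inner_add_right)
  then show ?thesis using e(1) e'(1) by (intro that[of "ball w e \<inter> ball w e'" k "m \<bullet> t + a"]) auto
qed

lemma metric_sum:
  assumes "finite J" and z: "\<zeta> \<in> tangent_space \<A> (\<pi> w)"
  shows "g (\<pi> w) (tang w (\<Sum>j\<in>J. a j *\<^sub>R y j)) \<zeta> = (\<Sum>j\<in>J. a j * g (\<pi> w) (tang w (y j)) \<zeta>)"
proof -
  have T: "tang w x \<in> tangent_space \<A> (\<pi> w)" for x unfolding tangent_space_eq by blast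
  have sc: "g (\<pi> w) (tang w (r *\<^sub>R x)) \<zeta> = r * g (\<pi> w) (tang w x) \<zeta>" for r x
    unfolding tang_scale using metric T z unfolding riemannian_metric_def by blast
  have ad: "g (\<pi> w) (tang w (x + y)) \<zeta> = g (\<pi> w) (tang w x) \<zeta> + g (\<pi> w) (tang w y) \<zeta>" for x y
    unfolding tang_add using metric T z unfolding riemannian_metric_def by blast
  show ?thesis using assms(1)
  proof (induction J rule: finite_induct)
    case empty then show ?case using sc[of 0 0] by simp
  next
    case (insert j J) then show ?case by (simp add: ad sc)
  qed
qed

lemma metric_form:
  assumes u: "u \<in> \<U>" "\<pi> w \<in> dom u"
  shows "second_form (snd u) (snd (fst u) (\<pi> w)) v = g (\<pi> w) (tang w (cinv (fst u) w *v v)) (tang w (cinv (fst u) w *v v))"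
proof -
  have T: "tang w x \<in> tangent_space \<A> (\<pi> w)" for x unfolding tangent_space_eq by blast
  have symm: "g (\<pi> w) (tang w x) (tang w y) = g (\<pi> w) (tang w y) (tang w x)" for x y
    using metric T unfolding riemannian_metric_def by blast
  define C where "C = cinv (fst u) w"
  have ex: "C *v v = (\<Sum>k\<in>UNIV. v $ k *\<^sub>R (C *v axis k 1))"
    by (rule linear_axis_expansion) simp
  have "g (\<pi> w) (tang w (C *v v)) (tang w (C *v v)) = (\<Sum>k\<in>UNIV. v $ k * g (\<pi> w) (tang w (C *v axis k 1)) (tang w (C *v v)))"
    by (subst (1) ex) (rule metric_sum[OF finite T])
  also have "\<dots> = (\<Sum>k\<in>UNIV. v $ k * (\<Sum>j\<in>UNIV. v $ j * g (\<pi> w) (tang w (C *v axis j 1)) (tang w (C *v axis k 1))))"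
  proof (intro sum.cong refl arg_cong2[where f="(*)"])
    fix k
    have "g (\<pi> w) (tang w (C *v axis k 1)) (tang w (C *v v)) = g (\<pi> w) (tang w (C *v v)) (tang w (C *v axis k 1))" by (rule symm)
    also have "\<dots> = (\<Sum>j\<in>UNIV. v $ j * g (\<pi> w) (tang w (C *v axis j 1)) (tang w (C *v axis k 1)))"
      by (subst ex) (rule metric_sum[OF finite T])
    finally show "g (\<pi> w) (tang w (C *v axis k 1)) (tang w (C *v v)) = (\<Sum>j\<in>UNIV. v $ j * g (\<pi> w) (tang w (C *v axis j 1)) (tang w (C *v axis k 1)))" .
  qed
  also have "\<dots> = (\<Sum>k\<in>UNIV. \<Sum>j\<in>UNIV. v $ k * v $ j * metric_matrix \<A> g (fst u) (\<pi> w) $ j $ k)"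
    unfolding metric_matrix_def tangent_of_eq[OF pot_charts_at[OF u]] C_def[symmetric]
    by (simp add: sum_distrib_left mult.assoc)
  finally show ?thesis unfolding second_form_def potD(3)[OF u(1) u(2)] C_def by simp
qed

text \<open>The lift is affine in the chart of u, so pulling back the potential turns its Hessian
  into the metric evaluated on \<open>tang w v\<close>; positivity is that of g.\<close>

lemma psi_form_pos:
  assumes u: "u \<in> \<U>" "\<pi> w \<in> dom u" and v: "v \<noteq> 0"
  shows "second_form (psi u) w v > 0" "second_form (psi u) w v = g (\<pi> w) (tang w v) (tang w v)"
proof -
  obtain e t where e: "e > 0" "\<And>w'. w' \<in> ball w e \<Longrightarrow> snd (fst u) (\<pi> w') = lu u w *v w' + t"
    "\<And>w'. w' \<in> ball w e \<Longrightarrow> lu u w *v w' + t \<in> chart_range (fst u)"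
    "\<And>w'. w' \<in> ball w e \<Longrightarrow> psi u w' = snd u (lu u w *v w' + t)" using psi_local[OF u] by metis
  have w: "w \<in> ball w e" using e by simp
  have "second_form (psi u) w v = second_form (snd u) (lu u w *v w + t) (lu u w *v v)"
    by (rule second_form_affine[OF potD(2)[OF u(1)] affine_chartsD(4)[OF potD(1)[OF u(1)]] open_ball w e(3,4)])
  also have "\<dots> = g (\<pi> w) (tang w v) (tang w v)"
    using metric_form[OF u, of "lu u w *v v"] e(2)[OF w] by (simp add: GLZ_inv_vec[OF charts_at_lin[OF pot_charts_at[OF u]]])
  finally show "second_form (psi u) w v = g (\<pi> w) (tang w v) (tang w v)" .
  moreover have "tang w v \<in> tangent_space \<A> (\<pi> w)" unfolding tangent_space_eq by blast
  moreover have "tang w v \<noteq> 0" using v tang_0 by blast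
  ultimately show "second_form (psi u) w v > 0" using metric unfolding riemannian_metric_def by metis
qed

section \<open>The Hessian on the universal cover\<close>

definition pot_at :: "real^'n \<Rightarrow> ('b, 'n) potential" where
  "pot_at w = (SOME u. u \<in> \<U> \<and> \<pi> w \<in> dom u)"

lemma pot_at: "pot_at w \<in> \<U>" "\<pi> w \<in> dom (pot_at w)"
proof -
  have "\<exists>u. u \<in> \<U> \<and> \<pi> w \<in> dom u" using ex_pot by metis
  from someI_ex[OF this] show "pot_at w \<in> \<U>" "\<pi> w \<in> dom (pot_at w)" unfolding pot_at_def by auto
qed

text \<open>The choice \<open>pot_at w\<close> may jump with w. Second derivatives do not notice,
  since local potentials differ by affine functions on the cover
  (\<open>hess_entry_eq\<close>).\<close>

definition hess_entry :: "'n \<Rightarrow> 'n \<Rightarrow> real^'n \<Rightarrow> real" where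
  "hess_entry j k w = partial j (partial k (psi (pot_at w))) w"

lemma hess_entry_eq:
  assumes u: "u \<in> \<U>" "\<pi> w \<in> dom u" shows "hess_entry j k w = partial j (partial k (psi u)) w"
proof -
  obtain W m a where W: "open W" "w \<in> W" "\<And>w'. w' \<in> W \<Longrightarrow> psi (pot_at w) w' = psi u w' + int_vec m \<bullet> w' + a"
    using psi_difference[OF pot_at u] by metis
  obtain e where e: "e > 0" "smooth_on (ball w e) (psi u)" using psi_local[OF u] by metis
  have "partial j (partial k (psi (pot_at w))) w = partial j (partial k (psi u)) w"
    by (rule partial2_add_affine[of "ball w e \<inter> W"]) (use W e in \<open>auto intro: smooth_on_subset\<close>)
  then show ?thesis by (simp add: hess_entry_def)
qed

lemma hess_entry_local:
  obtains u e where "u \<in> \<U>" "e > 0" "smooth_on (ball w e) (psi u)" "\<And>w'. w' \<in> ball w e \<Longrightarrow> \<pi> w' \<in> dom u"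
    "\<And>w' j k. w' \<in> ball w e \<Longrightarrow> hess_entry j k w' = partial j (partial k (psi u)) w'"
proof -
  obtain e where e: "e > 0" "smooth_on (ball w e) (psi (pot_at w))" "\<And>w'. w' \<in> ball w e \<Longrightarrow> \<pi> w' \<in> dom (pot_at w)"
    using psi_local[OF pot_at] by metis
  show ?thesis by (rule that[OF pot_at(1) e]) (use hess_entry_eq[OF pot_at(1)] e(3) in auto)
qed

lemma hess_entry_smooth: "smooth_on UNIV (hess_entry j k)"
proof (rule smooth_on_local)
  fix w
  obtain u e where e: "u \<in> \<U>" "e > 0" "smooth_on (ball w e) (psi u)"
    "\<And>w' j k. w' \<in> ball w e \<Longrightarrow> hess_entry j k w' = partial j (partial k (psi u)) w'" using hess_entry_local[of w] by metis
  have "smooth_on (ball w e) (hess_entry j k)"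
    by (rule smooth_on_eq[OF open_ball smooth_on_partial[OF smooth_on_partial[OF e(3)]] e(4)])
  then show "\<exists>T. open T \<and> w \<in> T \<and> smooth_on T (hess_entry j k)" using e(2) by (intro exI[of _ "ball w e"]) auto
qed simp

lemma hess_entry_sym: "hess_entry j k w = hess_entry k j w"
proof -
  obtain u e where e: "u \<in> \<U>" "e > 0" "smooth_on (ball w e) (psi u)"
    "\<And>w' j k. w' \<in> ball w e \<Longrightarrow> hess_entry j k w' = partial j (partial k (psi u)) w'" using hess_entry_local[of w] by metis
  show ?thesis using e(4)[of w] e(2) mixed_partials_commute[OF e(3) open_ball, of w] by simp
qed

text \<open>Near w the entries are second derivatives of one smooth function, so this is the
  symmetry of third derivatives.\<close>

lemma hess_entry_closed: "partial i (hess_entry j k) w = partial j (hess_entry i k) w"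
proof -
  obtain u e where e: "u \<in> \<U>" "e > 0" "smooth_on (ball w e) (psi u)"
    "\<And>w' j k. w' \<in> ball w e \<Longrightarrow> hess_entry j k w' = partial j (partial k (psi u)) w'" using hess_entry_local[of w] by metis
  have w: "w \<in> ball w e" using e by simp
  have "partial i (hess_entry j k) w = partial i (partial j (partial k (psi u))) w" for i j
    by (rule partial_cong_open[OF open_ball w e(4)])
  then show ?thesis using mixed_partials_commute[OF smooth_on_partial[OF e(3)] open_ball w] by simp
qed

definition hessian :: "real^'n \<Rightarrow> real^'n^'n" where "hessian w = (\<chi> j k. hess_entry j k w)"

lemma hessian_form: "v \<bullet> (hessian w *v v) = second_form (psi (pot_at w)) w v"
  unfolding hessian_def second_form_def hess_entry_def
  by (subst sum.swap) (simp add: inner_vec_def matrix_vector_mult_def sum_distrib_left mult_ac)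

lemma grad_psi_derivative:
  assumes u: "u \<in> \<U>" "\<pi> w \<in> dom u" shows "(grad (psi u) has_derivative (\<lambda>v. hessian w *v v)) (at w)"
proof -
  obtain e where e: "e > 0" "smooth_on (ball w e) (psi u)" using psi_local[OF u] by metis
  have w: "w \<in> ball w e" using e by simp
  have "((\<lambda>w. \<chi> k. partial k (psi u) w) has_derivative (\<lambda>v. \<chi> k. \<Sum>j\<in>UNIV. v $ j *\<^sub>R partial j (partial k (psi u)) w)) (at w)"
    by (rule has_derivative_vec) (rule has_derivative_partial[OF smooth_on_has_derivative[OF smooth_on_partial[OF e(2)] open_ball w]])
  moreover have "(\<chi> k. \<Sum>j\<in>UNIV. v $ j *\<^sub>R partial j (partial k (psi u)) w) = hessian w *v v" for v
    using hess_entry_sym by (simp add: hessian_def matrix_vector_mult_def vec_eq_iff mult.commute flip: hess_entry_eq[OF u])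
  ultimately show ?thesis unfolding grad_def[abs_def] by simp
qed

text \<open>A function \<open>\<Phi>0\<close> with the prescribed Hessian differs from each local
  potential by an affine function whose slope is a priori only real. One linear correction makes the
  slope integral at a single point, and connectedness together with \<open>psi_difference\<close>
  makes it integral everywhere.\<close>

lemma ex_global_potential:
  obtains \<Phi> where "\<And>u w. u \<in> \<U> \<Longrightarrow> \<pi> w \<in> dom u \<Longrightarrow>
    \<exists>W k a. open W \<and> w \<in> W \<and> (\<forall>w'\<in>W. \<pi> w' \<in> dom u \<and> \<Phi> w' = psi u w' + int_vec k \<bullet> w' + a)"
proof -
  obtain \<Phi>0 p where p: "\<And>x. (\<Phi>0 has_derivative (\<lambda>v. p x \<bullet> v)) (at x)" "\<And>x. (p has_derivative (\<lambda>v. hessian x *v v)) (at x)"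
  proof (rule hessian_potential[OF hess_entry_smooth hess_entry_sym hess_entry_closed])
    fix \<Phi> p assume "\<And>x. (\<Phi> has_derivative (\<lambda>v. p x \<bullet> v)) (at x)" "\<And>x. (p has_derivative (\<lambda>v. (\<chi> j k. hess_entry j k x) *v v)) (at x)"
    then show thesis by (intro that[of \<Phi> p]) (auto simp: hessian_def)
  qed
  have real: "\<exists>e q a. e > 0 \<and> (\<forall>w'\<in>ball w e. \<pi> w' \<in> dom u \<and> \<Phi>0 w' = psi u w' + q \<bullet> w' + a)"
    if u: "u \<in> \<U>" "\<pi> w \<in> dom u" for u w
  proof -
    obtain e where e: "e > 0" "smooth_on (ball w e) (psi u)" "\<And>w'. w' \<in> ball w e \<Longrightarrow> \<pi> w' \<in> dom u" using psi_local[OF u] by metis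
    obtain q where q: "\<And>w'. w' \<in> ball w e \<Longrightarrow> p w' - grad (psi u) w' = q"
    proof (rule has_derivative_zero_ball[of w e "\<lambda>w'. p w' - grad (psi u) w'"])
      fix w' assume "w' \<in> ball w e"
      from has_derivative_diff[OF p(2) grad_psi_derivative[OF u(1) e(3)[OF this]]]
      show "((\<lambda>w'. p w' - grad (psi u) w') has_derivative (\<lambda>h. 0)) (at w')" by simp
    qed blast
    obtain a where a: "\<And>w'. w' \<in> ball w e \<Longrightarrow> \<Phi>0 w' - psi u w' - q \<bullet> w' = a"
    proof (rule has_derivative_zero_ball[of w e "\<lambda>w'. \<Phi>0 w' - psi u w' - q \<bullet> w'"])
      fix w' assume w': "w' \<in> ball w e"
      have "((\<lambda>w'. \<Phi>0 w' - psi u w' - q \<bullet> w') has_derivative (\<lambda>v. p w' \<bullet> v - grad (psi u) w' \<bullet> v - q \<bullet> v)) (at w')"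
        by (intro has_derivative_diff p(1) has_derivative_grad[OF e(2) open_ball w'] has_derivative_inner_right has_derivative_ident)
      moreover have "p w' \<bullet> v - grad (psi u) w' \<bullet> v - q \<bullet> v = 0" for v
        unfolding q[OF w', symmetric] by (simp add: inner_diff_left)
      ultimately show "((\<lambda>w'. \<Phi>0 w' - psi u w' - q \<bullet> w') has_derivative (\<lambda>h. 0)) (at w')" by simp
    qed blast
    have "\<Phi>0 w' = psi u w' + q \<bullet> w' + a" if "w' \<in> ball w e" for w' using a[OF that] by simp
    then show ?thesis using e by blast
  qed
  \<comment> \<open>The slope of \<open>\<Phi>0\<close> relative to one local potential at 0.
    Subtracting it makes the relative slope there zero, in particular integral.\<close>
  obtain q0 where q0: "\<exists>e a. e > 0 \<and> (\<forall>w'\<in>ball 0 e. \<Phi>0 w' = psi (pot_at 0) w' + q0 \<bullet> w' + a)"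
    using real[OF pot_at, of 0] by meson
  define \<Phi> where "\<Phi> = (\<lambda>x. \<Phi>0 x - q0 \<bullet> x)"
  have real': "\<exists>W q a. open W \<and> w \<in> W \<and> (\<forall>w'\<in>W. \<pi> w' \<in> dom u \<and> \<Phi> w' = psi u w' + q \<bullet> w' + a)"
    if u: "u \<in> \<U>" "\<pi> w \<in> dom u" for u w
  proof -
    obtain e q a where e: "e > 0" "\<And>w'. w' \<in> ball w e \<Longrightarrow> \<pi> w' \<in> dom u \<and> \<Phi>0 w' = psi u w' + q \<bullet> w' + a" using real[OF u] by blast
    then show ?thesis
      by (intro exI[of _ "ball w e"] exI[of _ "q - q0"] exI[of _ a]) (auto simp: \<Phi>_def inner_diff_left)
  qed
  define I where "I = (\<lambda>u w. \<exists>W k a. open W \<and> w \<in> W \<and> (\<forall>w'\<in>W. \<pi> w' \<in> dom u \<and> \<Phi> w' = psi u w' + int_vec k \<bullet> w' + a))"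
  \<comment> \<open>The slope relative to \<open>u\<close> is constant on \<open>W\<close>. At one
    point \<open>z\<close> it is compared with an integral slope relative to \<open>v\<close>, and
    the slopes of \<open>v\<close> and \<open>u\<close> differ by an integral vector.\<close>
  have spread: "I u w" if u: "u \<in> \<U>" and W: "open W" "w \<in> W" "z \<in> W" "\<And>w'. w' \<in> W \<Longrightarrow> \<pi> w' \<in> dom u \<and> \<Phi> w' = psi u w' + q \<bullet> w' + a"
    and v: "v \<in> \<U>" "I v z" for u v w z W q a
  proof -
    obtain V k b where V: "open V" "z \<in> V" "\<And>w'. w' \<in> V \<Longrightarrow> \<pi> w' \<in> dom v \<and> \<Phi> w' = psi v w' + int_vec k \<bullet> w' + b"
      using v(2) unfolding I_def by blast
    have zd: "\<pi> z \<in> dom u" "\<pi> z \<in> dom v" using W V by blast+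
    obtain U l c where U: "open U" "z \<in> U" "\<And>w'. w' \<in> U \<Longrightarrow> psi v w' = psi u w' + int_vec l \<bullet> w' + c"
      using psi_difference[OF v(1) zd(2) u zd(1)] by metis
    have "q \<bullet> y + a = int_vec (k + l) \<bullet> y + (b + c)" if "y \<in> W \<inter> V \<inter> U" for y
      using W(4)[of y] V(3)[of y] U(3)[of y] that by (auto simp: inner_add_left)
    then have "q = int_vec (k + l)" using real_affine_eq_on_open(1)[of "W \<inter> V \<inter> U" z] W V U by blast
    then show ?thesis unfolding I_def using W by blast
  qed
  define S where "S = {w. \<exists>u\<in>\<U>. I u w}"
  have "open S" unfolding open_subopen[of S]
  proof
    fix w assume "w \<in> S"
    then obtain u W k a where W: "u \<in> \<U>" "open W" "w \<in> W" "\<forall>w'\<in>W. \<pi> w' \<in> dom u \<and> \<Phi> w' = psi u w' + int_vec k \<bullet> w' + a"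
      unfolding S_def I_def by blast
    then have "I u z" if "z \<in> W" for z unfolding I_def using that by blast
    then show "\<exists>T. open T \<and> w \<in> T \<and> T \<subseteq> S" using W unfolding S_def by blast
  qed
  moreover have "closed S"
  proof (rule closed_limpt[THEN iffD2], intro allI impI)
    fix w assume w: "w islimpt S"
    obtain W q a where W: "open W" "w \<in> W" "\<And>w'. w' \<in> W \<Longrightarrow> \<pi> w' \<in> dom (pot_at w) \<and> \<Phi> w' = psi (pot_at w) w' + q \<bullet> w' + a"
      using real'[OF pot_at, of w] by blast
    obtain z where "z \<in> S" "z \<in> W" using w W by (auto simp: islimpt_def)
    then obtain v where "v \<in> \<U>" "I v z" unfolding S_def by blast
    then have "I (pot_at w) w" using spread[OF pot_at(1) W(1,2) \<open>z \<in> W\<close> W(3)] by blast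
    then show "w \<in> S" unfolding S_def using pot_at(1) by blast
  qed
  moreover have "0 \<in> S"
  proof -
    obtain e a where e: "e > 0" "\<And>w'. w' \<in> ball 0 e \<Longrightarrow> \<Phi>0 w' = psi (pot_at 0) w' + q0 \<bullet> w' + a" using q0 by blast
    obtain e' where e': "e' > 0" "\<And>w'. w' \<in> ball 0 e' \<Longrightarrow> \<pi> w' \<in> dom (pot_at 0)" using psi_local[OF pot_at] by metis
    have "I (pot_at 0) 0" unfolding I_def
      by (rule exI[of _ "ball 0 e \<inter> ball 0 e'"], rule exI[of _ 0], rule exI[of _ a]) (use e e' in \<open>auto simp: \<Phi>_def\<close>)
    then show ?thesis unfolding S_def using pot_at(1) by blast
  qed
  ultimately have S: "S = UNIV" using clopen by blast
  show ?thesis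
  proof (rule that[of \<Phi>])
    fix u w assume u: "u \<in> \<U>" "\<pi> w \<in> dom u"
    obtain W q a where W: "open W" "w \<in> W" "\<And>w'. w' \<in> W \<Longrightarrow> \<pi> w' \<in> dom u \<and> \<Phi> w' = psi u w' + q \<bullet> w' + a"
      using real'[OF u] by blast
    obtain v where "v \<in> \<U>" "I v w" using S unfolding S_def by blast
    then have "I u w" using spread[OF u(1) W(1,2,2,3)] by blast
    then show "\<exists>W k a. open W \<and> w \<in> W \<and> (\<forall>w'\<in>W. \<pi> w' \<in> dom u \<and> \<Phi> w' = psi u w' + int_vec k \<bullet> w' + a)"
      unfolding I_def .
  qed
qed

end

section \<open>The path space and Bohr-Sommerfeld fibres in lifted coordinates\<close>

lemma grad_affine_pullback:
  fixes L :: "real^'n::finite^'n"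
  assumes f: "(f has_derivative (\<lambda>v. a \<bullet> v)) (at (L *v x + c))"
  shows "((\<lambda>y. f (L *v y + c)) has_derivative (\<lambda>v. (transpose L *v a) \<bullet> v)) (at x)"
proof -
  have "((\<lambda>y. L *v y + c) has_derivative (\<lambda>v. L *v v)) (at x)"
    using bounded_linear_imp_has_derivative[OF matrix_vector_mul_bounded_linear[of L]] by (auto intro!: derivative_eq_intros)
  from has_derivative_compose[OF this f]
  show ?thesis by (simp add: transpose_matrix_vector dot_lmul_matrix)
qed

lemma finite_int_vec_bounded: "finite {m :: int^'n::finite. norm (int_vec m) \<le> B}"
proof -
  have "{m :: int^'n. norm (int_vec m) \<le> B} \<subseteq> vec_lambda ` (PiE UNIV (\<lambda>_. {- \<lceil>B\<rceil>..\<lceil>B\<rceil>}))"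
  proof
    fix m :: "int^'n" assume "m \<in> {m. norm (int_vec m) \<le> B}"
    then have "\<bar>real_of_int (m $ j)\<bar> \<le> B" for j using component_le_norm_cart[of "int_vec m" j] by simp
    then have "m $ j \<in> {- \<lceil>B\<rceil>..\<lceil>B\<rceil>}" for j
      using le_of_int_ceiling[of B] by (metis abs_le_D1 abs_le_D2 atLeastAtMost_iff le_ceiling_iff minus_le_iff of_int_le_iff of_int_minus order_trans)
    then have "vec_nth m \<in> PiE UNIV (\<lambda>_. {- \<lceil>B\<rceil>..\<lceil>B\<rceil>})" by (auto simp: PiE_def extensional_def)
    then show "m \<in> vec_lambda ` (PiE UNIV (\<lambda>_. {- \<lceil>B\<rceil>..\<lceil>B\<rceil>}))" by (metis image_eqI vec_nth_inverse)
  qed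
  then show ?thesis by (rule finite_subset) (intro finite_imageI finite_PiE, auto)
qed

locale polarized_lift = hessian_lift \<A> \<pi> g \<U>
  for \<A> :: "('b::t2_space, 'n::finite) chart set" and \<pi> g \<U> +
  fixes \<Phi> :: "real^'n \<Rightarrow> real"
  assumes Phi_local: "\<And>u w. u \<in> \<U> \<Longrightarrow> \<pi> w \<in> dom u \<Longrightarrow>
      \<exists>W k a. open W \<and> w \<in> W \<and> (\<forall>w'\<in>W. \<pi> w' \<in> dom u \<and> \<Phi> w' = psi u w' + int_vec k \<bullet> w' + a)"
    and compact_base: "compact (UNIV :: 'b set)"
begin

lemma Phi_local_ball:
  assumes u: "u \<in> \<U>" "\<pi> w \<in> dom u"
  obtains e k a where "e > 0" "\<And>w'. w' \<in> ball w e \<Longrightarrow> \<pi> w' \<in> dom u" "smooth_on (ball w e) (psi u)"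
    "\<And>w'. w' \<in> ball w e \<Longrightarrow> \<Phi> w' = psi u w' + int_vec k \<bullet> w' + a"
    "\<And>w'. w' \<in> ball w e \<Longrightarrow> grad \<Phi> w' = grad (psi u) w' + int_vec k"
proof -
  obtain W k a where W: "open W" "w \<in> W" "\<And>w'. w' \<in> W \<Longrightarrow> \<pi> w' \<in> dom u \<and> \<Phi> w' = psi u w' + int_vec k \<bullet> w' + a"
    using Phi_local[OF u] by metis
  obtain e where e: "e > 0" "smooth_on (ball w e) (psi u)" using psi_local[OF u] by metis
  obtain e' where e': "e' > 0" "ball w e' \<subseteq> W" using W(1,2) open_contains_ball by metis
  define d where "d = min e e'"
  have d: "d > 0" "ball w d \<subseteq> ball w e" "ball w d \<subseteq> W" using e(1) e' by (auto simp: d_def)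
  have s: "smooth_on (ball w d) (psi u)" by (rule smooth_on_subset[OF e(2) d(2)])
  have eq: "\<Phi> w' = psi u w' + int_vec k \<bullet> w' + a" if "w' \<in> ball w d" for w' using W(3) d(3) that by blast
  have gr: "grad \<Phi> w' = grad (psi u) w' + int_vec k" if "w' \<in> ball w d" for w'
    using partial_add_affine[OF s open_ball that eq] by (simp add: grad_def vec_eq_iff)
  show ?thesis by (rule that[OF d(1) _ s eq gr]) (use W(3) d(3) in blast)
qed

lemma Phi_smooth: "smooth_on UNIV \<Phi>"
proof (rule smooth_on_local)
  fix w
  obtain e k a where e: "e > 0" "smooth_on (ball w e) (psi (pot_at w))"
    "\<And>w'. w' \<in> ball w e \<Longrightarrow> \<Phi> w' = psi (pot_at w) w' + int_vec k \<bullet> w' + a" using Phi_local_ball[OF pot_at] by metis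
  have "smooth_on (ball w e) (\<lambda>w'. psi (pot_at w) w' + int_vec k \<bullet> w' + a)"
    by (intro smooth_on_add smooth_on_const smooth_on_bounded_linear e bounded_linear_inner_right) auto
  from smooth_on_eq[OF open_ball this e(3)] show "\<exists>T. open T \<and> w \<in> T \<and> smooth_on T \<Phi>"
    using e(1) by (intro exI[of _ "ball w e"]) auto
qed simp

lemma Phi_grad: "(\<Phi> has_derivative (\<lambda>v. grad \<Phi> w \<bullet> v)) (at w)"
  by (rule has_derivative_grad[OF Phi_smooth]) auto

lemma grad_Phi_derivative: "(grad \<Phi> has_derivative (\<lambda>v. hessian w *v v)) (at w)"
proof -
  obtain e k where e: "e > 0" "\<And>w'. w' \<in> ball w e \<Longrightarrow> grad \<Phi> w' = grad (psi (pot_at w)) w' + int_vec k"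
    using Phi_local_ball[OF pot_at] by metis
  have "((\<lambda>w'. grad (psi (pot_at w)) w' + int_vec k) has_derivative (\<lambda>v. hessian w *v v)) (at w)"
    using grad_psi_derivative[OF pot_at, of w] by (auto intro!: derivative_eq_intros)
  moreover have "((grad \<Phi>) has_derivative (\<lambda>v. hessian w *v v)) (at w) \<longleftrightarrow>
      ((\<lambda>w'. grad (psi (pot_at w)) w' + int_vec k) has_derivative (\<lambda>v. hessian w *v v)) (at w)"
    by (rule has_derivative_cong_open[of "ball w e"]) (use e in auto)
  ultimately show ?thesis by blast
qed

text \<open>\<open>psi\<close> descends to the base, so \<Phi> \<circ> \<gamma> and \<Phi> have the
  same local potential up to affine terms; a locally affine difference on \<real>^n is
  affine.\<close>

lemma Phi_deck:
  assumes \<gamma>: "A \<in> GLZ" "\<gamma> = (\<lambda>x. A *v x + t)" "\<And>x. \<pi> (\<gamma> x) = \<pi> x"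
  obtains m a where "\<And>x. \<Phi> (\<gamma> x) = \<Phi> x + m \<bullet> x + a" "\<And>x. transpose A *v grad \<Phi> (\<gamma> x) = grad \<Phi> x + m"
proof -
  have "\<exists>W m a. open W \<and> x \<in> W \<and> (\<forall>y\<in>W. \<Phi> (\<gamma> y) - \<Phi> y = m \<bullet> y + a)" for x
  proof -
    obtain W k a where W: "open W" "x \<in> W" "\<And>w'. w' \<in> W \<Longrightarrow> \<pi> w' \<in> dom (pot_at x) \<and> \<Phi> w' = psi (pot_at x) w' + int_vec k \<bullet> w' + a"
      using Phi_local[OF pot_at] by metis
    have "\<pi> (\<gamma> x) \<in> dom (pot_at x)" using \<gamma>(3) pot_at by simp
    then obtain V l b where V: "open V" "\<gamma> x \<in> V" "\<And>w'. w' \<in> V \<Longrightarrow> \<pi> w' \<in> dom (pot_at x) \<and> \<Phi> w' = psi (pot_at x) w' + int_vec l \<bullet> w' + b"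
      using Phi_local[OF pot_at(1)] by metis
    have "open (\<gamma> -` V)" unfolding \<gamma>(2) by (intro open_vimage continuous_intros V(1))
    moreover have "\<Phi> (\<gamma> y) - \<Phi> y = (transpose A *v int_vec l - int_vec k) \<bullet> y + (int_vec l \<bullet> t + b - a)" if "y \<in> W \<inter> \<gamma> -` V" for y
    proof -
      have "\<Phi> (\<gamma> y) = psi (pot_at x) (\<gamma> y) + int_vec l \<bullet> \<gamma> y + b" "\<Phi> y = psi (pot_at x) y + int_vec k \<bullet> y + a" using W V that by auto
      moreover have "psi (pot_at x) (\<gamma> y) = psi (pot_at x) y" by (simp add: psi_def \<gamma>(3))
      moreover have "int_vec l \<bullet> \<gamma> y = (transpose A *v int_vec l) \<bullet> y + int_vec l \<bullet> t"
        unfolding \<gamma>(2) by (simp add: inner_add_right transpose_matrix_vector dot_lmul_matrix)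
      ultimately show ?thesis by (simp add: inner_diff_left)
    qed
    ultimately show ?thesis using W(1,2) V(2)
      by (intro exI[of _ "W \<inter> \<gamma> -` V"] exI[of _ "transpose A *v int_vec l - int_vec k"] exI[of _ "int_vec l \<bullet> t + b - a"]) auto
  qed
  then obtain m a where ma: "\<And>y. \<Phi> (\<gamma> y) - \<Phi> y = m \<bullet> y + a" by (rule locally_affine_affine[of "\<lambda>y. \<Phi> (\<gamma> y) - \<Phi> y"]) blast
  have 1: "\<Phi> (\<gamma> x) = \<Phi> x + m \<bullet> x + a" for x using ma[of x] by simp
  have "transpose A *v grad \<Phi> (\<gamma> x) = grad \<Phi> x + m" for x
  proof -
    have "((\<lambda>x. \<Phi> (\<gamma> x)) has_derivative (\<lambda>v. (transpose A *v grad \<Phi> (\<gamma> x)) \<bullet> v)) (at x)"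
      unfolding \<gamma>(2) by (rule grad_affine_pullback[OF Phi_grad])
    moreover have "((\<lambda>x. \<Phi> (\<gamma> x)) has_derivative (\<lambda>v. (grad \<Phi> x + m) \<bullet> v)) (at x)"
      unfolding 1 by (rule derivative_eq_intros Phi_grad refl)+ (simp add: inner_add_left)
    ultimately show ?thesis using grad_at by metis
  qed
  then show ?thesis using that 1 by blast
qed

sublocale cc: cocompact_convex \<Phi> "grad \<Phi>" hessian deck
proof -
  interpret ec: strictly_convex \<Phi> "grad \<Phi>" hessian
  proof
    show "(\<Phi> has_derivative (\<lambda>v. grad \<Phi> x \<bullet> v)) (at x)" for x by (rule Phi_grad)
    show "(grad \<Phi> has_derivative (\<lambda>v. hessian x *v v)) (at x)" for x by (rule grad_Phi_derivative)
    show "continuous_on UNIV hessian" unfolding hessian_def by (intro continuous_intros smooth_on_continuous hess_entry_smooth)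
    show "v \<bullet> (hessian x *v v) > 0" if "v \<noteq> 0" for x v unfolding hessian_form by (rule psi_form_pos(1)[OF pot_at that])
  qed
  show "cocompact_convex \<Phi> (grad \<Phi>) hessian deck"
  proof
    show "\<exists>A t. \<gamma> = (\<lambda>x. A *v x + t)" if "\<gamma> \<in> deck" for \<gamma> using that unfolding deck_def by blast
    show "\<exists>\<delta>\<in>deck. \<gamma> \<circ> \<delta> = id \<and> \<delta> \<circ> \<gamma> = id" if "\<gamma> \<in> deck" for \<gamma> using deck_inverse[OF that] .
    show "\<exists>r. \<forall>x. \<exists>\<gamma>\<in>deck. norm (\<gamma> x) \<le> r" using deck_cocompact[OF compact_base] by blast
    fix \<gamma> x y assume "\<gamma> \<in> deck"
    then obtain A t where \<gamma>: "A \<in> GLZ" "\<gamma> = (\<lambda>x. A *v x + t)" "\<And>x. \<pi> (\<gamma> x) = \<pi> x" by (metis deckD)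
    obtain m a where m: "\<And>x. \<Phi> (\<gamma> x) = \<Phi> x + m \<bullet> x + a" "\<And>x. transpose A *v grad \<Phi> (\<gamma> x) = grad \<Phi> x + m"
      using Phi_deck[OF \<gamma>] by metis
    \<comment> \<open>Moving the linear part of \<gamma> to the other side of the inner product
      replaces the gradient at \<open>\<gamma> x\<close> by \<open>grad \<Phi> x + m\<close>. In the
      divergence the terms with \<open>m\<close> and \<open>a\<close> then cancel.\<close>
    have "grad \<Phi> (\<gamma> x) \<bullet> (\<gamma> y - \<gamma> x) = grad \<Phi> (\<gamma> x) \<bullet> (A *v (y - x))" by (simp add: \<gamma>(2) matrix_vector_mult_diff_distrib)
    also have "\<dots> = (grad \<Phi> x + m) \<bullet> (y - x)"
      unfolding m(2)[symmetric] by (simp add: transpose_matrix_vector dot_lmul_matrix)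
    finally show "ec.breg (\<gamma> y) (\<gamma> x) = ec.breg y x"
      by (simp add: ec.breg_def m(1) inner_add_left inner_diff_right)
  qed
qed

section \<open>Critical points and growth of the sheets\<close>

abbreviation breg :: "real^'n \<Rightarrow> real^'n \<Rightarrow> real" where "breg \<equiv> cc.breg"

text \<open>The indices for which \<Phi>(w) + (m, w) has a critical point; by
  \<open>path_at_constant\<close> they are those whose sheet contains a constant path.\<close>

definition crit :: "int^'n \<Rightarrow> bool" where "crit m \<longleftrightarrow> (\<exists>w. grad \<Phi> w = - int_vec m)"

text \<open>An arbitrary point unless \<open>crit m\<close>.\<close>

definition wmin :: "int^'n \<Rightarrow> real^'n" where "wmin m = (SOME w. grad \<Phi> w = - int_vec m)"

lemma critI: "grad \<Phi> w = - int_vec m \<Longrightarrow> crit m" unfolding crit_def by blast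

lemma grad_wmin: "crit m \<Longrightarrow> grad \<Phi> (wmin m) = - int_vec m"
  unfolding wmin_def crit_def by (rule someI_ex)

lemma wminI: "grad \<Phi> w = - int_vec m \<Longrightarrow> wmin m = w"
  using cc.p_inj grad_wmin critI by metis

lemma breg_wmin: "crit m \<Longrightarrow> breg w (wmin m) = (\<Phi> w + int_vec m \<bullet> w) - (\<Phi> (wmin m) + int_vec m \<bullet> wmin m)"
  by (simp add: cc.breg_def grad_wmin inner_diff_right)

text \<open>Compare w with the point z at distance \<rho> from it in direction -m. The value at z is
  at least the minimum, the linear term drops by \<open>\<rho> * norm (int_vec m)\<close> between w
  and z, and \<Phi> is bounded on K and its \<rho>-neighbourhood. As \<rho> is arbitrary, the growth
  beats every linear rate.\<close>

lemma breg_wmin_lower: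
  assumes K: "compact K" and r: "\<rho> \<ge> 0"
  obtains C where "\<And>w m. w \<in> K \<Longrightarrow> crit m \<Longrightarrow> breg w (wmin m) \<ge> \<rho> * norm (int_vec m) - C"
proof -
  define K' where "K' = (\<lambda>z. fst z + snd z) ` (K \<times> cball (0::real^'n) \<rho>)"
  have "compact K'" unfolding K'_def by (intro compact_continuous_image continuous_intros compact_Times K compact_cball)
  then have "bounded (\<Phi> ` (K \<union> K'))" by (intro compact_imp_bounded compact_continuous_image cc.cont_Phi compact_Un K)
  then obtain B where B: "\<And>w. w \<in> K \<union> K' \<Longrightarrow> \<bar>\<Phi> w\<bar> \<le> B" by (auto simp: bounded_iff)
  have "breg w (wmin m) \<ge> \<rho> * norm (int_vec m) - 2 * B" if w: "w \<in> K" and m: "crit m" for w m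
  proof -
    define z where "z = w + (if m = 0 then 0 else - (\<rho> / norm (int_vec m)) *\<^sub>R int_vec m)"
    have nz: "norm (int_vec m) \<noteq> 0" if "m \<noteq> 0" using that int_vec_inj[of m 0] by simp
    have "z = (\<lambda>z. fst z + snd z) (w, if m = 0 then 0 else - (\<rho> / norm (int_vec m)) *\<^sub>R int_vec m)" by (simp add: z_def)
    moreover have "(w, if m = 0 then 0 else - (\<rho> / norm (int_vec m)) *\<^sub>R int_vec m) \<in> K \<times> cball 0 \<rho>" using w r nz by auto
    ultimately have z: "z \<in> K'" unfolding K'_def by blast
    have "breg z (wmin m) \<ge> 0" by (rule cc.breg_nonneg)
    then have "breg w (wmin m) \<ge> breg w (wmin m) - breg z (wmin m)" by simp
    also have "breg w (wmin m) - breg z (wmin m) = \<Phi> w - \<Phi> z + int_vec m \<bullet> (w - z)"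
      unfolding breg_wmin[OF m] by (simp add: inner_diff_right)
    also have "int_vec m \<bullet> (w - z) = \<rho> * norm (int_vec m)"
      using nz by (auto simp: z_def dot_square_norm power2_eq_square)
    finally show ?thesis using B[of w] B[of z] w z by force
  qed
  then show ?thesis using that by blast
qed

text \<open>
  Sheets of the path space are indexed by the differential of the global potential \<open>\<Phi>\<close>; the index with
  respect to a local potential differs by \<open>shift\<close> and the linear part of the chart.
\<close>

definition path_at :: "int^'n \<Rightarrow> real^'n \<Rightarrow> 'b \<times> ('b, 'n) vect" where
  "path_at m w = (\<pi> w, cotang w (grad \<Phi> w + int_vec m))"

text \<open>Two descriptions of one path differ by a deck transformation, which acts on the indices
  by an affine lattice map and carries the critical point of one function to that of the other. This
  makes functions given sheet by sheet on the cover well defined.\<close>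

lemma path_at_eqD:
  assumes "path_at m w = path_at m' w'"
  obtains A t where "\<And>x. \<pi> (A *v x + t) = \<pi> x" "crit m' \<longleftrightarrow> crit m"
    "crit m \<Longrightarrow> wmin m' = A *v wmin m + t" "crit m \<Longrightarrow> breg w' (wmin m') = breg w (wmin m)"
proof -
  have e: "\<pi> w = \<pi> w'" "cotang w (grad \<Phi> w + int_vec m) = cotang w' (grad \<Phi> w' + int_vec m')" using assms by (auto simp: path_at_def)
  obtain \<gamma> where "\<gamma> \<in> deck" "\<gamma> w = w'" using deck_transitive[OF e(1)] by blast
  then obtain A t where \<gamma>: "A \<in> GLZ" "\<gamma> = (\<lambda>x. A *v x + t)" "\<And>x. \<pi> (\<gamma> x) = \<pi> x" "\<gamma> \<in> deck" "\<gamma> w = w'" by (metis deckD)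
  obtain m0 a where m0: "\<And>x. transpose A *v grad \<Phi> (\<gamma> x) = grad \<Phi> x + m0" using Phi_deck[OF \<gamma>(1-3)] by metis
  have "cotang w (grad \<Phi> w + int_vec m) = cotang w (transpose A *v (grad \<Phi> (\<gamma> w) + int_vec m'))"
    using e(2) cotang_deck[OF \<gamma>(1-3), of w] \<gamma>(5) by simp
  then have "grad \<Phi> w + int_vec m = transpose A *v (grad \<Phi> (\<gamma> w) + int_vec m')" unfolding cotang_inj .
  also have "\<dots> = grad \<Phi> w + m0 + transpose A *v int_vec m'" by (simp add: matrix_vector_right_distrib m0)
  finally have mm: "int_vec m = m0 + transpose A *v int_vec m'" by simp
  have cr: "grad \<Phi> (\<gamma> x) = - int_vec m' \<longleftrightarrow> grad \<Phi> x = - int_vec m" for x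
  proof -
    have e: "transpose A *v (grad \<Phi> (\<gamma> x) + int_vec m') = grad \<Phi> x + int_vec m"
      by (simp add: matrix_vector_right_distrib m0 mm)
    then have e': "grad \<Phi> (\<gamma> x) + int_vec m' = transpose (matrix_inv A) *v (grad \<Phi> x + int_vec m)"
      using GLZ_transpose_inv_vec(2)[OF \<gamma>(1)] by metis
    have "grad \<Phi> (\<gamma> x) + int_vec m' = 0 \<longleftrightarrow> grad \<Phi> x + int_vec m = 0"
      using e e' matrix_vector_mult_0_right by metis
    then show ?thesis unfolding eq_neg_iff_add_eq_0 .
  qed
  have "\<gamma> (matrix_inv A *v (y - t)) = y" for y by (simp add: \<gamma>(2) GLZ_inv_vec[OF \<gamma>(1)])
  then have 0: "crit m' \<longleftrightarrow> crit m" unfolding crit_def using cr by metis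
  have 1: "wmin m' = \<gamma> (wmin m)" if "crit m" using cr grad_wmin[OF that] by (intro wminI) blast
  have 2: "breg w' (wmin m') = breg w (wmin m)" if "crit m"
    unfolding 1[OF that] \<gamma>(5)[symmetric] by (rule cc.equivariant[OF \<gamma>(4)])
  show ?thesis by (rule that[OF _ 0 _ 2]) (use \<gamma> 1 in auto)
qed

definition shift :: "('b, 'n) potential \<Rightarrow> real^'n \<Rightarrow> int^'n" where
  "shift u w = (SOME k. grad \<Phi> w = grad (psi u) w + int_vec k)"

lemma shift:
  assumes u: "u \<in> \<U>" "\<pi> w \<in> dom u" shows "grad \<Phi> w = grad (psi u) w + int_vec (shift u w)"
proof -
  obtain e k where e: "e > 0" "\<And>w'. w' \<in> ball w e \<Longrightarrow> grad \<Phi> w' = grad (psi u) w' + int_vec k"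
    using Phi_local_ball[OF u] by metis
  then have "grad \<Phi> w = grad (psi u) w + int_vec k" by simp
  then show ?thesis unfolding shift_def by (rule someI)
qed

lemma shift_local:
  assumes u: "u \<in> \<U>" "\<pi> w \<in> dom u"
  obtains e a where "e > 0" "\<And>w'. w' \<in> ball w e \<Longrightarrow> \<pi> w' \<in> dom u" "\<And>w'. w' \<in> ball w e \<Longrightarrow> shift u w' = shift u w"
    "\<And>w'. w' \<in> ball w e \<Longrightarrow> \<Phi> w' = psi u w' + int_vec (shift u w) \<bullet> w' + a"
proof -
  obtain e k a where e: "e > 0" "\<And>w'. w' \<in> ball w e \<Longrightarrow> \<pi> w' \<in> dom u"
    "\<And>w'. w' \<in> ball w e \<Longrightarrow> grad \<Phi> w' = grad (psi u) w' + int_vec k"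
    "\<And>w'. w' \<in> ball w e \<Longrightarrow> \<Phi> w' = psi u w' + int_vec k \<bullet> w' + a"
    using Phi_local_ball[OF u] by metis
  have k: "shift u w' = k" if "w' \<in> ball w e" for w'
  proof -
    have "grad (psi u) w' + int_vec k = grad (psi u) w' + int_vec (shift u w')"
      using shift[OF u(1) e(2)[OF that]] e(3)[OF that] by metis
    then show ?thesis unfolding add_left_cancel int_vec_inj ..
  qed
  then have "shift u w = k" using e(1) by simp
  then show ?thesis using that[OF e(1,2)] k e(4) by blast
qed

lemma grad_psi:
  assumes u: "u \<in> \<U>" "\<pi> w \<in> dom u"
  shows "grad (psi u) w = transpose (lu u w) *v grad (snd u) (snd (fst u) (\<pi> w))"
proof -
  obtain e t where e: "e > 0" "\<And>w'. w' \<in> ball w e \<Longrightarrow> snd (fst u) (\<pi> w') = lu u w *v w' + t"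
    "\<And>w'. w' \<in> ball w e \<Longrightarrow> lu u w *v w' + t \<in> chart_range (fst u)"
    "\<And>w'. w' \<in> ball w e \<Longrightarrow> psi u w' = snd u (lu u w *v w' + t)" using psi_local[OF u] by metis
  have w: "w \<in> ball w e" using e by simp
  have "((\<lambda>w'. snd u (lu u w *v w' + t)) has_derivative (\<lambda>v. (transpose (lu u w) *v grad (snd u) (lu u w *v w + t)) \<bullet> v)) (at w)"
    by (rule grad_affine_pullback[OF has_derivative_grad[OF potD(2)[OF u(1)] affine_chartsD(4)[OF potD(1)[OF u(1)]] e(3)[OF w]]])
  then have "(psi u has_derivative (\<lambda>v. (transpose (lu u w) *v grad (snd u) (lu u w *v w + t)) \<bullet> v)) (at w)"
    using has_derivative_cong_open[OF open_ball w, of "psi u" "\<lambda>w'. snd u (lu u w *v w' + t)"] e(4) by blast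
  from grad_at[OF this] show ?thesis using e(2)[OF w] by simp
qed

lemma lu_GLZ: "u \<in> \<U> \<Longrightarrow> \<pi> w \<in> dom u \<Longrightarrow> lu u w \<in> GLZ"
  using charts_at_lin[OF pot_charts_at] .

definition sheet_index :: "('b, 'n) potential \<Rightarrow> real^'n \<Rightarrow> int^'n \<Rightarrow> int^'n" where
  "sheet_index u w m = int_act (transpose (lu u w)) m - shift u w"

lemma bij_sheet_index: assumes "u \<in> \<U>" "\<pi> w \<in> dom u" shows "bij (sheet_index u w)"
proof -
  have "sheet_index u w = (\<lambda>m. m - shift u w) \<circ> int_act (transpose (lu u w))" by (simp add: sheet_index_def fun_eq_iff)
  moreover have "bij (\<lambda>m. m - shift u w)" by (rule o_bij[of "\<lambda>m. m + shift u w"]) (auto simp: fun_eq_iff)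
  ultimately show ?thesis using bij_int_act[OF GLZ_transpose[OF lu_GLZ[OF assms]]] by (simp add: bij_comp)
qed

lemma cotangent_of_sheet:
  assumes u: "u \<in> \<U>" "\<pi> w \<in> dom u"
  shows "(\<pi> w, cotangent_of \<A> (fst u) (\<pi> w) (grad (snd u) (snd (fst u) (\<pi> w)) + int_vec m)) = path_at (sheet_index u w m) w"
  unfolding path_at_def cotangent_of_eq[OF pot_charts_at[OF u]]
  by (simp add: matrix_vector_right_distrib grad_psi[OF u, symmetric] shift[OF u] sheet_index_def int_vec_act[OF GLZ_transpose[OF lu_GLZ[OF u]]])

lemma sheet_eq:
  assumes u: "u \<in> \<U>" "\<pi> w \<in> dom u"
  shows "sheet \<A> f u m (snd (fst u) (\<pi> w)) = f (path_at (sheet_index u w m) w)"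
  unfolding sheet_def cotangent_of_sheet[OF u, symmetric]
  using chart_inv_eq[OF potD(1)[OF u(1)]] u(2) by (simp add: dom_def Let_def)

lemma path_space_eq: "path_space \<A> \<U> = {path_at m w | m w. True}"
proof (intro set_eqI iffI)
  fix P assume "P \<in> path_space \<A> \<U>"
  then obtain b \<eta> where P: "P = (b, \<eta>)" "\<eta> \<in> cotangent_space \<A> b" "dual_point \<A> b \<eta> \<in> L_g \<A> \<U>" unfolding path_space_def by blast
  then obtain b' u where u: "u \<in> \<U>" "b' \<in> dom u" "dual_point \<A> b \<eta> = dual_point \<A> b' (d_pot \<A> u b')"
    unfolding L_g_def dom_def by blast
  then have "b' = b" by (simp add: dual_point_def)
  obtain w where w: "b = \<pi> w" using surj by blast
  obtain y where y: "\<eta> = cotang w y" using P(2) unfolding w cotangent_space_eq by blast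
  have uw: "\<pi> w \<in> dom u" using u(2) \<open>b' = b\<close> w by simp
  have dp: "d_pot \<A> u b' = cotang w (grad \<Phi> w + int_vec (- shift u w))"
    unfolding d_pot_def \<open>b' = b\<close> w cotangent_of_eq[OF pot_charts_at[OF u(1) uw]] grad_psi[OF u(1) uw, symmetric]
    by (simp add: shift[OF u(1) uw])
  have "dual_point \<A> (\<pi> w) (cotang w (grad \<Phi> w + int_vec (- shift u w))) = dual_point \<A> (\<pi> w) (cotang w y)"
    using u(3) unfolding dp unfolding \<open>b' = b\<close> w y by (rule sym)
  then obtain k where "y = grad \<Phi> w + int_vec (- shift u w) + int_vec k" unfolding dual_point_eq_iff by blast
  then have "y = grad \<Phi> w + int_vec (k - shift u w)" by simp
  then have "P = path_at (k - shift u w) w" unfolding P(1) path_at_def w y by simp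
  then show "P \<in> {path_at m w | m w. True}" by blast
next
  fix P assume "P \<in> {path_at m w | m w. True}"
  then obtain m w where P: "P = path_at m w" by blast
  let ?u = "pot_at w"
  have dp: "d_pot \<A> ?u (\<pi> w) = cotang w (grad \<Phi> w + int_vec (- shift ?u w))"
    unfolding d_pot_def cotangent_of_eq[OF pot_charts_at[OF pot_at]] grad_psi[OF pot_at, symmetric]
    by (simp add: shift[OF pot_at])
  have "dual_point \<A> (\<pi> w) (cotang w (grad \<Phi> w + int_vec m)) = dual_point \<A> (\<pi> w) (d_pot \<A> ?u (\<pi> w))"
    unfolding dp dual_point_eq_iff by (rule exI[of _ "- shift ?u w - m"]) simp
  then have "dual_point \<A> (\<pi> w) (cotang w (grad \<Phi> w + int_vec m)) \<in> L_g \<A> \<U>"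
    unfolding L_g_def using pot_at[of w] unfolding dom_def by blast
  moreover have "cotang w (grad \<Phi> w + int_vec m) \<in> cotangent_space \<A> (\<pi> w)" unfolding cotangent_space_eq by blast
  ultimately show "P \<in> path_space \<A> \<U>" unfolding P path_at_def path_space_def by blast
qed

section \<open>The transform in lifted coordinates\<close>

lemma check_point_rep:
  obtains k where "(SOME \<xi>. \<xi> \<in> snd (check_point \<A> (\<pi> w) (tang w y))) = tang w (y + int_vec k)"
proof -
  have "tang w y + tang w (int_vec 0) \<in> snd (check_point \<A> (\<pi> w) (tang w y))"
    unfolding check_point_def tangent_lattice_eq snd_conv by (intro imageI UNIV_I)
  then have "(SOME \<xi>. \<xi> \<in> snd (check_point \<A> (\<pi> w) (tang w y))) \<in> snd (check_point \<A> (\<pi> w) (tang w y))"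
    by (intro someI_ex[of "\<lambda>\<xi>. \<xi> \<in> snd (check_point \<A> (\<pi> w) (tang w y))"]) blast
  then show ?thesis using that unfolding check_point_def tangent_lattice_eq by (auto simp: tang_add)
qed

lemma X_check_eq: "X_check \<A> = {check_point \<A> (\<pi> w) (tang w y) | w y. True}"
proof -
  have "\<exists>w y. q = check_point \<A> (\<pi> w) (tang w y)" if q: "q = check_point \<A> b \<xi>" "\<xi> \<in> tangent_space \<A> b" for q b \<xi>
  proof -
    obtain w where w: "b = \<pi> w" using surj by blast
    obtain y where "\<xi> = tang w y" using q(2) unfolding w tangent_space_eq by blast
    then show ?thesis using q(1) w by blast
  qed
  then show ?thesis unfolding X_check_def using tangent_space_eq by blast
qed

lemma ee_matrix:
  assumes "A \<in> GLZ" shows "ee m (A *v y) = ee (int_act (transpose A) m) y"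
  unfolding ee_def int_vec_act[OF GLZ_transpose[OF assms]] by (simp add: transpose_matrix_vector dot_lmul_matrix)

lemma ee_periodic_GLZ: "A \<in> GLZ \<Longrightarrow> ee m (A *v (y + int_vec k)) = ee m (A *v y)"
  by (simp add: ee_matrix ee_simps)

definition fibre_series :: "('b \<times> ('b, 'n) vect \<Rightarrow> complex) \<Rightarrow> real^'n \<Rightarrow> real^'n \<Rightarrow> complex" where
  "fibre_series f w y = infsum (\<lambda>m. f (path_at m w) * ee m y) UNIV"

text \<open>Renumbering the sheets by \<open>sheet_index\<close> pulls out the factor
  \<open>ee (shift u w) y\<close>. It is the transition between the frame of u and the frame of
  \<Phi>; what remains is one Fourier series for all u.\<close>

lemma SYZ_eq:
  assumes u: "u \<in> \<U>" "\<pi> w \<in> dom u"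
  shows "SYZ \<A> \<U> f (check_point \<A> (\<pi> w) (tang w y)) u = ee (shift u w) y * fibre_series f w y"
proof -
  obtain k where k: "(SOME \<xi>. \<xi> \<in> snd (check_point \<A> (\<pi> w) (tang w y))) = tang w (y + int_vec k)" by (rule check_point_rep)
  have q: "check_point \<A> (\<pi> w) (tang w y) \<in> X_check \<A>" "fst (check_point \<A> (\<pi> w) (tang w y)) = \<pi> w"
    unfolding X_check_eq by (auto simp: check_point_def)
  have "SYZ \<A> \<U> f (check_point \<A> (\<pi> w) (tang w y)) u
      = infsum (\<lambda>m. sheet \<A> f u m (snd (fst u) (\<pi> w)) * ee m (tang w (y + int_vec k) (fst u))) UNIV"
    unfolding SYZ_def k Let_def ee_def q(2) using u q(1) by (simp add: dom_def)
  also have "\<dots> = infsum (\<lambda>m. ee (shift u w) y * (f (path_at (sheet_index u w m) w) * ee (sheet_index u w m) y)) UNIV"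
  proof (rule infsum_cong)
    fix m
    have "ee m (tang w (y + int_vec k) (fst u)) = ee (sheet_index u w m + shift u w) y"
      unfolding tang_chart[OF pot_charts_at[OF u]] ee_matrix[OF lu_GLZ[OF u]]
      by (simp add: sheet_index_def ee_simps(2,5))
    then show "sheet \<A> f u m (snd (fst u) (\<pi> w)) * ee m (tang w (y + int_vec k) (fst u))
      = ee (shift u w) y * (f (path_at (sheet_index u w m) w) * ee (sheet_index u w m) y)"
      by (simp add: sheet_eq[OF u] ee_simps)
  qed
  also have "\<dots> = ee (shift u w) y * infsum (\<lambda>m. f (path_at (sheet_index u w m) w) * ee (sheet_index u w m) y) UNIV"
    by (rule infsum_cmult_right')
  also have "infsum (\<lambda>m. f (path_at (sheet_index u w m) w) * ee (sheet_index u w m) y) UNIV = fibre_series f w y"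
    unfolding fibre_series_def by (rule infsum_reindex_bij_betw[OF bij_sheet_index[OF u], of "\<lambda>m. f (path_at m w) * ee m y"])
  finally show ?thesis .
qed

lemma path_at_constant: "path_at m w = (\<pi> w, 0) \<longleftrightarrow> grad \<Phi> w = - int_vec m"
proof -
  have "path_at m w = (\<pi> w, 0) \<longleftrightarrow> grad \<Phi> w + int_vec m = 0" unfolding path_at_def using cotang_inj[of w _ 0] cotang_0 by auto
  then show ?thesis by (simp add: eq_neg_iff_add_eq_0)
qed

section \<open>Bohr-Sommerfeld fibres\<close>

lemma parallel_frame:
  fixes H :: "real^'n \<Rightarrow> complex"
  assumes s: "smooth_on UNIV H" and d: "\<And>y j. partial j H y + 2 * of_real pi * \<i> * of_real (a $ j) * H y = 0"
  shows "H y = H 0 * exp (- (2 * of_real pi * \<i> * of_real (a \<bullet> y)))"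
proof -
  define G where "G = (\<lambda>y. H y * exp (2 * of_real pi * \<i> * of_real (a \<bullet> y)))"
  have "(G has_derivative (\<lambda>h. 0)) (at y within UNIV)" for y
  proof -
    have dH: "(H has_derivative (\<lambda>v. \<Sum>j\<in>UNIV. v $ j *\<^sub>R partial j H y)) (at y)"
      by (rule has_derivative_partial[OF smooth_on_has_derivative[OF s]]) auto
    have "((\<lambda>y. 2 * of_real pi * \<i> * of_real (a \<bullet> y) :: complex) has_derivative (\<lambda>v. 2 * of_real pi * \<i> * of_real (a \<bullet> v))) (at y)"
      by (rule bounded_linear_imp_has_derivative)
         (intro bounded_linear_const_mult bounded_linear_compose[OF bounded_linear_of_real] bounded_linear_inner_right)
    from has_derivative_compose[OF this DERIV_exp[unfolded has_field_derivative_def]]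
    have dE: "((\<lambda>y. exp (2 * of_real pi * \<i> * of_real (a \<bullet> y) :: complex)) has_derivative
        (\<lambda>v. exp (2 * of_real pi * \<i> * of_real (a \<bullet> y)) * (2 * of_real pi * \<i> * of_real (a \<bullet> v)))) (at y)" .
    have sm: "(\<Sum>j\<in>UNIV. v $ j *\<^sub>R partial j H y) = - (2 * of_real pi * \<i> * of_real (a \<bullet> v)) * H y" for v
    proof -
      have "(\<Sum>j\<in>UNIV. v $ j *\<^sub>R partial j H y) = (\<Sum>j\<in>UNIV. - (2 * of_real pi * \<i> * H y) * of_real (a $ j * v $ j))"
      proof (intro sum.cong refl)
        fix j
        have "partial j H y = - (2 * of_real pi * \<i> * of_real (a $ j) * H y)" using d[of j y] by (simp add: eq_neg_iff_add_eq_0)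
        then show "v $ j *\<^sub>R partial j H y = - (2 * of_real pi * \<i> * H y) * of_real (a $ j * v $ j)"
          by (simp add: scaleR_conv_of_real)
      qed
      also have "\<dots> = - (2 * of_real pi * \<i> * H y) * of_real (a \<bullet> v)"
        unfolding sum_distrib_left[symmetric] of_real_sum[symmetric] by (simp add: inner_vec_def)
      finally show ?thesis by (simp add: mult_ac)
    qed
    show ?thesis unfolding G_def
      using has_derivative_mult[OF dH dE] unfolding sm by (simp add: algebra_simps)
  qed
  then obtain c where "\<And>y. G y = c" using has_derivative_zero_constant[of UNIV G] by auto
  then have "G y = G 0" by simp
  then have "H y * exp (2 * of_real pi * \<i> * of_real (a \<bullet> y)) = H 0" by (simp add: G_def)
  then have "H y * (exp (2 * of_real pi * \<i> * of_real (a \<bullet> y)) * exp (- (2 * of_real pi * \<i> * of_real (a \<bullet> y)))) = H 0 * exp (- (2 * of_real pi * \<i> * of_real (a \<bullet> y)))"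
    by (metis mult.assoc)
  then show ?thesis by (simp flip: exp_add)
qed

lemma ee_partial: "partial j (ee m) y + 2 * of_real pi * \<i> * of_real ((- int_vec m) $ j) * ee m y = 0"
  using partial_at[OF ee_has_derivative, of j m y] by (simp add: inner_axis)

lemma ee_smooth: "smooth_on UNIV (ee m)"
  unfolding ee_def[abs_def]
  by (intro smooth_on_exp smooth_on_bounded_linear)
     (auto intro!: bounded_linear_const_mult bounded_linear_compose[OF bounded_linear_of_real] bounded_linear_inner_right)

text \<open>A parallel frame on the fibre is a multiple of exp (-2 \<pi> i (a, y)) with a the
  differential of the local potential. It is single valued on the torus exactly if a is integral,
  and integrality of a amounts to integrality of the gradient of \<Phi>.\<close>

lemma BS_iff: "Bohr_Sommerfeld \<A> \<U> (\<pi> w) \<longleftrightarrow> (\<exists>m. grad \<Phi> w = - int_vec m)"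
proof
  assume "Bohr_Sommerfeld \<A> \<U> (\<pi> w)"
  then obtain u h where u: "u \<in> \<U>" "\<pi> w \<in> dom u" and
    h: "smooth_on UNIV (\<lambda>y. h (check_point \<A> (\<pi> w) (tangent_of \<A> (fst u) (\<pi> w) y)))"
    "\<And>y. h (check_point \<A> (\<pi> w) (tangent_of \<A> (fst u) (\<pi> w) y)) \<noteq> (0::complex)"
    "\<And>y j. partial j (\<lambda>y. h (check_point \<A> (\<pi> w) (tangent_of \<A> (fst u) (\<pi> w) y))) y +
        2 * of_real pi * \<i> * of_real (partial j (snd u) (snd (fst u) (\<pi> w))) * h (check_point \<A> (\<pi> w) (tangent_of \<A> (fst u) (\<pi> w) y)) = 0"
    unfolding Bohr_Sommerfeld_def dom_def Let_def by blast
  define H where "H = (\<lambda>y. h (check_point \<A> (\<pi> w) (tangent_of \<A> (fst u) (\<pi> w) y)))"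
  define a where "a = grad (snd u) (snd (fst u) (\<pi> w))"
  have H: "H y = H 0 * exp (- (2 * of_real pi * \<i> * of_real (a \<bullet> y)))" for y
    by (rule parallel_frame) (use h in \<open>auto simp: H_def a_def grad_def\<close>)
  have "a $ j \<in> \<int>" for j
  proof -
    \<comment> \<open>A coordinate vector is a lattice vector in every affine chart, so both
      arguments name the same point of the fibre.\<close>
    have "H (axis j 1) = H 0"
    proof -
      have "axis j 1 = int_vec (axis j 1 :: int^'n)" by (auto simp: int_vec_def axis_def vec_eq_iff)
      moreover have "int_vec (int_act (cinv (fst u) w) (axis j 1)) = cinv (fst u) w *v int_vec (axis j 1)"
        by (rule int_vec_act[OF GLZ_inv(1)[OF lu_GLZ[OF u]]])
      ultimately have "cinv (fst u) w *v axis j 1 = 0 + int_vec (int_act (cinv (fst u) w) (axis j 1))" by simp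
      then have "check_point \<A> (\<pi> w) (tang w 0) = check_point \<A> (\<pi> w) (tang w (cinv (fst u) w *v axis j 1))"
        unfolding check_point_eq_iff by blast
      then show ?thesis unfolding H_def tangent_of_eq[OF pot_charts_at[OF u]] by simp
    qed
    then have "exp (- (2 * of_real pi * \<i> * of_real (a $ j))) = (1::complex)"
      using H[of "axis j 1"] h(2)[of 0] by (simp add: inner_axis H_def)
    then have "exp (2 * of_real pi * \<i> * of_real (a $ j)) = (1::complex)" by (simp add: exp_minus)
    then obtain n :: int where "2 * pi * (a $ j) = of_int (2 * n) * pi" by (auto simp: exp_eq_1)
    then have "a $ j = of_int n" by simp
    then show ?thesis by simp
  qed
  then obtain k where k: "a = int_vec k" using integer_vec_iff[of a] by blast
  have "grad \<Phi> w = int_vec (int_act (transpose (lu u w)) k + shift u w)"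
    by (simp add: shift[OF u] grad_psi[OF u] a_def[symmetric] k int_vec_act[OF GLZ_transpose[OF lu_GLZ[OF u]]])
  then have "grad \<Phi> w = - int_vec (- (int_act (transpose (lu u w)) k + shift u w))" by simp
  then show "\<exists>m. grad \<Phi> w = - int_vec m" by blast
next
  assume "\<exists>m. grad \<Phi> w = - int_vec m"
  then obtain m where m: "grad \<Phi> w = - int_vec m" by blast
  let ?u = "pot_at w"
  note G = lu_GLZ[OF pot_at[of w]]
  define a where "a = int_act (transpose (cinv (fst ?u) w)) (- m - shift ?u w)"
  have "transpose (lu ?u w) *v grad (snd ?u) (snd (fst ?u) (\<pi> w)) = int_vec (- m - shift ?u w)"
    using shift[OF pot_at[of w]] m unfolding grad_psi[OF pot_at[of w]] by simp
  then have a: "grad (snd ?u) (snd (fst ?u) (\<pi> w)) = int_vec a"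
    unfolding a_def int_vec_act[OF GLZ_transpose[OF GLZ_inv(1)[OF G]]] using GLZ_transpose_inv_vec(2)[OF G] by metis
  \<comment> \<open>The frame is evaluated on an arbitrary representative of the coset; the
    character \<open>ee (- a)\<close> does not depend on the choice.\<close>
  define h :: "('b, 'n) torus_point \<Rightarrow> complex" where "h = (\<lambda>q. ee (- a) ((SOME \<xi>. \<xi> \<in> snd q) (fst ?u)))"
  have H: "h (check_point \<A> (\<pi> w) (tangent_of \<A> (fst ?u) (\<pi> w) y)) = ee (- a) y" for y
  proof -
    obtain k where k: "(SOME \<xi>. \<xi> \<in> snd (check_point \<A> (\<pi> w) (tang w (cinv (fst ?u) w *v y)))) = tang w (cinv (fst ?u) w *v y + int_vec k)"
      by (rule check_point_rep)
    show ?thesis unfolding h_def tangent_of_eq[OF pot_charts_at[OF pot_at]] k tang_chart[OF pot_charts_at[OF pot_at]]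
      ee_periodic_GLZ[OF G] GLZ_inv_vec[OF G] ..
  qed
  have pa: "partial j (snd ?u) (snd (fst ?u) (\<pi> w)) = (- int_vec (- a)) $ j" for j
    using a by (simp add: grad_def vec_eq_iff)
  show "Bohr_Sommerfeld \<A> \<U> (\<pi> w)"
    unfolding Bohr_Sommerfeld_def Let_def
  proof (rule bexI[OF _ pot_at(1)], intro conjI exI[of _ h] allI)
    show "\<pi> w \<in> fst (fst ?u)" using pot_at(2) by (simp add: dom_def)
    show "partial j (\<lambda>y. h (check_point \<A> (\<pi> w) (tangent_of \<A> (fst ?u) (\<pi> w) y))) y +
       2 * of_real pi * \<i> * of_real (partial j (snd ?u) (snd (fst ?u) (\<pi> w))) * h (check_point \<A> (\<pi> w) (tangent_of \<A> (fst ?u) (\<pi> w) y)) = 0" for y j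
      unfolding H pa using ee_partial[of j "- a" y] by (simp add: eta_contract_eq)
  qed (auto simp: H ee_simps ee_smooth eta_contract_eq)
qed

text \<open>On a ball that maps onto the base the gradient is bounded, so it takes only finitely
  many integral values, and each value determines its point.\<close>

lemma finite_BS: "finite {b. Bohr_Sommerfeld \<A> \<U> b}"
proof -
  obtain r where r: "\<pi> ` cball 0 r = UNIV" using deck_cocompact[OF compact_base] by blast
  have "bounded (grad \<Phi> ` cball 0 r)" by (intro compact_imp_bounded compact_continuous_image cc.cont_p compact_cball)
  then obtain B where "\<forall>x\<in>grad \<Phi> ` cball 0 r. norm x \<le> B" unfolding bounded_iff by blast
  then have B: "\<And>w. w \<in> cball 0 r \<Longrightarrow> norm (grad \<Phi> w) \<le> B" by blast
  define M where "M = {m :: int^'n. norm (int_vec m) \<le> B}"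
  have "finite M" unfolding M_def by (rule finite_int_vec_bounded)
  moreover have "{b. Bohr_Sommerfeld \<A> \<U> b} \<subseteq> (\<lambda>m. \<pi> (wmin m)) ` M"
  proof
    fix b assume b: "b \<in> {b. Bohr_Sommerfeld \<A> \<U> b}"
    obtain w where w: "w \<in> cball 0 r" "b = \<pi> w" using r by blast
    then obtain m where m: "grad \<Phi> w = - int_vec m" using b BS_iff by blast
    then have "norm (int_vec m) \<le> B" using B[OF w(1)] by simp
    then show "b \<in> (\<lambda>m. \<pi> (wmin m)) ` M" using wminI[OF m] w(2) unfolding M_def by blast
  qed
  ultimately show ?thesis by (meson finite_imageI finite_subset)
qed

end

section \<open>Tensor norms\<close>

text \<open>Iterated partial derivatives apply the last index of the list first, so tensors are
  peeled off from the right.\<close>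

lemma partials_snoc: "partials (J @ [j]) f = partials J (partial j f)"
  by (simp add: partials_def)

lemma sum_lists_snoc:
  fixes h :: "'n::finite list \<Rightarrow> 'a::comm_monoid_add"
  shows "(\<Sum>J | length J = Suc l. h J) = (\<Sum>J | length J = l. \<Sum>j\<in>UNIV. h (J @ [j]))"
proof -
  have "(\<Sum>J | length J = Suc l. h J) = (\<Sum>(J, j)\<in>{J. length J = l} \<times> UNIV. h (J @ [j]))"
  proof (rule sum.reindex_bij_witness[of _ "\<lambda>(J, j). J @ [j]" "\<lambda>J. (butlast J, last J)"])
    fix J :: "'n list" assume "J \<in> {J. length J = Suc l}"
    then have "butlast J @ [last J] = J" by (intro append_butlast_last_id) auto
    then show "(case (butlast J, last J) of (J, j) \<Rightarrow> J @ [j]) = J"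
      "(case (butlast J, last J) of (J, j) \<Rightarrow> h (J @ [j])) = h J" by simp_all
  qed auto
  then show ?thesis by (simp add: sum.cartesian_product)
qed

text \<open>The Hermitian form behind \<open>tensor_norm\<close> for arrays of iterated derivatives,
  contracted one pair of indices at a time. It takes two functions because the recursion
  differentiates the two slots in different directions.\<close>

fun tensor_form :: "real^'n::finite^'n \<Rightarrow> nat \<Rightarrow> (real^'n \<Rightarrow> complex) \<Rightarrow> (real^'n \<Rightarrow> complex) \<Rightarrow> real^'n \<Rightarrow> complex" where
  "tensor_form G 0 p q x = p x * cnj (q x)"
| "tensor_form G (Suc l) p q x =
     (\<Sum>j\<in>UNIV. \<Sum>k\<in>UNIV. of_real (G $ j $ k) * tensor_form G l (partial j p) (partial k q) x)"

lemma tensor_form_eq: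
  "(\<Sum>J | length J = l. \<Sum>K | length K = l. of_real (\<Prod>i<l. G $ (J ! i) $ (K ! i)) * partials J p x * cnj (partials K q x))
     = tensor_form G l p q x"
proof (induction l arbitrary: p q)
  case 0
  show ?case by (simp add: partials_def)
next
  case (Suc l)
  define Y where "Y J j K k = of_real (\<Prod>i<Suc l. G $ ((J @ [j]) ! i) $ ((K @ [k]) ! i)) * partials (J @ [j]) p x * cnj (partials (K @ [k]) q x)" for J j K k
  have Y: "Y J j K k = of_real (G $ j $ k) * (of_real (\<Prod>i<l. G $ (J ! i) $ (K ! i)) * partials J (partial j p) x * cnj (partials K (partial k q) x))"
    if "length J = l" "length K = l" for J j K k
  proof -
    have "(\<Prod>i<Suc l. G $ ((J @ [j]) ! i) $ ((K @ [k]) ! i)) = (\<Prod>i<l. G $ (J ! i) $ (K ! i)) * G $ j $ k"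
      using that by (simp add: nth_append)
    then show ?thesis by (simp add: Y_def partials_snoc)
  qed
  have "(\<Sum>J | length J = Suc l. \<Sum>K | length K = Suc l. of_real (\<Prod>i<Suc l. G $ (J ! i) $ (K ! i)) * partials J p x * cnj (partials K q x))
      = (\<Sum>J | length J = l. \<Sum>j\<in>UNIV. \<Sum>K | length K = l. \<Sum>k\<in>UNIV. Y J j K k)"
    unfolding sum_lists_snoc Y_def ..
  also have "\<dots> = (\<Sum>J | length J = l. \<Sum>j\<in>UNIV. \<Sum>k\<in>UNIV. \<Sum>K | length K = l. Y J j K k)"
    by (intro sum.cong refl sum.swap)
  also have "\<dots> = (\<Sum>j\<in>UNIV. \<Sum>J | length J = l. \<Sum>k\<in>UNIV. \<Sum>K | length K = l. Y J j K k)" by (rule sum.swap)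
  also have "\<dots> = (\<Sum>j\<in>UNIV. \<Sum>k\<in>UNIV. \<Sum>J | length J = l. \<Sum>K | length K = l. Y J j K k)"
    by (intro sum.cong refl sum.swap)
  also have "\<dots> = tensor_form G (Suc l) p q x"
    unfolding tensor_form.simps Suc.IH[symmetric] sum_distrib_left
    by (intro sum.cong refl) (simp add: Y)
  finally show ?case .
qed

lemma tensor_norm_eq: "tensor_norm G l (\<lambda>J. partials J f x) = sqrt (Re (tensor_form G l f f x))"
  unfolding tensor_norm_def tensor_form_eq ..

lemma tensor_form_cong:
  assumes "open S" "x \<in> S" "\<And>y. y \<in> S \<Longrightarrow> p y = p' y" "\<And>y. y \<in> S \<Longrightarrow> q y = q' y"
  shows "tensor_form G l p q x = tensor_form G l p' q' x"
  using assms(3,4)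
proof (induction l arbitrary: p q p' q')
  case 0
  then show ?case using assms(2) by simp
next
  case (Suc l)
  have "tensor_form G l (partial j p) (partial k q) x = tensor_form G l (partial j p') (partial k q') x" for j k
    by (rule Suc.IH) (use Suc.prems partial_cong_open[OF assms(1)] in blast)+
  then show ?case by simp
qed

lemma sum_swap4:
  "(\<Sum>j\<in>J. \<Sum>k\<in>K. \<Sum>a\<in>A. \<Sum>b\<in>B. f j k a b) = (\<Sum>a\<in>A. \<Sum>b\<in>B. \<Sum>j\<in>J. \<Sum>k\<in>K. f j k a b)"
proof -
  have "(\<Sum>j\<in>J. \<Sum>k\<in>K. \<Sum>a\<in>A. \<Sum>b\<in>B. f j k a b) = (\<Sum>j\<in>J. \<Sum>a\<in>A. \<Sum>k\<in>K. \<Sum>b\<in>B. f j k a b)"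
    by (intro sum.cong refl sum.swap)
  also have "\<dots> = (\<Sum>a\<in>A. \<Sum>j\<in>J. \<Sum>k\<in>K. \<Sum>b\<in>B. f j k a b)" by (rule sum.swap)
  also have "\<dots> = (\<Sum>a\<in>A. \<Sum>j\<in>J. \<Sum>b\<in>B. \<Sum>k\<in>K. f j k a b)" by (intro sum.cong refl sum.swap)
  also have "\<dots> = (\<Sum>a\<in>A. \<Sum>b\<in>B. \<Sum>j\<in>J. \<Sum>k\<in>K. f j k a b)" by (intro sum.cong refl sum.swap)
  finally show ?thesis .
qed

lemma partial_lincomb:
  fixes p :: "'i \<Rightarrow> real^'n::finite \<Rightarrow> complex"
  assumes "finite A" "\<And>a. a \<in> A \<Longrightarrow> smooth_on UNIV (p a)"
  shows "partial j (\<lambda>y. \<Sum>a\<in>A. c a * p a y) = (\<lambda>y. \<Sum>a\<in>A. c a * partial j (p a) y)"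
proof
  fix y
  have "((\<lambda>y. \<Sum>a\<in>A. c a * p a y) has_derivative (\<lambda>v. \<Sum>a\<in>A. c a * frechet_derivative (p a) (at y) v)) (at y)"
    by (intro has_derivative_sum has_derivative_mult_right smooth_on_has_derivative[OF assms(2)]) auto
  from partial_at[OF this] show "partial j (\<lambda>y. \<Sum>a\<in>A. c a * p a y) y = (\<Sum>a\<in>A. c a * partial j (p a) y)"
    by (simp add: partial_def)
qed

lemma tensor_form_lincomb:
  fixes p :: "'i \<Rightarrow> real^'n::finite \<Rightarrow> complex" and q :: "'k \<Rightarrow> real^'n \<Rightarrow> complex"
  assumes "finite A" "finite B" "\<And>a. a \<in> A \<Longrightarrow> smooth_on UNIV (p a)" "\<And>b. b \<in> B \<Longrightarrow> smooth_on UNIV (q b)"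
  shows "tensor_form G l (\<lambda>y. \<Sum>a\<in>A. of_real (c a) * p a y) (\<lambda>y. \<Sum>b\<in>B. of_real (d b) * q b y) x
    = (\<Sum>a\<in>A. \<Sum>b\<in>B. of_real (c a * d b) * tensor_form G l (p a) (q b) x)"
  using assms(3,4)
proof (induction l arbitrary: p q)
  case 0
  show ?case by (simp add: sum_product mult_ac)
next
  case (Suc l)
  have "tensor_form G (Suc l) (\<lambda>y. \<Sum>a\<in>A. of_real (c a) * p a y) (\<lambda>y. \<Sum>b\<in>B. of_real (d b) * q b y) x
    = (\<Sum>j\<in>UNIV. \<Sum>k\<in>UNIV. of_real (G $ j $ k) *
        (\<Sum>a\<in>A. \<Sum>b\<in>B. of_real (c a * d b) * tensor_form G l (partial j (p a)) (partial k (q b)) x))"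
  proof -
    have p: "partial j (\<lambda>y. \<Sum>a\<in>A. of_real (c a) * p a y) = (\<lambda>y. \<Sum>a\<in>A. of_real (c a) * partial j (p a) y)" for j
      by (rule partial_lincomb) (use assms Suc.prems in auto)
    have q: "partial k (\<lambda>y. \<Sum>b\<in>B. of_real (d b) * q b y) = (\<lambda>y. \<Sum>b\<in>B. of_real (d b) * partial k (q b) y)" for k
      by (rule partial_lincomb) (use assms Suc.prems in auto)
    show ?thesis unfolding tensor_form.simps p q
      by (intro sum.cong refl arg_cong2[where f="(*)"] Suc.IH smooth_on_partial Suc.prems)
  qed
  also have "\<dots> = (\<Sum>j\<in>UNIV. \<Sum>k\<in>UNIV. \<Sum>a\<in>A. \<Sum>b\<in>B. of_real (c a * d b) *
        (of_real (G $ j $ k) * tensor_form G l (partial j (p a)) (partial k (q b)) x))"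
    unfolding sum_distrib_left by (intro sum.cong refl) (rule mult.left_commute)
  also have "\<dots> = (\<Sum>a\<in>A. \<Sum>b\<in>B. \<Sum>j\<in>UNIV. \<Sum>k\<in>UNIV. of_real (c a * d b) *
        (of_real (G $ j $ k) * tensor_form G l (partial j (p a)) (partial k (q b)) x))" by (rule sum_swap4)
  finally show ?case by (simp add: sum_distrib_left)
qed

lemma partial_affine:
  fixes C :: "real^'n::finite^'n" and p :: "real^'n \<Rightarrow> complex"
  assumes "smooth_on UNIV p"
  shows "partial j (\<lambda>y. p (C *v y + t)) = (\<lambda>y. \<Sum>a\<in>UNIV. of_real (C $ a $ j) * partial a p (C *v y + t))"
proof
  fix y
  have "((\<lambda>y. C *v y + t) has_derivative (\<lambda>v. C *v v)) (at y)"
    using bounded_linear_imp_has_derivative[OF matrix_vector_mul_bounded_linear[of C]] by (auto intro!: derivative_eq_intros)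
  from has_derivative_compose[OF this has_derivative_partial[OF smooth_on_has_derivative[OF assms open_UNIV UNIV_I]]]
  show "partial j (\<lambda>y. p (C *v y + t)) y = (\<Sum>a\<in>UNIV. of_real (C $ a $ j) * partial a p (C *v y + t))"
    by (subst partial_at) (assumption, simp add: matrix_vector_mult_basis column_def scaleR_conv_of_real)
qed

lemma smooth_affine:
  fixes C :: "real^'n::finite^'n"
  shows "smooth_on UNIV p \<Longrightarrow> smooth_on UNIV (\<lambda>y. p (C *v y + t))"
  by (rule smooth_on_affine_comp[OF matrix_vector_mul_bounded_linear open_UNIV open_UNIV]) auto

text \<open>By the chain rule each contraction receives one factor of C on either side, so the
  inverse metric changes to C G C^T. This carries norms from chart coordinates to the cover.\<close>

lemma tensor_form_affine:
  fixes C :: "real^'n::finite^'n"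
  assumes "smooth_on UNIV p" "smooth_on UNIV q"
  shows "tensor_form G l (\<lambda>y. p (C *v y + t)) (\<lambda>y. q (C *v y + t)) x = tensor_form (C ** G ** transpose C) l p q (C *v x + t)"
  using assms
proof (induction l arbitrary: p q)
  case 0
  show ?case by simp
next
  case (Suc l)
  note s = smooth_on_partial[OF Suc.prems(1)] smooth_on_partial[OF Suc.prems(2)]
  let ?T = "\<lambda>a b. tensor_form (C ** G ** transpose C) l (partial a p) (partial b q) (C *v x + t)"
  have "tensor_form G (Suc l) (\<lambda>y. p (C *v y + t)) (\<lambda>y. q (C *v y + t)) x
    = (\<Sum>j\<in>UNIV. \<Sum>k\<in>UNIV. of_real (G $ j $ k) * (\<Sum>a\<in>UNIV. \<Sum>b\<in>UNIV. of_real (C $ a $ j * C $ b $ k) * ?T a b))"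
  proof -
    have "tensor_form G l (\<lambda>y. \<Sum>a\<in>UNIV. of_real (C $ a $ j) * partial a p (C *v y + t))
        (\<lambda>y. \<Sum>b\<in>UNIV. of_real (C $ b $ k) * partial b q (C *v y + t)) x
      = (\<Sum>a\<in>UNIV. \<Sum>b\<in>UNIV. of_real (C $ a $ j * C $ b $ k) *
          tensor_form G l (\<lambda>y. partial a p (C *v y + t)) (\<lambda>y. partial b q (C *v y + t)) x)" for j k
      by (rule tensor_form_lincomb) (rule finite smooth_affine s)+
    then show ?thesis
      unfolding tensor_form.simps partial_affine[OF Suc.prems(1)] partial_affine[OF Suc.prems(2)] Suc.IH[OF s] by simp
  qed
  also have "\<dots> = (\<Sum>j\<in>UNIV. \<Sum>k\<in>UNIV. \<Sum>a\<in>UNIV. \<Sum>b\<in>UNIV. of_real (C $ a $ j * G $ j $ k * C $ b $ k) * ?T a b)"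
    unfolding sum_distrib_left by (intro sum.cong refl) (simp add: mult_ac del: tensor_form.simps)
  also have "\<dots> = (\<Sum>a\<in>UNIV. \<Sum>b\<in>UNIV. \<Sum>j\<in>UNIV. \<Sum>k\<in>UNIV. of_real (C $ a $ j * G $ j $ k * C $ b $ k) * ?T a b)"
    by (rule sum_swap4)
  also have "\<dots> = (\<Sum>a\<in>UNIV. \<Sum>b\<in>UNIV. of_real ((C ** G ** transpose C) $ a $ b) * ?T a b)"
  proof (intro sum.cong refl)
    fix a b
    have "(C ** G ** transpose C) $ a $ b = (\<Sum>k\<in>UNIV. \<Sum>j\<in>UNIV. C $ a $ j * G $ j $ k * C $ b $ k)"
      by (simp add: matrix_matrix_mult_def transpose_def sum_distrib_right)
    also have "\<dots> = (\<Sum>j\<in>UNIV. \<Sum>k\<in>UNIV. C $ a $ j * G $ j $ k * C $ b $ k)" by (rule sum.swap)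
    finally show "(\<Sum>j\<in>UNIV. \<Sum>k\<in>UNIV. of_real (C $ a $ j * G $ j $ k * C $ b $ k) * ?T a b) = of_real ((C ** G ** transpose C) $ a $ b) * ?T a b"
      by (simp add: sum_distrib_right)
  qed
  finally show ?case by simp
qed

section \<open>Polynomial growth in the sheet\<close>

text \<open>Constants and degrees are hidden on purpose: any polynomial in the index m will be
  absorbed by exponential decay.\<close>

definition poly_le :: "(real^'n) set \<Rightarrow> (int^'n::finite \<Rightarrow> real^'n \<Rightarrow> real) \<Rightarrow> (int^'n \<Rightarrow> real^'n \<Rightarrow> real) \<Rightarrow> bool" where
  "poly_le K x y \<longleftrightarrow> (\<exists>C\<ge>0. \<exists>N. \<forall>m. \<forall>w\<in>K. x m w \<le> C * (1 + norm (int_vec m)) ^ N * y m w)"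

lemma poly_leI: "C \<ge> 0 \<Longrightarrow> (\<And>m w. w \<in> K \<Longrightarrow> x m w \<le> C * (1 + norm (int_vec m)) ^ N * y m w) \<Longrightarrow> poly_le K x y"
  unfolding poly_le_def by blast

lemma poly_le_mono: "poly_le K x y \<Longrightarrow> (\<And>m w. w \<in> K \<Longrightarrow> x' m w \<le> x m w) \<Longrightarrow> poly_le K x' y"
  unfolding poly_le_def by (meson order_trans)

lemma poly_le_add:
  fixes K :: "(real^'n::finite) set"
  assumes "poly_le K x y" "poly_le K x' y" "\<And>m w. w \<in> K \<Longrightarrow> y m w \<ge> 0"
  shows "poly_le K (\<lambda>m w. x m w + x' m w) y"
proof -
  obtain C N where C: "C \<ge> 0" "\<And>m w. w \<in> K \<Longrightarrow> x m w \<le> C * (1 + norm (int_vec m)) ^ N * y m w"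
    using assms(1) unfolding poly_le_def by blast
  obtain C' N' where C': "C' \<ge> 0" "\<And>m w. w \<in> K \<Longrightarrow> x' m w \<le> C' * (1 + norm (int_vec m)) ^ N' * y m w"
    using assms(2) unfolding poly_le_def by blast
  show ?thesis
  proof (rule poly_leI[where N="N + N'"])
    show "C + C' \<ge> 0" using C(1) C'(1) by simp
    fix m :: "int^'n" and w assume w: "w \<in> K"
    let ?r = "1 + norm (int_vec m)"
    have "?r ^ N \<le> ?r ^ (N + N')" "?r ^ N' \<le> ?r ^ (N + N')" by (intro power_increasing; simp)+
    then have "C * ?r ^ N * y m w \<le> C * ?r ^ (N + N') * y m w" "C' * ?r ^ N' * y m w \<le> C' * ?r ^ (N + N') * y m w"
      by (intro mult_right_mono mult_left_mono C C' assms(3) w; simp)+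
    then show "x m w + x' m w \<le> (C + C') * ?r ^ (N + N') * y m w"
      using C(2)[OF w, of m] C'(2)[OF w, of m] by (simp add: distrib_right)
  qed
qed

lemma poly_le_sum:
  assumes "finite I" "\<And>i. i \<in> I \<Longrightarrow> poly_le K (x i) y" "\<And>m w. w \<in> K \<Longrightarrow> y m w \<ge> 0"
  shows "poly_le K (\<lambda>m w. \<Sum>i\<in>I. x i m w) y"
  using assms(1,2)
proof (induction I)
  case empty
  show ?case by (rule poly_leI[of 0]) auto
next
  case (insert i I)
  have "poly_le K (\<lambda>m w. x i m w + (\<Sum>i\<in>I. x i m w)) y"
    by (rule poly_le_add[OF _ _ assms(3)]) (use insert in auto)
  then show ?case using insert by simp
qed

lemma poly_le_mult:
  fixes K :: "(real^'n::finite) set"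
  assumes "poly_le K x y" "poly_le K x' y'" "\<And>m w. w \<in> K \<Longrightarrow> y m w \<ge> 0" "\<And>m w. w \<in> K \<Longrightarrow> x' m w \<ge> 0"
  shows "poly_le K (\<lambda>m w. x m w * x' m w) (\<lambda>m w. y m w * y' m w)"
proof -
  obtain C N where C: "C \<ge> 0" "\<And>m w. w \<in> K \<Longrightarrow> x m w \<le> C * (1 + norm (int_vec m)) ^ N * y m w"
    using assms(1) unfolding poly_le_def by blast
  obtain C' N' where C': "C' \<ge> 0" "\<And>m w. w \<in> K \<Longrightarrow> x' m w \<le> C' * (1 + norm (int_vec m)) ^ N' * y' m w"
    using assms(2) unfolding poly_le_def by blast
  show ?thesis
  proof (rule poly_leI[where N="N + N'"])
    show "C * C' \<ge> 0" using C(1) C'(1) by simp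
    fix m :: "int^'n" and w assume w: "w \<in> K"
    have "x m w * x' m w \<le> (C * (1 + norm (int_vec m)) ^ N * y m w) * (C' * (1 + norm (int_vec m)) ^ N' * y' m w)"
      by (intro mult_mono C(2) C'(2) w mult_nonneg_nonneg C(1) assms(3,4)) auto
    then show "x m w * x' m w \<le> C * C' * (1 + norm (int_vec m)) ^ (N + N') * (y m w * y' m w)"
      by (simp add: power_add mult_ac)
  qed
qed

text \<open>The prefactors that arise when exp (-2 \<pi> (\<Phi>(w) + (m, w))) is differentiated in
  w: generated by smooth functions of w and the coordinates of m, hence closed under derivatives and
  of polynomial growth in m.\<close>

inductive pol :: "(int^'n::finite \<Rightarrow> real^'n \<Rightarrow> complex) \<Rightarrow> bool" where
  pol_smooth: "smooth_on UNIV f \<Longrightarrow> pol (\<lambda>m. f)"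
| pol_coord: "pol (\<lambda>m w. of_int (m $ j))"
| pol_add: "pol q \<Longrightarrow> pol r \<Longrightarrow> pol (\<lambda>m w. q m w + r m w)"
| pol_mult: "pol q \<Longrightarrow> pol r \<Longrightarrow> pol (\<lambda>m w. q m w * r m w)"

lemma smooth_on_pol: "pol q \<Longrightarrow> smooth_on UNIV (q m)"
  by (induction arbitrary: m rule: pol.induct) (auto intro: smooth_on_const smooth_on_add smooth_on_mult)

lemma partial_mult:
  fixes f h :: "real^'n::finite \<Rightarrow> complex"
  assumes "smooth_on UNIV f" "smooth_on UNIV h"
  shows "partial j (\<lambda>w. f w * h w) = (\<lambda>w. f w * partial j h w + partial j f w * h w)"
  using partial_at[OF has_derivative_mult[OF smooth_on_has_derivative[OF assms(1)] smooth_on_has_derivative[OF assms(2)]]]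
  by (auto simp: partial_def fun_eq_iff)

lemma partial_add:
  fixes f h :: "real^'n::finite \<Rightarrow> complex"
  assumes "smooth_on UNIV f" "smooth_on UNIV h"
  shows "partial j (\<lambda>w. f w + h w) = (\<lambda>w. partial j f w + partial j h w)"
  using partial_at[OF has_derivative_add[OF smooth_on_has_derivative[OF assms(1)] smooth_on_has_derivative[OF assms(2)]]]
  by (auto simp: partial_def fun_eq_iff)

lemma partial_const: "partial j (\<lambda>w. c) = (\<lambda>w. 0)"
  using partial_at[OF has_derivative_const] by (auto simp: fun_eq_iff)

lemma pol_partial: "pol q \<Longrightarrow> pol (\<lambda>m. partial j (q m))"
proof (induction rule: pol.induct)
  case (pol_smooth f)
  then show ?case by (intro pol.pol_smooth smooth_on_partial)
next
  case (pol_coord i)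
  show ?case unfolding partial_const by (intro pol.pol_smooth smooth_on_const) simp
next
  case (pol_add q r)
  then show ?case by (simp add: partial_add smooth_on_pol pol.pol_add)
next
  case (pol_mult q r)
  then show ?case by (simp add: partial_mult smooth_on_pol pol.pol_add pol.pol_mult)
qed

lemma pol_bound: "pol q \<Longrightarrow> compact K \<Longrightarrow> poly_le K (\<lambda>m w. norm (q m w)) (\<lambda>m w. 1)"
proof (induction rule: pol.induct)
  case (pol_smooth f)
  have "bounded (f ` K)"
    by (intro compact_imp_bounded compact_continuous_image pol_smooth.prems continuous_on_subset[OF smooth_on_continuous[OF pol_smooth.hyps]]) simp
  then obtain B where B: "\<And>w. w \<in> K \<Longrightarrow> norm (f w) \<le> B" unfolding bounded_iff by blast
  show ?case by (rule poly_leI[of "\<bar>B\<bar>" _ _ 0]) (use B in force)+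
next
  case (pol_coord j)
  show ?case
  proof (rule poly_leI[of 1 _ _ 1])
    fix m :: "int^'a" and w
    have "norm (of_int (m $ j) :: complex) = \<bar>int_vec m $ j\<bar>" by simp
    also have "\<dots> \<le> norm (int_vec m)" by (rule component_le_norm_cart)
    finally show "norm (of_int (m $ j) :: complex) \<le> 1 * (1 + norm (int_vec m)) ^ 1 * 1" by simp
  qed simp
next
  case (pol_add q r)
  show ?case by (rule poly_le_mono[OF poly_le_add[OF pol_add.IH(1,2)]]) (auto simp: pol_add.prems norm_triangle_ineq)
next
  case (pol_mult q r)
  from poly_le_mult[OF pol_mult.IH(1,2)[OF pol_mult.prems]] show ?case by (simp add: norm_mult)
qed

text \<open>Since the derivatives of \<open>e m\<close> are multiples \<open>d j m\<close> of
  itself, each derivative of a \<open>pol\<close> prefactor times \<open>e m\<close> is again of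
  this form. The induction on the order therefore runs over all prefactors q and r.\<close>

lemma tensor_form_pol:
  assumes e: "\<And>m. smooth_on UNIV (e m)" and d: "\<And>m j w. partial j (e m) w = d j m w * e m w" "\<And>j. pol (d j)"
    and K: "compact K" and G: "\<And>w j k. w \<in> K \<Longrightarrow> \<bar>G w $ j $ k\<bar> \<le> c" and qr: "pol q" "pol r"
  shows "poly_le K (\<lambda>m w. norm (tensor_form (G w) l (\<lambda>w. q m w * e m w) (\<lambda>w. r m w * e m w) w)) (\<lambda>m w. (norm (e m w))\<^sup>2)"
  using qr
proof (induction l arbitrary: q r)
  case 0
  have "poly_le K (\<lambda>m w. norm (q m w * r m w)) (\<lambda>m w. 1)" by (rule pol_bound[OF pol_mult[OF 0] K])
  moreover have "poly_le K (\<lambda>m w. (norm (e m w))\<^sup>2) (\<lambda>m w. (norm (e m w))\<^sup>2)" by (rule poly_leI[of 1 _ _ 0]) auto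
  ultimately have "poly_le K (\<lambda>m w. norm (q m w * r m w) * (norm (e m w))\<^sup>2) (\<lambda>m w. 1 * (norm (e m w))\<^sup>2)"
    by (rule poly_le_mult) auto
  then show ?case by (simp add: norm_mult power2_eq_square mult_ac)
next
  case (Suc l)
  define D where "D j q m w = q m w * d j m w + partial j (q m) w" for j q m w
  have D: "pol (D j q)" if "pol q" for j q unfolding D_def by (intro pol_add pol_mult that d(2) pol_partial)
  have p: "partial j (\<lambda>w. q m w * e m w) = (\<lambda>w. D j q m w * e m w)" if "pol q" for j q m
    unfolding partial_mult[OF smooth_on_pol[OF that] e] D_def d(1) by (simp add: algebra_simps)
  let ?T = "\<lambda>j k m w. tensor_form (G w) l (\<lambda>w. D j q m w * e m w) (\<lambda>w. D k r m w * e m w) w"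
  have "poly_le K (\<lambda>m w. \<bar>c\<bar>) (\<lambda>m w. 1)" by (rule poly_leI[of "\<bar>c\<bar>" _ _ 0]) auto
  then have "poly_le K (\<lambda>m w. \<bar>c\<bar> * norm (?T j k m w)) (\<lambda>m w. 1 * (norm (e m w))\<^sup>2)" for j k
    by (rule poly_le_mult) (auto intro: Suc.IH D Suc.prems)
  then have t: "poly_le K (\<lambda>m w. \<bar>c\<bar> * norm (?T j k m w)) (\<lambda>m w. (norm (e m w))\<^sup>2)" for j k by simp
  have "poly_le K (\<lambda>m w. \<Sum>j\<in>UNIV. \<Sum>k\<in>UNIV. \<bar>c\<bar> * norm (?T j k m w)) (\<lambda>m w. (norm (e m w))\<^sup>2)"
    by (intro poly_le_sum t) auto
  then show ?case
  proof (rule poly_le_mono)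
    fix m w assume w: "w \<in> K"
    show "norm (tensor_form (G w) (Suc l) (\<lambda>w. q m w * e m w) (\<lambda>w. r m w * e m w) w) \<le> (\<Sum>j\<in>UNIV. \<Sum>k\<in>UNIV. \<bar>c\<bar> * norm (?T j k m w))"
      unfolding tensor_form.simps p[OF Suc.prems(1)] p[OF Suc.prems(2)]
    proof (intro order_trans[OF norm_sum] sum_mono)
      fix j k
      have "\<bar>G w $ j $ k\<bar> \<le> \<bar>c\<bar>" using G[OF w, of j k] by simp
      then show "norm (of_real (G w $ j $ k) * ?T j k m w) \<le> \<bar>c\<bar> * norm (?T j k m w)"
        by (simp add: norm_mult mult_right_mono)
    qed
  qed
qed

section \<open>Positive definite matrices and their inverses\<close>

lemma coercive_inverse:
  fixes H :: "real^'n::finite^'n"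
  assumes c: "c > 0" "\<And>v. c * (norm v)\<^sup>2 \<le> v \<bullet> (H *v v)"
  shows "H ** matrix_inv H = mat 1" "matrix_inv H ** H = mat 1" "norm (matrix_inv H *v v) \<le> norm v / c"
proof -
  have "x = 0" if "H *v x = 0" for x using c(2)[of x] c(1) that by (simp add: mult_le_0_iff)
  then have "invertible H" unfolding invertible_left_inverse matrix_left_invertible_ker by blast
  then show i: "H ** matrix_inv H = mat 1" "matrix_inv H ** H = mat 1" by (rule invertible_matrix_inv)+
  define u where "u = matrix_inv H *v v"
  have "H *v u = v" by (simp add: u_def matrix_vector_mul_assoc i)
  then have "c * (norm u)\<^sup>2 \<le> norm u * norm v" using c(2)[of u] norm_cauchy_schwarz[of u v] by simp
  then have "norm u * (c * norm u) \<le> norm u * norm v" by (simp add: power2_eq_square mult_ac)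
  then have "c * norm u \<le> norm v" by (cases "norm u = 0") (auto simp: mult_le_cancel_left_pos)
  then show "norm (matrix_inv H *v v) \<le> norm v / c" using c(1) by (simp add: u_def[symmetric] field_simps)
qed

text \<open>For u = H^-1 v, coercivity bounds (v, u) from below by the square of
  \<open>norm u\<close>, and boundedness of H bounds \<open>norm u\<close> from below by
  \<open>norm v\<close>.\<close>

lemma coercive_inverse_lower:
  fixes H :: "real^'n::finite^'n"
  assumes c: "c > 0" "\<And>v. c * (norm v)\<^sup>2 \<le> v \<bullet> (H *v v)"
  obtains c' where "c' > 0" "\<And>v. c' * norm v \<le> covector_norm (matrix_inv H) v"
proof -
  obtain B where B: "B > 0" "\<And>x. norm (H *v x) \<le> norm x * B"
    using bounded_linear.pos_bounded[OF matrix_vector_mul_bounded_linear[of H]] by blast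
  have "sqrt c / B * norm v \<le> covector_norm (matrix_inv H) v" for v
  proof -
    define u where "u = matrix_inv H *v v"
    have Hu: "H *v u = v" by (simp add: u_def matrix_vector_mul_assoc coercive_inverse[OF c])
    have "norm v / B \<le> norm u" using B(2)[of u] B(1) by (simp add: Hu field_simps)
    then have "sqrt c / B * norm v \<le> sqrt c * norm u" using c(1) by (simp add: mult_left_mono flip: times_divide_eq_right)
    also have "\<dots> = sqrt (c * (norm u)\<^sup>2)" by (simp add: real_sqrt_mult)
    also have "\<dots> \<le> sqrt (v \<bullet> u)" using c(2)[of u] by (simp add: Hu inner_commute)
    finally show ?thesis by (simp add: covector_norm_def u_def)
  qed
  then show ?thesis using that[of "sqrt c / B"] B(1) c(1) by simp
qed

lemma symmetric_eq_of_quadratic: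
  fixes A B :: "real^'n::finite^'n"
  assumes s: "transpose A = A" "transpose B = B" and q: "\<And>v. v \<bullet> (A *v v) = v \<bullet> (B *v v)"
  shows "A = B"
proof -
  have sy: "x \<bullet> (M *v y) = y \<bullet> (M *v x)" if "transpose M = M" for M :: "real^'n^'n" and x y
    using that by (metis dot_lmul_matrix inner_commute transpose_matrix_vector)
  have "x \<bullet> (A *v y) = x \<bullet> (B *v y)" for x y
    using q[of "x + y"] q[of x] q[of y] sy[OF s(1), of x y] sy[OF s(2), of x y]
    by (simp add: matrix_vector_right_distrib inner_add_left inner_add_right)
  then have "A *v y = B *v y" for y by (metis vector_eq_ldot)
  then show ?thesis by (simp add: matrix_eq)
qed

section \<open>Rapid decay\<close>

lemma matrix_inv_eqI:
  fixes A B :: "real^'n::finite^'n"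
  assumes "A ** B = mat 1" "B ** A = mat 1" shows "matrix_inv A = B"
proof -
  have "invertible A" using assms unfolding invertible_def by blast
  then have "matrix_inv A = matrix_inv A ** (A ** B)" "matrix_inv A ** A = mat 1"
    using assms by (simp_all add: invertible_matrix_inv)
  then show ?thesis by (simp add: matrix_mul_assoc)
qed

context polarized_lift
begin

text \<open>The quadratic form attains a positive minimum on the product of K with the unit sphere;
  homogeneity extends the bound to all vectors.\<close>

lemma hessian_coercive:
  assumes K: "compact K"
  obtains c where "c > 0" "\<And>w v. w \<in> K \<Longrightarrow> c * (norm v)\<^sup>2 \<le> v \<bullet> (hessian w *v v)"
proof (cases "K = {}")
  case True
  then show ?thesis using that[of 1] by simp
next
  case False
  define S where "S = K \<times> sphere (0::real^'n) 1"
  have cS: "compact S" unfolding S_def by (intro compact_Times K compact_sphere)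
  have "axis undefined 1 \<in> sphere (0::real^'n) 1" by simp
  then have nS: "S \<noteq> {}" using False unfolding S_def by blast
  have "continuous_on S (\<lambda>z. snd z \<bullet> (hessian (fst z) *v snd z))" by (intro continuous_intros)
  from continuous_attains_inf[OF cS nS this] obtain z where z: "z \<in> S"
    "\<And>y. y \<in> S \<Longrightarrow> snd z \<bullet> (hessian (fst z) *v snd z) \<le> snd y \<bullet> (hessian (fst y) *v snd y)" by blast
  define c where "c = snd z \<bullet> (hessian (fst z) *v snd z)"
  have "snd z \<noteq> 0" using z(1) by (auto simp: S_def)
  then have c: "c > 0" unfolding c_def by (rule cc.pos)
  have "c * (norm v)\<^sup>2 \<le> v \<bullet> (hessian w *v v)" if w: "w \<in> K" for w v
  proof (cases "v = 0")
    case False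
    define u where "u = (1 / norm v) *\<^sub>R v"
    have "(w, u) \<in> S" using w False by (simp add: S_def u_def)
    from z(2)[OF this] have "c \<le> u \<bullet> (hessian w *v u)" by (simp add: c_def)
    moreover have "v = norm v *\<^sub>R u" using False by (simp add: u_def)
    then have "v \<bullet> (hessian w *v v) = (norm v)\<^sup>2 * (u \<bullet> (hessian w *v u))"
      by (metis inner_scaleR_left inner_scaleR_right matrix_vector_mult_scaleR mult.assoc power2_eq_square)
    ultimately show ?thesis by (simp add: mult.commute[of c] mult_left_mono)
  qed simp
  then show ?thesis using that c by blast
qed

text \<open>Both sides are symmetric, so comparing the quadratic forms suffices; both are the metric
  on the lifted vector.\<close>

lemma metric_matrix_lift:
  assumes u: "u \<in> \<U>" "\<pi> w \<in> dom u"
  shows "metric_matrix \<A> g (fst u) (\<pi> w) = transpose (cinv (fst u) w) ** hessian w ** cinv (fst u) w"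
proof (rule symmetric_eq_of_quadratic)
  have T: "tang w x \<in> tangent_space \<A> (\<pi> w)" for x unfolding tangent_space_eq by blast
  have "g (\<pi> w) (tang w x) (tang w y) = g (\<pi> w) (tang w y) (tang w x)" for x y
    using metric T unfolding riemannian_metric_def by blast
  then show "transpose (metric_matrix \<A> g (fst u) (\<pi> w)) = metric_matrix \<A> g (fst u) (\<pi> w)"
    unfolding metric_matrix_def tangent_of_eq[OF pot_charts_at[OF u]] by (simp add: transpose_def vec_eq_iff)
  have "transpose (hessian w) = hessian w" by (simp add: hessian_def transpose_def vec_eq_iff hess_entry_sym)
  then show "transpose (transpose (cinv (fst u) w) ** hessian w ** cinv (fst u) w) = transpose (cinv (fst u) w) ** hessian w ** cinv (fst u) w"
    by (simp add: matrix_transpose_mul matrix_mul_assoc)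
  fix v
  define z where "z = cinv (fst u) w *v v"
  have "v \<bullet> (metric_matrix \<A> g (fst u) (\<pi> w) *v v) = second_form (snd u) (snd (fst u) (\<pi> w)) v"
    unfolding second_form_def potD(3)[OF u, symmetric]
    by (subst sum.swap) (simp add: inner_vec_def matrix_vector_mult_def sum_distrib_left mult_ac)
  also have "\<dots> = second_form (psi (pot_at w)) w z"
    unfolding metric_form[OF u] z_def[symmetric] using psi_form_pos(2)[OF pot_at, of z w] T
    by (cases "z = 0") (auto simp: second_form_def metric_sum[of "{}", simplified])
  also have "\<dots> = v \<bullet> ((transpose (cinv (fst u) w) ** hessian w ** cinv (fst u) w) *v v)"
  proof -
    have "v \<bullet> ((transpose (cinv (fst u) w) ** hessian w ** cinv (fst u) w) *v v) = ((hessian w *v z) v* cinv (fst u) w) \<bullet> v"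
      unfolding z_def by (simp add: matrix_vector_mul_assoc[symmetric] transpose_matrix_vector inner_commute)
    also have "\<dots> = z \<bullet> (hessian w *v z)" unfolding dot_lmul_matrix z_def[symmetric] by (rule inner_commute)
    finally show ?thesis unfolding hessian_form ..
  qed
  finally show "v \<bullet> (metric_matrix \<A> g (fst u) (\<pi> w) *v v) = v \<bullet> ((transpose (cinv (fst u) w) ** hessian w ** cinv (fst u) w) *v v)" .
qed

lemma hessian_inverse: "hessian w ** matrix_inv (hessian w) = mat 1" "matrix_inv (hessian w) ** hessian w = mat 1"
proof -
  obtain c where c: "c > 0" "\<And>w' v. w' \<in> {w} \<Longrightarrow> c * (norm v)\<^sup>2 \<le> v \<bullet> (hessian w' *v v)" by (rule hessian_coercive[OF compact_sing[of w]]) (rule that; blast)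
  from coercive_inverse(1,2)[OF c(1) c(2)[OF singletonI]] show "hessian w ** matrix_inv (hessian w) = mat 1" "matrix_inv (hessian w) ** hessian w = mat 1" .
qed

lemma inverse_metric_lift:
  assumes u: "u \<in> \<U>" "\<pi> w \<in> dom u"
  shows "matrix_inv (metric_matrix \<A> g (fst u) (\<pi> w)) = lu u w ** matrix_inv (hessian w) ** transpose (lu u w)"
proof (rule matrix_inv_eqI)
  define L where "L = lu u w"
  define C where "C = matrix_inv L"
  have 1: "L ** C = mat 1" "C ** L = mat 1" using GLZ_inv[OF lu_GLZ[OF u]] by (simp_all add: L_def C_def)
  then have 2: "transpose C ** transpose L = mat 1" "transpose L ** transpose C = mat 1"
    by (simp_all flip: matrix_transpose_mul)
  have v: "L *v (C *v x) = x" "C *v (L *v x) = x" "transpose C *v (transpose L *v x) = x" "transpose L *v (transpose C *v x) = x"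
    "hessian w *v (matrix_inv (hessian w) *v x) = x" "matrix_inv (hessian w) *v (hessian w *v x) = x" for x
    by (simp_all add: matrix_vector_mul_assoc 1 2 hessian_inverse)
  show "metric_matrix \<A> g (fst u) (\<pi> w) ** (lu u w ** matrix_inv (hessian w) ** transpose (lu u w)) = mat 1"
    "(lu u w ** matrix_inv (hessian w) ** transpose (lu u w)) ** metric_matrix \<A> g (fst u) (\<pi> w) = mat 1"
    unfolding metric_matrix_lift[OF u] L_def[symmetric] C_def[symmetric]
    by (simp_all add: matrix_eq matrix_vector_mul_assoc[symmetric] v)
qed

lemma lift_covector:
  assumes u: "u \<in> \<U>" "\<pi> w \<in> dom u"
  shows "grad \<Phi> w + int_vec (sheet_index u w m) = transpose (lu u w) *v (grad (snd u) (snd (fst u) (\<pi> w)) + int_vec m)"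
  by (simp add: matrix_vector_right_distrib grad_psi[OF u, symmetric] shift[OF u] sheet_index_def int_vec_act[OF GLZ_transpose[OF lu_GLZ[OF u]]])

text \<open>The norms in \<open>rapidly_decaying\<close> are computed in the charts of the cover by
  potentials; this moves them to the flat coordinates, where all local potentials share one
  estimate.\<close>

lemma covector_norm_lift:
  assumes u: "u \<in> \<U>" "\<pi> w \<in> dom u"
  shows "covector_norm (matrix_inv (metric_matrix \<A> g (fst u) (\<pi> w))) (grad (snd u) (snd (fst u) (\<pi> w)) + int_vec m)
    = covector_norm (matrix_inv (hessian w)) (grad \<Phi> w + int_vec (sheet_index u w m))"
  unfolding inverse_metric_lift[OF u] lift_covector[OF u] covector_norm_def
  by (simp add: matrix_vector_mul_assoc[symmetric] transpose_matrix_vector dot_lmul_matrix)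

lemma chart_local:
  assumes u: "u \<in> \<U>" "\<pi> w \<in> dom u"
  obtains T t where "open T" "snd (fst u) (\<pi> w) \<in> T" "T \<subseteq> chart_range (fst u)" "cinv (fst u) w *v (snd (fst u) (\<pi> w)) + t = w"
    "\<And>y. y \<in> T \<Longrightarrow> chart_inv (fst u) y = \<pi> (cinv (fst u) w *v y + t)" "\<And>y. y \<in> T \<Longrightarrow> \<pi> (cinv (fst u) w *v y + t) \<in> dom u"
    "\<And>y. y \<in> T \<Longrightarrow> snd (fst u) (\<pi> (cinv (fst u) w *v y + t)) = y"
    "\<And>y. y \<in> T \<Longrightarrow> lu u (cinv (fst u) w *v y + t) = lu u w" "\<And>y. y \<in> T \<Longrightarrow> shift u (cinv (fst u) w *v y + t) = shift u w"
proof -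
  have d: "\<pi> w \<in> fst (fst u)" using u(2) by (simp add: dom_def)
  obtain T t where T: "open T" "snd (fst u) (\<pi> w) \<in> T" "T \<subseteq> chart_range (fst u)" "w = cinv (fst u) w *v (snd (fst u) (\<pi> w)) + t"
    "\<And>y. y \<in> T \<Longrightarrow> chart_inv (fst u) y = \<pi> (cinv (fst u) w *v y + t) \<and> lu u (cinv (fst u) w *v y + t) = lu u w"
    using local_inverse[OF potD(1)[OF u(1)] d] by metis
  obtain e where e: "e > 0" "\<And>w'. w' \<in> ball w e \<Longrightarrow> shift u w' = shift u w" using shift_local[OF u] by metis
  define T' where "T' = T \<inter> (\<lambda>y. cinv (fst u) w *v y + t) -` ball w e"
  have "open T'" unfolding T'_def by (intro open_Int T(1) open_vimage continuous_intros) auto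
  moreover have "snd (fst u) (\<pi> w) \<in> T'" using T(2) T(4)[symmetric] e(1) by (simp add: T'_def)
  moreover have "T' \<subseteq> T" by (simp add: T'_def)
  moreover have ci: "chart_inv (fst u) y = \<pi> (cinv (fst u) w *v y + t)" if "y \<in> T" for y using T(5)[OF that] by blast
  moreover have "\<pi> (cinv (fst u) w *v y + t) \<in> dom u" "snd (fst u) (\<pi> (cinv (fst u) w *v y + t)) = y" if "y \<in> T" for y
    unfolding ci[OF that, symmetric] dom_def using T(3) that by (auto intro: inv_into_into f_inv_into_f)
  ultimately show ?thesis
    by (intro that[of T' t]) (use T(3) T(4)[symmetric] T(5) e(2) in \<open>unfold T'_def, blast+\<close>)
qed

lemma sheet_local:
  assumes u: "u \<in> \<U>" "\<pi> w \<in> dom u"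
  obtains T t where "open T" "snd (fst u) (\<pi> w) \<in> T" "cinv (fst u) w *v (snd (fst u) (\<pi> w)) + t = w"
    "\<And>f m y. y \<in> T \<Longrightarrow> sheet \<A> f u m y = f (path_at (sheet_index u w m) (cinv (fst u) w *v y + t))"
proof -
  obtain T t where T: "open T" "snd (fst u) (\<pi> w) \<in> T" "cinv (fst u) w *v (snd (fst u) (\<pi> w)) + t = w"
    "\<And>y. y \<in> T \<Longrightarrow> \<pi> (cinv (fst u) w *v y + t) \<in> dom u"
    "\<And>y. y \<in> T \<Longrightarrow> snd (fst u) (\<pi> (cinv (fst u) w *v y + t)) = y"
    "\<And>y. y \<in> T \<Longrightarrow> lu u (cinv (fst u) w *v y + t) = lu u w" "\<And>y. y \<in> T \<Longrightarrow> shift u (cinv (fst u) w *v y + t) = shift u w"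
    using chart_local[OF u] by metis
  have "sheet \<A> f u m y = f (path_at (sheet_index u w m) (cinv (fst u) w *v y + t))" if "y \<in> T" for f m y
    using sheet_eq[OF u(1) T(4)[OF that], of f m] T(5-7)[OF that] by (simp add: sheet_index_def)
  then show ?thesis using that T(1-3) by blast
qed

text \<open>
  The section with value \<open>a\<close> at the constant paths: on the sheet \<open>m\<close> it is a multiple of
  \<open>exp (-2\<pi> (\<Phi>(w) + (m, w)))\<close>, normalised at the critical point of \<open>\<Phi> + (m, \<cdot>)\<close>, if there is one.
\<close>

definition gauss_sheet :: "('b \<Rightarrow> complex) \<Rightarrow> int^'n \<Rightarrow> real^'n \<Rightarrow> complex" where
  "gauss_sheet a m w = (if crit m then a (\<pi> (wmin m)) * of_real (exp (- 2 * pi * breg w (wmin m))) else 0)"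

text \<open>One point of the path space has a description \<open>path_at m w\<close> for each lift w
  of its base point; by \<open>path_at_eqD\<close> the value is the same for all of them.\<close>

definition gauss :: "('b \<Rightarrow> complex) \<Rightarrow> 'b \<times> ('b, 'n) vect \<Rightarrow> complex" where
  "gauss a P = (if P \<in> path_space \<A> \<U> then SOME z. \<exists>m w. P = path_at m w \<and> z = gauss_sheet a m w else 0)"

lemma gauss_EE: "gauss a (path_at m w) = gauss_sheet a m w"
proof -
  have "gauss_sheet a m' w' = gauss_sheet a m w" if e: "path_at m w = path_at m' w'" for m' w'
  proof -
    obtain A t where "\<And>x. \<pi> (A *v x + t) = \<pi> x" "crit m' \<longleftrightarrow> crit m"
      "crit m \<Longrightarrow> wmin m' = A *v wmin m + t" "crit m \<Longrightarrow> breg w' (wmin m') = breg w (wmin m)"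
      using path_at_eqD[OF e] by metis
    then show ?thesis by (simp add: gauss_sheet_def)
  qed
  then have "(SOME z. \<exists>m' w'. path_at m w = path_at m' w' \<and> z = gauss_sheet a m' w') = gauss_sheet a m w" by (intro some_equality) blast+
  then show ?thesis unfolding gauss_def path_space_eq by auto
qed

lemma gauss_sheet_noncrit: "\<not> crit m \<Longrightarrow> gauss_sheet a m = (\<lambda>w. 0)"
  by (simp add: gauss_sheet_def fun_eq_iff)

lemma gauss_sheet_smooth: "smooth_on UNIV (gauss_sheet a m)"
proof (cases "crit m")
  case True
  have "smooth_on UNIV (\<lambda>w. \<Phi> w + (int_vec m \<bullet> w + (- (\<Phi> (wmin m) + int_vec m \<bullet> wmin m))))"
    by (intro smooth_on_add Phi_smooth smooth_on_bounded_linear smooth_on_const bounded_linear_inner_right) auto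
  then have "smooth_on UNIV (\<lambda>w. breg w (wmin m))" by (rule smooth_on_eq[OF open_UNIV]) (simp add: breg_wmin[OF True])
  then have "smooth_on UNIV (\<lambda>w. complex_of_real (exp ((- 2 * pi) *\<^sub>R breg w (wmin m))))"
    by (intro smooth_on_linear_comp[OF bounded_linear_of_real] smooth_on_exp
      smooth_on_linear_comp[OF bounded_linear_scaleR_right]) auto
  then have "smooth_on UNIV (\<lambda>w. a (\<pi> (wmin m)) * complex_of_real (exp ((- 2 * pi) *\<^sub>R breg w (wmin m))))"
    by (intro smooth_on_mult smooth_on_const) auto
  then show ?thesis by (rule smooth_on_eq[OF open_UNIV]) (simp add: gauss_sheet_def True)
qed (simp add: gauss_sheet_noncrit smooth_on_const)

text \<open>The logarithmic derivative is affine in m with smooth coefficients, which is the input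
  that \<open>tensor_form_pol\<close> requires; on sheets without a critical point both sides
  vanish.\<close>

lemma gauss_sheet_partial: "partial j (gauss_sheet a m) w = (of_real (- 2 * pi) * (of_real (grad \<Phi> w $ j) + of_int (m $ j))) * gauss_sheet a m w"
proof (cases "crit m")
  case True
  have "((\<lambda>w. breg w (wmin m)) has_derivative (\<lambda>v. (grad \<Phi> w + int_vec m) \<bullet> v)) (at w)"
    unfolding breg_wmin[OF True] by (rule derivative_eq_intros Phi_grad refl)+ (simp add: inner_add_left)
  then have "((\<lambda>w. exp (- 2 * pi * breg w (wmin m))) has_derivative
      (\<lambda>v. exp (- 2 * pi * breg w (wmin m)) * (- 2 * pi * ((grad \<Phi> w + int_vec m) \<bullet> v)))) (at w)"
    by (auto intro!: derivative_eq_intros)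
  from has_derivative_mult_right[OF bounded_linear.has_derivative[OF bounded_linear_of_real this]]
  have "((\<lambda>w. a (\<pi> (wmin m)) * complex_of_real (exp (- 2 * pi * breg w (wmin m)))) has_derivative
      (\<lambda>v. a (\<pi> (wmin m)) * complex_of_real (exp (- 2 * pi * breg w (wmin m)) * (- 2 * pi * ((grad \<Phi> w + int_vec m) \<bullet> v))))) (at w)" .
  then have "(gauss_sheet a m has_derivative
      (\<lambda>v. a (\<pi> (wmin m)) * complex_of_real (exp (- 2 * pi * breg w (wmin m)) * (- 2 * pi * ((grad \<Phi> w + int_vec m) \<bullet> v))))) (at w)"
    by (simp add: gauss_sheet_def[abs_def] True)
  from partial_at[OF this] show ?thesis
    by (simp add: inner_axis gauss_sheet_def True inner_add_left algebra_simps)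
qed (simp add: gauss_sheet_noncrit partial_const)

lemma grad_Phi_bounded:
  assumes "compact K" obtains P where "P \<ge> 0" "\<And>w. w \<in> K \<Longrightarrow> norm (grad \<Phi> w) \<le> P"
proof -
  have "bounded (grad \<Phi> ` K)" by (intro compact_imp_bounded compact_continuous_image cc.cont_p assms)
  then obtain B where "\<forall>x\<in>grad \<Phi> ` K. norm x \<le> B" unfolding bounded_iff by blast
  then show ?thesis using that[of "\<bar>B\<bar>"] by force
qed

text \<open>\<open>breg_wmin_lower\<close> with slope 1 suffices, because the exponent carries the
  factor 2 \<pi>. The rate 2 leaves one factor \<open>exp (- norm (int_vec m))\<close> after the
  polynomial growth of derivatives has used up the other.\<close>

lemma gauss_sheet_decay:
  assumes a: "\<And>b. norm (a b) \<le> A" and K: "compact K"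
  obtains M where "M \<ge> 0" "\<And>m w. w \<in> K \<Longrightarrow> norm (gauss_sheet a m w) \<le> M * exp (- 2 * norm (int_vec m))"
proof -
  obtain C where C: "\<And>w m. w \<in> K \<Longrightarrow> crit m \<Longrightarrow> breg w (wmin m) \<ge> 1 * norm (int_vec m) - C" using breg_wmin_lower[OF K, of 1] by auto
  have A: "A \<ge> 0" using a[of undefined] norm_ge_zero order_trans by blast
  have "norm (gauss_sheet a m w) \<le> (A * exp (2 * pi * C)) * exp (- 2 * norm (int_vec m))" if w: "w \<in> K" for m w
  proof (cases "crit m")
    case True
    have "1 * norm (int_vec m) \<le> pi * norm (int_vec m)" using pi_gt3 by (intro mult_right_mono) auto
    moreover have "2 * pi * (norm (int_vec m) - C) \<le> 2 * pi * breg w (wmin m)" using C[OF w True] by (intro mult_left_mono) auto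
    ultimately have "- 2 * pi * breg w (wmin m) \<le> 2 * pi * C + - 2 * norm (int_vec m)" by (simp add: algebra_simps)
    then have "exp (- 2 * pi * breg w (wmin m)) \<le> exp (2 * pi * C) * exp (- 2 * norm (int_vec m))" by (simp flip: exp_add)
    then have "norm (a (\<pi> (wmin m))) * exp (- 2 * pi * breg w (wmin m)) \<le> A * (exp (2 * pi * C) * exp (- 2 * norm (int_vec m)))"
      by (intro mult_mono a A) auto
    then show ?thesis by (simp add: gauss_sheet_def True norm_mult mult.assoc)
  qed (simp add: gauss_sheet_noncrit A)
  then show ?thesis using that[of "A * exp (2 * pi * C)"] A by simp
qed

text \<open>Coercivity of the Hessian on K bounds the covector norm linearly in m, derivatives cost
  a polynomial in m, and exponential decay beats both. Nonnegativity of the covector norm is a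
  premise; in the application that norm exceeds a positive threshold.\<close>

lemma gauss_sheet_rapid:
  assumes a: "\<And>b. norm (a b) \<le> A" and K: "compact K"
  obtains D M where "D > 0" "M \<ge> 0"
    "\<And>m w. w \<in> K \<Longrightarrow> covector_norm (matrix_inv (hessian w)) (grad \<Phi> w + int_vec m) \<le> D * (1 + norm (int_vec m))"
    "\<And>m w. w \<in> K \<Longrightarrow> covector_norm (matrix_inv (hessian w)) (grad \<Phi> w + int_vec m) \<ge> 0 \<Longrightarrow>
      covector_norm (matrix_inv (hessian w)) (grad \<Phi> w + int_vec m) ^ k *
      sqrt (Re (tensor_form (matrix_inv (hessian w)) l (gauss_sheet a m) (gauss_sheet a m) w)) \<le> M * exp (- norm (int_vec m))"
proof -
  obtain c where c: "c > 0" "\<And>w v. w \<in> K \<Longrightarrow> c * (norm v)\<^sup>2 \<le> v \<bullet> (hessian w *v v)" using hessian_coercive[OF K] by metis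
  obtain P where P: "P \<ge> 0" "\<And>w. w \<in> K \<Longrightarrow> norm (grad \<Phi> w) \<le> P" using grad_Phi_bounded[OF K] by metis
  obtain M where M: "M \<ge> 0" "\<And>m w. w \<in> K \<Longrightarrow> norm (gauss_sheet a m w) \<le> M * exp (- 2 * norm (int_vec m))" by (rule gauss_sheet_decay[of a A, OF a K]) (rule that; blast)
  define D where "D = (P + 1) / sqrt c"
  have D: "D > 0" using c(1) P(1) by (simp add: D_def)
  have cov: "covector_norm (matrix_inv (hessian w)) (grad \<Phi> w + int_vec m) \<le> D * (1 + norm (int_vec m))" if w: "w \<in> K" for w m
  proof -
    let ?v = "grad \<Phi> w + int_vec m"
    have "?v \<bullet> (matrix_inv (hessian w) *v ?v) \<le> norm ?v * norm (matrix_inv (hessian w) *v ?v)" by (rule norm_cauchy_schwarz)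
    also have "\<dots> \<le> norm ?v * (norm ?v / c)" by (intro mult_left_mono coercive_inverse(3)[OF c(1) c(2)[OF w]]) auto
    also have "\<dots> = (norm ?v / sqrt c)\<^sup>2" using c(1) by (simp add: power_divide power2_eq_square)
    finally have "covector_norm (matrix_inv (hessian w)) ?v \<le> norm ?v / sqrt c"
      unfolding covector_norm_def using c(1) by (intro real_le_lsqrt) auto
    also have "norm ?v \<le> P + norm (int_vec m)" using norm_triangle_ineq[of "grad \<Phi> w" "int_vec m"] P(2)[OF w] by simp
    also have "\<dots> \<le> (P + 1) * (1 + norm (int_vec m))" using P(1) by (simp add: algebra_simps)
    finally show ?thesis using c(1) by (simp add: D_def divide_right_mono)
  qed
  have "poly_le K (\<lambda>m w. norm (tensor_form (matrix_inv (hessian w)) l (\<lambda>w. 1 * gauss_sheet a m w) (\<lambda>w. 1 * gauss_sheet a m w) w)) (\<lambda>m w. (norm (gauss_sheet a m w))\<^sup>2)"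
  proof (rule tensor_form_pol[OF gauss_sheet_smooth gauss_sheet_partial _ K])
    show "pol (\<lambda>m w. of_real (- 2 * pi) * (of_real (grad \<Phi> w $ j) + of_int (m $ j)))" for j
    proof (intro pol_mult pol_add pol_coord pol_smooth smooth_on_const)
      have "smooth_on UNIV (\<lambda>w. complex_of_real (partial j \<Phi> w))"
        by (rule smooth_on_linear_comp[OF bounded_linear_of_real open_UNIV smooth_on_partial[OF Phi_smooth]])
      then show "smooth_on UNIV (\<lambda>w. complex_of_real (grad \<Phi> w $ j))" by (simp add: grad_def)
    qed simp
    show "pol (\<lambda>m w. 1)" "pol (\<lambda>m w. 1)" by (intro pol_smooth smooth_on_const; simp)+
    show "\<bar>matrix_inv (hessian w) $ i $ j\<bar> \<le> 1 / c" if w: "w \<in> K" for w i j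
    proof -
      have "matrix_inv (hessian w) $ i $ j = (matrix_inv (hessian w) *v axis j 1) $ i" by (simp add: matrix_vector_mult_basis column_def)
      then have "\<bar>matrix_inv (hessian w) $ i $ j\<bar> \<le> norm (matrix_inv (hessian w) *v axis j 1)" by (simp add: component_le_norm_cart)
      also have "\<dots> \<le> norm (axis j (1::real)) / c" by (rule coercive_inverse(3)[OF c(1) c(2)[OF w]])
      finally show ?thesis by simp
    qed
  qed
  then obtain C N where C: "C \<ge> 0" "\<And>m w. w \<in> K \<Longrightarrow>
      norm (tensor_form (matrix_inv (hessian w)) l (gauss_sheet a m) (gauss_sheet a m) w) \<le> C * (1 + norm (int_vec m)) ^ N * (norm (gauss_sheet a m w))\<^sup>2"
    unfolding poly_le_def by (auto simp: eta_contract_eq)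
  define E where "E = D ^ k * sqrt C * M * real (k + N + 1) ^ (k + N)"
  have "covector_norm (matrix_inv (hessian w)) (grad \<Phi> w + int_vec m) ^ k *
      sqrt (Re (tensor_form (matrix_inv (hessian w)) l (gauss_sheet a m) (gauss_sheet a m) w)) \<le> E * exp (- norm (int_vec m))"
    if w: "w \<in> K" and nn: "covector_norm (matrix_inv (hessian w)) (grad \<Phi> w + int_vec m) \<ge> 0" for m w
  proof -
    define r where "r = norm (int_vec m)"
    have r: "r \<ge> 0" by (simp add: r_def)
    have "Re (tensor_form (matrix_inv (hessian w)) l (gauss_sheet a m) (gauss_sheet a m) w) \<le> norm (tensor_form (matrix_inv (hessian w)) l (gauss_sheet a m) (gauss_sheet a m) w)" by (rule complex_Re_le_cmod)
    also have "\<dots> \<le> C * (1 + r) ^ N * (norm (gauss_sheet a m w))\<^sup>2" unfolding r_def by (rule C(2)[OF w])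
    \<comment> \<open>The power is replaced by its square so that the square root can be extracted
      exactly.\<close>
    also have "\<dots> \<le> C * ((1 + r) ^ N)\<^sup>2 * (norm (gauss_sheet a m w))\<^sup>2"
    proof (intro mult_right_mono mult_left_mono C(1))
      have "(1 + r) ^ N \<ge> 1" using r by simp
      then show "(1 + r) ^ N \<le> ((1 + r) ^ N)\<^sup>2" by (simp add: power2_eq_square)
    qed simp
    finally have "sqrt (Re (tensor_form (matrix_inv (hessian w)) l (gauss_sheet a m) (gauss_sheet a m) w)) \<le> sqrt (C * ((1 + r) ^ N)\<^sup>2 * (norm (gauss_sheet a m w))\<^sup>2)" by simp
    also have "\<dots> = sqrt C * (1 + r) ^ N * norm (gauss_sheet a m w)" using r by (simp add: real_sqrt_mult)
    also have "\<dots> \<le> sqrt C * (1 + r) ^ N * (M * exp (- 2 * r))" unfolding r_def using C(1) by (intro mult_left_mono M(2) w) auto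
    finally have t: "sqrt (Re (tensor_form (matrix_inv (hessian w)) l (gauss_sheet a m) (gauss_sheet a m) w)) \<le> sqrt C * (1 + r) ^ N * (M * exp (- 2 * r))" .
    have "covector_norm (matrix_inv (hessian w)) (grad \<Phi> w + int_vec m) ^ k \<le> (D * (1 + r)) ^ k"
      unfolding r_def by (intro power_mono cov w nn)
    then have "covector_norm (matrix_inv (hessian w)) (grad \<Phi> w + int_vec m) ^ k *
      sqrt (Re (tensor_form (matrix_inv (hessian w)) l (gauss_sheet a m) (gauss_sheet a m) w)) \<le> (D * (1 + r)) ^ k * (sqrt C * (1 + r) ^ N * (M * exp (- 2 * r)))"
      by (rule order_trans[OF mult_left_mono[OF t zero_le_power[OF nn]] mult_right_mono]) (use C(1) M(1) r in auto)
    also have "\<dots> = (D ^ k * sqrt C * M) * ((1 + r) ^ (k + N) * exp (- 2 * r))" by (simp add: power_mult_distrib power_add mult_ac)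
    also have "\<dots> \<le> (D ^ k * sqrt C * M) * ((real (k + N + 1) ^ (k + N) * exp r) * exp (- 2 * r))"
      by (intro mult_left_mono mult_right_mono power_le_exp r) (use C(1) M(1) D in auto)
    also have "\<dots> = E * exp (- r)" by (simp add: E_def mult.assoc flip: exp_add)
    finally show ?thesis by (simp add: r_def)
  qed
  moreover have "E \<ge> 0" unfolding E_def using C(1) M(1) D by (intro mult_nonneg_nonneg) auto
  ultimately show ?thesis using that[of D E] D cov by blast
qed

lemma Gamma_real_bounded:
  assumes "a \<in> Gamma_real \<A> \<U>" obtains A where "\<And>b. norm (a b) \<le> A"
proof -
  have "finite (insert 0 (a ` {b. a b \<noteq> 0}))" using assms unfolding Gamma_real_def by simp
  then have "finite (range a)" by (rule finite_subset[rotated]) auto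
  from finite_imp_bounded[OF this] show ?thesis using that unfolding bounded_iff by blast
qed

text \<open>One closed ball of the cover maps onto the compact base, so a single estimate over this
  ball is uniform over all K and all local potentials.\<close>

lemma rapidly_decaying_gauss:
  assumes "a \<in> Gamma_real \<A> \<U>" shows "rapidly_decaying \<A> g \<U> (gauss a)"
  unfolding rapidly_decaying_def
proof (intro conjI allI ballI impI)
  show "gauss a P = 0" if "P \<notin> path_space \<A> \<U>" for P using that by (simp add: gauss_def)
next
  fix u m assume u: "u \<in> \<U>"
  show "smooth_on (chart_range (fst u)) (sheet \<A> (gauss a) u m)"
  proof (rule smooth_on_local)
    show "open (chart_range (fst u))" by (rule affine_chartsD(4)[OF potD(1)[OF u]])
    fix x assume "x \<in> chart_range (fst u)"
    then obtain w where w: "x = snd (fst u) (\<pi> w)" "\<pi> w \<in> dom u" using surj unfolding dom_def by (metis imageE surjD)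
    obtain T t where T: "open T" "x \<in> T" "\<And>y. y \<in> T \<Longrightarrow> sheet \<A> (gauss a) u m y = gauss a (path_at (sheet_index u w m) (cinv (fst u) w *v y + t))"
      using sheet_local[OF u w(2)] unfolding w(1) by metis
    have "smooth_on T (\<lambda>y. gauss_sheet a (sheet_index u w m) (cinv (fst u) w *v y + t))"
      by (rule smooth_on_subset[OF smooth_affine[OF gauss_sheet_smooth]]) simp
    from smooth_on_eq[OF T(1) this] have "smooth_on T (sheet \<A> (gauss a) u m)" using T(3) by (simp add: gauss_EE)
    then show "\<exists>T. open T \<and> x \<in> T \<and> smooth_on T (sheet \<A> (gauss a) u m)" using T(1,2) by blast
  qed
next
  fix K :: "'b set" and k l and \<epsilon> :: real assume \<epsilon>: "compact K \<and> \<epsilon> > 0"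
  obtain A where A: "\<And>b. norm (a b) \<le> A" using Gamma_real_bounded[OF assms] by metis
  obtain r where r: "\<pi> ` cball 0 r = UNIV" using deck_cocompact[OF compact_base] by blast
  obtain D M where D: "D > 0" "M \<ge> 0"
    "\<And>m w. w \<in> cball 0 r \<Longrightarrow> covector_norm (matrix_inv (hessian w)) (grad \<Phi> w + int_vec m) \<le> D * (1 + norm (int_vec m))"
    "\<And>m w. w \<in> cball 0 r \<Longrightarrow> covector_norm (matrix_inv (hessian w)) (grad \<Phi> w + int_vec m) \<ge> 0 \<Longrightarrow>
      covector_norm (matrix_inv (hessian w)) (grad \<Phi> w + int_vec m) ^ k *
      sqrt (Re (tensor_form (matrix_inv (hessian w)) l (gauss_sheet a m) (gauss_sheet a m) w)) \<le> M * exp (- norm (int_vec m))"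
    by (rule gauss_sheet_rapid[of a A "cball 0 r" k l, OF A compact_cball]) (rule that; blast)
  show "\<exists>R. \<forall>u\<in>\<U>. \<forall>b\<in>K \<inter> fst (fst u). \<forall>m.
           let x = snd (fst u) b; G = matrix_inv (metric_matrix \<A> g (fst u) b); \<eta> = grad (snd u) x + int_vec m
           in covector_norm G \<eta> > R \<longrightarrow>
              covector_norm G \<eta> ^ k * tensor_norm G l (\<lambda>J. partials J (sheet \<A> (gauss a) u m) x) < \<epsilon>"
    unfolding Let_def
  \<comment> \<open>A covector longer than this threshold forces
    \<open>M / \<epsilon> < norm (int_vec n)\<close> by the linear bound with constant
    \<open>D\<close>; as r < exp r, the bound \<open>M * exp (- norm (int_vec n))\<close> is then
    below \<epsilon>.\<close>
  proof (intro exI[of _ "D * (1 + M / \<epsilon>)"] ballI allI impI)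
    fix u b m assume u: "u \<in> \<U>" and b: "b \<in> K \<inter> fst (fst u)"
      and big: "D * (1 + M / \<epsilon>) < covector_norm (matrix_inv (metric_matrix \<A> g (fst u) b)) (grad (snd u) (snd (fst u) b) + int_vec m)"
    obtain w where w: "w \<in> cball 0 r" "b = \<pi> w" using r by blast
    have uw: "\<pi> w \<in> dom u" using b w(2) by (simp add: dom_def)
    define n where "n = sheet_index u w m"
    define C where "C = cinv (fst u) w"
    obtain T t where T: "open T" "snd (fst u) (\<pi> w) \<in> T" "C *v (snd (fst u) (\<pi> w)) + t = w"
      "\<And>y. y \<in> T \<Longrightarrow> sheet \<A> (gauss a) u m y = gauss a (path_at n (C *v y + t))"
      using sheet_local[OF u uw] unfolding n_def C_def by metis
    have CL: "C ** lu u w = mat 1" using GLZ_inv(3)[OF lu_GLZ[OF u uw]] by (simp add: C_def)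
    have "C ** (lu u w ** matrix_inv (hessian w) ** transpose (lu u w)) ** transpose C = (C ** lu u w) ** matrix_inv (hessian w) ** transpose (C ** lu u w)"
      by (simp add: matrix_mul_assoc matrix_transpose_mul)
    then have CGC: "C ** matrix_inv (metric_matrix \<A> g (fst u) b) ** transpose C = matrix_inv (hessian w)"
      unfolding w(2) inverse_metric_lift[OF u uw] by (simp add: CL)
    have "tensor_form G l (sheet \<A> (gauss a) u m) (sheet \<A> (gauss a) u m) (snd (fst u) (\<pi> w))
        = tensor_form G l (\<lambda>y. gauss_sheet a n (C *v y + t)) (\<lambda>y. gauss_sheet a n (C *v y + t)) (snd (fst u) (\<pi> w))" for G
      by (rule tensor_form_cong[OF T(1,2)]) (simp_all add: T(4) gauss_EE)
    also have "\<dots> G = tensor_form (C ** G ** transpose C) l (gauss_sheet a n) (gauss_sheet a n) w" for G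
      unfolding tensor_form_affine[OF gauss_sheet_smooth gauss_sheet_smooth] T(3) ..
    finally have tn: "tensor_norm (matrix_inv (metric_matrix \<A> g (fst u) b)) l (\<lambda>J. partials J (sheet \<A> (gauss a) u m) (snd (fst u) b))
        = sqrt (Re (tensor_form (matrix_inv (hessian w)) l (gauss_sheet a n) (gauss_sheet a n) w))"
      unfolding tensor_norm_eq w(2) using CGC w(2) by simp
    note cv = covector_norm_lift[OF u uw, of m, folded w(2) n_def]
    have pos: "D * (1 + M / \<epsilon>) > 0" using D \<epsilon> by (intro mult_pos_pos add_pos_nonneg) auto
    have "D * (1 + M / \<epsilon>) < D * (1 + norm (int_vec n))" using big D(3)[OF w(1), of n] unfolding cv by linarith
    then have "M / \<epsilon> < norm (int_vec n)" using D(1) by simp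
    also have "\<dots> < exp (norm (int_vec n))" by (rule exp_gt_self)
    finally have "M * exp (- norm (int_vec n)) < \<epsilon>" using \<epsilon> by (simp add: exp_minus field_simps)
    then show "covector_norm (matrix_inv (metric_matrix \<A> g (fst u) b)) (grad (snd u) (snd (fst u) b) + int_vec m) ^ k *
        tensor_norm (matrix_inv (metric_matrix \<A> g (fst u) b)) l (\<lambda>J. partials J (sheet \<A> (gauss a) u m) (snd (fst u) b)) < \<epsilon>"
      using D(4)[OF w(1), of n] big pos unfolding tn cv by linarith
  qed
qed

text \<open>Use the decay at the single point below w, without derivatives and with power twice the
  dimension: outside a finite set of indices the covector norm is comparable to the norm of the
  index.\<close>

lemma rapidly_decaying_summable:
  assumes f: "rapidly_decaying \<A> g \<U> f" shows "(\<lambda>m. norm (f (path_at m w))) summable_on UNIV"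
proof -
  let ?u = "pot_at w"
  define N where "N = 2 * CARD('n)"
  define G where "G = matrix_inv (hessian w)"
  have "\<forall>K k l \<epsilon>. compact K \<and> \<epsilon> > 0 \<longrightarrow>
        (\<exists>R. \<forall>u\<in>\<U>. \<forall>b\<in>K \<inter> fst (fst u). \<forall>m.
           let x = snd (fst u) b; G = matrix_inv (metric_matrix \<A> g (fst u) b); \<eta> = grad (snd u) x + int_vec m
           in covector_norm G \<eta> > R \<longrightarrow> covector_norm G \<eta> ^ k * tensor_norm G l (\<lambda>J. partials J (sheet \<A> f u m) x) < \<epsilon>)"
    using f unfolding rapidly_decaying_def by blast
  from this[rule_format, of "{\<pi> w}" 1 N 0] obtain R where R:
    "\<And>m. covector_norm (matrix_inv (metric_matrix \<A> g (fst ?u) (\<pi> w))) (grad (snd ?u) (snd (fst ?u) (\<pi> w)) + int_vec m) > R \<Longrightarrow>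
      covector_norm (matrix_inv (metric_matrix \<A> g (fst ?u) (\<pi> w))) (grad (snd ?u) (snd (fst ?u) (\<pi> w)) + int_vec m) ^ N *
      tensor_norm (matrix_inv (metric_matrix \<A> g (fst ?u) (\<pi> w))) 0 (\<lambda>J. partials J (sheet \<A> f ?u m) (snd (fst ?u) (\<pi> w))) < 1"
    using pot_at[of w] unfolding dom_def Let_def by auto
  have R': "covector_norm G (grad \<Phi> w + int_vec n) ^ N * norm (f (path_at n w)) < 1" if big: "covector_norm G (grad \<Phi> w + int_vec n) > R" for n
  proof -
    obtain m where m: "n = sheet_index ?u w m" using bij_sheet_index[OF pot_at, of w] by (metis bij_pointE)
    have "tensor_norm H 0 (\<lambda>J. partials J (sheet \<A> f ?u m) (snd (fst ?u) (\<pi> w))) = norm (f (path_at n w))" for H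
      unfolding tensor_norm_eq m by (simp add: sheet_eq[OF pot_at] complex_norm_square[symmetric] del: complex_norm_square)
    then show ?thesis using R[of m] big unfolding covector_norm_lift[OF pot_at] m[symmetric] G_def by simp
  qed
  obtain c where c: "c > 0" "\<And>w' v. w' \<in> {w} \<Longrightarrow> c * (norm v)\<^sup>2 \<le> v \<bullet> (hessian w' *v v)" by (rule hessian_coercive[OF compact_sing[of w]]) (rule that; blast)
  obtain c' where c'0: "c' > 0" "\<And>v. c' * norm v \<le> covector_norm (matrix_inv (hessian w)) v"
    by (rule coercive_inverse_lower[of c "hessian w", OF c(1) c(2)[OF singletonI]]) (rule that; blast)
  note c' = c'0[folded G_def]
  define p where "p = norm (grad \<Phi> w)"
  \<comment> \<open>Beyond \<open>B\<close> three things hold: the gradient of \<Phi> takes away at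
    most half of the index, the index has norm at least 1, and the covector norm exceeds
    \<open>R\<close>.\<close>
  define B where "B = 2 * p + 1 + 2 * \<bar>R\<bar> / c'"
  have big: "norm (f (path_at n w)) * (1 + (norm (int_vec n))\<^sup>2) ^ CARD('n) \<le> (8 / c'\<^sup>2) ^ CARD('n)" if n: "norm (int_vec n) > B" for n
  proof -
    define r v where "r = norm (int_vec n)" and "v = covector_norm G (grad \<Phi> w + int_vec n)"
    have p: "p \<ge> 0" by (simp add: p_def)
    have rB: "r > B" using n by (simp add: r_def)
    have "2 * \<bar>R\<bar> / c' \<ge> 0" using c'(1) by simp
    then have r: "r > 2 * p" "r \<ge> 1" "r > 2 * \<bar>R\<bar> / c'" using rB p unfolding B_def by linarith+
    have "r \<le> norm (grad \<Phi> w + int_vec n) + p"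
      using norm_triangle_ineq4[of "grad \<Phi> w + int_vec n" "grad \<Phi> w"] by (simp add: r_def p_def)
    then have "r / 2 \<le> norm (grad \<Phi> w + int_vec n)" using r(1) by simp
    then have "c' * (r / 2) \<le> c' * norm (grad \<Phi> w + int_vec n)" using c'(1) by (intro mult_left_mono) auto
    then have v: "c' * r / 2 \<le> v" using c'(2)[of "grad \<Phi> w + int_vec n"] by (simp add: v_def)
    have "R < c' * r / 2" using r(3) c'(1) by (simp add: field_simps)
    then have "v > R" using v by linarith
    then have fv: "v ^ N * norm (f (path_at n w)) < 1" unfolding v_def by (rule R')
    have "1 + r\<^sup>2 \<le> 2 * r\<^sup>2" using r(2) by simp
    also have "2 * r\<^sup>2 = (8 / c'\<^sup>2) * (c' * r / 2)\<^sup>2" using c'(1) by (simp add: power_mult_distrib power_divide)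
    also have "\<dots> \<le> (8 / c'\<^sup>2) * v\<^sup>2" using v c'(1) r(2) by (intro mult_left_mono power_mono) auto
    finally have "(1 + r\<^sup>2) ^ CARD('n) \<le> ((8 / c'\<^sup>2) * v\<^sup>2) ^ CARD('n)" by (intro power_mono) auto
    also have "\<dots> = (8 / c'\<^sup>2) ^ CARD('n) * v ^ N" unfolding power_mult_distrib N_def power_mult ..
    finally have "norm (f (path_at n w)) * (1 + r\<^sup>2) ^ CARD('n) \<le> norm (f (path_at n w)) * ((8 / c'\<^sup>2) ^ CARD('n) * v ^ N)"
      by (intro mult_left_mono) auto
    also have "\<dots> = (8 / c'\<^sup>2) ^ CARD('n) * (v ^ N * norm (f (path_at n w)))" by (simp add: mult_ac)
    also have "\<dots> \<le> (8 / c'\<^sup>2) ^ CARD('n) * 1" using fv by (intro mult_left_mono) auto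
    finally show ?thesis by (simp add: r_def)
  qed
  have "finite ((\<lambda>n. norm (f (path_at n w)) * (1 + (norm (int_vec n))\<^sup>2) ^ CARD('n)) ` {n. norm (int_vec n) \<le> B})"
    by (intro finite_imageI finite_int_vec_bounded)
  then obtain C where C: "\<And>n. norm (int_vec n) \<le> B \<Longrightarrow> norm (f (path_at n w)) * (1 + (norm (int_vec n))\<^sup>2) ^ CARD('n) \<le> C"
    by (metis (mono_tags, lifting) bdd_above_finite bdd_above.E image_eqI mem_Collect_eq)
  show ?thesis
  proof (rule polynomial_decay_summable)
    show "norm (f (path_at n w)) * (1 + (norm (int_vec n))\<^sup>2) ^ CARD('n) \<le> max C ((8 / c'\<^sup>2) ^ CARD('n))" for n
      using C[of n] big[of n] by (cases "norm (int_vec n) \<le> B") auto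
  qed
qed

end

section \<open>Sections in lifted coordinates\<close>

lemma torus_integral_directional:
  fixes h :: "real^'n::finite \<Rightarrow> complex"
  assumes d: "\<And>y. (h has_derivative h' y) (at y)" and c: "\<And>v. continuous_on UNIV (\<lambda>y. h' y v)" and p: "periodic h"
  shows "integral (cbox 0 1) (\<lambda>y. h' y v) = 0"
proof -
  have ex: "h' y v = (\<Sum>j\<in>UNIV. v $ j *\<^sub>R h' y (axis j 1))" for y
    by (rule linear_axis_expansion[OF has_derivative_linear[OF d]])
  have i: "(\<lambda>y. v $ j *\<^sub>R h' y (axis j 1)) integrable_on cbox 0 1" for j
    by (intro integrable_continuous continuous_intros continuous_on_subset[OF c]) auto
  have "integral (cbox 0 1) (\<lambda>y. h' y v) = (\<Sum>j\<in>UNIV. integral (cbox 0 1) (\<lambda>y. v $ j *\<^sub>R h' y (axis j 1)))"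
    unfolding ex by (rule integral_sum) (auto intro: i)
  then show ?thesis by (simp add: torus_integral_derivative[OF d c p])
qed

context polarized_lift
begin

abbreviation lift_pt :: "real^'n \<Rightarrow> real^'n \<Rightarrow> ('b, 'n) torus_point" where
  "lift_pt w y \<equiv> check_point \<A> (\<pi> w) (tang w y)"

text \<open>
  The coefficient in the frame that is defined by \<open>\<Phi>\<close>, as a function on \<open>\<real>\<^sup>n \<times> \<real>\<^sup>n\<close>; it does not depend on
  the choice of the local potential \<open>pot_at w\<close>.
\<close>

definition lifted :: "('b, 'n) lsection \<Rightarrow> (real^'n) \<times> (real^'n) \<Rightarrow> complex" where
  "lifted s z = ee (- shift (pot_at (fst z)) (fst z)) (snd z) * s (lift_pt (fst z) (snd z)) (pot_at (fst z))"

definition transitions :: "('b, 'n) lsection \<Rightarrow> bool" where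
  "transitions s \<longleftrightarrow> (\<forall>u\<in>\<U>. \<forall>v\<in>\<U>. \<forall>w y. \<pi> w \<in> dom u \<longrightarrow> \<pi> w \<in> dom v \<longrightarrow> s (lift_pt w y) v = ee (shift v w - shift u w) y * s (lift_pt w y) u)"

definition supported :: "('b, 'n) lsection \<Rightarrow> bool" where
  "supported s \<longleftrightarrow> (\<forall>q u. \<not> (q \<in> X_check \<A> \<and> u \<in> \<U> \<and> fst q \<in> dom u) \<longrightarrow> s q u = 0)"

text \<open>The covariant derivative along v d/dx - i v d/dy in the frame of \<Phi>; the connection
  form contributes 2 \<pi> i (-i) = 2 \<pi>. Equivalently, exp (2 \<pi> \<Phi>) S is holomorphic in
  y + i x.\<close>

definition hol_lift :: "((real^'n) \<times> (real^'n) \<Rightarrow> complex) \<Rightarrow> bool" where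
  "hol_lift S \<longleftrightarrow> (\<forall>w y v. frechet_derivative S (at (w, y)) (v, 0) - \<i> * frechet_derivative S (at (w, y)) (0, v)
     + 2 * of_real pi * of_real (grad \<Phi> w \<bullet> v) * S (w, y) = 0)"

lemma d_pot_lift:
  assumes u: "u \<in> \<U>" "\<pi> w \<in> dom u" shows "d_pot \<A> u (\<pi> w) = cotang w (grad \<Phi> w - int_vec (shift u w))"
  unfolding d_pot_def cotangent_of_eq[OF pot_charts_at[OF u]] grad_psi[OF u, symmetric] by (simp add: shift[OF u])

text \<open>The pairing of a covector with a vector is the same in a chart and on the cover, so the
  transition function of the bundle becomes a character in flat coordinates.\<close>

lemma transition_factor:
  assumes u: "u \<in> \<U>" "\<pi> w \<in> dom u" and v: "v \<in> \<U>" "\<pi> w \<in> dom v"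
  shows "exp (2 * of_real pi * \<i> * of_real ((d_pot \<A> u (\<pi> w) - d_pot \<A> v (\<pi> w)) (fst v) \<bullet> tang w y (fst v))) = ee (shift v w - shift u w) y"
proof -
  note c = pot_charts_at[OF v]
  have "(d_pot \<A> u (\<pi> w) - d_pot \<A> v (\<pi> w)) (fst v) = transpose (cinv (fst v) w) *v int_vec (shift v w - shift u w)"
    unfolding d_pot_lift[OF u] d_pot_lift[OF v] minus_apply cotang_chart[OF c]
    by (simp flip: matrix_vector_mult_diff_distrib)
  then have "(d_pot \<A> u (\<pi> w) - d_pot \<A> v (\<pi> w)) (fst v) \<bullet> tang w y (fst v) = int_vec (shift v w - shift u w) \<bullet> y"
    unfolding tang_chart[OF c] by (simp add: transpose_matrix_vector dot_lmul_matrix GLZ_inv_vec[OF lu_GLZ[OF v]] del: int_vec_simps)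
  then show ?thesis unfolding ee_def by simp
qed

lemma transitions_iff:
  "(\<forall>u\<in>\<U>. \<forall>v\<in>\<U>. \<forall>b\<in>fst (fst u) \<inter> fst (fst v). \<forall>\<xi>\<in>tangent_space \<A> b.
      s (check_point \<A> b \<xi>) v = exp (2 * of_real pi * \<i> * of_real ((d_pot \<A> u b - d_pot \<A> v b) (fst v) \<bullet> \<xi> (fst v))) *
          s (check_point \<A> b \<xi>) u) \<longleftrightarrow> transitions s" (is "?L \<longleftrightarrow> _")
proof
  assume L: ?L
  show "transitions s" unfolding transitions_def
  proof (intro ballI allI impI)
    fix u v w y assume u: "u \<in> \<U>" and v: "v \<in> \<U>" and d: "\<pi> w \<in> dom u" "\<pi> w \<in> dom v"
    have "\<pi> w \<in> fst (fst u) \<inter> fst (fst v)" "tang w y \<in> tangent_space \<A> (\<pi> w)" using d unfolding dom_def tangent_space_eq by auto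
    from L[rule_format, OF u v this] show "s (lift_pt w y) v = ee (shift v w - shift u w) y * s (lift_pt w y) u"
      unfolding transition_factor[OF u d(1) v d(2)] .
  qed
next
  assume t: "transitions s"
  show ?L
  proof (intro ballI)
    fix u v b \<xi> assume u: "u \<in> \<U>" and v: "v \<in> \<U>" and b: "b \<in> fst (fst u) \<inter> fst (fst v)" and \<xi>: "\<xi> \<in> tangent_space \<A> b"
    obtain w where w: "b = \<pi> w" using surj by blast
    obtain y where y: "\<xi> = tang w y" using \<xi> unfolding w tangent_space_eq by blast
    have d: "\<pi> w \<in> dom u" "\<pi> w \<in> dom v" using b by (auto simp: w dom_def)
    show "s (check_point \<A> b \<xi>) v = exp (2 * of_real pi * \<i> * of_real ((d_pot \<A> u b - d_pot \<A> v b) (fst v) \<bullet> \<xi> (fst v))) *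
          s (check_point \<A> b \<xi>) u"
      unfolding w y transition_factor[OF u d(1) v d(2)] using t u v d unfolding transitions_def by blast
  qed
qed

lemma lifted_eq:
  assumes t: "transitions s" and u: "u \<in> \<U>" "\<pi> w \<in> dom u"
  shows "s (lift_pt w y) u = ee (shift u w) y * lifted s (w, y)"
proof -
  have "s (lift_pt w y) u = ee (shift u w - shift (pot_at w) w) y * s (lift_pt w y) (pot_at w)"
    using t u pot_at[of w] unfolding transitions_def by blast
  also have "ee (shift u w - shift (pot_at w) w) y = ee (shift u w) y * ee (- shift (pot_at w) w) y" using ee_simps(1)[of "shift u w" "- shift (pot_at w) w" y] by simp
  finally show ?thesis by (simp add: lifted_def)
qed

lemma coeff_eq:
  assumes u: "u \<in> \<U>" "\<pi> w \<in> dom u"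
  shows "coeff \<A> s u (snd (fst u) (\<pi> w), y) = s (lift_pt w (cinv (fst u) w *v y)) u"
  unfolding coeff_def using chart_inv_eq[OF potD(1)[OF u(1)]] u(2)
  by (simp add: Let_def dom_def tangent_of_eq[OF pot_charts_at[OF u]])

lemma coeff_local:
  assumes t: "transitions s" and u: "u \<in> \<U>" "\<pi> w \<in> dom u"
  obtains T t where "open T" "snd (fst u) (\<pi> w) \<in> T" "T \<subseteq> chart_range (fst u)" "cinv (fst u) w *v (snd (fst u) (\<pi> w)) + t = w"
    "\<forall>z\<in>T \<times> UNIV. coeff \<A> s u z =
       ee (shift u w) (cinv (fst u) w *v snd z) * lifted s ((cinv (fst u) w *v fst z, cinv (fst u) w *v snd z) + (t, 0))"
proof -
  obtain T t where T: "open T" "snd (fst u) (\<pi> w) \<in> T" "T \<subseteq> chart_range (fst u)" "cinv (fst u) w *v (snd (fst u) (\<pi> w)) + t = w"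
    "\<And>y. y \<in> T \<Longrightarrow> chart_inv (fst u) y = \<pi> (cinv (fst u) w *v y + t)" "\<And>y. y \<in> T \<Longrightarrow> \<pi> (cinv (fst u) w *v y + t) \<in> dom u"
    "\<And>y. y \<in> T \<Longrightarrow> snd (fst u) (\<pi> (cinv (fst u) w *v y + t)) = y"
    "\<And>y. y \<in> T \<Longrightarrow> lu u (cinv (fst u) w *v y + t) = lu u w" "\<And>y. y \<in> T \<Longrightarrow> shift u (cinv (fst u) w *v y + t) = shift u w"
    using chart_local[OF u] by metis
  have "coeff \<A> s u z = ee (shift u w) (cinv (fst u) w *v snd z) * lifted s ((cinv (fst u) w *v fst z, cinv (fst u) w *v snd z) + (t, 0))"
    if "z \<in> T \<times> UNIV" for z
  proof -
    obtain x y where z: "z = (x, y)" by force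
    then have x: "x \<in> T" using that by simp
    let ?w = "cinv (fst u) w *v x + t"
    have "coeff \<A> s u (snd (fst u) (\<pi> ?w), y) = s (lift_pt ?w (cinv (fst u) ?w *v y)) u" by (rule coeff_eq[OF u(1) T(6)[OF x]])
    also have "\<dots> = ee (shift u ?w) (cinv (fst u) ?w *v y) * lifted s (?w, cinv (fst u) ?w *v y)" by (rule lifted_eq[OF t u(1) T(6)[OF x]])
    finally show ?thesis unfolding T(7)[OF x] T(8)[OF x] T(9)[OF x] by (simp add: z)
  qed
  then show ?thesis using that[OF T(1-4)] by blast
qed

lemma bounded_linear_pair_matrix:
  fixes C :: "real^'n^'n" shows "bounded_linear (\<lambda>z. (C *v fst z, C *v snd z))"
  by (intro bounded_linear_Pair bounded_linear_compose[OF matrix_vector_mul_bounded_linear] bounded_linear_fst bounded_linear_snd)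

lemma smooth_ee_snd: "smooth_on S (\<lambda>z :: (real^'n) \<times> (real^'n). ee k (C *v snd z))"
proof -
  have "bounded_linear (\<lambda>z :: (real^'n) \<times> (real^'n). C *v snd z)"
    by (intro bounded_linear_compose[OF matrix_vector_mul_bounded_linear] bounded_linear_snd)
  from smooth_on_affine_comp[OF this open_UNIV open_UNIV UNIV_I ee_smooth, of k 0]
  have "smooth_on UNIV (\<lambda>z :: (real^'n) \<times> (real^'n). ee k (C *v snd z))" unfolding add_0_right .
  from smooth_on_subset[OF this subset_UNIV] show ?thesis .
qed

lemma smooth_coeff:
  assumes t: "transitions s" and S: "smooth_on UNIV (lifted s)" and u: "u \<in> \<U>"
  shows "smooth_on (chart_range (fst u) \<times> UNIV) (coeff \<A> s u)"
proof (rule smooth_on_local)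
  show "open (chart_range (fst u) \<times> (UNIV :: (real^'n) set))" by (intro open_Times affine_chartsD(4)[OF potD(1)[OF u]] open_UNIV)
  fix z assume "z \<in> chart_range (fst u) \<times> (UNIV :: (real^'n) set)"
  then obtain x y where z: "z = (x, y)" "x \<in> chart_range (fst u)" by blast
  then obtain w where w: "x = snd (fst u) (\<pi> w)" "\<pi> w \<in> dom u" using surj unfolding dom_def by (metis imageE surjD)
  obtain T t where T0: "open T" "snd (fst u) (\<pi> w) \<in> T" "T \<subseteq> chart_range (fst u)" "cinv (fst u) w *v (snd (fst u) (\<pi> w)) + t = w"
    "\<forall>z\<in>T \<times> UNIV. coeff \<A> s u z =
       ee (shift u w) (cinv (fst u) w *v snd z) * lifted s ((cinv (fst u) w *v fst z, cinv (fst u) w *v snd z) + (t, 0))"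
    by (rule coeff_local[OF t u w(2)])
  note T = T0(1-4) T0(5)[rule_format]
  have o: "open (T \<times> (UNIV :: (real^'n) set))" by (intro open_Times T(1) open_UNIV)
  have "smooth_on (T \<times> UNIV) (\<lambda>z. ee (shift u w) (cinv (fst u) w *v snd z) * lifted s ((cinv (fst u) w *v fst z, cinv (fst u) w *v snd z) + (t, 0)))"
    by (rule smooth_on_mult[OF o smooth_ee_snd smooth_on_affine_comp[OF bounded_linear_pair_matrix open_UNIV o _ S]]) simp
  from smooth_on_eq[OF o this T(5)] have "smooth_on (T \<times> UNIV) (coeff \<A> s u)" .
  then show "\<exists>T. open T \<and> z \<in> T \<and> smooth_on T (coeff \<A> s u)" using o T(2) z(1) w(1) by blast
qed

lemma smooth_lifted:
  assumes t: "transitions s" and c: "\<And>u. u \<in> \<U> \<Longrightarrow> smooth_on (chart_range (fst u) \<times> UNIV) (coeff \<A> s u)"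
  shows "smooth_on UNIV (lifted s)"
proof (rule smooth_on_local)
  fix z :: "(real^'n) \<times> (real^'n)"
  obtain w y where z: "z = (w, y)" by force
  let ?u = "pot_at w"
  obtain e t where e: "e > 0" "\<And>w'. w' \<in> ball w e \<Longrightarrow> \<pi> w' \<in> dom ?u" "\<And>w'. w' \<in> ball w e \<Longrightarrow> lu ?u w' = lu ?u w"
    "\<And>w'. w' \<in> ball w e \<Longrightarrow> snd (fst ?u) (\<pi> w') = lu ?u w *v w' + t"
    "\<And>w'. w' \<in> ball w e \<Longrightarrow> lu ?u w *v w' + t \<in> chart_range (fst ?u)"
    by (rule psi_local[OF pot_at[of w]]) (rule that; blast)
  obtain e' where e': "e' > 0" "\<And>w'. w' \<in> ball w e' \<Longrightarrow> shift ?u w' = shift ?u w" using shift_local[OF pot_at] by metis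
  define T where "T = ball w (min e e') \<times> (UNIV :: (real^'n) set)"
  have o: "open T" unfolding T_def by (intro open_Times open_ball open_UNIV)
  have oc: "open (chart_range (fst ?u) \<times> (UNIV :: (real^'n) set))" by (intro open_Times affine_chartsD(4)[OF potD(1)[OF pot_at(1)]] open_UNIV)
  have eq: "lifted s z = ee (- shift ?u w) (mat 1 *v snd z) * coeff \<A> s ?u ((lu ?u w *v fst z, lu ?u w *v snd z) + (t, 0))" if "z \<in> T" for z
  proof -
    obtain w' y where z: "z = (w', y)" by force
    then have w': "w' \<in> ball w e" "w' \<in> ball w e'" using that by (auto simp: T_def)
    have "coeff \<A> s ?u (snd (fst ?u) (\<pi> w'), lu ?u w *v y) = s (lift_pt w' (cinv (fst ?u) w' *v (lu ?u w *v y))) ?u"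
      by (rule coeff_eq[OF pot_at(1) e(2)[OF w'(1)]])
    also have "\<dots> = s (lift_pt w' y) ?u" unfolding e(3)[OF w'(1)] GLZ_inv_vec[OF lu_GLZ[OF pot_at]] ..
    also have "\<dots> = ee (shift ?u w) y * lifted s (w', y)" using lifted_eq[OF t pot_at(1) e(2)[OF w'(1)]] e'(2)[OF w'(2)] by simp
    finally have "ee (- shift ?u w) y * coeff \<A> s ?u (snd (fst ?u) (\<pi> w'), lu ?u w *v y) = (ee (- shift ?u w) y * ee (shift ?u w) y) * lifted s (w', y)"
      by simp
    then show ?thesis unfolding ee_simps(6) e(4)[OF w'(1)] by (simp add: z)
  qed
  have "smooth_on T (\<lambda>z. ee (- shift ?u w) (mat 1 *v snd z) * coeff \<A> s ?u ((lu ?u w *v fst z, lu ?u w *v snd z) + (t, 0)))"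
    by (rule smooth_on_mult[OF o smooth_ee_snd smooth_on_affine_comp[OF bounded_linear_pair_matrix oc o _ c[OF pot_at(1)]]])
       (use e(5) in \<open>auto simp: T_def\<close>)
  from smooth_on_eq[OF o this eq] show "\<exists>T. open T \<and> z \<in> T \<and> smooth_on T (lifted s)"
    using o e(1) e'(1) by (intro exI[of _ T]) (auto simp: T_def z)
qed simp

text \<open>A vector (p, w) of \<open>P_complex\<close> is determined by p, since w = -i p;
  covariant differentiation along it is a complex linear combination of n basic expressions.\<close>

lemma nabla_zero_iff:
  "(\<forall>Z\<in>P_complex. nabla \<A> s u (x, y) Z = 0) \<longleftrightarrow>
   (\<forall>j. frechet_derivative (coeff \<A> s u) (at (x, y)) (axis j 1, 0) - \<i> * frechet_derivative (coeff \<A> s u) (at (x, y)) (0, axis j 1)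
      + 2 * of_real pi * of_real (partial j (snd u) x) * coeff \<A> s u (x, y) = 0)" (is "?L \<longleftrightarrow> (\<forall>j. ?E j = 0)")
proof -
  have n: "nabla \<A> s u (x, y) (p, w) = (\<Sum>j\<in>UNIV. p $ j * ?E j)" if "(p, w) \<in> P_complex" for p w
  proof -
    have w: "w $ j = - \<i> * p $ j" for j
      using that unfolding P_complex_def by (simp add: eq_neg_iff_add_eq_0)
    show ?thesis
      unfolding nabla_def prod.case w sum_distrib_left sum_distrib_right sum.distrib[symmetric]
      by (intro sum.cong refl) (simp add: algebra_simps)
  qed
  show ?thesis
  proof
    assume L: ?L
    show "\<forall>j. ?E j = 0"
    proof
      fix i :: 'n
      have Z: "(axis i 1, \<chi> j. - \<i> * axis i 1 $ j) \<in> P_complex" by (simp add: P_complex_def)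
      from L Z have "nabla \<A> s u (x, y) (axis i 1, \<chi> j. - \<i> * axis i 1 $ j) = 0" by blast
      then have "(\<Sum>j\<in>UNIV. axis i 1 $ j * ?E j) = 0" unfolding n[OF Z] .
      then show "?E i = 0" by (simp add: axis_def if_distrib[of "\<lambda>c. c * _"] cong: if_cong)
    qed
  next
    assume "\<forall>j. ?E j = 0"
    then show ?L using n by (metis (mono_tags, lifting) mult_zero_right prod.exhaust sum.neutral)
  qed
qed

text \<open>Passing to the frame of \<Phi> multiplies by the character \<open>ee k\<close>. Its
  y-derivative, times -i, supplies the term with \<open>int_vec k\<close> that completes the
  differential of the local potential to that of \<Phi>.\<close>

lemma coeff_holomorphic_iff:
  assumes t: "transitions s" and S: "smooth_on UNIV (lifted s)" and u: "u \<in> \<U>" "\<pi> w \<in> dom u"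
  shows "frechet_derivative (coeff \<A> s u) (at (snd (fst u) (\<pi> w), y)) (axis j 1, 0)
      - \<i> * frechet_derivative (coeff \<A> s u) (at (snd (fst u) (\<pi> w), y)) (0, axis j 1)
      + 2 * of_real pi * of_real (partial j (snd u) (snd (fst u) (\<pi> w))) * coeff \<A> s u (snd (fst u) (\<pi> w), y) = 0 \<longleftrightarrow>
    frechet_derivative (lifted s) (at (w, cinv (fst u) w *v y)) (cinv (fst u) w *v axis j 1, 0)
      - \<i> * frechet_derivative (lifted s) (at (w, cinv (fst u) w *v y)) (0, cinv (fst u) w *v axis j 1)
      + 2 * of_real pi * of_real (grad \<Phi> w \<bullet> (cinv (fst u) w *v axis j 1)) * lifted s (w, cinv (fst u) w *v y) = 0"
proof -
  define C where "C = cinv (fst u) w"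
  define x where "x = snd (fst u) (\<pi> w)"
  define k where "k = shift u w"
  define D where "D = frechet_derivative (lifted s) (at (w, C *v y))"
  obtain T t where T0: "open T" "x \<in> T" "T \<subseteq> chart_range (fst u)" "C *v x + t = w"
    "\<forall>z\<in>T \<times> UNIV. coeff \<A> s u z = ee k (C *v snd z) * lifted s ((C *v fst z, C *v snd z) + (t, 0))"
    unfolding C_def x_def k_def by (rule coeff_local[OF t u])
  note T = T0(1,2,4) T0(5)[rule_format]
  have "bounded_linear (\<lambda>z :: (real^'n) \<times> (real^'n). C *v snd z)"
    by (intro bounded_linear_compose[OF matrix_vector_mul_bounded_linear] bounded_linear_snd)
  from has_derivative_compose[OF bounded_linear_imp_has_derivative[OF this] ee_has_derivative, of k "(x, y)" UNIV]
  have 1: "((\<lambda>z. ee k (C *v snd z)) has_derivative (\<lambda>h. ee k (C *v y) * (2 * of_real pi * \<i> * of_real (int_vec k \<bullet> (C *v snd h))))) (at (x, y))"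
    unfolding snd_conv .
  have "((\<lambda>z. (C *v fst z, C *v snd z) + (t, 0)) has_derivative (\<lambda>h. (C *v fst h, C *v snd h))) (at (x, y))"
    using has_derivative_add[OF bounded_linear_imp_has_derivative[OF bounded_linear_pair_matrix[of C]] has_derivative_const[of "(t, 0)"]]
    by simp
  moreover have "(lifted s has_derivative D) (at ((C *v fst (x, y), C *v snd (x, y)) + (t, 0)))"
    using smooth_on_has_derivative[OF S open_UNIV UNIV_I, of "(w, C *v y)"] T(3) by (simp add: D_def)
  ultimately have 2: "((\<lambda>z. lifted s ((C *v fst z, C *v snd z) + (t, 0))) has_derivative (\<lambda>h. D (C *v fst h, C *v snd h))) (at (x, y))"
    by (rule has_derivative_compose)
  have 3: "(coeff \<A> s u has_derivative (\<lambda>h. ee k (C *v y) * D (C *v fst h, C *v snd h) +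
      ee k (C *v y) * (2 * of_real pi * \<i> * of_real (int_vec k \<bullet> (C *v snd h))) * lifted s (w, C *v y))) (at (x, y))"
  proof -
    have "((\<lambda>z. ee k (C *v snd z) * lifted s ((C *v fst z, C *v snd z) + (t, 0))) has_derivative (\<lambda>h. ee k (C *v y) * D (C *v fst h, C *v snd h) +
      ee k (C *v y) * (2 * of_real pi * \<i> * of_real (int_vec k \<bullet> (C *v snd h))) * lifted s (w, C *v y))) (at (x, y))"
      using has_derivative_mult[OF 1 2] T(3) by simp
    moreover have "open (T \<times> (UNIV :: (real^'n) set))" "(x, y) \<in> T \<times> UNIV" using T(1,2) by (auto intro: open_Times)
    ultimately show ?thesis
      using has_derivative_cong_open[of "T \<times> UNIV" "(x, y)" "coeff \<A> s u", OF _ _ T(4)] by blast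
  qed
  have fd: "frechet_derivative (coeff \<A> s u) (at (x, y)) h = ee k (C *v y) * (D (C *v fst h, C *v snd h) +
      2 * of_real pi * \<i> * of_real (int_vec k \<bullet> (C *v snd h)) * lifted s (w, C *v y))" for h
    unfolding frechet_derivative_at[OF 3, symmetric] by (simp add: algebra_simps)
  have co: "coeff \<A> s u (x, y) = ee k (C *v y) * lifted s (w, C *v y)" using T(4)[of "(x, y)"] T(2,3) by simp
  have "grad (psi u) w \<bullet> (C *v axis j 1) = grad (snd u) x \<bullet> axis j 1"
    unfolding grad_psi[OF u] x_def C_def by (simp add: transpose_matrix_vector dot_lmul_matrix GLZ_inv_vec[OF lu_GLZ[OF u]])
  then have g: "grad \<Phi> w \<bullet> (C *v axis j 1) = partial j (snd u) x + int_vec k \<bullet> (C *v axis j 1)"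
    unfolding shift[OF u] k_def inner_add_left by (simp add: inner_axis grad_def)
  have "frechet_derivative (coeff \<A> s u) (at (x, y)) (axis j 1, 0)
      - \<i> * frechet_derivative (coeff \<A> s u) (at (x, y)) (0, axis j 1)
      + 2 * of_real pi * of_real (partial j (snd u) x) * coeff \<A> s u (x, y)
    = ee k (C *v y) * (D (C *v axis j 1, 0) - \<i> * D (0, C *v axis j 1)
      + 2 * of_real pi * of_real (grad \<Phi> w \<bullet> (C *v axis j 1)) * lifted s (w, C *v y))"
    unfolding fd co g by (simp add: algebra_simps)
  then show ?thesis unfolding C_def[symmetric] x_def[symmetric] D_def[symmetric] by (simp add: ee_simps(7))
qed

lemma Gamma_complex_iff:
  "s \<in> Gamma_complex \<A> \<U> \<longleftrightarrow> supported s \<and> transitions s \<and> smooth_on UNIV (lifted s) \<and> hol_lift (lifted s)"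
proof -
  have "smooth_section \<A> \<U> s \<longleftrightarrow> supported s \<and> transitions s \<and> smooth_on UNIV (lifted s)"
    unfolding smooth_section_def transitions_iff supported_def dom_def using smooth_coeff smooth_lifted by blast
  moreover have "(\<forall>u\<in>\<U>. \<forall>x\<in>chart_range (fst u). \<forall>y. \<forall>Z\<in>P_complex. nabla \<A> s u (x, y) Z = 0) \<longleftrightarrow> hol_lift (lifted s)"
    if t: "transitions s" and S: "smooth_on UNIV (lifted s)"
  proof
    assume L: "\<forall>u\<in>\<U>. \<forall>x\<in>chart_range (fst u). \<forall>y. \<forall>Z\<in>P_complex. nabla \<A> s u (x, y) Z = 0"
    show "hol_lift (lifted s)" unfolding hol_lift_def
    proof (intro allI)
      fix w y v
      define L C where "L = lu (pot_at w) w" and "C = cinv (fst (pot_at w)) w"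
      define E where "E v = frechet_derivative (lifted s) (at (w, y)) (v, 0) - \<i> * frechet_derivative (lifted s) (at (w, y)) (0, v)
         + 2 * of_real pi * of_real (grad \<Phi> w \<bullet> v) * lifted s (w, y)" for v
      have CL: "C *v (L *v z) = z" for z unfolding C_def L_def by (rule GLZ_inv_vec[OF lu_GLZ[OF pot_at]])
      have "snd (fst (pot_at w)) (\<pi> w) \<in> chart_range (fst (pot_at w))" using pot_at(2)[of w] unfolding dom_def by blast
      then have "E (C *v axis j 1) = 0"
        for j using coeff_holomorphic_iff[OF t S pot_at, of w "L *v y" j] L pot_at(1)[of w] unfolding E_def C_def[symmetric] CL nabla_zero_iff by blast
      \<comment> \<open>The equation is known along the vectors \<open>C *v axis j 1\<close>, which
        span; real linearity carries it to every direction.\<close>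
      moreover have "linear (\<lambda>z. E (C *v z))"
      proof -
        have l: "linear (frechet_derivative (lifted s) (at (w, y)))"
          by (rule has_derivative_linear[OF smooth_on_has_derivative[OF S]]) auto
        show ?thesis unfolding E_def
        proof (rule linearI)
          show "frechet_derivative (lifted s) (at (w, y)) (C *v (a + b), 0) - \<i> * frechet_derivative (lifted s) (at (w, y)) (0, C *v (a + b))
             + 2 * of_real pi * of_real (grad \<Phi> w \<bullet> (C *v (a + b))) * lifted s (w, y)
            = (frechet_derivative (lifted s) (at (w, y)) (C *v a, 0) - \<i> * frechet_derivative (lifted s) (at (w, y)) (0, C *v a)
             + 2 * of_real pi * of_real (grad \<Phi> w \<bullet> (C *v a)) * lifted s (w, y)) +
              (frechet_derivative (lifted s) (at (w, y)) (C *v b, 0) - \<i> * frechet_derivative (lifted s) (at (w, y)) (0, C *v b)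
             + 2 * of_real pi * of_real (grad \<Phi> w \<bullet> (C *v b)) * lifted s (w, y))" for a b
            using linear_add[OF l, of "(C *v a, 0)" "(C *v b, 0)"] linear_add[OF l, of "(0, C *v a)" "(0, C *v b)"]
            by (simp add: matrix_vector_right_distrib inner_add_right algebra_simps)
          show "frechet_derivative (lifted s) (at (w, y)) (C *v (r *\<^sub>R a), 0) - \<i> * frechet_derivative (lifted s) (at (w, y)) (0, C *v (r *\<^sub>R a))
             + 2 * of_real pi * of_real (grad \<Phi> w \<bullet> (C *v (r *\<^sub>R a))) * lifted s (w, y)
            = r *\<^sub>R (frechet_derivative (lifted s) (at (w, y)) (C *v a, 0) - \<i> * frechet_derivative (lifted s) (at (w, y)) (0, C *v a)
             + 2 * of_real pi * of_real (grad \<Phi> w \<bullet> (C *v a)) * lifted s (w, y))" for r a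
            using linear_scale[OF l, of r "(C *v a, 0)"] linear_scale[OF l, of r "(0, C *v a)"]
            by (simp add: matrix_vector_mult_scaleR) (simp add: scaleR_conv_of_real algebra_simps)
        qed
      qed
      from linear_axis_expansion[OF this, of "L *v v"] have "E v = (\<Sum>j\<in>UNIV. (L *v v) $ j *\<^sub>R E (C *v axis j 1))" by (simp add: CL)
      ultimately show "E v = 0" by simp
    qed
  next
    assume h: "hol_lift (lifted s)"
    show "\<forall>u\<in>\<U>. \<forall>x\<in>chart_range (fst u). \<forall>y. \<forall>Z\<in>P_complex. nabla \<A> s u (x, y) Z = 0"
      unfolding nabla_zero_iff
    proof (intro ballI allI)
      fix u x y j assume u: "u \<in> \<U>" and "x \<in> chart_range (fst u)"
      then obtain w where w: "x = snd (fst u) (\<pi> w)" "\<pi> w \<in> dom u" using surj unfolding dom_def by (metis imageE surjD)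
      show "frechet_derivative (coeff \<A> s u) (at (x, y)) (axis j 1, 0) - \<i> * frechet_derivative (coeff \<A> s u) (at (x, y)) (0, axis j 1)
        + 2 * of_real pi * of_real (partial j (snd u) x) * coeff \<A> s u (x, y) = 0"
        unfolding w(1) coeff_holomorphic_iff[OF t S u w(2)] using h unfolding hol_lift_def by blast
    qed
  qed
  ultimately show ?thesis unfolding Gamma_complex_def by blast
qed

end

section \<open>Fibrewise Fourier coefficients and the isomorphisms\<close>

lemma complex_linear_isoI:
  assumes V: "complex_subspace sv V" and add: "\<And>v w. v \<in> V \<Longrightarrow> w \<in> V \<Longrightarrow> T (v + w) = T v + T w"
    and sc: "\<And>a v. v \<in> V \<Longrightarrow> T (sv a v) = sw a (T v)" and inj: "inj_on T V" and W: "T ` V = W"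
  shows "complex_linear_iso sv sw V W T"
proof -
  have V': "0 \<in> V" "\<And>v w. v \<in> V \<Longrightarrow> w \<in> V \<Longrightarrow> v + w \<in> V" "\<And>a v. v \<in> V \<Longrightarrow> sv a v \<in> V"
    using V unfolding complex_subspace_def by blast+
  have "T 0 = 0" using add[OF V'(1) V'(1)] by simp
  then have "0 \<in> W" using V'(1) W by (metis imageI)
  moreover have "v + w \<in> W" if v: "v \<in> W" and w: "w \<in> W" for v w
  proof -
    obtain v' w' where "v = T v'" "v' \<in> V" "w = T w'" "w' \<in> V" using v w W by blast
    then show ?thesis using add V'(2) W by (metis imageI)
  qed
  moreover have "sw a v \<in> W" if v: "v \<in> W" for a v
  proof -
    obtain v' where "v = T v'" "v' \<in> V" using v W by blast
    then show ?thesis using sc V'(3) W by (metis imageI)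
  qed
  ultimately show ?thesis
    unfolding complex_linear_iso_def complex_subspace_def[of sw] bij_betw_def using V add sc inj W by blast
qed

context polarized_lift
begin

lemma transitions_SYZ: "transitions (SYZ \<A> \<U> f)"
  unfolding transitions_def
proof (intro ballI allI impI)
  fix u v w y assume u: "u \<in> \<U>" "\<pi> w \<in> dom u" and v: "v \<in> \<U>" "\<pi> w \<in> dom v"
  have "ee (shift v w) y = ee (shift v w - shift u w) y * ee (shift u w) y" using ee_simps(1)[of "shift v w - shift u w" "shift u w" y] by simp
  then show "SYZ \<A> \<U> f (lift_pt w y) v = ee (shift v w - shift u w) y * SYZ \<A> \<U> f (lift_pt w y) u"
    unfolding SYZ_eq[OF u] SYZ_eq[OF v] by simp
qed

lemma supported_SYZ: "supported (SYZ \<A> \<U> f)"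
  unfolding supported_def SYZ_def dom_def by auto

lemma lifted_SYZ: "lifted (SYZ \<A> \<U> f) (w, y) = fibre_series f w y"
  unfolding lifted_def fst_conv snd_conv SYZ_eq[OF pot_at] mult.assoc[symmetric] ee_simps(6) by simp

lemma section_eqI:
  assumes s: "supported s" "transitions s" and s': "supported s'" "transitions s'" and e: "\<And>w y. lifted s (w, y) = lifted s' (w, y)"
  shows "s = s'"
proof (intro ext)
  fix q u
  show "s q u = s' q u"
  proof (cases "q \<in> X_check \<A> \<and> u \<in> \<U> \<and> fst q \<in> dom u")
    case True
    then obtain w y where q: "q = lift_pt w y" unfolding X_check_eq by blast
    then have u: "u \<in> \<U>" "\<pi> w \<in> dom u" using True by (auto simp: check_point_def)
    show ?thesis unfolding q lifted_eq[OF s(2) u] lifted_eq[OF s'(2) u] e ..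
  next
    case False
    then show ?thesis using s(1) s'(1) unfolding supported_def by metis
  qed
qed

text \<open>The fibrewise series factors as exp (-2 \<pi> \<Phi>(w)) times the holomorphic series
  \<open>theta c\<close>. The exponential cancels the connection term, and \<open>theta c\<close>
  satisfies the Cauchy-Riemann equations.\<close>

lemma SYZ_gauss_mem:
  assumes a: "a \<in> Gamma_real \<A> \<U>" shows "SYZ \<A> \<U> (gauss a) \<in> Gamma_complex \<A> \<U>"
proof -
  \<comment> \<open>The part of the exponent that depends on neither w nor y: the normalisation by
    the minimum of \<Phi> + (m, w).\<close>
  define c where "c m = (if crit m then a (\<pi> (wmin m)) * of_real (exp (2 * pi * (\<Phi> (wmin m) + int_vec m \<bullet> wmin m))) else 0)" for m
  obtain A where A: "\<And>b. norm (a b) \<le> A" by (rule Gamma_real_bounded[OF a]) (rule that; blast)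
  have A0: "A \<ge> 0" using A[of undefined] norm_ge_zero order_trans by blast
  have sd: "super_decay c" unfolding super_decay_def
  proof
    fix \<rho> :: real
    \<comment> \<open>As \<open>c\<close> does not involve w, the base point 0 suffices: the lower
      bound for \<open>breg 0 (wmin m)\<close> is an upper bound for the minimum, and its slope is
      arbitrary.\<close>
    obtain C where C: "\<And>w m. w \<in> {0} \<Longrightarrow> crit m \<Longrightarrow> breg w (wmin m) \<ge> \<bar>\<rho>\<bar> * norm (int_vec m) - C"
      using breg_wmin_lower[of "{0}" "\<bar>\<rho>\<bar>"] by auto
    have "norm (c m) \<le> (A * exp (2 * pi * (\<Phi> 0 + C))) * exp (- \<rho> * norm (int_vec m))" for m
    proof (cases "crit m")
      case True
      have "\<Phi> (wmin m) + int_vec m \<bullet> wmin m \<le> \<Phi> 0 + C - \<bar>\<rho>\<bar> * norm (int_vec m)"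
        using C[of 0 m] True by (simp add: breg_wmin)
      then have "2 * pi * (\<Phi> (wmin m) + int_vec m \<bullet> wmin m) \<le> 2 * pi * (\<Phi> 0 + C - \<bar>\<rho>\<bar> * norm (int_vec m))" by (intro mult_left_mono) auto
      moreover have "\<rho> * norm (int_vec m) \<le> 2 * pi * (\<bar>\<rho>\<bar> * norm (int_vec m))"
      proof -
        have "\<rho> * norm (int_vec m) \<le> 1 * (\<bar>\<rho>\<bar> * norm (int_vec m))" by (simp add: mult_right_mono)
        also have "\<dots> \<le> 2 * pi * (\<bar>\<rho>\<bar> * norm (int_vec m))" using pi_gt3 by (intro mult_right_mono) auto
        finally show ?thesis .
      qed
      ultimately have "2 * pi * (\<Phi> (wmin m) + int_vec m \<bullet> wmin m) \<le> 2 * pi * (\<Phi> 0 + C) + - \<rho> * norm (int_vec m)"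
        by (simp add: right_diff_distrib)
      then have "exp (2 * pi * (\<Phi> (wmin m) + int_vec m \<bullet> wmin m)) \<le> exp (2 * pi * (\<Phi> 0 + C)) * exp (- \<rho> * norm (int_vec m))"
        by (simp flip: exp_add)
      then have "norm (a (\<pi> (wmin m))) * exp (2 * pi * (\<Phi> (wmin m) + int_vec m \<bullet> wmin m))
          \<le> A * (exp (2 * pi * (\<Phi> 0 + C)) * exp (- \<rho> * norm (int_vec m)))" by (intro mult_mono A A0) auto
      then show ?thesis by (simp add: c_def True norm_mult mult.assoc)
    qed (simp add: c_def A0)
    then show "\<exists>M. \<forall>m. norm (c m) \<le> M * exp (- \<rho> * norm (int_vec m))" by blast
  qed
  let ?E = "\<lambda>z :: (real^'n) \<times> (real^'n). complex_of_real (exp ((- 2 * pi) *\<^sub>R \<Phi> (fst z)))"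
  have S: "lifted (SYZ \<A> \<U> (gauss a)) z = ?E z * theta c z" for z
  proof -
    obtain w y where z: "z = (w, y)" by force
    have "lifted (SYZ \<A> \<U> (gauss a)) z = infsum (\<lambda>m. gauss_sheet a m w * ee m y) UNIV"
      unfolding z lifted_SYZ fibre_series_def gauss_EE ..
    also have "\<dots> = infsum (\<lambda>m. ?E z * (c m * exp (ell m z))) UNIV"
    proof (rule infsum_cong)
      fix m
      have "exp (ell m z) = complex_of_real (exp (- 2 * pi * (int_vec m \<bullet> w))) * ee m y"
        unfolding ell_def ee_def z fst_conv snd_conv exp_of_real[symmetric] exp_add[symmetric] by simp
      moreover have "exp (- 2 * pi * breg w (wmin m)) = exp ((- 2 * pi) *\<^sub>R \<Phi> w) * (exp (2 * pi * (\<Phi> (wmin m) + int_vec m \<bullet> wmin m)) * exp (- 2 * pi * (int_vec m \<bullet> w)))" if "crit m"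
        unfolding breg_wmin[OF that] exp_add[symmetric] by (simp add: algebra_simps)
      ultimately show "gauss_sheet a m w * ee m y = ?E z * (c m * exp (ell m z))" by (simp add: gauss_sheet_def c_def z mult_ac)
    qed
    also have "\<dots> = ?E z * theta c z" unfolding theta_def by (rule infsum_cmult_right')
    finally show ?thesis .
  qed
  have dE: "(?E has_derivative (\<lambda>h. ?E (w, y) * of_real (- 2 * pi * (grad \<Phi> w \<bullet> fst h)))) (at (w, y))" for w y
  proof -
    have "((\<lambda>z :: (real^'n) \<times> (real^'n). fst z) has_derivative fst) (at (w, y))" by (rule has_derivative_fst[OF has_derivative_ident])
    from has_derivative_compose[OF this, of \<Phi> "\<lambda>v. grad \<Phi> w \<bullet> v"]
    have "((\<lambda>z :: (real^'n) \<times> (real^'n). \<Phi> (fst z)) has_derivative (\<lambda>h. grad \<Phi> w \<bullet> fst h)) (at (w, y))" using Phi_grad by simp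
    then have "((\<lambda>z :: (real^'n) \<times> (real^'n). exp ((- 2 * pi) *\<^sub>R \<Phi> (fst z))) has_derivative
       (\<lambda>h. exp ((- 2 * pi) *\<^sub>R \<Phi> w) * (- 2 * pi * (grad \<Phi> w \<bullet> fst h)))) (at (w, y))"
      by (auto intro!: derivative_eq_intros)
    from bounded_linear.has_derivative[OF bounded_linear_of_real this] show ?thesis by simp
  qed
  have sm: "smooth_on UNIV (lifted (SYZ \<A> \<U> (gauss a)))"
  proof -
    have "smooth_on UNIV (\<lambda>z :: (real^'n) \<times> (real^'n). \<Phi> (fst z + 0))"
      by (rule smooth_on_affine_comp[OF bounded_linear_fst open_UNIV open_UNIV UNIV_I Phi_smooth])
    then have "smooth_on UNIV (\<lambda>z :: (real^'n) \<times> (real^'n). \<Phi> (fst z))" by simp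
    then have "smooth_on UNIV ?E"
      by (intro smooth_on_linear_comp[OF bounded_linear_of_real] smooth_on_exp smooth_on_linear_comp[OF bounded_linear_scaleR_right]) auto
    from smooth_on_mult[OF open_UNIV this theta_smooth[OF sd]]
    have "smooth_on UNIV (\<lambda>z. ?E z * theta c z)" .
    then show ?thesis by (rule smooth_on_eq[OF open_UNIV]) (rule S)
  qed
  have "hol_lift (lifted (SYZ \<A> \<U> (gauss a)))" unfolding hol_lift_def
  proof (intro allI)
    fix w y v :: "real^'n"
    define D where "D h = (\<Sum>j\<in>UNIV. lam j h * theta (\<lambda>m. of_int (m $ j) * c m) (w, y))" for h
    have "(lifted (SYZ \<A> \<U> (gauss a)) has_derivative (\<lambda>h. ?E (w, y) * D h + (?E (w, y) * of_real (- 2 * pi * (grad \<Phi> w \<bullet> fst h))) * theta c (w, y))) (at (w, y))"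
      unfolding S[abs_def] D_def by (rule has_derivative_mult[OF dE theta_derivative[OF sd]])
    then have fd: "frechet_derivative (lifted (SYZ \<A> \<U> (gauss a))) (at (w, y)) =
        (\<lambda>h. ?E (w, y) * D h + (?E (w, y) * of_real (- 2 * pi * (grad \<Phi> w \<bullet> fst h))) * theta c (w, y))"
      by (rule frechet_derivative_at[symmetric])
    \<comment> \<open>The Cauchy-Riemann equation for the coordinate y_j + i x_j.\<close>
    have "lam j (v, 0) = \<i> * lam j (0, v)" for j by (simp add: lam_def mult_ac)
    then have D: "D (v, 0) = \<i> * D (0, v)" unfolding D_def sum_distrib_left mult.assoc[symmetric] by simp
    show "frechet_derivative (lifted (SYZ \<A> \<U> (gauss a))) (at (w, y)) (v, 0) - \<i> * frechet_derivative (lifted (SYZ \<A> \<U> (gauss a))) (at (w, y)) (0, v)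
       + 2 * of_real pi * of_real (grad \<Phi> w \<bullet> v) * lifted (SYZ \<A> \<U> (gauss a)) (w, y) = 0"
      unfolding fd S D by (simp add: algebra_simps)
  qed
  then show ?thesis unfolding Gamma_complex_iff using sm supported_SYZ transitions_SYZ by blast
qed

section \<open>Fourier coefficients of a holomorphic section\<close>

definition fibre_coeff :: "('b, 'n) lsection \<Rightarrow> int^'n \<Rightarrow> real^'n \<Rightarrow> complex" where
  "fibre_coeff s m w = integral (cbox 0 1) (\<lambda>y. lifted s (w, y) * ee (- m) y)"

lemma lifted_periodic:
  assumes "transitions s" shows "periodic (\<lambda>y. lifted s (w, y))"
proof -
  have "lift_pt w (y + int_vec k) = lift_pt w y" for y k using check_point_eq_iff[of w y "y + int_vec k"] by auto
  then show ?thesis unfolding periodic_def lifted_def by (simp add: ee_simps(2,5))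
qed

lemma lifted_continuous: "smooth_on UNIV (lifted s) \<Longrightarrow> continuous_on UNIV (\<lambda>y. lifted s (w, y))"
  by (rule continuous_on_compose2[OF smooth_on_continuous[of UNIV "lifted s"]]) (auto intro: continuous_intros)

text \<open>Differentiate under the integral: holomorphicity trades the derivative in x for one in
  y, and integration by parts over the torus turns the latter into multiplication by 2 \<pi> i
  m.\<close>

lemma fibre_coeff_line:
  assumes t: "transitions s" and S: "smooth_on UNIV (lifted s)" and h: "hol_lift (lifted s)"
  shows "((\<lambda>r. fibre_coeff s m (w + r *\<^sub>R v)) has_vector_derivative
     - (2 * of_real pi * of_real ((grad \<Phi> (w + r *\<^sub>R v) + int_vec m) \<bullet> v)) * fibre_coeff s m (w + r *\<^sub>R v)) (at r)"
proof -
  define D where "D z = frechet_derivative (lifted s) (at z)" for z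
  have dS: "(lifted s has_derivative D z) (at z)" for z unfolding D_def by (rule smooth_on_has_derivative[OF S]) auto
  have cD: "continuous_on UNIV (\<lambda>z. D z b)" for b unfolding D_def by (rule smooth_on_continuous[OF smooth_on_derivative[OF S]])
  have cD': "continuous_on R (\<lambda>x. D (f x) b)" if "continuous_on R f" for R f b
    by (rule continuous_on_compose2[OF cD that]) simp
  have cS: "continuous_on R (\<lambda>x. lifted s (f x))" if "continuous_on R f" for R f
    by (rule continuous_on_compose2[OF smooth_on_continuous[OF S] that]) simp
  have "((\<lambda>r. integral (cbox 0 1) (\<lambda>y. lifted s (w + r *\<^sub>R v, y) * ee (- m) y)) has_vector_derivative
      integral (cbox 0 1) (\<lambda>y. D (w + r *\<^sub>R v, y) (v, 0) * ee (- m) y)) (at r within UNIV)"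
  proof (rule leibniz_rule_vector_derivative)
    fix r :: real and y :: "real^'n"
    have "(lifted s has_derivative D (w + r *\<^sub>R v, y)) (at ((w, y) + r *\<^sub>R (v, 0)))" using dS by simp
    from has_vector_derivative_line[OF this]
    have "((\<lambda>r. lifted s (w + r *\<^sub>R v, y)) has_vector_derivative D (w + r *\<^sub>R v, y) (v, 0)) (at r)" by simp
    then show "((\<lambda>r. lifted s (w + r *\<^sub>R v, y) * ee (- m) y) has_vector_derivative D (w + r *\<^sub>R v, y) (v, 0) * ee (- m) y) (at r)"
      by (rule has_vector_derivative_mult_left)
    show "(\<lambda>y. lifted s (w + r *\<^sub>R v, y) * ee (- m) y) integrable_on cbox 0 1"
      by (intro integrable_continuous continuous_intros cS)
    show "continuous_on (UNIV \<times> cbox 0 1) (\<lambda>(r, y). D (w + r *\<^sub>R v, y) (v, 0) * ee (- m) y)"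
      unfolding case_prod_beta by (intro continuous_intros cD')
  qed auto
  moreover have "integral (cbox 0 1) (\<lambda>y. D (x, y) (v, 0) * ee (- m) y) =
      - (2 * of_real pi * of_real ((grad \<Phi> x + int_vec m) \<bullet> v)) * fibre_coeff s m x" for x
  proof -
    define p where "p y = D (x, y) (0, v) * ee (- m) y" for y
    define q where "q y = lifted s (x, y) * ee (- m) y" for y
    have ip: "p integrable_on cbox 0 1" and ip': "\<And>c. (\<lambda>y. c * p y) integrable_on cbox 0 1" and iq: "\<And>c. (\<lambda>y. c * q y) integrable_on cbox 0 1"
      unfolding p_def q_def by (intro integrable_continuous continuous_intros cS cD')+
    define k where "k = 2 * of_real pi * \<i> * complex_of_real (int_vec m \<bullet> v)"
    have dq: "(q has_derivative (\<lambda>b. lifted s (x, y) * (ee (- m) y * (2 * of_real pi * \<i> * of_real (int_vec (- m) \<bullet> b))) + D (x, y) (0, b) * ee (- m) y)) (at y)" for y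
    proof -
      have "((\<lambda>y. (x, y)) has_derivative (\<lambda>b. (0, b))) (at y)" by (auto intro!: derivative_eq_intros)
      from has_derivative_compose[OF this dS] have "((\<lambda>y. lifted s (x, y)) has_derivative (\<lambda>b. D (x, y) (0, b))) (at y)" .
      from has_derivative_mult[OF this ee_has_derivative] show ?thesis unfolding q_def[abs_def] .
    qed
    have pq: "periodic q" using lifted_periodic[OF t, of x] unfolding periodic_def q_def by (simp add: ee_simps(2,5))
    have "integral (cbox 0 1) (\<lambda>y. lifted s (x, y) * (ee (- m) y * (2 * of_real pi * \<i> * of_real (int_vec (- m) \<bullet> v))) + D (x, y) (0, v) * ee (- m) y) = 0"
      by (rule torus_integral_directional[OF dq _ pq]) (intro continuous_intros cS cD')
    moreover have "(\<lambda>y. lifted s (x, y) * (ee (- m) y * (2 * of_real pi * \<i> * of_real (int_vec (- m) \<bullet> v))) + D (x, y) (0, v) * ee (- m) y)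
        = (\<lambda>y. p y - k * q y)" by (auto simp: p_def q_def k_def algebra_simps)
    ultimately have "integral (cbox 0 1) (\<lambda>y. p y - k * q y) = 0" by simp
    moreover have "integral (cbox 0 1) (\<lambda>y. p y - k * q y) = integral (cbox 0 1) p - k * integral (cbox 0 1) q"
      using integral_diff[OF ip iq[of k]] by simp
    ultimately have ipk: "integral (cbox 0 1) p = k * integral (cbox 0 1) q" by simp
    have Dv: "D (x, y) (v, 0) = \<i> * D (x, y) (0, v) - 2 * of_real pi * of_real (grad \<Phi> x \<bullet> v) * lifted s (x, y)" for y
    proof -
      have "D (x, y) (v, 0) - \<i> * D (x, y) (0, v) + 2 * of_real pi * of_real (grad \<Phi> x \<bullet> v) * lifted s (x, y) = 0"
        using h unfolding hol_lift_def D_def by blast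
      then show ?thesis by (simp add: algebra_simps add_eq_0_iff)
    qed
    have "(\<lambda>y. D (x, y) (v, 0) * ee (- m) y) = (\<lambda>y. \<i> * p y - (2 * of_real pi * of_real (grad \<Phi> x \<bullet> v)) * q y)"
      unfolding Dv p_def q_def by (simp add: algebra_simps)
    then have "integral (cbox 0 1) (\<lambda>y. D (x, y) (v, 0) * ee (- m) y) =
        \<i> * integral (cbox 0 1) p - (2 * of_real pi * of_real (grad \<Phi> x \<bullet> v)) * integral (cbox 0 1) q"
      using integral_diff[OF ip'[of "\<i>"] iq[of "2 * of_real pi * of_real (grad \<Phi> x \<bullet> v)"]] by simp
    moreover have "integral (cbox 0 1) q = fibre_coeff s m x" by (simp add: fibre_coeff_def q_def[abs_def])
    ultimately show ?thesis unfolding ipk k_def by (simp add: inner_add_left algebra_simps)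
  qed
  ultimately show ?thesis unfolding fibre_coeff_def[symmetric] by simp
qed

text \<open>\<open>fibre_coeff_line\<close> is a linear differential equation along the segment from
  x to w. The product of the coefficient with exp (2 \<pi> (\<Phi> + (m, w))) has derivative 0
  there.\<close>

lemma fibre_coeff_formula:
  assumes t: "transitions s" and S: "smooth_on UNIV (lifted s)" and h: "hol_lift (lifted s)"
  shows "fibre_coeff s m w = fibre_coeff s m x * of_real (exp (2 * pi * ((\<Phi> x + int_vec m \<bullet> x) - (\<Phi> w + int_vec m \<bullet> w))))"
proof -
  define v where "v = w - x"
  define \<Psi> where "\<Psi> w = \<Phi> w + int_vec m \<bullet> w" for w
  define E where "E r = fibre_coeff s m (x + r *\<^sub>R v) * of_real (exp (2 * pi * \<Psi> (x + r *\<^sub>R v)))" for r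
  have "(E has_vector_derivative 0) (at r)" for r
  proof -
    have "((\<lambda>r. \<Psi> (x + r *\<^sub>R v)) has_real_derivative (grad \<Phi> (x + r *\<^sub>R v) + int_vec m) \<bullet> v) (at r)"
      unfolding \<Psi>_def inner_add_left
    proof (rule DERIV_add[OF cc.Phi_line_derivative])
      show "((\<lambda>r. int_vec m \<bullet> (x + r *\<^sub>R v)) has_real_derivative int_vec m \<bullet> v) (at r)"
        unfolding inner_add_right inner_scaleR_right by (auto intro!: derivative_eq_intros)
    qed
    then have "((\<lambda>r. exp (2 * pi * \<Psi> (x + r *\<^sub>R v))) has_real_derivative
        exp (2 * pi * \<Psi> (x + r *\<^sub>R v)) * (2 * pi * ((grad \<Phi> (x + r *\<^sub>R v) + int_vec m) \<bullet> v))) (at r)"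
      by (auto intro!: derivative_eq_intros)
    then have "((\<lambda>r. complex_of_real (exp (2 * pi * \<Psi> (x + r *\<^sub>R v)))) has_vector_derivative
        complex_of_real (exp (2 * pi * \<Psi> (x + r *\<^sub>R v)) * (2 * pi * ((grad \<Phi> (x + r *\<^sub>R v) + int_vec m) \<bullet> v)))) (at r)"
      by (rule has_vector_derivative_of_real)
    from has_vector_derivative_mult[OF fibre_coeff_line[OF t S h, of m x v r] this]
    show ?thesis unfolding E_def[abs_def] by (simp add: algebra_simps)
  qed
  then have "(E has_derivative (\<lambda>h. 0)) (at r within UNIV)" for r by (simp add: has_vector_derivative_def)
  then obtain c where "\<And>r. E r = c" using has_derivative_zero_constant[of UNIV E] by auto
  then have "E 1 = E 0" by simp
  then have "fibre_coeff s m w * of_real (exp (2 * pi * \<Psi> w)) = fibre_coeff s m x * of_real (exp (2 * pi * \<Psi> x))" by (simp add: E_def v_def)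
  from arg_cong[OF this, of "\<lambda>z. z * of_real (exp (- 2 * pi * \<Psi> w))"]
  have "fibre_coeff s m w * (of_real (exp (2 * pi * \<Psi> w)) * of_real (exp (- 2 * pi * \<Psi> w))) = fibre_coeff s m x * (of_real (exp (2 * pi * \<Psi> x)) * of_real (exp (- 2 * pi * \<Psi> w)))"
    by (simp only: mult.assoc)
  then show ?thesis unfolding of_real_mult[symmetric] exp_add[symmetric] \<Psi>_def by (simp add: algebra_simps)
qed

lemma deck_cp: "\<gamma> = (\<lambda>x. A *v x + t) \<Longrightarrow> (\<And>x. \<pi> (\<gamma> x) = \<pi> x) \<Longrightarrow> lift_pt (\<gamma> w) (A *v y) = lift_pt w y"
  using tang_deck[of \<gamma> A t w y] by simp

text \<open>All frame changes are characters of modulus 1, so the modulus is that of a section on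
  the compact total space: invariant under the deck group and periodic in y. A compact ball times
  the unit cube therefore suffices.\<close>

lemma lifted_bounded:
  assumes t: "transitions s" and S: "smooth_on UNIV (lifted s)"
  obtains M where "M \<ge> 0" "\<And>w y. norm (lifted s (w, y)) \<le> M"
proof -
  obtain r where r: "\<And>x. \<exists>\<gamma>\<in>deck. norm (\<gamma> x) \<le> r" using deck_cocompact[OF compact_base] by blast
  have "compact (cball (0::real^'n) r \<times> cbox (0::real^'n) 1)" by (intro compact_Times compact_cball compact_cbox)
  then have "bounded (lifted s ` (cball 0 r \<times> cbox 0 1))"
    by (intro compact_imp_bounded compact_continuous_image continuous_on_subset[OF smooth_on_continuous[OF S]]) auto
  then obtain M where M: "\<forall>x\<in>lifted s ` (cball 0 r \<times> cbox 0 1). norm x \<le> M" unfolding bounded_iff by blast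
  have "norm (lifted s (w, y)) \<le> \<bar>M\<bar>" for w y
  proof -
    obtain \<gamma> where "\<gamma> \<in> deck" and n: "norm (\<gamma> w) \<le> r" using r by blast
    then obtain A t where \<gamma>: "A \<in> GLZ" "\<gamma> = (\<lambda>x. A *v x + t)" "\<And>x. \<pi> (\<gamma> x) = \<pi> x" by (metis deckD)
    have "norm (lifted s (w, y)) = norm (s (lift_pt w y) (pot_at w))" unfolding lifted_eq[OF t pot_at] by (simp add: norm_mult ee_simps(4))
    also have "\<dots> = norm (s (lift_pt (\<gamma> w) (A *v y)) (pot_at w))" unfolding deck_cp[OF \<gamma>(2,3)] ..
    also have "\<dots> = norm (lifted s (\<gamma> w, A *v y))"
      using lifted_eq[OF t pot_at(1), of "\<gamma> w" w "A *v y"] pot_at(2)[of w] \<gamma>(3)[of w] by (simp add: norm_mult ee_simps(4))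
    finally have 1: "norm (lifted s (w, y)) = norm (lifted s (\<gamma> w, A *v y))" .
    obtain k where k: "A *v y + int_vec k \<in> cbox 0 1" by (rule translate_into_unit_cube)
    have "lifted s (\<gamma> w, A *v y + int_vec k) = lifted s (\<gamma> w, A *v y)" using lifted_periodic[OF t] unfolding periodic_def by blast
    moreover have "norm (lifted s (\<gamma> w, A *v y + int_vec k)) \<le> M" using M n k by (auto simp: mem_cball)
    ultimately show ?thesis unfolding 1 by simp
  qed
  then show ?thesis using that[of "\<bar>M\<bar>"] by simp
qed

text \<open>
  Without a critical point \<open>\<Phi> + (m, \<cdot>)\<close> is unbounded below, while the coefficient is bounded because
  \<open>B\<close> is compact.
\<close>

lemma fibre_coeff_eq:
  assumes t: "transitions s" and S: "smooth_on UNIV (lifted s)" and h: "hol_lift (lifted s)"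
  shows "fibre_coeff s m w = (if crit m then fibre_coeff s m (wmin m) * of_real (exp (- 2 * pi * breg w (wmin m))) else 0)"
    and "\<exists>M\<ge>0. \<forall>m x. norm (fibre_coeff s m x) \<le> M"
proof -
  obtain M where M: "M \<ge> 0" "\<And>w y. norm (lifted s (w, y)) \<le> M" by (rule lifted_bounded[OF t S]) (rule that; blast)
  have F: "norm (fibre_coeff s m x) \<le> M" for m x
  proof -
    have "norm (integral (cbox 0 1) (\<lambda>y. lifted s (x, y) * ee (- m) y)) \<le> integral (cbox (0::real^'n) 1) (\<lambda>y. M)"
      by (rule integral_norm_bound_integral)
        (auto intro!: integrable_continuous continuous_intros continuous_on_subset[OF lifted_continuous[OF S]] simp: norm_mult ee_simps(4) M(2))
    then show ?thesis by (simp add: fibre_coeff_def measure_unit_cube)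
  qed
  then show "\<exists>M\<ge>0. \<forall>m x. norm (fibre_coeff s m x) \<le> M" using M(1) by blast
  have "fibre_coeff s m w = 0" if "\<not> crit m"
  proof (rule ccontr)
    define c where "c = norm (fibre_coeff s m w)"
    assume "fibre_coeff s m w \<noteq> 0"
    then have c: "c > 0" by (simp add: c_def)
    \<comment> \<open>If one value \<open>c\<close> is nonzero, \<open>r < exp r\<close> turns the
      upper bound \<open>M\<close> for the coefficient at \<open>x\<close> into a lower bound for
      \<Phi> + (m, x).\<close>
    have "\<Phi> w + int_vec m \<bullet> w - M / (2 * pi * c) \<le> \<Phi> x - (- int_vec m) \<bullet> x" for x
    proof -
      define r where "r = 2 * pi * ((\<Phi> w + int_vec m \<bullet> w) - (\<Phi> x + int_vec m \<bullet> x))"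
      have "c * r \<le> c * exp r" using exp_gt_self[of r] c by simp
      also have "\<dots> = norm (fibre_coeff s m x)" using fibre_coeff_formula[OF t S h, of m x w] by (simp add: norm_mult c_def r_def)
      finally have "c * r \<le> M" using F[of m x] by simp
      then have "r / (2 * pi) \<le> M / (2 * pi * c)" using c by (simp add: field_simps)
      then show ?thesis by (simp add: r_def)
    qed
    then have "\<exists>x. grad \<Phi> x = - int_vec m" by (rule cc.critical_point_of_bounded_below)
    then show False using that unfolding crit_def by blast
  qed
  moreover have "fibre_coeff s m w = fibre_coeff s m (wmin m) * of_real (exp (- 2 * pi * breg w (wmin m)))" if "crit m"
    unfolding breg_wmin[OF that] by (subst fibre_coeff_formula[OF t S h, of m w "wmin m"]) (simp add: algebra_simps)
  ultimately show "fibre_coeff s m w = (if crit m then fibre_coeff s m (wmin m) * of_real (exp (- 2 * pi * breg w (wmin m))) else 0)" by simp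
qed

text \<open>Every coefficient is its value at the critical point, bounded uniformly in m, times a
  factor that decays by \<open>breg_wmin_lower\<close>.\<close>

lemma fibre_coeff_summable:
  assumes t: "transitions s" and S: "smooth_on UNIV (lifted s)" and h: "hol_lift (lifted s)"
  shows "(\<lambda>m. norm (fibre_coeff s m w)) summable_on UNIV"
proof -
  obtain M where M: "M \<ge> 0" "\<And>m x. norm (fibre_coeff s m x) \<le> M" using fibre_coeff_eq(2)[OF t S h] by blast
  obtain C where C: "\<And>x m. x \<in> {w} \<Longrightarrow> crit m \<Longrightarrow> breg x (wmin m) \<ge> 1 * norm (int_vec m) - C" using breg_wmin_lower[of "{w}" 1] by auto
  show ?thesis
  proof (rule exp_decay_summable)
    fix m :: "int^'n"
    show "norm (fibre_coeff s m w) \<le> (M * exp (2 * pi * C)) * exp (- norm (int_vec m))"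
    proof (cases "crit m")
      case True
      have "1 * norm (int_vec m) \<le> 2 * pi * norm (int_vec m)" using pi_gt3 by (intro mult_right_mono) auto
      moreover have "2 * pi * (norm (int_vec m) - C) \<le> 2 * pi * breg w (wmin m)" using C[of w m] True by (intro mult_left_mono) auto
      ultimately have "- 2 * pi * breg w (wmin m) \<le> 2 * pi * C + - norm (int_vec m)" by (simp add: algebra_simps)
      then have "exp (- 2 * pi * breg w (wmin m)) \<le> exp (2 * pi * C) * exp (- norm (int_vec m))" by (simp flip: exp_add)
      then have "norm (fibre_coeff s m (wmin m)) * exp (- 2 * pi * breg w (wmin m)) \<le> M * (exp (2 * pi * C) * exp (- norm (int_vec m)))"
        by (intro mult_mono M) auto
      then show ?thesis by (subst fibre_coeff_eq(1)[OF t S h]) (simp add: True norm_mult mult.assoc)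
    qed (subst fibre_coeff_eq(1)[OF t S h], simp add: M(1))
  qed
qed

lemma lifted_fourier:
  assumes t: "transitions s" and S: "smooth_on UNIV (lifted s)" and h: "hol_lift (lifted s)"
  shows "lifted s (w, y) = infsum (\<lambda>m. fibre_coeff s m w * ee m y) UNIV"
  unfolding fibre_coeff_def
  by (rule fourier_inversion[OF lifted_continuous[OF S] lifted_periodic[OF t]]) (rule fibre_coeff_summable[OF t S h, unfolded fibre_coeff_def])

text \<open>Equivariance under the deck group and uniqueness of the Fourier coefficients.\<close>

lemma fibre_coeff_wmin:
  assumes t: "transitions s" and S: "smooth_on UNIV (lifted s)" and h: "hol_lift (lifted s)" and e: "\<pi> (wmin m) = \<pi> (wmin m')"
    and cr: "crit m" "crit m'"
  shows "fibre_coeff s m (wmin m) = fibre_coeff s m' (wmin m')"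
proof -
  define w where "w = wmin m"
  define u where "u = pot_at w"
  have u: "u \<in> \<U>" "\<pi> w \<in> dom u" unfolding u_def by (rule pot_at)+
  obtain \<gamma> where "\<gamma> \<in> deck" and gw: "\<gamma> w = wmin m'" using deck_transitive[OF e] unfolding w_def by blast
  then obtain A t' where \<gamma>: "A \<in> GLZ" "\<gamma> = (\<lambda>x. A *v x + t')" "\<And>x. \<pi> (\<gamma> x) = \<pi> x" by (metis deckD)
  have u': "\<pi> (\<gamma> w) \<in> dom u" using u(2) \<gamma>(3) by simp
  \<comment> \<open>The index shift caused by the two frames at \<open>w\<close> and
    \<open>\<gamma> w\<close>: the lifted section picks up the character \<open>ee \<kappa>\<close>,
    without any constant phase, as \<open>tr\<close> shows. Accordingly \<beta> matches the Fourier
    indices at \<open>\<gamma> w\<close> with those at \<open>w\<close>.\<close>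
  define \<kappa> where "\<kappa> = shift u w - int_act (transpose A) (shift u (\<gamma> w))"
  define \<beta> where "\<beta> n = int_act (transpose A) n - \<kappa>" for n
  have AT: "int_vec (int_act (transpose A) n) = transpose A *v int_vec n" for n by (rule int_vec_act[OF GLZ_transpose[OF \<gamma>(1)]])
  have "bij \<beta>"
  proof -
    have "bij (\<lambda>n. n - \<kappa>)" by (rule o_bij[of "\<lambda>n. n + \<kappa>"]) (auto simp: fun_eq_iff)
    from bij_comp[OF bij_int_act[OF GLZ_transpose[OF \<gamma>(1)]] this] show ?thesis by (simp add: \<beta>_def[abs_def] comp_def)
  qed
  have \<beta>m: "\<beta> m' = m"
  proof -
    have "grad (psi u) w = transpose A *v grad (psi u) (\<gamma> w)"
      unfolding grad_psi[OF u] grad_psi[OF u(1) u'] \<gamma>(3) lin_deck[OF \<gamma>(2,3) pot_charts_at[OF u]]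
      by (simp add: matrix_transpose_mul matrix_vector_mul_assoc)
    moreover have "grad (psi u) w = - int_vec m - int_vec (shift u w)" using shift[OF u] grad_wmin[OF cr(1)] by (simp add: w_def algebra_simps)
    moreover have "grad (psi u) (\<gamma> w) = - int_vec m' - int_vec (shift u (\<gamma> w))" using shift[OF u(1) u'] grad_wmin[OF cr(2)] by (simp add: gw algebra_simps)
    ultimately have "- int_vec m - int_vec (shift u w) = - (transpose A *v int_vec m') - transpose A *v int_vec (shift u (\<gamma> w))"
      by (simp add: matrix_vector_mult_diff_distrib vec.neg)
    then have "int_vec (\<beta> m') = int_vec m" by (simp add: \<beta>_def \<kappa>_def AT algebra_simps)
    then show ?thesis unfolding int_vec_inj .
  qed
  have tr: "lifted s (\<gamma> w, A *v y) = ee \<kappa> y * lifted s (w, y)" for y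
  proof -
    have "ee (shift u (\<gamma> w)) (A *v y) * lifted s (\<gamma> w, A *v y) = ee (shift u w) y * lifted s (w, y)"
      unfolding lifted_eq[OF t u(1) u', symmetric] lifted_eq[OF t u, symmetric] deck_cp[OF \<gamma>(2,3)] ..
    then have "ee (- shift u (\<gamma> w)) (A *v y) * ee (shift u (\<gamma> w)) (A *v y) * lifted s (\<gamma> w, A *v y)
        = ee (- shift u (\<gamma> w)) (A *v y) * ee (shift u w) y * lifted s (w, y)" by (simp add: mult.assoc)
    then have "lifted s (\<gamma> w, A *v y) = ee (- shift u (\<gamma> w)) (A *v y) * ee (shift u w) y * lifted s (w, y)" by (simp add: ee_simps(6))
    moreover have "ee (- shift u (\<gamma> w)) (A *v y) * ee (shift u w) y = ee \<kappa> y"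
    proof -
      have "int_vec (int_act (transpose A) (- shift u (\<gamma> w)) + shift u w) = int_vec \<kappa>" by (simp add: AT \<kappa>_def vec.neg)
      then have "int_act (transpose A) (- shift u (\<gamma> w)) + shift u w = \<kappa>" unfolding int_vec_inj .
      then show ?thesis unfolding ee_matrix[OF \<gamma>(1)] ee_simps(1)[symmetric] by simp
    qed
    ultimately show ?thesis by simp
  qed
  have "infsum (\<lambda>n. fibre_coeff s n (\<gamma> w) * ee n z) UNIV = infsum (\<lambda>n. fibre_coeff s (\<beta> n) w * ee n z) UNIV" for z
  proof -
    define y where "y = matrix_inv A *v z"
    have z: "A *v y = z" unfolding y_def by (rule GLZ_inv_vec[OF \<gamma>(1)])
    have "infsum (\<lambda>n. fibre_coeff s n (\<gamma> w) * ee n z) UNIV = ee \<kappa> y * lifted s (w, y)" unfolding lifted_fourier[OF t S h, symmetric] z[symmetric] tr ..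
    also have "\<dots> = infsum (\<lambda>n. fibre_coeff s n w * ee (n + \<kappa>) y) UNIV"
      unfolding lifted_fourier[OF t S h] infsum_cmult_right'[symmetric] by (intro infsum_cong) (simp add: ee_simps(1) mult_ac)
    also have "\<dots> = infsum (\<lambda>n. fibre_coeff s (\<beta> n) w * ee (\<beta> n + \<kappa>) y) UNIV"
      using infsum_reindex_bij_betw[OF \<open>bij \<beta>\<close>, of "\<lambda>n. fibre_coeff s n w * ee (n + \<kappa>) y"] by simp
    also have "\<dots> = infsum (\<lambda>n. fibre_coeff s (\<beta> n) w * ee n z) UNIV"
      unfolding z[symmetric] ee_matrix[OF \<gamma>(1)] by (simp add: \<beta>_def)
    finally show ?thesis .
  qed
  then have "fibre_coeff s m' (\<gamma> w) = fibre_coeff s (\<beta> m') w"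
  proof (rule fourier_coefficients_unique[OF fibre_coeff_summable[OF t S h], rotated])
    have "(\<lambda>n. norm (fibre_coeff s n w)) summable_on range \<beta>" using fibre_coeff_summable[OF t S h, of w] \<open>bij \<beta>\<close> by (simp add: bij_is_surj)
    then show "(\<lambda>n. norm (fibre_coeff s (\<beta> n) w)) summable_on UNIV"
      using summable_on_reindex[OF bij_is_inj[OF \<open>bij \<beta>\<close>], of "\<lambda>n. norm (fibre_coeff s n w)"] by (simp add: comp_def)
  qed
  then show ?thesis unfolding \<beta>m gw unfolding w_def by (rule sym)
qed

text \<open>The coefficient at a critical point depends only on its image in the base by
  \<open>fibre_coeff_wmin\<close>, which defines \<open>a\<close>. Then \<open>gauss a\<close> and
  the section have the same Fourier coefficients on every fibre.\<close>

lemma Gamma_complex_SYZ: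
  assumes s: "s \<in> Gamma_complex \<A> \<U>"
  obtains a where "a \<in> Gamma_real \<A> \<U>" "s = SYZ \<A> \<U> (gauss a)"
proof -
  have S: "transitions s" "smooth_on UNIV (lifted s)" "hol_lift (lifted s)" "supported s" using s unfolding Gamma_complex_iff by auto
  define M where "M b = (SOME m. crit m \<and> \<pi> (wmin m) = b)" for b
  define a where "a b = (if \<exists>m. crit m \<and> \<pi> (wmin m) = b then fibre_coeff s (M b) (wmin (M b)) else 0)" for b
  have aw: "a (\<pi> (wmin m)) = fibre_coeff s m (wmin m)" if m: "crit m" for m
  proof -
    have "crit (M (\<pi> (wmin m))) \<and> \<pi> (wmin (M (\<pi> (wmin m)))) = \<pi> (wmin m)" unfolding M_def by (rule someI[of _ m]) (simp add: m)
    with fibre_coeff_wmin[OF S(1-3)] m show ?thesis unfolding a_def by metis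
  qed
  have "Bohr_Sommerfeld \<A> \<U> b" if "a b \<noteq> 0" for b using that unfolding a_def using BS_iff grad_wmin by (metis (full_types))
  then have "a \<in> Gamma_real \<A> \<U>" unfolding Gamma_real_def using finite_subset[OF _ finite_BS, of "{b. a b \<noteq> 0}"] by blast
  moreover have "s = SYZ \<A> \<U> (gauss a)"
  proof (rule section_eqI[OF S(4,1) supported_SYZ transitions_SYZ])
    fix w y
    have "gauss_sheet a m w = fibre_coeff s m w" for m using aw[of m] fibre_coeff_eq(1)[OF S(1-3), of m w] by (simp add: gauss_sheet_def)
    then show "lifted s (w, y) = lifted (SYZ \<A> \<U> (gauss a)) (w, y)" unfolding lifted_SYZ fibre_series_def gauss_EE lifted_fourier[OF S(1-3)] by simp
  qed
  ultimately show ?thesis by (rule that)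
qed

text \<open>At the critical point the exponent \<open>breg\<close> is 0; over a fibre that is not
  Bohr-Sommerfeld the constant path lies outside the path space.\<close>

lemma gauss_constant:
  assumes "a \<in> Gamma_real \<A> \<U>" shows "at_constant_paths (gauss a) = a"
proof
  fix b
  obtain w where w: "b = \<pi> w" using surj by blast
  show "at_constant_paths (gauss a) b = a b"
  proof (cases "Bohr_Sommerfeld \<A> \<U> b")
    case True
    then obtain m where gm: "grad \<Phi> w = - int_vec m" unfolding w BS_iff by blast
    note m = wminI[OF gm] critI[OF gm]
    then have "(b, 0) = path_at m w" unfolding w using path_at_constant gm by metis
    then show ?thesis unfolding at_constant_paths_def by (simp add: gauss_EE gauss_sheet_def m w)
  next
    case False
    have "(b, 0) \<notin> path_space \<A> \<U>"
    proof
      assume "(b, 0) \<in> path_space \<A> \<U>"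
      then obtain m w' where e: "path_at m w' = (b, 0)" unfolding path_space_eq by force
      then have "b = \<pi> w'" by (simp add: path_at_def)
      then have "grad \<Phi> w' = - int_vec m" using e path_at_constant by metis
      then show False using False BS_iff \<open>b = \<pi> w'\<close> by blast
    qed
    moreover have "a b = 0" using assms False unfolding Gamma_real_def by blast
    ultimately show ?thesis by (simp add: at_constant_paths_def gauss_def)
  qed
qed

text \<open>Rapid decay makes the fibrewise series absolutely summable, so its Fourier coefficients
  give back the function. Injectivity of the transform follows.\<close>

lemma SYZ_coefficients:
  assumes f: "rapidly_decaying \<A> g \<U> f" shows "fibre_coeff (SYZ \<A> \<U> f) m w = f (path_at m w)"
  unfolding fibre_coeff_def lifted_SYZ fibre_series_def by (rule fourier_series(3)[OF rapidly_decaying_summable[OF f]])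

lemma rapidly_decaying_eqI:
  assumes "rapidly_decaying \<A> g \<U> f" "rapidly_decaying \<A> g \<U> h" "\<And>m w. f (path_at m w) = h (path_at m w)" shows "f = h"
proof
  fix P show "f P = h P"
  proof (cases "P \<in> path_space \<A> \<U>")
    case True
    then show ?thesis using assms(3) unfolding path_space_eq by blast
  next
    case False
    then have "k P = 0" if "rapidly_decaying \<A> g \<U> k" for k
      using that[unfolded rapidly_decaying_def, THEN conjunct1] by blast
    then show ?thesis using assms(1,2) by metis
  qed
qed

text \<open>A polarized function has the same transform as some \<open>gauss a\<close> by
  \<open>Gamma_complex_SYZ\<close>, and both are recovered from their transforms.\<close>

lemma polarized_functions_eq: "polarized_functions \<A> g \<U> = gauss ` Gamma_real \<A> \<U>"
proof (intro set_eqI iffI)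
  fix f assume "f \<in> gauss ` Gamma_real \<A> \<U>"
  then show "f \<in> polarized_functions \<A> g \<U>" unfolding polarized_functions_def using rapidly_decaying_gauss SYZ_gauss_mem by blast
next
  fix f assume "f \<in> polarized_functions \<A> g \<U>"
  then have f: "rapidly_decaying \<A> g \<U> f" "SYZ \<A> \<U> f \<in> Gamma_complex \<A> \<U>" unfolding polarized_functions_def by auto
  obtain a where a: "a \<in> Gamma_real \<A> \<U>" "SYZ \<A> \<U> f = SYZ \<A> \<U> (gauss a)" using Gamma_complex_SYZ[OF f(2)] by metis
  have "f = gauss a"
    using rapidly_decaying_eqI[OF f(1) rapidly_decaying_gauss[OF a(1)]] SYZ_coefficients[OF f(1)] SYZ_coefficients[OF rapidly_decaying_gauss[OF a(1)]] a(2)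
    by metis
  then show "f \<in> gauss ` Gamma_real \<A> \<U>" using a(1) by blast
qed

section \<open>Linearity and the isomorphisms\<close>

lemma Gamma_real_subspace: "complex_subspace fun_scale (Gamma_real \<A> \<U>)"
proof -
  have "a + b \<in> Gamma_real \<A> \<U>" if "a \<in> Gamma_real \<A> \<U>" "b \<in> Gamma_real \<A> \<U>" for a b
  proof -
    have "{x. (a + b) x \<noteq> 0} \<subseteq> {x. a x \<noteq> 0} \<union> {x. b x \<noteq> 0}" by auto
    then have "finite {x. (a + b) x \<noteq> 0}" using that unfolding Gamma_real_def by (auto intro: finite_subset)
    moreover have "a x \<noteq> 0 \<or> b x \<noteq> 0" if "(a + b) x \<noteq> 0" for x using that by auto
    ultimately show ?thesis using that unfolding Gamma_real_def by blast
  qed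
  moreover have "fun_scale c a \<in> Gamma_real \<A> \<U>" if "a \<in> Gamma_real \<A> \<U>" for c a
  proof -
    have "{x. fun_scale c a x \<noteq> 0} \<subseteq> {x. a x \<noteq> 0}" by (auto simp: fun_scale_def)
    then have "finite {x. fun_scale c a x \<noteq> 0}" using that unfolding Gamma_real_def by (auto intro: finite_subset)
    then show ?thesis using that unfolding Gamma_real_def by (auto simp: fun_scale_def)
  qed
  moreover have "0 \<in> Gamma_real \<A> \<U>" by (simp add: Gamma_real_def)
  ultimately show ?thesis unfolding complex_subspace_def by blast
qed

lemma gauss_sheet_add: "gauss_sheet (a + b) m w = gauss_sheet a m w + gauss_sheet b m w" by (simp add: gauss_sheet_def distrib_right)

lemma gauss_sheet_scale: "gauss_sheet (fun_scale c a) m w = c * gauss_sheet a m w" by (simp add: gauss_sheet_def fun_scale_def)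

lemma gauss_add: "gauss (a + b) = gauss a + gauss b"
proof
  fix P show "gauss (a + b) P = (gauss a + gauss b) P"
  proof (cases "P \<in> path_space \<A> \<U>")
    case True
    then obtain m w where "P = path_at m w" unfolding path_space_eq by blast
    then show ?thesis by (simp add: gauss_EE gauss_sheet_add)
  qed (simp add: gauss_def)
qed

lemma gauss_scale: "gauss (fun_scale c a) = fun_scale c (gauss a)"
proof
  fix P show "gauss (fun_scale c a) P = fun_scale c (gauss a) P"
  proof (cases "P \<in> path_space \<A> \<U>")
    case True
    then obtain m w where "P = path_at m w" unfolding path_space_eq by blast
    then show ?thesis by (simp add: gauss_EE gauss_sheet_scale fun_scale_def[of c "gauss a"])
  qed (simp add: gauss_def fun_scale_def)
qed

lemma fibre_series_summable:
  assumes "rapidly_decaying \<A> g \<U> f" shows "(\<lambda>m. f (path_at m w) * ee m y) summable_on UNIV"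
  by (rule fourier_series_summable[OF rapidly_decaying_summable[OF assms]])

lemma SYZ_linear:
  assumes f: "rapidly_decaying \<A> g \<U> f" and h: "rapidly_decaying \<A> g \<U> h"
  shows "SYZ \<A> \<U> (f + h) = SYZ \<A> \<U> f + SYZ \<A> \<U> h" "SYZ \<A> \<U> (fun_scale c f) = section_scale c (SYZ \<A> \<U> f)"
proof -
  have add: "fibre_series (f + h) w y = fibre_series f w y + fibre_series h w y" for w y
    unfolding fibre_series_def using infsum_add[OF fibre_series_summable[OF f] fibre_series_summable[OF h]] by (simp add: distrib_right)
  have sc: "fibre_series (fun_scale c f) w y = c * fibre_series f w y" for w y
    unfolding fibre_series_def fun_scale_def mult.assoc by (rule infsum_cmult_right')
  have "SYZ \<A> \<U> (f + h) q u = (SYZ \<A> \<U> f + SYZ \<A> \<U> h) q u \<and> SYZ \<A> \<U> (fun_scale c f) q u = section_scale c (SYZ \<A> \<U> f) q u" for q u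
  proof (cases "q \<in> X_check \<A> \<and> u \<in> \<U> \<and> fst q \<in> dom u")
    case True
    then obtain w y where q: "q = lift_pt w y" unfolding X_check_eq by blast
    then have u: "u \<in> \<U>" "\<pi> w \<in> dom u" using True by (auto simp: check_point_def)
    show ?thesis unfolding q section_scale_def plus_fun_apply SYZ_eq[OF u] add sc by (simp add: algebra_simps)
  next
    case False
    then have "SYZ \<A> \<U> k q u = 0" for k using supported_SYZ unfolding supported_def by metis
    then show ?thesis by (simp add: section_scale_def)
  qed
  then show "SYZ \<A> \<U> (f + h) = SYZ \<A> \<U> f + SYZ \<A> \<U> h" "SYZ \<A> \<U> (fun_scale c f) = section_scale c (SYZ \<A> \<U> f)" by blast+
qed

lemma gauss_iso: "complex_linear_iso fun_scale fun_scale (Gamma_real \<A> \<U>) (polarized_functions \<A> g \<U>) gauss"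
  by (rule complex_linear_isoI[OF Gamma_real_subspace gauss_add gauss_scale _ polarized_functions_eq[symmetric]])
     (metis gauss_constant inj_on_inverseI)

lemma SYZ_iso: "complex_linear_iso fun_scale section_scale (polarized_functions \<A> g \<U>) (Gamma_complex \<A> \<U>) (SYZ \<A> \<U>)"
proof (rule complex_linear_isoI)
  have r: "rapidly_decaying \<A> g \<U> f" if "f \<in> polarized_functions \<A> g \<U>" for f using that unfolding polarized_functions_def by blast
  show "complex_subspace fun_scale (polarized_functions \<A> g \<U>)" using gauss_iso unfolding complex_linear_iso_def by blast
  show "SYZ \<A> \<U> (f + h) = SYZ \<A> \<U> f + SYZ \<A> \<U> h" if "f \<in> polarized_functions \<A> g \<U>" "h \<in> polarized_functions \<A> g \<U>" for f h
    by (rule SYZ_linear(1)[OF r r]) fact+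
  show "SYZ \<A> \<U> (fun_scale c f) = section_scale c (SYZ \<A> \<U> f)" if "f \<in> polarized_functions \<A> g \<U>" for c f
    by (rule SYZ_linear(2)[OF r r]) fact+
  show "inj_on (SYZ \<A> \<U>) (polarized_functions \<A> g \<U>)"
    by (rule inj_onI) (metis rapidly_decaying_eqI SYZ_coefficients r)
  show "SYZ \<A> \<U> ` polarized_functions \<A> g \<U> = Gamma_complex \<A> \<U>"
    unfolding polarized_functions_eq using Gamma_complex_SYZ SYZ_gauss_mem by blast
qed

lemma at_constant_paths_iso:
  "complex_linear_iso fun_scale fun_scale (polarized_functions \<A> g \<U>) (Gamma_real \<A> \<U>) at_constant_paths"
proof (rule complex_linear_isoI)
  show "complex_subspace fun_scale (polarized_functions \<A> g \<U>)" using gauss_iso unfolding complex_linear_iso_def by blast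
  show "inj_on at_constant_paths (polarized_functions \<A> g \<U>)"
    unfolding polarized_functions_eq by (rule inj_onI) (auto simp: gauss_constant)
  show "at_constant_paths ` polarized_functions \<A> g \<U> = Gamma_real \<A> \<U>"
    unfolding polarized_functions_eq image_image by (simp add: gauss_constant cong: image_cong)
qed (auto simp: at_constant_paths_def fun_scale_def)

text \<open>The inverse of restriction to the constant paths is \<open>gauss\<close>, so the induced
  map is \<open>SYZ\<close> after \<open>gauss\<close>, a composition of two isomorphisms.\<close>

lemma SYZ_induced_iso:
  "complex_linear_iso fun_scale section_scale (Gamma_real \<A> \<U>) (Gamma_complex \<A> \<U>) (SYZ_induced \<A> g \<U>)"
proof (rule complex_linear_isoI[OF Gamma_real_subspace])
  note iso = at_constant_paths_iso[unfolded complex_linear_iso_def bij_betw_def] SYZ_iso[unfolded complex_linear_iso_def bij_betw_def]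
  have ind: "SYZ_induced \<A> g \<U> a = SYZ \<A> \<U> (gauss a)" if "a \<in> Gamma_real \<A> \<U>" for a
    unfolding SYZ_induced_def using iso(1) that polarized_functions_eq gauss_constant[OF that] by (metis imageI inv_into_f_eq)
  have g: "gauss a \<in> polarized_functions \<A> g \<U>" if "a \<in> Gamma_real \<A> \<U>" for a using that polarized_functions_eq by blast
  have sub: "a + b \<in> Gamma_real \<A> \<U>" "fun_scale c a \<in> Gamma_real \<A> \<U>" if "a \<in> Gamma_real \<A> \<U>" "b \<in> Gamma_real \<A> \<U>" for a b c
    using Gamma_real_subspace that unfolding complex_subspace_def by blast+
  show "SYZ_induced \<A> g \<U> (a + b) = SYZ_induced \<A> g \<U> a + SYZ_induced \<A> g \<U> b" if "a \<in> Gamma_real \<A> \<U>" "b \<in> Gamma_real \<A> \<U>" for a b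
    using iso(2) g that by (simp add: ind sub gauss_add)
  show "SYZ_induced \<A> g \<U> (fun_scale c a) = section_scale c (SYZ_induced \<A> g \<U> a)" if "a \<in> Gamma_real \<A> \<U>" for a c
    using iso(2) g that sub(2)[OF that that] by (simp add: ind gauss_scale)
  show "inj_on (SYZ_induced \<A> g \<U>) (Gamma_real \<A> \<U>)"
  proof (rule inj_onI)
    fix a b assume a: "a \<in> Gamma_real \<A> \<U>" "b \<in> Gamma_real \<A> \<U>" and e: "SYZ_induced \<A> g \<U> a = SYZ_induced \<A> g \<U> b"
    have "gauss a = gauss b" using e iso(2) g a unfolding ind[OF a(1)] ind[OF a(2)] inj_on_def by blast
    then show "a = b" using gauss_constant a by metis
  qed
  have "SYZ_induced \<A> g \<U> ` Gamma_real \<A> \<U> = (\<lambda>a. SYZ \<A> \<U> (gauss a)) ` Gamma_real \<A> \<U>" by (rule image_cong[OF refl ind])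
  also have "\<dots> = SYZ \<A> \<U> ` polarized_functions \<A> g \<U>" unfolding polarized_functions_eq image_image ..
  also have "\<dots> = Gamma_complex \<A> \<U>" using iso(2) by blast
  finally show "SYZ_induced \<A> g \<U> ` Gamma_real \<A> \<U> = Gamma_complex \<A> \<U>" .
qed

end

theorem theorem1p1:
  fixes \<A> :: "('b::t2_space, 'n::finite) chart set"
    and g :: "'b \<Rightarrow> ('b, 'n) vect \<Rightarrow> ('b, 'n) vect \<Rightarrow> real"
    and \<U> :: "('b, 'n) potential set"
  assumes "compact (UNIV :: 'b set)"
    and "special_integral_affine_manifold \<A>"
    and "complete_affine \<A>"
    and "hessian_type_metric \<A> g"
    and "integral_potentials \<A> g \<U>"
  shows "complex_linear_iso fun_scale fun_scale
           (polarized_functions \<A> g \<U>) (Gamma_real \<A> \<U>) at_constant_paths \<and>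
         complex_linear_iso fun_scale section_scale
           (polarized_functions \<A> g \<U>) (Gamma_complex \<A> \<U>) (SYZ \<A> \<U>) \<and>
         complex_linear_iso fun_scale section_scale
           (Gamma_real \<A> \<U>) (Gamma_complex \<A> \<U>) (SYZ_induced \<A> g \<U>)"
proof -
  have "affine_atlas GLZ \<A>"
    using assms(2) unfolding special_integral_affine_manifold_def integral_affine_manifold_def by blast
  then obtain \<pi> where "lift_setup \<A> \<pi>" using ex_lift_setup assms(3) by metis
  then interpret lift_setup \<A> \<pi> .
  interpret hessian_lift \<A> \<pi> g \<U>
    by unfold_locales (use assms(4,5) in \<open>auto simp: hessian_type_metric_def\<close>)
  obtain \<Phi> where "\<And>u w. u \<in> \<U> \<Longrightarrow> \<pi> w \<in> dom u \<Longrightarrow>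
      \<exists>W k a. open W \<and> w \<in> W \<and> (\<forall>w'\<in>W. \<pi> w' \<in> dom u \<and> \<Phi> w' = psi u w' + int_vec k \<bullet> w' + a)"
    using ex_global_potential by metis
  then interpret polarized_lift \<A> \<pi> g \<U> \<Phi> by unfold_locales (use assms(1) in auto)
  show ?thesis using at_constant_paths_iso SYZ_iso SYZ_induced_iso by blast
qed

end
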